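(* Let $f:M^n\to\mathbb{R}^{n+1}$ be an affine immersion centroaffinely congruent to its centre map $c$. Assume that both $f$ and $c$ are centroaffine, that the Blaschke metric $h$ is positive definite, and that $f$ is quasi-umbilical, i.e. its shape operator $S$ has two distinct eigenvalues, $\lambda_0$ of multiplicity $1$ and $\lambda_1$ of multiplicity $n-1$, with the multiple eigenvalue $\lambda_1\neq 0$. Then such a hypersurface exists if and only if $\lambda_0+\lambda_1<0$, and in that case $(M,h)$ is locally isometric to a warped product $\mathbb{R}\times_{e^F}N^{n-1}$. Moreover: (i) if $(n+2)\lambda_0+n\lambda_1\neq 0$, then there exists a proper affine hypersphere $g_2:N^{n-1}\to\mathbb{R}^n$ such that, up to an affine transformation of $\mathbb{R}^{n+1}$, $$f(t,\vec u)=\left(t^{-2K_1}g_2(\vec u),\ \frac{t^{N}}{N}\right),$$ where $K_1$ and (in the exponent and denominator of the last component) $N$ are constants related to $\lambda_0,\lambda_1$, given in the context; (ii) if $(n+2)\lambda_0+n\lambda_1=0$, then, up to an affine transformation of $\mathbb{R}^{n+1}$, $$f(t,\vec u)=\left(t^{-2K_1},\ t^{-2K_1}\vec u,\ \varphi_0\,t^{-2K_1}\Bigl(\mathcal F(\vec u)-\frac1{2K_1}\log t\Bigr)\right),$$ where $\mathcal F$ is a solution of the Monge–Ampère equation $\det\left(\frac{\partial^2\mathcal F}{\partial u_i\partial u_j}\right)=1$, and $K_1,\varphi_0$ are constants. The converse also holds, i.e. the hypersurfaces described in (i) and (ii) satisfy the assumptions above.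
   Context: Let $f:M\to\mathbb{R}^{n+1}$ be a non-degenerate immersion of an $n$-dimensional oriented manifold, with its Blaschke structure: $D$ is the standard flat connection of $\mathbb{R}^{n+1}$, $\xi$ the affine normal, $\nabla$ the induced equiaffine connection, $h$ the equiaffine (Blaschke) metric and $S$ the shape operator, so that $D_Xf_*Y=f_*\nabla_XY+h(X,Y)\xi$ and $D_X\xi=-f_*SX$. Write the position vector as $f=f_*Z+\rho\,\xi$, with $Z$ a vector field on $M$ and $\rho$ the affine support function. The centre map of $f$ is $c:M\to\mathbb{R}^{n+1}$, $c=f-\rho\,\xi=f_*Z$. An immersion into $\mathbb{R}^{n+1}$ is centroaffine if its position vector is everywhere transversal to the tangent space. $f$ is centroaffinely congruent to $c$ if $c=Af$ for some $A\in GL(n+1,\mathbb{R})$. The constants are $K_0=\frac{\lambda_0}{\lambda_0-\lambda_1}$, $K_1=\frac{\lambda_1}{\lambda_0-\lambda_1}$ and $N=(n-2)K_1+(n+2)K_0$ (the letter $N$ also denotes the manifold $N^{n-1}$). Here $t$ is a local coordinate on $\mathbb{R}$ and $\vec u=(u_1,\dots,u_{n-1})$ are local coordinates on $N^{n-1}$. For Riemannian manifolds $(M_1,g_1)$, $(M_2,g_2)$ and a function $F$ on $M_1\times M_2$ depending only on $M_1$, the warped product $M_1\times_{e^F}M_2$ is $M_1\times M_2$ with the metric $g(V,W)=g_1(V_1,W_1)+e^{2F}g_2(V_2,W_2)$, where $V=V_1+V_2$, $W=W_1+W_2$ are the decompositions into components tangent to $M_1$ and $M_2$. A proper affine hypersphere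 is a non-degenerate hypersurface whose shape operator is a nonzero constant multiple of the identity.
   Formalization: Existence claim and converse of (i) require N≠0 (no such hypersurface exists if N=0); in the converse g_2 is centred at the origin, locally strongly convex and of the type forced by h>0, F is convex and φ_0≠0; n≥3 is taken from "multiple eigenvalue". *)

theory Defs
  imports "HOL-Analysis.Analysis"
begin

section \<open>Smooth maps\<close>

primrec Ck_on :: "nat \<Rightarrow> 'a::real_normed_vector set \<Rightarrow> ('a \<Rightarrow> 'b::real_normed_vector) \<Rightarrow> bool" where
  "Ck_on 0 V f \<longleftrightarrow> continuous_on V f"
| "Ck_on (Suc k) V f \<longleftrightarrow>
     (\<forall>x\<in>V. f differentiable (at x)) \<and> (\<forall>v. Ck_on k V (\<lambda>x. frechet_derivative f (at x) v))"

text \<open>Only used for open \<open>V\<close>, where the derivatives depend on \<open>f\<close> restricted to \<open>V\<close> alone.\<close>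

definition smooth_on :: "'a::real_normed_vector set \<Rightarrow> ('a \<Rightarrow> 'b::real_normed_vector) \<Rightarrow> bool" where
  "smooth_on V f \<longleftrightarrow> (\<forall>k. Ck_on k V f)"

definition partial :: "'n \<Rightarrow> (real^'n \<Rightarrow> 'b::real_normed_vector) \<Rightarrow> real^'n \<Rightarrow> 'b" where
  "partial i f z = frechet_derivative f (at z) (axis i 1)"

section \<open>Oriented smooth manifolds\<close>

text \<open>
  A chart is a pair \<open>(U, x)\<close> of an open set and a coordinate map into \<open>real^'n\<close>; the dimension is
  \<open>CARD('n)\<close>.  A manifold is a topology together with an atlas, the orientation being the one for
  which the charts of the atlas are positive.
\<close>

type_synonym ('m, 'n) chart = "'m set \<times> ('m \<Rightarrow> real^'n)"

definition chart_image :: "('m, 'n::finite) chart \<Rightarrow> (real^'n) set" where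
  "chart_image c = snd c ` fst c"

definition local_rep :: "('m, 'n::finite) chart \<Rightarrow> ('m \<Rightarrow> 'b) \<Rightarrow> real^'n \<Rightarrow> 'b" where
  "local_rep c f = f \<circ> inv_into (fst c) (snd c)"

definition topological_chart :: "'m topology \<Rightarrow> ('m, 'n::finite) chart \<Rightarrow> bool" where
  "topological_chart X c \<longleftrightarrow>
     openin X (fst c) \<and> open (chart_image c) \<and>
     homeomorphic_map (subtopology X (fst c)) (top_of_set (chart_image c)) (snd c)"

definition smooth_transition :: "('m, 'n::finite) chart \<Rightarrow> ('m, 'n) chart \<Rightarrow> bool" where
  "smooth_transition c d \<longleftrightarrow> smooth_on (snd c ` (fst c \<inter> fst d)) (local_rep c (snd d))"

definition positive_transition :: "('m, 'n::finite) chart \<Rightarrow> ('m, 'n) chart \<Rightarrow> bool" where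
  "positive_transition c d \<longleftrightarrow>
     (\<forall>z \<in> snd c ` (fst c \<inter> fst d).
        0 < det (matrix (frechet_derivative (local_rep c (snd d)) (at z))))"

definition oriented_manifold :: "'m topology \<Rightarrow> ('m, 'n::finite) chart set \<Rightarrow> bool" where
  "oriented_manifold X A \<longleftrightarrow>
     Hausdorff_space X \<and> second_countable X \<and>
     (\<Union>c\<in>A. fst c) = topspace X \<and>
     (\<forall>c\<in>A. topological_chart X c) \<and>
     (\<forall>c\<in>A. \<forall>d\<in>A. smooth_transition c d \<and> positive_transition c d)"

text \<open>Charts of the smooth structure defined by the atlas, positive or not.\<close>

definition smooth_chart :: "'m topology \<Rightarrow> ('m, 'n::finite) chart set \<Rightarrow> ('m, 'n) chart \<Rightarrow> bool" where
  "smooth_chart X A c \<longleftrightarrow>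
     topological_chart X c \<and> (\<forall>d\<in>A. smooth_transition c d \<and> smooth_transition d c)"

definition domain_atlas :: "(real^'n::finite) set \<Rightarrow> (real^'n, 'n) chart set" where
  "domain_atlas V = {(V, id)}"

section \<open>Coordinates on a product with a line\<close>

text \<open>
  If \<open>CARD('n) = n\<close> then \<open>real^('n option)\<close> is (n+1)-dimensional; it is identified with the product
  of \<open>real^'n\<close> (the components \<open>Some i\<close>) and \<open>real\<close> (the component \<open>None\<close>).  As the index set is
  not ordered, the position of the additional component has no significance.
\<close>

definition append_coord :: "real^'n::finite \<Rightarrow> real \<Rightarrow> real^('n option)" where
  "append_coord v s = (\<chi> a. case a of None \<Rightarrow> s | Some i \<Rightarrow> v $ i)"

definition rest_coords :: "real^('n::finite option) \<Rightarrow> real^'n" where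
  "rest_coords z = (\<chi> i. z $ Some i)"

definition product_domain :: "real set \<Rightarrow> (real^'n::finite) set \<Rightarrow> (real^('n option)) set" where
  "product_domain I \<Omega> = {z. z $ None \<in> I \<and> rest_coords z \<in> \<Omega>}"

definition line_product_atlas ::
    "real set \<Rightarrow> ('q, 'n::finite) chart set \<Rightarrow> (real \<times> 'q, 'n option) chart set" where
  "line_product_atlas I B =
     (\<lambda>c. (I \<times> fst c, \<lambda>(t, q). append_coord (snd c q) t)) ` B"

section \<open>The Blaschke structure of an immersion\<close>

text \<open>
  The following notions refer to a coordinate expression \<open>f\<close> of the immersion and \<open>\<xi>\<close> of a
  transversal field.  The vector \<open>frame_coeff f \<xi> z w\<close> lists the coefficients of \<open>w\<close> in the basis
  consisting of the partial derivatives of \<open>f\<close> (components \<open>Some k\<close>) and \<open>\<xi>\<close> (component \<open>None\<close>).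
\<close>

definition frame ::
    "(real^'n::finite \<Rightarrow> real^('n option)) \<Rightarrow> (real^'n \<Rightarrow> real^('n option)) \<Rightarrow> real^'n
      \<Rightarrow> real^('n option)^('n option)" where
  "frame f \<xi> z = (\<chi> a. case a of None \<Rightarrow> \<xi> z | Some i \<Rightarrow> partial i f z)"

definition frame_coeff ::
    "(real^'n::finite \<Rightarrow> real^('n option)) \<Rightarrow> (real^'n \<Rightarrow> real^('n option)) \<Rightarrow> real^'n
      \<Rightarrow> real^('n option) \<Rightarrow> real^('n option)" where
  "frame_coeff f \<xi> z w = w v* matrix_inv (frame f \<xi> z)"

text \<open>
  The matrices of \<open>h\<close> and \<open>S\<close>, read off from the Gauss formula
  \<open>D\<^sub>X f\<^sub>* Y = f\<^sub>* \<nabla>\<^sub>X Y + h(X,Y) \<xi>\<close> and the Weingarten formula \<open>D\<^sub>X \<xi> = - f\<^sub>* S X\<close> for coordinate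
  vector fields, and the support function from \<open>f = f\<^sub>* Z + \<rho> \<xi>\<close>.
\<close>

definition affine_metric ::
    "(real^'n::finite \<Rightarrow> real^('n option)) \<Rightarrow> (real^'n \<Rightarrow> real^('n option)) \<Rightarrow> real^'n
      \<Rightarrow> real^'n^'n" where
  "affine_metric f \<xi> z = (\<chi> i j. frame_coeff f \<xi> z (partial i (partial j f) z) $ None)"

definition shape_operator ::
    "(real^'n::finite \<Rightarrow> real^('n option)) \<Rightarrow> (real^'n \<Rightarrow> real^('n option)) \<Rightarrow> real^'n
      \<Rightarrow> real^'n^'n" where
  "shape_operator f \<xi> z = (\<chi> k i. - (frame_coeff f \<xi> z (partial i \<xi> z) $ Some k))"

definition support_function ::
    "(real^'n::finite \<Rightarrow> real^('n option)) \<Rightarrow> (real^'n \<Rightarrow> real^('n option)) \<Rightarrow> real^'n \<Rightarrow> real" where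
  "support_function f \<xi> z = frame_coeff f \<xi> z (f z) $ None"

definition centre_map ::
    "(real^'n::finite \<Rightarrow> real^('n option)) \<Rightarrow> (real^'n \<Rightarrow> real^('n option)) \<Rightarrow> real^'n
      \<Rightarrow> real^('n option)" where
  "centre_map f \<xi> z = f z - support_function f \<xi> z *\<^sub>R \<xi> z"

definition immersion_on ::
    "(real^'n::finite) set \<Rightarrow> (real^'n \<Rightarrow> real^('n option)) \<Rightarrow> bool" where
  "immersion_on V f \<longleftrightarrow> smooth_on V f \<and> (\<forall>z\<in>V. inj (frechet_derivative f (at z)))"

definition transversal_on ::
    "(real^'n::finite) set \<Rightarrow> (real^'n \<Rightarrow> real^('n option)) \<Rightarrow> (real^'n \<Rightarrow> real^('n option)) \<Rightarrow> bool" where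
  "transversal_on V f \<xi> \<longleftrightarrow> (\<forall>z\<in>V. \<xi> z \<notin> range (frechet_derivative f (at z)))"

definition centroaffine_on ::
    "(real^'n::finite) set \<Rightarrow> (real^'n \<Rightarrow> real^('n option)) \<Rightarrow> bool" where
  "centroaffine_on V f \<longleftrightarrow> immersion_on V f \<and> transversal_on V f f"

text \<open>
  The affine normal of a non-degenerate immersion: the derivatives of \<open>\<xi>\<close> are tangential (the
  induced connection is equiaffine) and the volume induced by \<open>\<xi>\<close> is the volume of \<open>h\<close>.  Because of
  the absolute value, \<open>-\<xi>\<close> is an affine normal whenever \<open>\<xi>\<close> is; the choice of the sign amounts to
  the choice of an orientation, and it is fixed by requiring \<open>h\<close> to be positive definite.
\<close>

definition affine_normal_on ::
    "(real^'n::finite) set \<Rightarrow> (real^'n \<Rightarrow> real^('n option)) \<Rightarrow> (real^'n \<Rightarrow> real^('n option)) \<Rightarrow> bool" where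
  "affine_normal_on V f \<xi> \<longleftrightarrow>
     immersion_on V f \<and> smooth_on V \<xi> \<and> transversal_on V f \<xi> \<and>
     (\<forall>z\<in>V. det (affine_metric f \<xi> z) \<noteq> 0 \<and>
        (\<forall>i. frame_coeff f \<xi> z (partial i \<xi> z) $ None = 0) \<and>
        \<bar>det (frame f \<xi> z)\<bar> = sqrt \<bar>det (affine_metric f \<xi> z)\<bar>)"

definition blaschke_immersion ::
    "'m topology \<Rightarrow> ('m, 'n::finite) chart set \<Rightarrow> ('m \<Rightarrow> real^('n option)) \<Rightarrow> ('m \<Rightarrow> real^('n option)) \<Rightarrow> bool" where
  "blaschke_immersion X A f \<xi> \<longleftrightarrow>
     oriented_manifold X A \<and>
     (\<forall>c\<in>A. affine_normal_on (chart_image c) (local_rep c f) (local_rep c \<xi>))"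

definition positive_definite :: "real^'n^'n::finite \<Rightarrow> bool" where
  "positive_definite G \<longleftrightarrow> transpose G = G \<and> (\<forall>v. v \<noteq> 0 \<longrightarrow> 0 < v \<bullet> (G *v v))"

definition positive_blaschke_metric ::
    "('m, 'n::finite) chart set \<Rightarrow> ('m \<Rightarrow> real^('n option)) \<Rightarrow> ('m \<Rightarrow> real^('n option)) \<Rightarrow> bool" where
  "positive_blaschke_metric A f \<xi> \<longleftrightarrow>
     (\<forall>c\<in>A. \<forall>z\<in>chart_image c. positive_definite (affine_metric (local_rep c f) (local_rep c \<xi>) z))"

definition congruent_to_centre_map ::
    "('m, 'n::finite) chart set \<Rightarrow> ('m \<Rightarrow> real^('n option)) \<Rightarrow> ('m \<Rightarrow> real^('n option)) \<Rightarrow> bool" where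
  "congruent_to_centre_map A f \<xi> \<longleftrightarrow>
     (\<exists>T :: real^('n option)^('n option). invertible T \<and>
        (\<forall>c\<in>A. \<forall>z\<in>chart_image c.
           centre_map (local_rep c f) (local_rep c \<xi>) z = T *v local_rep c f z))"

definition eigenspace :: "real^'n^'n::finite \<Rightarrow> real \<Rightarrow> (real^'n) set" where
  "eigenspace S l = {v. S *v v = l *\<^sub>R v}"

text \<open>
  Geometric multiplicities: for definite \<open>h\<close> the shape operator is diagonalizable, being
  self-adjoint with respect to \<open>h\<close>.
\<close>

definition quasi_umbilical ::
    "('m, 'n::finite) chart set \<Rightarrow> ('m \<Rightarrow> real^('n option)) \<Rightarrow> ('m \<Rightarrow> real^('n option))
      \<Rightarrow> ('m \<Rightarrow> real) \<Rightarrow> ('m \<Rightarrow> real) \<Rightarrow> bool" where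
  "quasi_umbilical A f \<xi> \<kappa>0 \<kappa>1 \<longleftrightarrow>
     (\<forall>c\<in>A. \<forall>z\<in>chart_image c.
        let S = shape_operator (local_rep c f) (local_rep c \<xi>) z;
            l0 = local_rep c \<kappa>0 z; l1 = local_rep c \<kappa>1 z
        in l0 \<noteq> l1 \<and> dim (eigenspace S l0) = 1 \<and> dim (eigenspace S l1) = CARD('n) - 1)"

definition centre_congruent_hypersurface ::
    "'m topology \<Rightarrow> ('m, 'n::finite) chart set \<Rightarrow> ('m \<Rightarrow> real^('n option)) \<Rightarrow> ('m \<Rightarrow> real^('n option))
      \<Rightarrow> ('m \<Rightarrow> real) \<Rightarrow> ('m \<Rightarrow> real) \<Rightarrow> bool" where
  "centre_congruent_hypersurface X A f \<xi> \<kappa>0 \<kappa>1 \<longleftrightarrow>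
     blaschke_immersion X A f \<xi> \<and>
     congruent_to_centre_map A f \<xi> \<and>
     (\<forall>c\<in>A. centroaffine_on (chart_image c) (local_rep c f)) \<and>
     (\<forall>c\<in>A. centroaffine_on (chart_image c) (centre_map (local_rep c f) (local_rep c \<xi>))) \<and>
     positive_blaschke_metric A f \<xi> \<and>
     quasi_umbilical A f \<xi> \<kappa>0 \<kappa>1 \<and>
     (\<forall>p\<in>topspace X. \<kappa>1 p \<noteq> 0)"

section \<open>Warped products\<close>

definition riemannian_metric_on :: "(real^'n::finite) set \<Rightarrow> (real^'n \<Rightarrow> real^'n^'n) \<Rightarrow> bool" where
  "riemannian_metric_on \<Omega> g \<longleftrightarrow> smooth_on \<Omega> g \<and> (\<forall>u\<in>\<Omega>. positive_definite (g u))"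

text \<open>The metric \<open>dt\<^sup>2 + exp(2 F(t)) g\<close> in product coordinates (first factor: the line with its standard metric).\<close>

definition warped_metric ::
    "(real \<Rightarrow> real) \<Rightarrow> (real^'n::finite \<Rightarrow> real^'n^'n) \<Rightarrow> real^('n option)
      \<Rightarrow> real^('n option)^('n option)" where
  "warped_metric F g z =
     (\<chi> a b. case (a, b) of
         (None, None) \<Rightarrow> 1
       | (Some i, Some j) \<Rightarrow> exp (2 * F (z $ None)) * g (rest_coords z) $ i $ j
       | _ \<Rightarrow> 0)"

section \<open>The model hypersurfaces\<close>

definition K0 :: "real \<Rightarrow> real \<Rightarrow> real" where
  "K0 l0 l1 = l0 / (l0 - l1)"

definition K1 :: "real \<Rightarrow> real \<Rightarrow> real" where
  "K1 l0 l1 = l1 / (l0 - l1)"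

definition NN :: "real \<Rightarrow> real \<Rightarrow> real \<Rightarrow> real" where
  "NN n l0 l1 = (n - 2) * K1 l0 l1 + (n + 2) * K0 l0 l1"

definition open_interval :: "real set \<Rightarrow> bool" where
  "open_interval I \<longleftrightarrow> open I \<and> is_interval I \<and> I \<noteq> {}"

definition proper_affine_hypersphere ::
    "'q topology \<Rightarrow> ('q, 'n::finite) chart set \<Rightarrow> ('q \<Rightarrow> real^('n option)) \<Rightarrow> ('q \<Rightarrow> real^('n option))
      \<Rightarrow> real \<Rightarrow> bool" where
  "proper_affine_hypersphere Y B g \<eta> \<mu> \<longleftrightarrow>
     blaschke_immersion Y B g \<eta> \<and> \<mu> \<noteq> 0 \<and>
     (\<forall>c\<in>B. \<forall>z\<in>chart_image c. shape_operator (local_rep c g) (local_rep c \<eta>) z = mat \<mu>)"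

text \<open>
  A proper affine hypersphere with affine normal \<open>\<eta>\<close> and shape operator \<open>\<mu> I\<close> has the centre
  \<open>g + \<eta>/\<mu>\<close>; here it is required to be the origin.  For \<open>f = (t\<^sup>a g, t\<^sup>N/N)\<close> with \<open>a = -2 K1\<close> the
  Blaschke metric is positive on the \<open>t\<close>-direction and on the \<open>g\<close>-directions for one and the same
  choice of the affine normal if and only if the metric of \<open>g\<close> is definite and, \<open>\<eta>\<close> being chosen
  so that it is positive definite, \<open>\<mu> a (a - N) < 0\<close>, that is,
  \<open>\<mu> \<lambda>\<^sub>1 ((n+2) \<lambda>\<^sub>0 + n \<lambda>\<^sub>1) < 0\<close>.  So \<open>g\<close> is of elliptic or hyperbolic type depending on the
  eigenvalues.  Note that \<open>CARD('n) = n - 1\<close> here.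
\<close>

definition adapted_hypersphere ::
    "real \<Rightarrow> real \<Rightarrow> 'q topology \<Rightarrow> ('q, 'n::finite) chart set \<Rightarrow> ('q \<Rightarrow> real^('n option)) \<Rightarrow> bool" where
  "adapted_hypersphere l0 l1 Y B g \<longleftrightarrow>
     (\<exists>\<eta> \<mu>. proper_affine_hypersphere Y B g \<eta> \<mu> \<and>
        (\<forall>q\<in>topspace Y. g q + (1 / \<mu>) *\<^sub>R \<eta> q = 0) \<and>
        positive_blaschke_metric B g \<eta> \<and>
        (let n = real CARD('n option) in \<mu> * l1 * ((n + 2) * l0 + n * l1) < 0))"

definition hypersphere_model ::
    "real \<Rightarrow> real \<Rightarrow> ('q \<Rightarrow> real^'n::finite) \<Rightarrow> real \<times> 'q \<Rightarrow> real^('n option)" where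
  "hypersphere_model k N g = (\<lambda>(t, q). append_coord ((t powr (- 2 * k)) *\<^sub>R g q) (t powr N / N))"

definition hessian :: "(real^'n::finite \<Rightarrow> real) \<Rightarrow> real^'n \<Rightarrow> real^'n^'n" where
  "hessian F u = (\<chi> i j. partial i (partial j F) u)"

text \<open>
  The solution of the Monge-Ampere equation has to be convex, otherwise the Blaschke metric of
  \<open>monge_ampere_model\<close> is indefinite.
\<close>

definition convex_monge_ampere_solution :: "(real^'n::finite) set \<Rightarrow> (real^'n \<Rightarrow> real) \<Rightarrow> bool" where
  "convex_monge_ampere_solution \<Omega> F \<longleftrightarrow>
     smooth_on \<Omega> F \<and> (\<forall>u\<in>\<Omega>. det (hessian F u) = 1 \<and> positive_definite (hessian F u))"

definition monge_ampere_model ::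
    "real \<Rightarrow> real \<Rightarrow> (real^'n::finite \<Rightarrow> real) \<Rightarrow> real \<times> (real^'n) \<Rightarrow> real^('n option option)" where
  "monge_ampere_model k \<phi>0 F = (\<lambda>(t, u).
     append_coord (append_coord ((t powr (- 2 * k)) *\<^sub>R u) (t powr (- 2 * k)))
       (\<phi>0 * t powr (- 2 * k) * (F u - 1 / (2 * k) * ln t)))"

end

theory Submission imports Defs
begin

text \<open>
  Write \<open>c = T f\<close>.  Differentiating \<open>T f = f - \<rho> \<xi>\<close> shows that, at each point, \<open>T - \<alpha>\<close> with
  \<open>\<alpha> = 1 + \<rho> \<lambda>\<^sub>1\<close> maps the tangent space to the span of at most two vectors.  An eigenvector for \<open>\<alpha>\<close> that
  is transversal at some point, which exists because \<open>h\<close> is non-degenerate, shows that \<open>T - \<alpha>\<close> has rank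
  at most two, and if the rank were two, its image would be a plane containing the hypersurface.  Thus
  \<open>T w = \<alpha> w + (\<phi> \<bullet> w) v\<close>.  As \<open>\<alpha>\<close> takes values in the finite
  spectrum of \<open>T\<close>, it is locally a constant \<open>a\<close>; let \<open>\<beta> = a + \<phi> \<bullet> v\<close> be the simple eigenvalue.

  Since \<open>T f = f\<^sub>* Z\<close> is tangent, the hypersurface is locally invariant under the flow \<open>exp (s T)\<close>.  The
  function \<open>\<phi> \<bullet> f\<close> grows exponentially along the flow and \<open>\<rho>\<close> is a constant multiple of its power with
  exponent \<open>a\<close>; taking \<open>\<bar>\<rho>\<bar>\<close>, up to a constant, for \<open>t\<^sup>2\<close> and suitably rescaled linear functions of \<open>f\<close>
  for the other coordinates puts \<open>f\<close> in the form \<open>(t\<^sup>A G(u), t\<^sup>N / N)\<close> with \<open>A = 2 / \<beta>\<close>, \<open>N = 2 / a\<close> if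
  \<open>a \<noteq> \<beta>\<close>, while a Jordan block of \<open>T\<close> produces the logarithm if \<open>a = \<beta>\<close>.  Comparing the volume induced
  by \<open>\<xi>\<close> with the volume of \<open>h\<close> yields \<open>N + n A = n + 2\<close>, which fixes the ratio of the eigenvalues, and,
  as an equation in \<open>u\<close>, that \<open>G\<close> is a proper affine hypersphere, respectively the Monge-Ampere equation.
  Finally \<open>\<lambda>\<^sub>0 + \<lambda>\<^sub>1\<close> has the sign of \<open>a \<beta> \<rho> = - h(Z, Z)\<close>.
\<close>

section \<open>Smooth maps\<close>

text \<open>The exponents are quotients of growth rates. Along the flow with parameter s,
  \<open>\<phi> \<bullet> f\<close> grows like exp(\<beta> s), linear functions on the other
  eigendirections like exp(a s), and \<open>\<rho>\<close>, a multiple of the power a of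
  \<open>\<phi> \<bullet> f\<close>, like exp(a \<beta> s). With t^2 proportional to
  \<open>\<rho>\<close> these become t^(2/a) and t^(2/\<beta>). The volume relation is N + n A - 3 =
  n - 1: the left side is the power of t in the determinant of the frame, the right side that in the
  root of det h, because h is constant on d/dt and carries t^2 on the n - 1 directions of u. By the
  definition of \<open>\<alpha>\<close> one has \<open>\<rho> l1 = a - 1\<close>, and T (T f) gives
  \<open>\<rho> l0 = (1 - \<beta>) (a - 1)\<close>. So l0/l1 = 1 - \<beta> is a constant, while the
  eigenvalues themselves vary like 1/t^2. Two scalings are free in the classification: that of t
  makes d/dt a unit vector, so that F = ln, and that of u makes the Hessian determinant one. In the
  converse the free constant is r in \<open>\<rho> = r t^2\<close>; its sign makes h positive and
  its size satisfies the volume condition for a prescribed linear map L. The eigenvalues then come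
  out as \<open>C l0 / t^2\<close> and \<open>C l1 / t^2\<close>.\<close>

lemma Ck_on_cong:
  assumes "open V" "\<And>x. x \<in> V \<Longrightarrow> f x = g x" "Ck_on k V f"
  shows "Ck_on k V g"
  using assms
proof (induction k arbitrary: f g)
  case 0
  then show ?case using continuous_on_cong by (metis Ck_on.simps(1))
next
  case (Suc k)
  have d: "g differentiable at x \<and> frechet_derivative f (at x) = frechet_derivative g (at x)" if "x \<in> V" for x
  proof -
    have "f differentiable at x" using Suc.prems that by simp
    then have "(f has_derivative frechet_derivative f (at x)) (at x)" by (simp add: frechet_derivative_works)
    then have "(g has_derivative frechet_derivative f (at x)) (at x)"
      using has_derivative_transform_within_open[OF _ \<open>open V\<close> that] Suc.prems(2) by blast
    then show ?thesis using differentiable_def frechet_derivative_at by blast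
  qed
  have "Ck_on k V (\<lambda>x. frechet_derivative g (at x) v)" for v
    by (rule Suc.IH[of "\<lambda>x. frechet_derivative f (at x) v"]) (use Suc.prems d in auto)
  then show ?case using d by simp
qed

lemma Ck_on_subset:
  assumes "Ck_on k V f" "W \<subseteq> V"
  shows "Ck_on k W f"
  using assms by (induction k arbitrary: f) (auto intro: continuous_on_subset)

text \<open>Smoothness can be checked through any explicitly known derivative, since it coincides
  with \<open>frechet_derivative\<close>, to which the recursive definition refers.\<close>

lemma Ck_on_SucI:
  assumes "open V" "\<And>x. x \<in> V \<Longrightarrow> (f has_derivative f' x) (at x)"
    and "\<And>v. Ck_on k V (\<lambda>x. f' x v)"
  shows "Ck_on (Suc k) V f"
proof -
  have "frechet_derivative f (at x) = f' x" if "x \<in> V" for x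
    using assms(2)[OF that] frechet_derivative_at by metis
  then have "Ck_on k V (\<lambda>x. frechet_derivative f (at x) v)" for v
    by (intro Ck_on_cong[OF assms(1) _ assms(3)[of v]]) simp
  then show ?thesis using assms(2) by (auto simp: differentiable_def)
qed

lemma Ck_on_SucD:
  "Ck_on (Suc k) V f \<Longrightarrow> Ck_on k V f"
proof (induction k arbitrary: f)
  case 0
  then show ?case
    by (auto intro!: continuous_at_imp_continuous_on differentiable_imp_continuous_within)
next
  case (Suc k)
  then show ?case by (metis Ck_on.simps(2))
qed

lemma Ck_on_has_derivative:
  "Ck_on (Suc k) V f \<Longrightarrow> x \<in> V \<Longrightarrow> (f has_derivative frechet_derivative f (at x)) (at x)"
  by (simp add: frechet_derivative_works)

lemma Ck_on_const: "Ck_on k V (\<lambda>x. c)"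
proof (induction k arbitrary: c)
  case (Suc k)
  then show ?case by simp
qed simp

lemma Ck_on_bounded_linear:
  assumes "bounded_linear L" "open V"
  shows "Ck_on k V L"
proof (cases k)
  case 0
  then show ?thesis using assms by (simp add: linear_continuous_on)
next
  case (Suc j)
  then show ?thesis
    using Ck_on_SucI[OF assms(2) bounded_linear_imp_has_derivative[OF assms(1)] Ck_on_const] by blast
qed

lemma Ck_on_add:
  assumes "open V" "Ck_on k V f" "Ck_on k V g"
  shows "Ck_on k V (\<lambda>x. f x + g x)"
  using assms
proof (induction k arbitrary: f g)
  case 0
  then show ?case by (simp add: continuous_on_add)
next
  case (Suc k)
  show ?case
    by (rule Ck_on_SucI[OF Suc.prems(1), where f' = "\<lambda>x v. frechet_derivative f (at x) v + frechet_derivative g (at x) v"])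
      (use Suc in \<open>auto simp: frechet_derivative_works[symmetric] intro!: has_derivative_add\<close>)
qed

lemma Ck_on_bilinear:
  assumes "bounded_bilinear B" "open V" "Ck_on k V f" "Ck_on k V g"
  shows "Ck_on k V (\<lambda>x. B (f x) (g x))"
  using assms(2-)
proof (induction k arbitrary: f g)
  case 0
  then show ?case by (simp add: bounded_bilinear.continuous_on[OF assms(1)])
next
  case (Suc k)
  have 1: "Ck_on k V f" "Ck_on k V g" using Suc.prems Ck_on_SucD by blast+
  show ?case
    by (rule Ck_on_SucI[OF Suc.prems(1), where f' = "\<lambda>x v. B (f x) (frechet_derivative g (at x) v) + B (frechet_derivative f (at x) v) (g x)"])
      (use Suc 1 in \<open>auto simp: frechet_derivative_works[symmetric] intro!: bounded_bilinear.FDERIV[OF assms(1)] Ck_on_add\<close>)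
qed

lemma Ck_on_sum:
  assumes "open V" "\<And>i. i \<in> A \<Longrightarrow> Ck_on k V (f i)"
  shows "Ck_on k V (\<lambda>x. \<Sum>i\<in>A. f i x)"
  using assms(2)
  by (induction A rule: infinite_finite_induct) (auto intro: Ck_on_const Ck_on_add[OF assms(1)])

lemma Ck_on_linear_image:
  assumes "bounded_linear L" "open V" "Ck_on k V f"
  shows "Ck_on k V (\<lambda>x. L (f x))"
  using assms(2-)
proof (induction k arbitrary: f)
  case 0
  then show ?case
    by (simp add: bounded_linear.continuous_on[OF assms(1)])
next
  case (Suc k)
  show ?case
    by (rule Ck_on_SucI[OF Suc.prems(1), where f' = "\<lambda>x v. L (frechet_derivative f (at x) v)"])
      (use Suc in \<open>auto simp: frechet_derivative_works[symmetric] intro!: bounded_linear.has_derivative[OF assms(1)]\<close>)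
qed

lemma Ck_on_compose:
  fixes f :: "'a::real_normed_vector \<Rightarrow> 'b::euclidean_space"
  assumes "open V" "open W" "Ck_on k W g" "Ck_on k V f" "f ` V \<subseteq> W"
  shows "Ck_on k V (\<lambda>x. g (f x))"
  using assms
proof (induction k arbitrary: g)
  case 0
  then show ?case
    by (auto intro: continuous_on_compose2)
next
  case (Suc k)
  let ?Df = "\<lambda>x. frechet_derivative f (at x)" and ?Dg = "\<lambda>y. frechet_derivative g (at y)"
  have 1: "Ck_on k V f" using Suc.prems Ck_on_SucD by blast
  have "((\<lambda>x. g (f x)) has_derivative (\<lambda>v. ?Dg (f x) (?Df x v))) (at x)" if "x \<in> V" for x
    using diff_chain_at[OF Ck_on_has_derivative[OF Suc.prems(4) that], of g "?Dg (f x)"]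
      Ck_on_has_derivative[OF Suc.prems(3), of "f x"] Suc.prems(5) that
    by (auto simp: o_def)
  \<comment> \<open>The outer derivative is applied to a vector that moves with \<open>x\<close>,
    which the induction hypothesis does not cover. Expanding this vector in the basis leaves only
    \<open>?Dg (f x) b\<close> with \<open>b\<close> fixed.\<close>
  moreover have "?Dg (f x) (?Df x v) = (\<Sum>b\<in>Basis. (?Df x v \<bullet> b) *\<^sub>R ?Dg (f x) b)" if "x \<in> V" for x v
  proof -
    have "linear (?Dg (f x))"
      using Ck_on_has_derivative[OF Suc.prems(3), of "f x"] Suc.prems(5) that has_derivative_linear by blast
    then show ?thesis
      by (subst euclidean_representation[of "?Df x v", symmetric]) (simp add: linear_sum linear_cmul)
  qed
  ultimately have 2: "((\<lambda>x. g (f x)) has_derivative (\<lambda>v. \<Sum>b\<in>Basis. (?Df x v \<bullet> b) *\<^sub>R ?Dg (f x) b)) (at x)" if "x \<in> V" for x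
    using that by simp
  have "Ck_on k V (\<lambda>x. (?Df x v \<bullet> b) *\<^sub>R ?Dg (f x) b)" for v b
    apply (rule Ck_on_bilinear[OF bounded_bilinear_scaleR Suc.prems(1)])
    subgoal by (rule Ck_on_linear_image[OF bounded_linear_inner_left Suc.prems(1)]) (use Suc.prems in simp)
    subgoal by (rule Suc.IH) (use Suc.prems 1 in auto)
    done
  then show ?case
    by (intro Ck_on_SucI[OF Suc.prems(1) 2] Ck_on_sum[OF Suc.prems(1)]) auto
qed

section \<open>Inverses, powers and logarithms\<close>

lemma Ck_on_real:
  fixes f :: "real \<Rightarrow> real"
  assumes "open V" "\<And>x. x \<in> V \<Longrightarrow> (f has_real_derivative f' x) (at x)" "Ck_on k V f'"
  shows "Ck_on (Suc k) V f"
  by (rule Ck_on_SucI[OF assms(1), where f' = "\<lambda>x v. f' x * v"])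
    (use assms in \<open>auto simp: has_field_derivative_def intro: Ck_on_bilinear[OF bounded_bilinear_mult] Ck_on_const\<close>)

lemma Ck_on_inverse: "Ck_on k (- {0::real}) inverse"
proof (induction k)
  case 0
  then show ?case by (auto intro: continuous_intros)
next
  case (Suc k)
  have "Ck_on k (- {0}) (\<lambda>x::real. - (inverse x * inverse x))"
    by (intro Ck_on_linear_image[OF bounded_linear_minus[OF bounded_linear_ident]]
        Ck_on_bilinear[OF bounded_bilinear_mult] Suc) auto
  then show ?case
    by (rule Ck_on_real[rotated 2]) (auto intro!: derivative_eq_intros)
qed

lemma Ck_on_powr: "Ck_on k {0<..} (\<lambda>t::real. t powr a)"
proof (induction k arbitrary: a)
  case 0
  then show ?case by (auto intro!: continuous_intros)
next
  case (Suc k)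
  show ?case
    by (rule Ck_on_real[where f' = "\<lambda>t. a * t powr (a - 1)"])
      (auto intro!: derivative_eq_intros Ck_on_bilinear[OF bounded_bilinear_mult] Suc Ck_on_const)
qed

lemma Ck_on_ln: "Ck_on k {0<..} (ln :: real \<Rightarrow> real)"
proof (cases k)
  case 0
  then show ?thesis by (auto intro!: continuous_intros)
next
  case (Suc j)
  show ?thesis unfolding Suc
    by (rule Ck_on_real[where f' = inverse])
      (auto intro!: derivative_eq_intros Ck_on_subset[OF Ck_on_inverse] simp: inverse_eq_divide)
qed

lemma smooth_on_cong: "open V \<Longrightarrow> (\<And>x. x \<in> V \<Longrightarrow> f x = g x) \<Longrightarrow> smooth_on V f \<Longrightarrow> smooth_on V g"
  unfolding smooth_on_def using Ck_on_cong by blast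

lemma smooth_on_subset: "smooth_on V f \<Longrightarrow> W \<subseteq> V \<Longrightarrow> smooth_on W f"
  unfolding smooth_on_def using Ck_on_subset by blast

lemma smooth_on_has_derivative:
  "smooth_on V f \<Longrightarrow> x \<in> V \<Longrightarrow> (f has_derivative frechet_derivative f (at x)) (at x)"
  unfolding smooth_on_def using Ck_on_has_derivative by blast

lemma smooth_on_differentiable: "smooth_on V f \<Longrightarrow> x \<in> V \<Longrightarrow> f differentiable at x"
  using smooth_on_has_derivative differentiable_def by blast

lemma smooth_on_continuous: "smooth_on V f \<Longrightarrow> continuous_on V f"
  unfolding smooth_on_def using Ck_on.simps(1) by blast

lemma smooth_on_derivative: "smooth_on V f \<Longrightarrow> smooth_on V (\<lambda>x. frechet_derivative f (at x) v)"
  unfolding smooth_on_def by (metis Ck_on.simps(2))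

lemma smooth_on_partial: "smooth_on V f \<Longrightarrow> smooth_on V (partial i f)"
  unfolding partial_def[abs_def] by (rule smooth_on_derivative)

lemma smooth_on_const: "smooth_on V (\<lambda>x. c)"
  by (simp add: smooth_on_def Ck_on_const)

lemma smooth_on_bounded_linear: "bounded_linear L \<Longrightarrow> open V \<Longrightarrow> smooth_on V L"
  by (simp add: smooth_on_def Ck_on_bounded_linear)

lemma smooth_on_ident: "open V \<Longrightarrow> smooth_on V (\<lambda>x. x)"
  by (rule smooth_on_bounded_linear[OF bounded_linear_ident])

lemma smooth_on_add: "open V \<Longrightarrow> smooth_on V f \<Longrightarrow> smooth_on V g \<Longrightarrow> smooth_on V (\<lambda>x. f x + g x)"
  by (simp add: smooth_on_def Ck_on_add)

lemma smooth_on_linear_image: "bounded_linear L \<Longrightarrow> open V \<Longrightarrow> smooth_on V f \<Longrightarrow> smooth_on V (\<lambda>x. L (f x))"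
  by (simp add: smooth_on_def Ck_on_linear_image)

lemma smooth_on_minus: "open V \<Longrightarrow> smooth_on V f \<Longrightarrow> smooth_on V (\<lambda>x. - f x)"
  by (rule smooth_on_linear_image[OF bounded_linear_minus[OF bounded_linear_ident]])

lemma smooth_on_diff: "open V \<Longrightarrow> smooth_on V f \<Longrightarrow> smooth_on V g \<Longrightarrow> smooth_on V (\<lambda>x. f x - g x)"
  using smooth_on_add[OF _ _ smooth_on_minus] by fastforce

lemma smooth_on_sum: "open V \<Longrightarrow> (\<And>i. i \<in> A \<Longrightarrow> smooth_on V (f i)) \<Longrightarrow> smooth_on V (\<lambda>x. \<Sum>i\<in>A. f i x)"
  by (simp add: smooth_on_def Ck_on_sum)

lemma smooth_on_scaleR:
  "open V \<Longrightarrow> smooth_on V f \<Longrightarrow> smooth_on V g \<Longrightarrow> smooth_on V (\<lambda>x. f x *\<^sub>R g x)"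
  by (simp add: smooth_on_def Ck_on_bilinear[OF bounded_bilinear_scaleR])

lemma smooth_on_mult:
  fixes f g :: "_ \<Rightarrow> real"
  shows "open V \<Longrightarrow> smooth_on V f \<Longrightarrow> smooth_on V g \<Longrightarrow> smooth_on V (\<lambda>x. f x * g x)"
  by (simp add: smooth_on_def Ck_on_bilinear[OF bounded_bilinear_mult])

lemma smooth_on_prod:
  fixes f :: "_ \<Rightarrow> _ \<Rightarrow> real"
  assumes "open V" "\<And>i. i \<in> A \<Longrightarrow> smooth_on V (f i)"
  shows "smooth_on V (\<lambda>x. \<Prod>i\<in>A. f i x)"
  using assms(2)
  by (induction A rule: infinite_finite_induct) (auto intro: smooth_on_const smooth_on_mult[OF assms(1)])

lemma smooth_on_compose:
  fixes f :: "'a::real_normed_vector \<Rightarrow> 'b::euclidean_space"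
  assumes "smooth_on W g" "open V" "open W" "smooth_on V f" "\<And>x. x \<in> V \<Longrightarrow> f x \<in> W"
  shows "smooth_on V (\<lambda>x. g (f x))"
  using assms unfolding smooth_on_def by (blast intro: Ck_on_compose)

lemma smooth_on_inverse:
  fixes f :: "_ \<Rightarrow> real"
  assumes "open V" "smooth_on V f" "\<And>x. x \<in> V \<Longrightarrow> f x \<noteq> 0"
  shows "smooth_on V (\<lambda>x. inverse (f x))"
  by (rule smooth_on_compose[where W = "- {0}"]) (use assms in \<open>auto simp: smooth_on_def Ck_on_inverse\<close>)

lemma smooth_on_divide:
  fixes f g :: "_ \<Rightarrow> real"
  assumes "open V" "smooth_on V f" "smooth_on V g" "\<And>x. x \<in> V \<Longrightarrow> g x \<noteq> 0"
  shows "smooth_on V (\<lambda>x. f x / g x)"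
  unfolding divide_inverse by (intro smooth_on_mult smooth_on_inverse assms)

lemma smooth_on_powr:
  fixes f :: "_ \<Rightarrow> real"
  assumes "open V" "smooth_on V f" "\<And>x. x \<in> V \<Longrightarrow> f x > 0"
  shows "smooth_on V (\<lambda>x. f x powr a)"
  by (rule smooth_on_compose[where W = "{0<..}" and g = "\<lambda>t. t powr a"]) (use assms in \<open>auto simp: smooth_on_def Ck_on_powr\<close>)

lemma smooth_on_ln:
  fixes f :: "_ \<Rightarrow> real"
  assumes "open V" "smooth_on V f" "\<And>x. x \<in> V \<Longrightarrow> f x > 0"
  shows "smooth_on V (\<lambda>x. ln (f x))"
  by (rule smooth_on_compose[where W = "{0<..}" and g = ln]) (use assms in \<open>auto simp: smooth_on_def Ck_on_ln\<close>)

lemma smooth_on_euclidean: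
  fixes f :: "_ \<Rightarrow> 'b::euclidean_space"
  assumes "open V" "\<And>b. b \<in> Basis \<Longrightarrow> smooth_on V (\<lambda>x. f x \<bullet> b)"
  shows "smooth_on V f"
proof -
  have "smooth_on V (\<lambda>x. \<Sum>b\<in>Basis. (f x \<bullet> b) *\<^sub>R b)"
    by (intro smooth_on_sum smooth_on_scaleR smooth_on_const assms)
  then show ?thesis by (simp add: euclidean_representation)
qed

lemma smooth_on_vec_nth: "open V \<Longrightarrow> smooth_on V f \<Longrightarrow> smooth_on V (\<lambda>x. f x $ i)"
  by (rule smooth_on_linear_image[OF bounded_linear_vec_nth])

lemma smooth_on_vec:
  fixes f :: "_ \<Rightarrow> 'b::euclidean_space ^ 'n"
  assumes "open V" "\<And>i. smooth_on V (\<lambda>x. f x $ i)"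
  shows "smooth_on V f"
proof (rule smooth_on_euclidean[OF assms(1)])
  fix b :: "'b^'n" assume "b \<in> Basis"
  then obtain i u where "b = axis i u" by (auto simp: Basis_vec_def)
  then show "smooth_on V (\<lambda>x. f x \<bullet> b)"
    by (simp add: inner_axis) (intro smooth_on_linear_image[OF bounded_linear_inner_left] assms)
qed

lemma smooth_on_det:
  fixes A :: "_ \<Rightarrow> real^'n^'n"
  assumes "open V" "\<And>i j. smooth_on V (\<lambda>x. A x $ i $ j)"
  shows "smooth_on V (\<lambda>x. det (A x))"
  unfolding det_def
  by (intro smooth_on_sum smooth_on_mult smooth_on_const smooth_on_prod assms)

section \<open>Linear systems with parameters and smooth local inverses\<close>

lemma matrix_inv_mult:
  fixes A :: "real^'n^'n"
  assumes "det A \<noteq> 0"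
  shows "A ** matrix_inv A = mat 1" "matrix_inv A ** A = mat 1"
proof -
  have "\<exists>B. A ** B = mat 1 \<and> B ** A = mat 1"
    using assms invertible_det_nz invertible_def by blast
  then show "A ** matrix_inv A = mat 1" "matrix_inv A ** A = mat 1"
    unfolding matrix_inv_def by (metis (mono_tags, lifting) someI_ex)+
qed

text \<open>Cramer's rule exhibits solutions of linear systems as smooth functions of the data.\<close>

lemma smooth_on_solve:
  fixes A :: "_ \<Rightarrow> real^'n^'n"
  assumes V: "open V" and A: "\<And>i j. smooth_on V (\<lambda>x. A x $ i $ j)" and w: "smooth_on V w"
    and eq: "\<And>x. x \<in> V \<Longrightarrow> det (A x) \<noteq> 0 \<and> A x *v X x = w x"
  shows "smooth_on V X"
proof -
  let ?C = "\<lambda>x k. det (\<chi> i j. if j = k then w x $ i else A x $ i $ j) / det (A x)"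
  have num: "smooth_on V (\<lambda>x. (\<chi> i j. if j = k then w x $ i else A x $ i $ j) $ i $ j)" for k i j
    by (cases "j = k") (simp_all add: A smooth_on_vec_nth[OF V w])
  have "smooth_on V (\<lambda>x. ?C x k)" for k
    by (rule smooth_on_divide[OF V smooth_on_det[OF V num] smooth_on_det[OF V A]]) (simp add: eq)
  then have sC: "smooth_on V (\<lambda>x. \<chi> k. ?C x k)"
    by (intro smooth_on_vec V) simp
  have "(\<chi> k. ?C x k) = X x" if "x \<in> V" for x
    by (rule iffD1[OF cramer, symmetric]) (use eq[OF that] in blast)+
  then show ?thesis by (rule smooth_on_cong[OF V _ sC])
qed

text \<open>Differentiating \<open>f (g y) = y\<close> expresses the derivative of \<open>g\<close>
  at \<open>y\<close> as the inverse matrix of the derivative of \<open>f\<close> at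
  \<open>g y\<close>. That inverse is smooth in its base point by Cramer's rule, so each order of
  differentiability of \<open>g\<close> yields the next; continuity starts the induction.\<close>

lemma smooth_on_inverse_function:
  fixes f :: "real^'n \<Rightarrow> real^'n"
  assumes f: "smooth_on V f" and "open V" "open W"
    and g: "continuous_on W g" "\<And>y. y \<in> W \<Longrightarrow> g y \<in> V \<and> f (g y) = y"
    and D: "\<And>x. x \<in> V \<Longrightarrow> inj (frechet_derivative f (at x))"
    and dg: "\<And>y. y \<in> W \<Longrightarrow> g differentiable (at y)"
  shows "smooth_on W g"
proof -
  let ?Df = "\<lambda>x. frechet_derivative f (at x)" and ?Dg = "\<lambda>y. frechet_derivative g (at y)"
  define A where "A = (\<lambda>x. matrix (?Df x))"
  have fd: "(f has_derivative ?Df x) (at x)" if "x \<in> V" for x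
    using smooth_on_has_derivative[OF f that] .
  have lin: "linear (?Df x)" if "x \<in> V" for x using fd[OF that] has_derivative_linear by blast
  have Av: "A x *v v = ?Df x v" if "x \<in> V" for x v
    unfolding A_def by (metis lin[OF that] matrix_vector_mul(2))
  have detA: "det (A x) \<noteq> 0" if "x \<in> V" for x
    using det_nz_iff_inj[OF lin[OF that]] D[OF that] A_def by simp
  have As: "smooth_on V (\<lambda>x. A x $ i $ j)" for i j
    unfolding A_def matrix_def
    using smooth_on_vec_nth[OF \<open>open V\<close> smooth_on_derivative[OF f, of "axis j 1"], of i] by simp
  define H where "H v = (\<lambda>x. matrix_inv (A x) *v v)" for v
  have Hs: "smooth_on V (H v)" for v
  proof (rule smooth_on_solve[OF \<open>open V\<close> As smooth_on_const[of V v]])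
    show "det (A x) \<noteq> 0 \<and> A x *v H v x = v" if "x \<in> V" for x
      using detA[OF that] matrix_inv_mult[OF detA[OF that]]
      by (simp add: H_def matrix_vector_mul_assoc)
  qed
  have gd: "(g has_derivative ?Dg y) (at y)" if "y \<in> W" for y
    using dg[OF that] frechet_derivative_works by blast
  have Dg: "?Dg y v = H v (g y)" if "y \<in> W" for y v
  proof -
    have V: "g y \<in> V" using g(2) that by blast
    have "((\<lambda>y. f (g y)) has_derivative (\<lambda>v. ?Df (g y) (?Dg y v))) (at y)"
      using diff_chain_at[OF gd[OF that] fd[OF V]] by (simp add: o_def)
    moreover have "((\<lambda>y. f (g y)) has_derivative (\<lambda>v. v)) (at y)"
      by (rule has_derivative_transform_within_open[OF has_derivative_ident \<open>open W\<close> that]) (simp add: g(2))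
    ultimately have "?Df (g y) (?Dg y v) = v"
      using has_derivative_unique by metis
    then have "A (g y) *v ?Dg y v = v" using Av[OF V] by simp
    then have "matrix_inv (A (g y)) *v (A (g y) *v ?Dg y v) = H v (g y)" by (simp add: H_def)
    then show ?thesis using matrix_inv_mult[OF detA[OF V]] by (simp add: matrix_vector_mul_assoc)
  qed
  have "Ck_on k W g" for k
  proof (induction k)
    case 0
    then show ?case using g(1) by simp
  next
    case (Suc k)
    have "Ck_on k W (\<lambda>y. H v (g y))" for v
      by (rule Ck_on_compose[OF \<open>open W\<close> \<open>open V\<close>, of _ "H v" g]) (use Hs[of v, unfolded smooth_on_def] Suc.IH g(2) in auto)
    then have "Ck_on k W (\<lambda>y. ?Dg y v)" for v
      by (rule Ck_on_cong[OF \<open>open W\<close>, rotated]) (simp add: Dg)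
    then show ?case by (intro Ck_on_SucI[OF \<open>open W\<close> gd])
  qed
  then show ?thesis by (simp add: smooth_on_def)
qed

text \<open>The inverse function theorem gives a homeomorphism with differentiable inverse, and
  \<open>smooth_on_inverse_function\<close> makes that inverse smooth. Injectivity of the derivative
  on all of \<open>U\<close> is kept because it later identifies the coordinate field d/dt.\<close>

lemma smooth_on_local_inverse:
  fixes f :: "real^'n \<Rightarrow> real^'n"
  assumes f: "smooth_on V f" and V: "open V" "x0 \<in> V" and inj: "inj (frechet_derivative f (at x0))"
  obtains U W g where "open U" "U \<subseteq> V" "x0 \<in> U" "open W" "f x0 \<in> W" "homeomorphism U W f g"
    "smooth_on W g" "\<And>x. x \<in> U \<Longrightarrow> inj (frechet_derivative f (at x))"
proof -
  let ?Df = "\<lambda>x. frechet_derivative f (at x)"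
  have fd: "(f has_derivative ?Df x) (at x)" if "x \<in> V" for x
    using smooth_on_has_derivative[OF f that] .
  have bl: "bounded_linear (?Df x)" if "x \<in> V" for x using fd[OF that] has_derivative_bounded_linear by blast
  define f' where "f' x = Blinfun (?Df x)" for x
  have f': "blinfun_apply (f' x) = ?Df x" if "x \<in> V" for x
    unfolding f'_def using bounded_linear_Blinfun_apply bl[OF that] by blast
  have "continuous_on V (\<lambda>x. blinfun_apply (f' x) i)" if "i \<in> Basis" for i
    by (rule continuous_on_eq[OF smooth_on_continuous[OF smooth_on_derivative[OF f, of i]]]) (simp add: f')
  then have cont: "continuous_on V f'"
    using continuous_on_blinfun_componentwise[of V f'] by (simp add: continuous_on_eq_continuous_within)
  obtain k where k: "linear k" "k \<circ> ?Df x0 = id"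
    using linear_injective_left_inverse[OF bounded_linear.linear[OF bl[OF V(2)]] inj] by blast
  have "Blinfun k o\<^sub>L f' x0 = id_blinfun"
    using k f'[OF V(2)]
    by (intro blinfun_eqI) (simp add: fun_eq_iff linear_conv_bounded_linear bounded_linear_Blinfun_apply)
  then obtain U W g g' where *: "open U" "U \<subseteq> V" "x0 \<in> U" "open W" "f x0 \<in> W" "homeomorphism U W f g"
    "\<And>y. y \<in> W \<Longrightarrow> (g has_derivative (g' y)) (at y)"
    "\<And>y. y \<in> W \<Longrightarrow> bij (blinfun_apply (f'(g y)))"
    using inverse_function_theorem[OF V(1) _ cont V(2), of f] fd f' by metis
  have UD: "inj (?Df x)" if "x \<in> U" for x
  proof -
    have "f x \<in> W" "g (f x) = x" "x \<in> V" using *(2,6) that by (auto simp: homeomorphism_def)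
    then show ?thesis using *(8)[of "f x"] f' by (simp add: bij_def)
  qed
  have "smooth_on W g"
    by (rule smooth_on_inverse_function[OF smooth_on_subset[OF f *(2)] *(1) *(4)])
      (use *(6,7) UD in \<open>auto simp: homeomorphism_def differentiable_def\<close>)
  then show ?thesis using that * UD by metis
qed

section \<open>Determinants over an extended index set\<close>

lemma sum_UNIV_option: "(\<Sum>a\<in>(UNIV::'n::finite option set). g a) = g None + (\<Sum>i\<in>UNIV. g (Some i))"
  by (simp add: UNIV_option_conv sum.reindex)

lemma prod_UNIV_option: "(\<Prod>a\<in>(UNIV::'n::finite option set). g a) = g None * (\<Prod>i\<in>UNIV. g (Some i))"
  by (simp add: UNIV_option_conv prod.reindex)

text \<open>Only permutations fixing \<open>None\<close> contribute, every other one picking a zero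
  of that row. Transporting the remaining ones along \<open>Some\<close>, which preserves signs,
  yields the minor without any ordering of the index set.\<close>

lemma det_option_row:
  fixes M :: "real^('n::finite option)^('n option)"
  assumes "\<And>j. M $ None $ Some j = 0"
  shows "det M = M $ None $ None * det (\<chi> i j. M $ Some i $ Some j)"
proof -
  let ?R = "range Some :: 'n option set"
  let ?E = "map_permutation (UNIV :: 'n set) Some"
  let ?F = "map_permutation ?R the"
  let ?t = "\<lambda>p. of_int (sign p) * (\<Prod>a\<in>UNIV. M $ a $ p a)"
  have bS: "bij_betw Some (UNIV :: 'n set) ?R" by (simp add: bij_betw_def)
  have bT: "bij_betw the ?R (UNIV :: 'n set)" by (auto simp: bij_betw_def inj_on_def image_image)
  have "det M = (\<Sum>p | p permutes UNIV. ?t p)" by (simp add: det_def)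
  also have "\<dots> = (\<Sum>p | p permutes ?R. ?t p)"
  proof (rule sum.mono_neutral_right)
    show "{p. p permutes ?R} \<subseteq> {p. p permutes UNIV}" using permutes_subset by blast
    show "\<forall>p\<in>{p. p permutes UNIV} - {p. p permutes ?R}. ?t p = 0"
    proof
      fix p assume p: "p \<in> {p. p permutes UNIV} - {p. p permutes ?R}"
      have "p None \<noteq> None"
      proof
        assume p0: "p None = None"
        have "p x = x" if "x \<in> UNIV - ?R" for x
          using p0 that by (cases x) auto
        then have "p permutes ?R" using p permutes_superset[of p UNIV ?R] by blast
        then show False using p by simp
      qed
      then obtain j where "p None = Some j" by blast
      then have "(\<Prod>a\<in>UNIV. M $ a $ p a) = 0" using assms by (auto simp: prod_UNIV_option)
      then show "?t p = 0" by simp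
    qed
  qed (simp add: finite_permutations)
  also have "\<dots> = (\<Sum>q | q permutes (UNIV :: 'n set). ?t (?E q))"
  proof (rule sum.reindex_bij_witness[where i = ?E and j = ?F])
    fix p :: "'n option \<Rightarrow> 'n option" assume p: "p \<in> {p. p permutes ?R}"
    show "?E (?F p) = p"
      by (rule map_permutation_compose_inv[OF bT]) (use p in auto)
    then show "?t (?E (?F p)) = ?t p" by simp
    show "?F p \<in> {q. q permutes UNIV}" using map_permutation_permutes[OF bT] p by simp
  next
    fix q :: "'n \<Rightarrow> 'n" assume q: "q \<in> {q. q permutes UNIV}"
    show "?F (?E q) = q"
      by (rule map_permutation_compose_inv[OF bS]) (use q in auto)
    show "?E q \<in> {p. p permutes ?R}" using map_permutation_permutes[OF bS] q by simp
  qed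
  also have "\<dots> = (\<Sum>q | q permutes (UNIV :: 'n set). M $ None $ None * (of_int (sign q) * (\<Prod>i\<in>UNIV. M $ Some i $ Some (q i))))"
  proof (rule sum.cong)
    fix q :: "'n \<Rightarrow> 'n" assume "q \<in> {q. q permutes UNIV}"
    then have q: "q permutes UNIV" by simp
    have "sign (?E q) = sign q" by (rule sign_map_permutation) (use q in auto)
    moreover have "?E q None = None"
      using map_permutation_permutes[OF bS q] by (auto simp: permutes_def)
    moreover have "?E q (Some i) = Some (q i)" for i by (simp add: map_permutation_apply)
    ultimately show "?t (?E q) = M $ None $ None * (of_int (sign q) * (\<Prod>i\<in>UNIV. M $ Some i $ Some (q i)))"
      by (simp add: prod_UNIV_option)
  qed simp
  finally show ?thesis by (simp add: det_def sum_distrib_left)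
qed

lemma det_option_col:
  fixes M :: "real^('n::finite option)^('n option)"
  assumes "\<And>i. M $ Some i $ None = 0"
  shows "det M = M $ None $ None * det (\<chi> i j. M $ Some i $ Some j)"
proof -
  have "det (transpose M) = M $ None $ None * det (\<chi> i j. M $ Some j $ Some i)"
    using det_option_row[of "transpose M"] assms by (simp add: transpose_def)
  also have "(\<chi> i j. M $ Some j $ Some i) = transpose (\<chi> i j. M $ Some i $ Some j)"
    by (simp add: transpose_def vec_eq_iff)
  finally show ?thesis by (simp only: det_transpose)
qed

lemma det_cmult:
  fixes M :: "real^'n^'n"
  shows "det (\<chi> i j. c * M $ i $ j) = c ^ CARD('n) * det M"
proof -
  have "det (\<chi> i j. c * M $ i $ j) = det (\<chi> i. c *s M $ i)"
    by (rule arg_cong[where f = det]) (simp add: vec_eq_iff)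
  then show ?thesis using det_rows_mul[of "\<lambda>i. c" "\<lambda>i. M $ i"] by (simp add: prod_constant)
qed

section \<open>Extended coordinates\<close>

lemma append_coord_nth [simp]:
  "append_coord v s $ None = s" "append_coord v s $ Some i = v $ i"
  by (simp_all add: append_coord_def)

lemma rest_coords_nth [simp]: "rest_coords z $ i = z $ Some i"
  by (simp add: rest_coords_def)

lemma vec_option_eq_iff: "(x :: 'a^('n::finite option)) = y \<longleftrightarrow> x $ None = y $ None \<and> (\<forall>i. x $ Some i = y $ Some i)"
  by (simp add: vec_eq_iff split_option_all)

lemma rest_append [simp]: "rest_coords (append_coord v s) = v"
  by (simp add: vec_eq_iff)

lemma append_rest [simp]: "append_coord (rest_coords z) (z $ None) = z"
  by (simp add: vec_option_eq_iff)

lemma append_coord_inject [simp]: "append_coord v s = append_coord w t \<longleftrightarrow> v = w \<and> s = t"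
  by (metis append_coord_nth(1) rest_append)

lemma append_coord_add: "append_coord v s + append_coord w t = append_coord (v + w) (s + t)"
  by (simp add: vec_option_eq_iff)

lemma append_coord_scaleR: "c *\<^sub>R append_coord v s = append_coord (c *\<^sub>R v) (c * s)"
  by (simp add: vec_option_eq_iff)

lemma append_coord_eq_0_iff [simp]: "append_coord v s = 0 \<longleftrightarrow> v = 0 \<and> s = 0"
  by (auto simp: vec_option_eq_iff vec_eq_iff)

lemma append_coord_0 [simp]: "append_coord 0 0 = 0" by simp

lemma append_coord_axis:
  "axis (Some i) 1 = append_coord (axis i 1) 0" "axis None 1 = append_coord 0 (1::real)"
  by (simp_all add: vec_option_eq_iff axis_def)

lemma bounded_linear_rest_coords: "bounded_linear rest_coords"
  by (intro linear_conv_bounded_linear[THEN iffD1] linearI) (simp_all add: vec_eq_iff)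

lemma linear_append_coord: "linear (\<lambda>p. append_coord (fst p) (snd p))"
  by (intro linearI) (simp_all add: append_coord_add append_coord_scaleR)

lemma bounded_linear_append_coord_left: "bounded_linear (\<lambda>v. append_coord v 0)"
  by (intro linear_conv_bounded_linear[THEN iffD1] linearI) (simp_all add: vec_option_eq_iff)

lemma bounded_linear_append_coord_right: "bounded_linear (\<lambda>s. append_coord 0 s)"
  by (intro linear_conv_bounded_linear[THEN iffD1] linearI) (simp_all add: vec_option_eq_iff)

lemma append_coord_split: "append_coord v s = append_coord v 0 + append_coord 0 s"
  by (simp add: append_coord_add)

lemma has_derivative_append_coord:
  assumes "(f has_derivative f') F" "(g has_derivative g') F"
  shows "((\<lambda>x. append_coord (f x) (g x)) has_derivative (\<lambda>h. append_coord (f' h) (g' h))) F"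
  unfolding append_coord_split[of "f _" "g _"] append_coord_split[of "f' _" "g' _"]
  by (intro has_derivative_add bounded_linear.has_derivative[OF bounded_linear_append_coord_left]
      bounded_linear.has_derivative[OF bounded_linear_append_coord_right] assms)

lemma smooth_on_append_coord:
  assumes "open V" "smooth_on V f" "smooth_on V g"
  shows "smooth_on V (\<lambda>x. append_coord (f x) (g x))"
  unfolding append_coord_split[of "f _" "g _"]
  by (intro smooth_on_add smooth_on_linear_image[OF bounded_linear_append_coord_left]
      smooth_on_linear_image[OF bounded_linear_append_coord_right] assms)

lemma open_product_domain:
  assumes "open I" "open \<Omega>"
  shows "open (product_domain I \<Omega>)"
proof -
  have "product_domain I \<Omega> = (\<lambda>z. z $ None) -` I \<inter> rest_coords -` \<Omega>"
    by (auto simp: product_domain_def)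
  then show ?thesis
    by (auto intro!: open_Int open_vimage assms linear_continuous_on bounded_linear_rest_coords bounded_linear_vec_nth)
qed

lemma matrix_vector_sum: "A *v x = (\<Sum>i\<in>UNIV. x $ i *\<^sub>R (\<chi> k. A $ k $ i))" for A :: "real^'n^'m"
  by (simp add: vec_eq_iff matrix_vector_mult_def mult.commute)

section \<open>Frames\<close>

lemma frechet_derivative_cong_open:
  assumes "open V" "z \<in> V" "\<And>x. x \<in> V \<Longrightarrow> f x = g x"
  shows "frechet_derivative f (at z) = frechet_derivative g (at z)"
proof -
  have "(f has_derivative D) (at z) \<longleftrightarrow> (g has_derivative D) (at z)" for D
    using has_derivative_transform_within_open[OF _ assms(1,2)] assms(3) by metis
  then show ?thesis unfolding frechet_derivative_def by simp
qed

lemma frechet_derivative_eqI: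
  "(f has_derivative D) (at z) \<Longrightarrow> frechet_derivative f (at z) = D"
  using frechet_derivative_at by metis

lemma partial_eqI: "(f has_derivative D) (at z) \<Longrightarrow> partial i f z = D (axis i 1)"
  by (simp add: partial_def frechet_derivative_eqI)

lemma partial_cong:
  assumes "open V" "z \<in> V" "\<And>x. x \<in> V \<Longrightarrow> f x = g x"
  shows "partial i f z = partial i g z"
  unfolding partial_def using frechet_derivative_cong_open[OF assms] by simp

lemma frame_nth [simp]: "frame f \<xi> z $ None = \<xi> z" "frame f \<xi> z $ Some i = partial i f z"
  by (simp_all add: frame_def)

lemma frechet_derivative_partial:
  assumes "f differentiable at z"
  shows "frechet_derivative f (at z) X = (\<Sum>i\<in>UNIV. X $ i *\<^sub>R partial i f z)"
proof -
  have "linear (frechet_derivative f (at z))" using assms linear_frechet_derivative by blast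
  then show ?thesis
    by (subst basis_expansion[of X, symmetric])
      (simp add: linear_sum linear_cmul partial_def scalar_mult_eq_scaleR)
qed

text \<open>The rows of \<open>frame\<close> are the basis vectors, so multiplication from the left
  forms the linear combination with given coefficients. This connects the matrix definition of
  \<open>frame_coeff\<close> with decompositions into tangential and transversal parts.\<close>

lemma vector_mult_frame:
  assumes "f differentiable at z"
  shows "c v* frame f \<xi> z = c $ None *\<^sub>R \<xi> z + frechet_derivative f (at z) (rest_coords c)"
  unfolding frechet_derivative_partial[OF assms]
  by (simp add: vec_eq_iff vector_matrix_mult_def sum_UNIV_option mult.commute)

lemma det_frame_nz_iff:
  assumes "f differentiable at z"
  shows "det (frame f \<xi> z) \<noteq> 0 \<longleftrightarrow>
    inj (frechet_derivative f (at z)) \<and> \<xi> z \<notin> range (frechet_derivative f (at z))"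
    (is "_ \<longleftrightarrow> inj ?D \<and> _")
proof -
  have lin: "linear ?D" using assms linear_frechet_derivative by blast
  have "det (frame f \<xi> z) \<noteq> 0 \<longleftrightarrow> det (transpose (frame f \<xi> z)) \<noteq> 0" by simp
  also have "\<dots> \<longleftrightarrow> inj ((*v) (transpose (frame f \<xi> z)))"
    using det_nz_iff_inj[of "(*v) (transpose (frame f \<xi> z))"] by simp
  also have "\<dots> \<longleftrightarrow> (\<forall>c. c v* frame f \<xi> z = 0 \<longrightarrow> c = 0)"
    by (simp add: linear_injective_0)
  also have "\<dots> \<longleftrightarrow> inj ?D \<and> \<xi> z \<notin> range ?D"
  proof safe
    assume *: "\<forall>c. c v* frame f \<xi> z = 0 \<longrightarrow> c = 0"
    have "X = 0" if "?D X = 0" for X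
      using *[rule_format, of "append_coord X 0"] that by (simp add: vector_mult_frame[OF assms])
    then show "inj ?D" by (simp add: linear_injective_0[OF lin])
    fix X assume "\<xi> z = ?D X"
    then show False
      using *[rule_format, of "append_coord X (-1)"] by (simp add: vector_mult_frame[OF assms])
  next
    fix c assume inj: "inj ?D" and \<xi>: "\<xi> z \<notin> range ?D" and c: "c v* frame f \<xi> z = 0"
    then have eq: "c $ None *\<^sub>R \<xi> z + ?D (rest_coords c) = 0" by (simp add: vector_mult_frame[OF assms])
    have "c $ None = 0"
    proof (rule ccontr)
      assume ne: "c $ None \<noteq> 0"
      have "c $ None *\<^sub>R \<xi> z = - ?D (rest_coords c)" using eq by (simp add: eq_neg_iff_add_eq_0)
      then have "(1 / c $ None) *\<^sub>R (c $ None *\<^sub>R \<xi> z) = (1 / c $ None) *\<^sub>R (- ?D (rest_coords c))" by simp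
      then have "\<xi> z = ?D ((- 1 / c $ None) *\<^sub>R rest_coords c)"
        using ne by (simp add: linear_cmul[OF lin] linear_neg[OF lin])
      then show False using \<xi> by blast
    qed
    moreover then have "rest_coords c = 0" using eq inj linear_injective_0[OF lin] by simp
    ultimately show "c = 0" by (simp add: vec_option_eq_iff vec_eq_iff)
  qed
  finally show ?thesis .
qed

lemma frame_coeff_expand:
  assumes "f differentiable at z" "det (frame f \<xi> z) \<noteq> 0"
  shows "w = frame_coeff f \<xi> z w $ None *\<^sub>R \<xi> z + frechet_derivative f (at z) (rest_coords (frame_coeff f \<xi> z w))"
proof -
  have "frame_coeff f \<xi> z w v* frame f \<xi> z = w"
    using matrix_inv_mult[OF assms(2)] by (simp add: frame_coeff_def vector_matrix_mul_assoc)
  then show ?thesis by (simp add: vector_mult_frame[OF assms(1)])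
qed

text \<open>Uniqueness of the decomposition. Entries of h and S and the support function are
  computed below by exhibiting a vector in this form.\<close>

lemma frame_coeff_eqI:
  assumes "f differentiable at z" "det (frame f \<xi> z) \<noteq> 0"
    and "w = s *\<^sub>R \<xi> z + frechet_derivative f (at z) X"
  shows "frame_coeff f \<xi> z w = append_coord X s"
proof -
  have "append_coord X s v* frame f \<xi> z = w" by (simp add: vector_mult_frame[OF assms(1)] assms(3))
  then have "frame_coeff f \<xi> z w = append_coord X s v* (frame f \<xi> z ** matrix_inv (frame f \<xi> z))"
    unfolding frame_coeff_def vector_matrix_mul_assoc[symmetric] by simp
  then show ?thesis using matrix_inv_mult[OF assms(2)] by simp
qed

lemma linear_frame_coeff: "linear (frame_coeff f \<xi> z)"
  unfolding frame_coeff_def[abs_def]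
  by (rule linearI) (simp_all add: vec_eq_iff vector_matrix_mult_def sum.distrib algebra_simps sum_distrib_left)

lemma frame_coeff_tangent:
  assumes "f differentiable at z" "det (frame f \<xi> z) \<noteq> 0"
  shows "frame_coeff f \<xi> z (frechet_derivative f (at z) X) = append_coord X 0"
  by (rule frame_coeff_eqI[OF assms]) simp

lemma smooth_on_frame_coeff:
  assumes V: "open V" and f: "smooth_on V f" and \<xi>: "smooth_on V \<xi>" and w: "smooth_on V w"
    and det: "\<And>z. z \<in> V \<Longrightarrow> det (frame f \<xi> z) \<noteq> 0"
  shows "smooth_on V (\<lambda>z. frame_coeff f \<xi> z (w z))"
proof (rule smooth_on_solve[OF V _ w])
  have "smooth_on V (\<lambda>z. frame f \<xi> z $ a $ b)" for a b
    by (cases a) (simp_all add: smooth_on_vec_nth[OF V] \<xi> smooth_on_partial[OF f])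
  then show "smooth_on V (\<lambda>z. transpose (frame f \<xi> z) $ a $ b)" for a b
    by (simp add: transpose_def)
  show "det (transpose (frame f \<xi> z)) \<noteq> 0 \<and> transpose (frame f \<xi> z) *v frame_coeff f \<xi> z (w z) = w z" if "z \<in> V" for z
    using matrix_inv_mult[OF det[OF that]] det[OF that]
    by (simp add: frame_coeff_def vector_matrix_mul_assoc)
qed

text \<open>A tangential change of the transversal vector is a row operation: the matrix
  \<open>P\<close> of the change is the identity except for its row \<open>None\<close>, whose
  diagonal entry is \<open>s\<close>.\<close>

lemma det_frame_transversal:
  assumes "f differentiable at z" "\<xi> z = s *\<^sub>R \<eta> z + frechet_derivative f (at z) X"
  shows "det (frame f \<xi> z) = s * det (frame f \<eta> z)"
proof -
  define P :: "real^('a option)^('a option)" where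
    "P = (\<chi> a. case a of None \<Rightarrow> append_coord X s | Some i \<Rightarrow> axis (Some i) 1)"
  have "frame f \<xi> z = P ** frame f \<eta> z"
  proof (rule vec_option_eq_iff[THEN iffD2], intro conjI allI)
    show "frame f \<xi> z $ None = (P ** frame f \<eta> z) $ None"
      by (simp add: P_def vec_eq_iff matrix_matrix_mult_def sum_UNIV_option assms(2)
          frechet_derivative_partial[OF assms(1)])
    show "frame f \<xi> z $ Some i = (P ** frame f \<eta> z) $ Some i" for i
      by (simp add: P_def vec_eq_iff matrix_matrix_mult_def sum_UNIV_option axis_def if_distrib[of "\<lambda>x. x * _"] cong: if_cong)
  qed
  moreover have "det P = s"
  proof -
    have "P $ Some i $ None = 0" for i by (simp add: P_def axis_def)
    moreover have "P $ None $ None = s" by (simp add: P_def)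
    moreover have "(\<chi> i j. P $ Some i $ Some j) = (mat 1 :: real^'a^'a)"
      by (simp add: P_def vec_eq_iff mat_def axis_def)
    ultimately show ?thesis using det_option_col[of P] by simp
  qed
  ultimately show ?thesis by (simp add: det_mul)
qed

section \<open>Locality of the Blaschke data\<close>

lemma frame_cong:
  assumes "open V" "z \<in> V" "\<And>x. x \<in> V \<Longrightarrow> f x = g x" "\<And>x. x \<in> V \<Longrightarrow> \<xi> x = \<eta> x"
  shows "frame f \<xi> z = frame g \<eta> z"
proof -
  have "partial i f z = partial i g z" for i
    by (rule partial_cong[OF assms(1,2)]) (rule assms(3))
  then show ?thesis
    unfolding frame_def using assms(2,4) by (auto simp: vec_eq_iff split: option.split)
qed

lemma frame_coeff_cong:
  assumes "open V" "z \<in> V" "\<And>x. x \<in> V \<Longrightarrow> f x = g x" "\<And>x. x \<in> V \<Longrightarrow> \<xi> x = \<eta> x"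
  shows "frame_coeff f \<xi> z = frame_coeff g \<eta> z"
proof -
  have "frame f \<xi> z = frame g \<eta> z" by (rule frame_cong[OF assms(1,2)]) (simp_all add: assms)
  then show ?thesis unfolding frame_coeff_def[abs_def] by simp
qed

lemma partial_partial_cong:
  assumes "open V" "z \<in> V" "\<And>x. x \<in> V \<Longrightarrow> f x = g x"
  shows "partial i (partial j f) z = partial i (partial j g) z"
proof (rule partial_cong[OF assms(1,2)])
  fix x assume "x \<in> V"
  then show "partial j f x = partial j g x"
    by (rule partial_cong[OF assms(1)]) (rule assms(3))
qed

lemma affine_metric_cong:
  assumes "open V" "z \<in> V" "\<And>x. x \<in> V \<Longrightarrow> f x = g x" "\<And>x. x \<in> V \<Longrightarrow> \<xi> x = \<eta> x"
  shows "affine_metric f \<xi> z = affine_metric g \<eta> z"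
proof -
  have "frame_coeff f \<xi> z = frame_coeff g \<eta> z"
    by (rule frame_coeff_cong[OF assms(1,2)]) (simp_all add: assms)
  moreover have "partial i (partial j f) z = partial i (partial j g) z" for i j
    by (rule partial_partial_cong[OF assms(1,2)]) (rule assms(3))
  ultimately show ?thesis by (simp add: affine_metric_def)
qed

lemma shape_operator_cong:
  assumes "open V" "z \<in> V" "\<And>x. x \<in> V \<Longrightarrow> f x = g x" "\<And>x. x \<in> V \<Longrightarrow> \<xi> x = \<eta> x"
  shows "shape_operator f \<xi> z = shape_operator g \<eta> z"
proof -
  have "frame_coeff f \<xi> z = frame_coeff g \<eta> z"
    by (rule frame_coeff_cong[OF assms(1,2)]) (simp_all add: assms)
  moreover have "partial i \<xi> z = partial i \<eta> z" for i
    by (rule partial_cong[OF assms(1,2)]) (rule assms(4))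
  ultimately show ?thesis by (simp add: shape_operator_def)
qed

lemma centre_map_cong:
  assumes "open V" "z \<in> V" "\<And>x. x \<in> V \<Longrightarrow> f x = g x" "\<And>x. x \<in> V \<Longrightarrow> \<xi> x = \<eta> x"
  shows "centre_map f \<xi> z = centre_map g \<eta> z"
proof -
  have "frame_coeff f \<xi> z = frame_coeff g \<eta> z"
    by (rule frame_coeff_cong[OF assms(1,2)]) (simp_all add: assms)
  then show ?thesis by (simp add: centre_map_def support_function_def assms)
qed

lemma immersion_on_cong:
  assumes "open V" "\<And>x. x \<in> V \<Longrightarrow> f x = g x" "immersion_on V f"
  shows "immersion_on V g"
proof -
  have "frechet_derivative g (at z) = frechet_derivative f (at z)" if "z \<in> V" for z
    by (rule frechet_derivative_cong_open[OF assms(1) that, symmetric]) (rule assms(2))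
  moreover have "smooth_on V g"
    by (rule smooth_on_cong[OF assms(1,2)]) (use assms(3) in \<open>auto simp: immersion_on_def\<close>)
  ultimately show ?thesis using assms(3) by (simp add: immersion_on_def)
qed

lemma transversal_on_cong:
  assumes "open V" "\<And>x. x \<in> V \<Longrightarrow> f x = g x" "\<And>x. x \<in> V \<Longrightarrow> \<xi> x = \<eta> x" "transversal_on V f \<xi>"
  shows "transversal_on V g \<eta>"
proof -
  have "frechet_derivative g (at z) = frechet_derivative f (at z)" if "z \<in> V" for z
    by (rule frechet_derivative_cong_open[OF assms(1) that, symmetric]) (rule assms(2))
  then show ?thesis using assms(3,4) by (simp add: transversal_on_def)
qed

lemma centroaffine_on_cong:
  assumes "open V" "\<And>x. x \<in> V \<Longrightarrow> f x = g x" "centroaffine_on V f"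
  shows "centroaffine_on V g"
proof -
  have "immersion_on V g"
    by (rule immersion_on_cong[OF assms(1,2)]) (use assms(3) in \<open>auto simp: centroaffine_on_def\<close>)
  moreover have "transversal_on V g g"
    by (rule transversal_on_cong[OF assms(1,2,2)]) (use assms(3) in \<open>auto simp: centroaffine_on_def\<close>)
  ultimately show ?thesis by (simp add: centroaffine_on_def)
qed

lemma affine_normal_on_cong:
  assumes V: "open V" and f: "\<And>x. x \<in> V \<Longrightarrow> f x = g x" and \<xi>: "\<And>x. x \<in> V \<Longrightarrow> \<xi> x = \<eta> x"
    and "affine_normal_on V f \<xi>"
  shows "affine_normal_on V g \<eta>"
proof -
  have "immersion_on V g"
    by (rule immersion_on_cong[OF V f]) (use assms(4) in \<open>auto simp: affine_normal_on_def\<close>)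
  moreover have "transversal_on V g \<eta>"
    by (rule transversal_on_cong[OF V f \<xi>]) (use assms(4) in \<open>auto simp: affine_normal_on_def\<close>)
  moreover have "smooth_on V \<eta>"
    by (rule smooth_on_cong[OF V \<xi>]) (use assms(4) in \<open>auto simp: affine_normal_on_def\<close>)
  moreover have "det (affine_metric g \<eta> z) \<noteq> 0 \<and> (\<forall>i. frame_coeff g \<eta> z (partial i \<eta> z) $ None = 0) \<and>
      \<bar>det (frame g \<eta> z)\<bar> = sqrt \<bar>det (affine_metric g \<eta> z)\<bar>" if z: "z \<in> V" for z
  proof -
    have "affine_metric g \<eta> z = affine_metric f \<xi> z"
      by (rule affine_metric_cong[OF V z, symmetric]) (simp_all add: f \<xi>)
    moreover have "frame g \<eta> z = frame f \<xi> z"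
      by (rule frame_cong[OF V z, symmetric]) (simp_all add: f \<xi>)
    moreover have "frame_coeff g \<eta> z = frame_coeff f \<xi> z"
      by (rule frame_coeff_cong[OF V z, symmetric]) (simp_all add: f \<xi>)
    moreover have "partial i \<eta> z = partial i \<xi> z" for i
      by (rule partial_cong[OF V z, symmetric]) (simp add: \<xi>)
    ultimately show ?thesis using assms(4) z by (simp add: affine_normal_on_def)
  qed
  ultimately show ?thesis by (simp add: affine_normal_on_def)
qed

section \<open>Gauss and Weingarten formulas\<close>

lemma affine_metric_eqI:
  assumes "f differentiable at z" "det (frame f \<xi> z) \<noteq> 0"
    and "partial i (partial j f) z = s *\<^sub>R \<xi> z + frechet_derivative f (at z) X"
  shows "affine_metric f \<xi> z $ i $ j = s"
  by (simp add: affine_metric_def frame_coeff_eqI[OF assms])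

lemma det_frame_nz:
  assumes "immersion_on V f" "transversal_on V f \<xi>" "z \<in> V"
  shows "det (frame f \<xi> z) \<noteq> 0"
  using assms det_frame_nz_iff[of f z \<xi>] smooth_on_differentiable
  unfolding immersion_on_def transversal_on_def by blast

lemma weingarten:
  assumes "f differentiable at z" "\<xi> differentiable at z" "det (frame f \<xi> z) \<noteq> 0"
    and "\<And>i. frame_coeff f \<xi> z (partial i \<xi> z) $ None = 0"
  shows "frechet_derivative \<xi> (at z) X = - frechet_derivative f (at z) (shape_operator f \<xi> z *v X)"
proof -
  let ?D = "frechet_derivative f (at z)" and ?S = "shape_operator f \<xi> z"
  have lin: "linear ?D" using assms(1) linear_frechet_derivative by blast
  have "partial i \<xi> z = - ?D (\<chi> k. ?S $ k $ i)" for i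
  proof -
    have "rest_coords (frame_coeff f \<xi> z (partial i \<xi> z)) = - (\<chi> k. ?S $ k $ i)"
      by (simp add: vec_eq_iff shape_operator_def)
    then show ?thesis
      using frame_coeff_expand[OF assms(1,3), of "partial i \<xi> z"] assms(4)[of i]
      by (simp add: linear_neg[OF lin])
  qed
  then have "frechet_derivative \<xi> (at z) X = - ?D (\<Sum>i\<in>UNIV. X $ i *\<^sub>R (\<chi> k. ?S $ k $ i))"
    unfolding frechet_derivative_partial[OF assms(2)]
    by (simp add: linear_sum[OF lin] linear_cmul[OF lin] sum_negf)
  then show ?thesis by (simp add: matrix_vector_sum)
qed

text \<open>Converse of \<open>weingarten\<close>: whatever endomorphism satisfies the Weingarten
  formula is the shape operator, and the absence of a transversal term in that formula is the
  equiaffine condition.\<close>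

lemma shape_operator_eqI:
  assumes f: "f differentiable at z" and "\<xi> differentiable at z" and det: "det (frame f \<xi> z) \<noteq> 0"
    and D: "\<And>X. frechet_derivative \<xi> (at z) X = - frechet_derivative f (at z) (S *v X)"
  shows "shape_operator f \<xi> z = S" "frame_coeff f \<xi> z (partial i \<xi> z) $ None = 0"
proof -
  have lin: "linear (frechet_derivative f (at z))" using f linear_frechet_derivative by blast
  have *: "frame_coeff f \<xi> z (partial i \<xi> z) = append_coord (- (S *v axis i 1)) 0" for i
    by (rule frame_coeff_eqI[OF f det]) (simp add: partial_def D linear_neg[OF lin])
  then show "frame_coeff f \<xi> z (partial i \<xi> z) $ None = 0" by simp
  show "shape_operator f \<xi> z = S"
    by (simp add: shape_operator_def * vec_eq_iff matrix_vector_mult_basis column_def)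
qed

text \<open>With \<open>w\<close> written as a combination of partial derivatives of
  \<open>f\<close>, the terms in which the coefficients are differentiated are tangent, so the
  \<open>\<xi>\<close>-component is bilinear in \<open>X\<close> and \<open>Y z\<close>. Only this
  component is tracked; the connection stays implicit.\<close>

lemma gauss:
  assumes V: "open V" "z \<in> V" and f: "smooth_on V f" and Y: "smooth_on V Y"
    and det: "det (frame f \<xi> z) \<noteq> 0" and w: "\<And>x. x \<in> V \<Longrightarrow> w x = frechet_derivative f (at x) (Y x)"
  shows "frame_coeff f \<xi> z (frechet_derivative w (at z) X) $ None = X \<bullet> (affine_metric f \<xi> z *v Y z)"
proof -
  let ?c = "\<lambda>v. frame_coeff f \<xi> z v $ None"
  have lin: "linear ?c"
    using linear_frame_coeff[of f \<xi> z] by (simp add: linear_iff)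
  have fd: "f differentiable at x" if "x \<in> V" for x using smooth_on_differentiable[OF f that] .
  have tan: "?c (partial j f z) = 0" for j
    unfolding partial_def by (simp add: frame_coeff_tangent[OF fd[OF V(2)] det])
  let ?D = "\<lambda>X. \<Sum>j\<in>UNIV. Y z $ j *\<^sub>R frechet_derivative (partial j f) (at z) X + (frechet_derivative Y (at z) X) $ j *\<^sub>R partial j f z"
  have "((\<lambda>x. \<Sum>j\<in>UNIV. Y x $ j *\<^sub>R partial j f x) has_derivative ?D) (at z)"
    by (intro has_derivative_sum has_derivative_scaleR
        bounded_linear.has_derivative[OF bounded_linear_vec_nth]
        smooth_on_has_derivative[OF Y V(2)] smooth_on_has_derivative[OF smooth_on_partial[OF f] V(2)])
  then have "(w has_derivative ?D) (at z)"
    by (rule has_derivative_transform_within_open[OF _ V]) (simp add: w frechet_derivative_partial[OF fd])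
  then have "frechet_derivative w (at z) X = ?D X" by (simp add: frechet_derivative_eqI)
  moreover have "frechet_derivative (partial j f) (at z) X = (\<Sum>i\<in>UNIV. X $ i *\<^sub>R partial i (partial j f) z)" for j
    by (rule frechet_derivative_partial[OF smooth_on_differentiable[OF smooth_on_partial[OF f] V(2)]])
  ultimately have "?c (frechet_derivative w (at z) X) = (\<Sum>j\<in>UNIV. Y z $ j * (\<Sum>i\<in>UNIV. X $ i * affine_metric f \<xi> z $ i $ j))"
    by (simp add: linear_sum[OF lin] linear_add[OF lin] linear_cmul[OF lin] tan affine_metric_def)
  also have "\<dots> = X \<bullet> (affine_metric f \<xi> z *v Y z)"
    unfolding inner_vec_def matrix_vector_mult_def
    by (simp add: sum_distrib_left mult.commute mult.left_commute) (rule sum.swap)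
  finally show ?thesis .
qed

section \<open>Linear images and changes of coordinates\<close>

lemma has_derivative_linear_image:
  "(f has_derivative D) (at z) \<Longrightarrow> ((\<lambda>z. (L :: real^'a^'b) *v f z) has_derivative (\<lambda>X. L *v D X)) (at z)"
  by (rule bounded_linear.has_derivative[OF matrix_vector_mul_bounded_linear])

lemma smooth_on_matrix_mult:
  "open V \<Longrightarrow> smooth_on V f \<Longrightarrow> smooth_on V (\<lambda>z. (L :: real^'a^'b) *v f z)"
  by (rule smooth_on_linear_image[OF matrix_vector_mul_bounded_linear])

lemma frechet_derivative_linear_image:
  assumes "f differentiable at z"
  shows "frechet_derivative (\<lambda>z. (L :: real^'a^'b) *v f z) (at z) X = L *v frechet_derivative f (at z) X"
  by (rule fun_cong[OF frechet_derivative_eqI[OF has_derivative_linear_image[OF assms[unfolded frechet_derivative_works]]]])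

lemma partial_linear_image:
  assumes "f differentiable at z"
  shows "partial i (\<lambda>z. (L :: real^'a^'b) *v f z) z = L *v partial i f z"
  by (simp add: partial_def frechet_derivative_linear_image[OF assms])

lemma frame_linear_image:
  assumes "f differentiable at z"
  shows "frame (\<lambda>z. L *v f z) (\<lambda>z. L *v \<xi> z) z = frame f \<xi> z ** transpose L"
proof -
  have "(frame f \<xi> z ** transpose L) $ a = L *v (frame f \<xi> z $ a)" for a
    by (simp add: vec_eq_iff matrix_matrix_mult_def matrix_vector_mult_def transpose_def mult.commute)
  then show ?thesis
    by (simp add: vec_eq_iff[of "frame _ _ _"] split_option_all partial_linear_image[OF assms])
qed

context
  fixes L :: "real^('n::finite option)^('n option)"
  assumes L: "det L \<noteq> 0"
begin

lemma differentiable_linear_image: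
  "f differentiable at z \<Longrightarrow> (\<lambda>z. L *v f z) differentiable at z"
  using has_derivative_linear_image differentiable_def by metis

text \<open>A linear isomorphism of the ambient space carries frames to frames. Hence h and S are
  invariant, whereas the determinant of the frame is multiplied by \<open>det L\<close>.\<close>

lemma frame_coeff_linear_image:
  fixes f :: "real^'n \<Rightarrow> real^('n option)"
  assumes "f differentiable at z" "det (frame f \<xi> z) \<noteq> 0"
  shows "frame_coeff (\<lambda>z. L *v f z) (\<lambda>z. L *v \<xi> z) z (L *v w) = frame_coeff f \<xi> z w"
proof -
  have "det (frame (\<lambda>z. L *v f z) (\<lambda>z. L *v \<xi> z) z) \<noteq> 0"
    unfolding frame_linear_image[OF assms(1)] using L assms(2) by (simp add: det_mul)
  moreover have "L *v w = frame_coeff f \<xi> z w $ None *\<^sub>R (L *v \<xi> z) +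
      frechet_derivative (\<lambda>z. L *v f z) (at z) (rest_coords (frame_coeff f \<xi> z w))"
    unfolding frechet_derivative_linear_image[OF assms(1)]
    by (subst frame_coeff_expand[OF assms, of w])
      (simp add: matrix_vector_right_distrib matrix_vector_mult_scaleR)
  ultimately show ?thesis
    using frame_coeff_eqI[OF differentiable_linear_image[OF assms(1)]] by (metis append_rest)
qed

lemma affine_metric_linear_image:
  fixes f :: "real^'n \<Rightarrow> real^('n option)"
  assumes "open V" "z \<in> V" "smooth_on V f" "det (frame f \<xi> z) \<noteq> 0"
  shows "affine_metric (\<lambda>z. L *v f z) (\<lambda>z. L *v \<xi> z) z = affine_metric f \<xi> z"
proof -
  have d: "f differentiable at x" if "x \<in> V" for x using smooth_on_differentiable[OF assms(3) that] .
  have "partial i (partial j (\<lambda>z. L *v f z)) z = L *v partial i (partial j f) z" for i j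
  proof -
    have "partial i (partial j (\<lambda>z. L *v f z)) z = partial i (\<lambda>z. L *v partial j f z) z"
      by (rule partial_cong[OF assms(1,2)]) (rule partial_linear_image[OF d])
    also have "\<dots> = L *v partial i (partial j f) z"
      by (rule partial_linear_image[OF smooth_on_differentiable[OF smooth_on_partial[OF assms(3)] assms(2)]])
    finally show ?thesis .
  qed
  then show ?thesis
    by (simp add: affine_metric_def frame_coeff_linear_image[OF d[OF assms(2)] assms(4)])
qed

lemma shape_operator_linear_image:
  fixes f :: "real^'n \<Rightarrow> real^('n option)"
  assumes "f differentiable at z" "\<xi> differentiable at z" "det (frame f \<xi> z) \<noteq> 0"
  shows "shape_operator (\<lambda>z. L *v f z) (\<lambda>z. L *v \<xi> z) z = shape_operator f \<xi> z"
  by (simp add: shape_operator_def partial_linear_image[OF assms(2)] frame_coeff_linear_image[OF assms(1,3)])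

lemma immersion_on_linear_image:
  fixes f :: "real^'n \<Rightarrow> real^('n option)"
  assumes "open V" "immersion_on V f"
  shows "immersion_on V (\<lambda>z. L *v f z)"
proof -
  have inj: "inj ((*v) L)" using L inj_matrix_vector_mult invertible_det_nz by blast
  have f: "smooth_on V f" using assms(2) immersion_on_def by blast
  have "frechet_derivative (\<lambda>z. L *v f z) (at z) = (*v) L \<circ> frechet_derivative f (at z)" if "z \<in> V" for z
    by (rule ext) (simp add: frechet_derivative_linear_image[OF smooth_on_differentiable[OF f that]])
  then show ?thesis using assms smooth_on_matrix_mult[OF assms(1) f]
    unfolding immersion_on_def by (auto intro: inj_compose[OF inj])
qed

lemma transversal_on_linear_image:
  fixes f :: "real^'n \<Rightarrow> real^('n option)"
  assumes "smooth_on V f" "transversal_on V f \<xi>"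
  shows "transversal_on V (\<lambda>z. L *v f z) (\<lambda>z. L *v \<xi> z)"
proof -
  have inj: "inj ((*v) L)" using L inj_matrix_vector_mult invertible_det_nz by blast
  have "frechet_derivative (\<lambda>z. L *v f z) (at z) = (*v) L \<circ> frechet_derivative f (at z)" if "z \<in> V" for z
    by (rule ext) (simp add: frechet_derivative_linear_image[OF smooth_on_differentiable[OF assms(1) that]])
  then show ?thesis using assms(2) inj unfolding transversal_on_def inj_def by fastforce
qed

lemma centroaffine_on_linear_image:
  fixes f :: "real^'n \<Rightarrow> real^('n option)"
  assumes "open V" "centroaffine_on V f"
  shows "centroaffine_on V (\<lambda>z. L *v f z)"
  using assms immersion_on_linear_image transversal_on_linear_image
  unfolding centroaffine_on_def immersion_on_def by blast

end

section \<open>Changes of coordinates\<close>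

context
  fixes f \<xi> :: "real^'n::finite \<Rightarrow> real^('n option)" and \<Phi> :: "real^'n \<Rightarrow> real^'n" and V W z
  assumes V: "open V" "smooth_on V f" and W: "open W" "z \<in> W" "smooth_on W \<Phi>" "\<And>x. x \<in> W \<Longrightarrow> \<Phi> x \<in> V"
begin

lemma frechet_derivative_reparam:
  assumes "x \<in> W"
  shows "frechet_derivative (\<lambda>x. f (\<Phi> x)) (at x) X = frechet_derivative f (at (\<Phi> x)) (frechet_derivative \<Phi> (at x) X)"
  using frechet_derivative_compose[OF smooth_on_differentiable[OF W(3) assms] smooth_on_differentiable[OF V(2) W(4)[OF assms]]]
  by (simp add: o_def)

lemma det_frame_reparam:
  "det (frame (\<lambda>x. f (\<Phi> x)) (\<lambda>x. \<xi> (\<Phi> x)) z) = det (matrix (frechet_derivative \<Phi> (at z))) * det (frame f \<xi> (\<Phi> z))"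
proof -
  let ?J = "matrix (frechet_derivative \<Phi> (at z))"
  define P :: "real^('n option)^('n option)" where
    "P = (\<chi> a. case a of None \<Rightarrow> axis None 1 | Some i \<Rightarrow> append_coord (\<chi> k. ?J $ k $ i) 0)"
  have fd: "f differentiable at (\<Phi> z)" using smooth_on_differentiable[OF V(2) W(4)[OF W(2)]] .
  have p: "partial i (\<lambda>x. f (\<Phi> x)) z = (\<Sum>k\<in>UNIV. ?J $ k $ i *\<^sub>R partial k f (\<Phi> z))" for i
    unfolding partial_def[of i] frechet_derivative_reparam[OF W(2)] frechet_derivative_partial[OF fd]
    by (simp add: matrix_def)
  have "frame (\<lambda>x. f (\<Phi> x)) (\<lambda>x. \<xi> (\<Phi> x)) z = P ** frame f \<xi> (\<Phi> z)"
  proof (rule vec_option_eq_iff[THEN iffD2], intro conjI allI)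
    show "frame (\<lambda>x. f (\<Phi> x)) (\<lambda>x. \<xi> (\<Phi> x)) z $ None = (P ** frame f \<xi> (\<Phi> z)) $ None"
      by (simp add: P_def vec_eq_iff matrix_matrix_mult_def sum_UNIV_option axis_def)
    show "frame (\<lambda>x. f (\<Phi> x)) (\<lambda>x. \<xi> (\<Phi> x)) z $ Some i = (P ** frame f \<xi> (\<Phi> z)) $ Some i" for i
      by (simp add: P_def vec_eq_iff matrix_matrix_mult_def sum_UNIV_option p)
  qed
  moreover have "det P = det ?J"
  proof -
    have "P $ Some i $ None = 0" for i by (simp add: P_def)
    moreover have "P $ None $ None = 1" by (simp add: P_def)
    moreover have "(\<chi> i j. P $ Some i $ Some j) = transpose ?J"
      by (simp add: P_def vec_eq_iff transpose_def)
    ultimately show ?thesis using det_option_col[of P] by simp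
  qed
  ultimately show ?thesis by (simp add: det_mul)
qed

text \<open>Second derivatives of \<open>\<Phi>\<close> enter those of the composition only through
  tangent vectors, so the \<open>\<xi>\<close>-component transforms like a bilinear form.\<close>

lemma affine_metric_reparam:
  assumes det: "det (frame f \<xi> (\<Phi> z)) \<noteq> 0" and J: "det (matrix (frechet_derivative \<Phi> (at z))) \<noteq> 0"
  shows "affine_metric (\<lambda>x. f (\<Phi> x)) (\<lambda>x. \<xi> (\<Phi> x)) z =
    transpose (matrix (frechet_derivative \<Phi> (at z))) ** affine_metric f \<xi> (\<Phi> z) ** matrix (frechet_derivative \<Phi> (at z))"
proof -
  let ?J = "matrix (frechet_derivative \<Phi> (at z))" and ?f = "\<lambda>x. f (\<Phi> x)" and ?\<xi> = "\<lambda>x. \<xi> (\<Phi> x)"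
  let ?D = "frechet_derivative f (at (\<Phi> z))" and ?D\<Phi> = "frechet_derivative \<Phi> (at z)"
  let ?h = "affine_metric f \<xi> (\<Phi> z)"
  have \<Phi>z: "\<Phi> z \<in> V" using W by blast
  have fd: "f differentiable at (\<Phi> z)" using smooth_on_differentiable[OF V(2) \<Phi>z] .
  have lD: "linear ?D" using fd linear_frechet_derivative by blast
  have \<Phi>d: "\<Phi> differentiable at z" using smooth_on_differentiable[OF W(3,2)] .
  have fs: "smooth_on W ?f" by (rule smooth_on_compose[OF V(2) W(1) V(1) W(3,4)])
  have fd': "?f differentiable at z" using smooth_on_differentiable[OF fs W(2)] .
  have det': "det (frame ?f ?\<xi> z) \<noteq> 0" using det_frame_reparam det J by simp
  have Jn: "?D\<Phi> (axis j 1) = (\<chi> k. ?J $ k $ j)" for j by (simp add: matrix_def vec_eq_iff)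
  have lin\<Phi>: "linear ?D\<Phi>" using \<Phi>d linear_frechet_derivative by blast
  have surj: "\<exists>Y. ?D\<Phi> Y = X" for X
  proof -
    have "inj ?D\<Phi>" using J det_nz_iff_inj[OF lin\<Phi>] by simp
    then show ?thesis using linear_injective_imp_surjective[OF lin\<Phi>] by (metis surjD)
  qed
  \<comment> \<open>The derivative of \<open>\<Phi>\<close> is onto, so both parametrizations have
    the same tangent space and every vector has the same \<open>\<xi>\<close>-component.\<close>
  have none: "frame_coeff ?f ?\<xi> z w $ None = frame_coeff f \<xi> (\<Phi> z) w $ None" for w
  proof -
    obtain Y where Y: "?D\<Phi> Y = rest_coords (frame_coeff f \<xi> (\<Phi> z) w)" using surj by blast
    have "w = frame_coeff f \<xi> (\<Phi> z) w $ None *\<^sub>R ?\<xi> z + frechet_derivative ?f (at z) Y"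
      unfolding frechet_derivative_reparam[OF W(2)] Y using frame_coeff_expand[OF fd det] .
    then show ?thesis using frame_coeff_eqI[OF fd' det'] by (metis append_coord_nth(1))
  qed
  have "affine_metric ?f ?\<xi> z $ i $ j = (transpose ?J ** ?h ** ?J) $ i $ j" for i j
  proof -
    define Y where "Y = partial j \<Phi>"
    have Ys: "smooth_on W Y" unfolding Y_def by (rule smooth_on_partial[OF W(3)])
    let ?w = "\<lambda>x. \<Sum>k\<in>UNIV. Y x $ k *\<^sub>R partial k f (\<Phi> x)"
    have w: "partial j ?f x = ?w x" if "x \<in> W" for x
      unfolding partial_def[of j] frechet_derivative_reparam[OF that]
        frechet_derivative_partial[OF smooth_on_differentiable[OF V(2) W(4)[OF that]]]
      by (simp add: Y_def partial_def)
    let ?Dw = "\<lambda>X. \<Sum>k\<in>UNIV. Y z $ k *\<^sub>R frechet_derivative (partial k f) (at (\<Phi> z)) (?D\<Phi> X) + frechet_derivative Y (at z) X $ k *\<^sub>R partial k f (\<Phi> z)"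
    have d1: "((\<lambda>x. partial k f (\<Phi> x)) has_derivative (\<lambda>X. frechet_derivative (partial k f) (at (\<Phi> z)) (?D\<Phi> X))) (at z)" for k
      using diff_chain_at[OF smooth_on_has_derivative[OF W(3,2)] smooth_on_has_derivative[OF smooth_on_partial[OF V(2)] \<Phi>z]]
      by (simp add: o_def)
    have "(?w has_derivative ?Dw) (at z)"
      by (intro has_derivative_sum has_derivative_scaleR d1
          bounded_linear.has_derivative[OF bounded_linear_vec_nth] smooth_on_has_derivative[OF Ys W(2)])
    then have "partial i ?w z = ?Dw (axis i 1)" by (rule partial_eqI)
    then have "partial i (partial j ?f) z = ?Dw (axis i 1)"
      by (simp only: partial_cong[OF W(1,2) w])
    also have "\<dots> = (\<Sum>k\<in>UNIV. ?J $ k $ j *\<^sub>R (\<Sum>l\<in>UNIV. ?J $ l $ i *\<^sub>R partial l (partial k f) (\<Phi> z)))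
        + ?D (frechet_derivative Y (at z) (axis i 1))"
      unfolding frechet_derivative_partial[OF smooth_on_differentiable[OF smooth_on_partial[OF V(2)] \<Phi>z]]
        frechet_derivative_partial[OF fd] sum.distrib
      by (simp add: Y_def partial_def Jn)
    finally have eq: "partial i (partial j ?f) z = \<dots>" .
    let ?c = "\<lambda>w. frame_coeff f \<xi> (\<Phi> z) w $ None"
    have lin: "linear ?c" using linear_frame_coeff[of f \<xi> "\<Phi> z"] by (simp add: linear_iff)
    have "affine_metric ?f ?\<xi> z $ i $ j = ?c (partial i (partial j ?f) z)"
      by (simp add: affine_metric_def none)
    also have "\<dots> = (\<Sum>k\<in>UNIV. ?J $ k $ j * (\<Sum>l\<in>UNIV. ?J $ l $ i * ?h $ l $ k))"
      unfolding eq by (simp add: linear_add[OF lin] linear_sum[OF lin] linear_cmul[OF lin]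
          frame_coeff_tangent[OF fd det] affine_metric_def)
    also have "\<dots> = (transpose ?J ** ?h ** ?J) $ i $ j"
      by (simp add: matrix_matrix_mult_def transpose_def sum_distrib_left sum_distrib_right mult_ac)
    finally show ?thesis .
  qed
  then show ?thesis by (simp add: vec_eq_iff)
qed

end

section \<open>Hypersurfaces congruent to their centre map in coordinates\<close>

text \<open>Collects the hypotheses that concern one chart. \<open>T\<close> is a parameter because
  it must be common to all charts; \<open>l0\<close> and \<open>l1\<close> are bare functions
  without any regularity.\<close>

definition congruent_patch ::
    "(real^'n::finite) set \<Rightarrow> (real^'n \<Rightarrow> real^('n option)) \<Rightarrow> (real^'n \<Rightarrow> real^('n option))
      \<Rightarrow> real^('n option)^('n option) \<Rightarrow> (real^'n \<Rightarrow> real) \<Rightarrow> (real^'n \<Rightarrow> real) \<Rightarrow> bool" where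
  "congruent_patch V f \<xi> T l0 l1 \<longleftrightarrow>
     affine_normal_on V f \<xi> \<and> centroaffine_on V f \<and> centroaffine_on V (centre_map f \<xi>) \<and>
     (\<forall>z\<in>V. centre_map f \<xi> z = T *v f z \<and> positive_definite (affine_metric f \<xi> z) \<and>
        l0 z \<noteq> l1 z \<and> dim (eigenspace (shape_operator f \<xi> z) (l0 z)) = 1 \<and>
        dim (eigenspace (shape_operator f \<xi> z) (l1 z)) = CARD('n) - 1)"

lemma centre_congruent_hypersurface_iff:
  "centre_congruent_hypersurface X A f \<xi> \<kappa>0 \<kappa>1 \<longleftrightarrow>
     oriented_manifold X A \<and> (\<forall>p\<in>topspace X. \<kappa>1 p \<noteq> 0) \<and>
     (\<exists>T. invertible T \<and> (\<forall>c\<in>A. congruent_patch (chart_image c) (local_rep c f) (local_rep c \<xi>) T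
        (local_rep c \<kappa>0) (local_rep c \<kappa>1)))"
  unfolding centre_congruent_hypersurface_def congruent_patch_def blaschke_immersion_def
    congruent_to_centre_map_def positive_blaschke_metric_def quasi_umbilical_def Let_def
  by (rule iffI; (elim conjE exE)?; (intro conjI exI)?; blast)

lemma congruent_patch_cong:
  assumes V: "open V" and f: "\<And>x. x \<in> V \<Longrightarrow> f x = g x" and \<xi>: "\<And>x. x \<in> V \<Longrightarrow> \<xi> x = \<eta> x"
    and k: "\<And>x. x \<in> V \<Longrightarrow> l0 x = k0 x" "\<And>x. x \<in> V \<Longrightarrow> l1 x = k1 x"
    and p: "congruent_patch V f \<xi> T l0 l1"
  shows "congruent_patch V g \<eta> T k0 k1"
proof -
  have c: "centre_map f \<xi> z = centre_map g \<eta> z" if "z \<in> V" for z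
    by (rule centre_map_cong[OF V that]) (simp_all add: f \<xi>)
  have "affine_normal_on V g \<eta>"
    by (rule affine_normal_on_cong[OF V f \<xi>]) (use p in \<open>auto simp: congruent_patch_def\<close>)
  moreover have "centroaffine_on V g"
    by (rule centroaffine_on_cong[OF V f]) (use p in \<open>auto simp: congruent_patch_def\<close>)
  moreover have "centroaffine_on V (centre_map g \<eta>)"
    by (rule centroaffine_on_cong[OF V c]) (use p in \<open>auto simp: congruent_patch_def\<close>)
  moreover have "affine_metric g \<eta> z = affine_metric f \<xi> z" if "z \<in> V" for z
    by (rule affine_metric_cong[OF V that, symmetric]) (simp_all add: f \<xi>)
  moreover have "shape_operator g \<eta> z = shape_operator f \<xi> z" if "z \<in> V" for z
    by (rule shape_operator_cong[OF V that, symmetric]) (simp_all add: f \<xi>)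
  moreover have "l0 z = k0 z \<and> l1 z = k1 z \<and> f z = g z" if "z \<in> V" for z
    using k f that by blast
  ultimately show ?thesis using p c by (simp add: congruent_patch_def)
qed

text \<open>The data are checked for \<open>f\<close>, the conclusion concerns \<open>L f\<close>
  with affine normal \<open>L \<xi>\<close>: metric and shape operator do not change, the volume
  condition acquires \<open>\<bar>det L\<bar>\<close>, and the congruence is conjugated by
  \<open>L\<close>. The two centroaffine conditions follow from \<open>\<rho> z \<noteq> 0\<close>
  and \<open>det T \<noteq> 0\<close>.\<close>

lemma congruent_patchI:
  fixes f \<xi> :: "real^'n::finite \<Rightarrow> real^('n option)"
  assumes V: "open V" and f: "smooth_on V f" and \<xi>: "smooth_on V \<xi>"
    and L: "det L \<noteq> 0" and T: "det T \<noteq> 0"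
    and det: "\<And>z. z \<in> V \<Longrightarrow> det (frame f \<xi> z) \<noteq> 0"
    and W: "\<And>z X. z \<in> V \<Longrightarrow> frechet_derivative \<xi> (at z) X = - frechet_derivative f (at z) (S z *v X)"
    and c: "\<And>z. z \<in> V \<Longrightarrow> f z = frechet_derivative f (at z) (Z z) + \<rho> z *\<^sub>R \<xi> z \<and> \<rho> z \<noteq> 0 \<and>
        frechet_derivative f (at z) (Z z) = T *v f z"
    and pos: "\<And>z. z \<in> V \<Longrightarrow> positive_definite (affine_metric f \<xi> z)"
    and vol: "\<And>z. z \<in> V \<Longrightarrow> det (affine_metric f \<xi> z) \<noteq> 0 \<and>
       \<bar>det L\<bar> * \<bar>det (frame f \<xi> z)\<bar> = sqrt \<bar>det (affine_metric f \<xi> z)\<bar>"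
    and ev: "\<And>z. z \<in> V \<Longrightarrow> l0 z \<noteq> l1 z \<and> dim (eigenspace (S z) (l0 z)) = 1 \<and> dim (eigenspace (S z) (l1 z)) = CARD('n) - 1"
  shows "congruent_patch V (\<lambda>z. L *v f z) (\<lambda>z. L *v \<xi> z) (L ** T ** matrix_inv L) l0 l1"
proof -
  let ?f = "\<lambda>z. L *v f z" and ?\<xi> = "\<lambda>z. L *v \<xi> z"
  have fd: "f differentiable at z" and \<xi>d: "\<xi> differentiable at z" if "z \<in> V" for z
    using f \<xi> that smooth_on_differentiable by blast+
  have fr: "inj (frechet_derivative f (at z)) \<and> \<xi> z \<notin> range (frechet_derivative f (at z))" if "z \<in> V" for z
    using det_frame_nz_iff[OF fd[OF that]] det[OF that] by blast
  have imm: "immersion_on V f" using f fr by (simp add: immersion_on_def)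
  have tr: "transversal_on V f \<xi>" using fr by (simp add: transversal_on_def)
  \<comment> \<open>If \<open>f z\<close> were tangent, then so would be \<open>\<rho> z\<close>
    times \<open>\<xi> z\<close>, and hence \<open>\<xi> z\<close> itself.\<close>
  have trf: "transversal_on V f f"
    unfolding transversal_on_def
  proof (intro ballI notI)
    fix z assume z: "z \<in> V" and "f z \<in> range (frechet_derivative f (at z))"
    then obtain Y where Y: "f z = frechet_derivative f (at z) Y" by blast
    have lin: "linear (frechet_derivative f (at z))" using fd[OF z] linear_frechet_derivative by blast
    have "\<rho> z *\<^sub>R \<xi> z = frechet_derivative f (at z) (Y - Z z)"
    proof -
      have "frechet_derivative f (at z) Y = frechet_derivative f (at z) (Z z) + \<rho> z *\<^sub>R \<xi> z"
        by (rule trans[OF Y[symmetric]]) (use c[OF z] in blast)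
      then show ?thesis by (simp only: linear_diff[OF lin] add_diff_cancel_left')
    qed
    then have "(1 / \<rho> z) *\<^sub>R (\<rho> z *\<^sub>R \<xi> z) = frechet_derivative f (at z) ((1 / \<rho> z) *\<^sub>R (Y - Z z))"
      by (simp only: linear_cmul[OF lin])
    moreover have "(1 / \<rho> z) *\<^sub>R (\<rho> z *\<^sub>R \<xi> z) = \<xi> z" using c[OF z] by simp
    ultimately have "\<xi> z = frechet_derivative f (at z) ((1 / \<rho> z) *\<^sub>R (Y - Z z))" by (simp only:)
    then show False using fr[OF z] by blast
  qed
  have cf: "centroaffine_on V f" using imm trf by (simp add: centroaffine_on_def)
  have cLf: "centroaffine_on V ?f" by (rule centroaffine_on_linear_image[OF L V cf])
  have fd': "?f differentiable at z" if "z \<in> V" for z using differentiable_linear_image[OF L fd[OF that]] .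
  have det': "det (frame ?f ?\<xi> z) \<noteq> 0" if "z \<in> V" for z
    unfolding frame_linear_image[OF fd[OF that]] using L det[OF that] by (simp add: det_mul)
  have met: "affine_metric ?f ?\<xi> z = affine_metric f \<xi> z" if "z \<in> V" for z
    by (rule affine_metric_linear_image[OF L V that f det[OF that]])
  have sh: "shape_operator ?f ?\<xi> z = S z" if "z \<in> V" for z
    unfolding shape_operator_linear_image[OF L fd[OF that] \<xi>d[OF that] det[OF that]]
    by (rule shape_operator_eqI[OF fd[OF that] \<xi>d[OF that] det[OF that] W[OF that]])
  have eq: "frame_coeff ?f ?\<xi> z (partial i ?\<xi> z) $ None = 0" if "z \<in> V" for z i
    unfolding partial_linear_image[OF \<xi>d[OF that]] frame_coeff_linear_image[OF L fd[OF that] det[OF that]]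
    by (rule shape_operator_eqI[OF fd[OF that] \<xi>d[OF that] det[OF that] W[OF that]])
  have vol': "\<bar>det (frame ?f ?\<xi> z)\<bar> = sqrt \<bar>det (affine_metric ?f ?\<xi> z)\<bar>" if "z \<in> V" for z
    unfolding frame_linear_image[OF fd[OF that]] met[OF that]
    using vol[OF that] by (simp add: det_mul abs_mult mult.commute)
  have "immersion_on V ?f" by (rule immersion_on_linear_image[OF L V imm])
  moreover have "transversal_on V ?f ?\<xi>" by (rule transversal_on_linear_image[OF L f tr])
  moreover have "smooth_on V ?\<xi>" by (rule smooth_on_matrix_mult[OF V \<xi>])
  ultimately have an: "affine_normal_on V ?f ?\<xi>"
    unfolding affine_normal_on_def using vol' eq vol met by auto
  have cm: "centre_map ?f ?\<xi> z = (L ** T ** matrix_inv L) *v ?f z" if "z \<in> V" for z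
  proof -
    have 1: "f z = frechet_derivative f (at z) (Z z) + \<rho> z *\<^sub>R \<xi> z"
      and 2: "frechet_derivative f (at z) (Z z) = T *v f z" using c[OF that] by blast+
    have "frame_coeff f \<xi> z (f z) = append_coord (Z z) (\<rho> z)"
      by (rule frame_coeff_eqI[OF fd[OF that] det[OF that]]) (subst 1, rule add.commute)
    then have "centre_map ?f ?\<xi> z = L *v (f z - \<rho> z *\<^sub>R \<xi> z)"
      by (simp add: centre_map_def support_function_def frame_coeff_linear_image[OF L fd[OF that] det[OF that]]
          matrix_vector_mult_diff_distrib matrix_vector_mult_scaleR)
    also have "f z - \<rho> z *\<^sub>R \<xi> z = T *v f z"
      using trans[OF diff_eq_eq[THEN iffD2, OF 1] 2] .
    also have "L *v (T *v f z) = (L ** T ** matrix_inv L) *v ?f z"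
      using matrix_inv_mult[OF L] by (simp add: matrix_vector_mul_assoc flip: matrix_mul_assoc)
    finally show ?thesis .
  qed
  have LT: "det (L ** T ** matrix_inv L) \<noteq> 0"
  proof -
    have "det (L ** matrix_inv L) = 1" using matrix_inv_mult[OF L] by simp
    then show ?thesis using L T by (auto simp: det_mul)
  qed
  \<comment> \<open>The centre map is an invertible linear image of a centroaffine
    immersion.\<close>
  have "centroaffine_on V (centre_map ?f ?\<xi>)"
    by (rule centroaffine_on_cong[OF V cm[symmetric] centroaffine_on_linear_image[OF LT V cLf]])
  then show ?thesis
    unfolding congruent_patch_def using an cLf cm met pos sh ev by simp
qed

section \<open>The model hypersurfaces\<close>

text \<open>\<open>None\<close> is the direction of t, which carries the simple eigenvalue.\<close>

definition diagonal_shape :: "real \<Rightarrow> real \<Rightarrow> real^('k::finite option)^('k option)" where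
  "diagonal_shape l0 l1 = (\<chi> a b. if a = b then (if a = None then l0 else l1) else 0)"

lemma diagonal_shape_mult: "diagonal_shape l0 l1 *v X = append_coord (l1 *\<^sub>R rest_coords X) (l0 * X $ None)"
  by (simp add: vec_option_eq_iff diagonal_shape_def matrix_vector_mult_def sum_UNIV_option
      if_distrib[of "\<lambda>x. x * _"] cong: if_cong)

lemma dim_eigenspace_diagonal_shape:
  assumes "l0 \<noteq> l1"
  shows "dim (eigenspace (diagonal_shape l0 l1 :: real^('k::finite option)^('k option)) l0) = 1"
    "dim (eigenspace (diagonal_shape l0 l1 :: real^('k option)^('k option)) l1) = CARD('k)"
proof -
  have "eigenspace (diagonal_shape l0 l1 :: real^('k option)^('k option)) l0 = span {axis None 1}"
  proof safe
    fix x :: "real^('k option)" assume "x \<in> eigenspace (diagonal_shape l0 l1) l0"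
    then have "x = x $ None *\<^sub>R axis None 1"
      using assms by (auto simp: eigenspace_def diagonal_shape_mult vec_option_eq_iff axis_def)
    then show "x \<in> span {axis None 1}" by (metis span_base span_scale singletonI)
  next
    fix x :: "real^('k option)" assume "x \<in> span {axis None 1}"
    then obtain c where "x = c *\<^sub>R axis None 1" by (auto simp: span_singleton)
    then show "x \<in> eigenspace (diagonal_shape l0 l1) l0"
      by (simp add: eigenspace_def diagonal_shape_mult vec_option_eq_iff axis_def)
  qed
  then show "dim (eigenspace (diagonal_shape l0 l1 :: real^('k option)^('k option)) l0) = 1"
    by (simp add: dim_singleton)
  have "eigenspace (diagonal_shape l0 l1 :: real^('k option)^('k option)) l1 = (\<lambda>v. append_coord v 0) ` UNIV"
  proof safe
    fix x :: "real^('k option)" assume "x \<in> eigenspace (diagonal_shape l0 l1) l1"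
    then have "x = append_coord (rest_coords x) 0"
      using assms by (auto simp: eigenspace_def diagonal_shape_mult vec_option_eq_iff)
    then show "x \<in> range (\<lambda>v. append_coord v 0)" by blast
  qed (simp add: eigenspace_def diagonal_shape_mult vec_option_eq_iff)
  moreover have "dim ((\<lambda>v. append_coord v 0) ` (UNIV :: (real^'k) set)) = dim (UNIV :: (real^'k) set)"
    by (rule dim_image_eq[OF bounded_linear.linear[OF bounded_linear_append_coord_left]]) (simp add: inj_on_def)
  ultimately show "dim (eigenspace (diagonal_shape l0 l1 :: real^('k option)^('k option)) l1) = CARD('k)"
    by simp
qed

text \<open>Serves \<open>f\<close>, its t-derivative and \<open>\<xi>\<close> of both models at
  once: each is a function of t times a map of u, plus a function of t times a fixed vector.\<close>

lemma has_derivative_product_form: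
  fixes H :: "real^'k::finite \<Rightarrow> 'b::real_normed_vector"
  assumes "(\<alpha> has_real_derivative \<alpha>') (at (z $ None))" "(\<beta> has_real_derivative \<beta>') (at (z $ None))"
    and "(H has_derivative DH) (at (rest_coords z))"
  shows "((\<lambda>z. \<alpha> (z $ None) *\<^sub>R H (rest_coords z) + \<beta> (z $ None) *\<^sub>R e) has_derivative
     (\<lambda>X. \<alpha> (z $ None) *\<^sub>R DH (rest_coords X) + (\<alpha>' * X $ None) *\<^sub>R H (rest_coords z) + (\<beta>' * X $ None) *\<^sub>R e)) (at z)"
proof -
  have n: "((\<lambda>z. z $ None) has_derivative (\<lambda>X. X $ None)) (at z)"
    by (rule bounded_linear_imp_has_derivative[OF bounded_linear_vec_nth])
  have c: "((\<lambda>z. \<gamma> (z $ None)) has_derivative (\<lambda>X. \<gamma>' * X $ None)) (at z)"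
    if "(\<gamma> has_real_derivative \<gamma>') (at (z $ None))" for \<gamma> \<gamma>'
    using diff_chain_at[OF n that[unfolded has_field_derivative_def]] by (simp add: o_def)
  have h: "((\<lambda>z. H (rest_coords z)) has_derivative (\<lambda>X. DH (rest_coords X))) (at z)"
    using diff_chain_at[OF bounded_linear_imp_has_derivative[OF bounded_linear_rest_coords] assms(3)] by (simp add: o_def)
  show ?thesis
    using has_derivative_add[OF has_derivative_scaleR[OF c[OF assms(1)] h]
        has_derivative_scaleR[OF c[OF assms(2)] has_derivative_const[of e]]] by simp
qed

lemma partial_product_form:
  fixes H :: "real^'k::finite \<Rightarrow> 'b::real_normed_vector"
  assumes "(\<alpha> has_real_derivative \<alpha>') (at (z $ None))" "(\<beta> has_real_derivative \<beta>') (at (z $ None))"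
    and "H differentiable (at (rest_coords z))"
  shows "partial None (\<lambda>z. \<alpha> (z $ None) *\<^sub>R H (rest_coords z) + \<beta> (z $ None) *\<^sub>R e) z = \<alpha>' *\<^sub>R H (rest_coords z) + \<beta>' *\<^sub>R e"
    and "partial (Some i) (\<lambda>z. \<alpha> (z $ None) *\<^sub>R H (rest_coords z) + \<beta> (z $ None) *\<^sub>R e) z = \<alpha> (z $ None) *\<^sub>R partial i H (rest_coords z)"
proof -
  have lin: "linear (frechet_derivative H (at (rest_coords z)))" using assms(3) linear_frechet_derivative by blast
  note D = has_derivative_product_form[OF assms(1,2) assms(3)[unfolded frechet_derivative_works], of e]
  have r: "rest_coords (axis None 1 :: real^('k option)) = 0" "rest_coords (axis (Some i) 1 :: real^('k option)) = axis i 1"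
    by (simp_all add: vec_eq_iff axis_def)
  show "partial None (\<lambda>z. \<alpha> (z $ None) *\<^sub>R H (rest_coords z) + \<beta> (z $ None) *\<^sub>R e) z = \<alpha>' *\<^sub>R H (rest_coords z) + \<beta>' *\<^sub>R e"
    unfolding partial_eqI[OF D] r by (simp add: linear_0[OF lin] axis_def)
  show "partial (Some i) (\<lambda>z. \<alpha> (z $ None) *\<^sub>R H (rest_coords z) + \<beta> (z $ None) *\<^sub>R e) z = \<alpha> (z $ None) *\<^sub>R partial i H (rest_coords z)"
    unfolding partial_eqI[OF D] r by (simp add: axis_def partial_def)
qed

lemma smooth_on_product_form:
  fixes H :: "real^'k::finite \<Rightarrow> 'b::real_normed_vector"
  assumes "open I" "open \<Omega>" "smooth_on I \<alpha>" "smooth_on I \<beta>" "smooth_on \<Omega> H"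
  shows "smooth_on (product_domain I \<Omega>) (\<lambda>z. \<alpha> (z $ None) *\<^sub>R H (rest_coords z) + \<beta> (z $ None) *\<^sub>R e)"
proof -
  note V = open_product_domain[OF assms(1,2)]
  have n: "smooth_on (product_domain I \<Omega>) (\<lambda>z. z $ None)"
    by (rule smooth_on_bounded_linear[OF bounded_linear_vec_nth V])
  have r: "smooth_on (product_domain I \<Omega>) rest_coords"
    by (rule smooth_on_bounded_linear[OF bounded_linear_rest_coords V])
  have in_: "z $ None \<in> I" "rest_coords z \<in> \<Omega>" if "z \<in> product_domain I \<Omega>" for z
    using that by (auto simp: product_domain_def)
  show ?thesis
    by (intro smooth_on_add smooth_on_scaleR V smooth_on_const
        smooth_on_compose[OF assms(3) V assms(1) n] smooth_on_compose[OF assms(4) V assms(1) n]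
        smooth_on_compose[OF assms(5) V assms(2) r] in_)
qed

text \<open>
  Both models have the form \<open>(t\<^sup>a G(u), t\<^sup>a E(u) + B(t))\<close>, where \<open>B\<close> is annihilated by
  \<open>(\<theta> - a) (\<theta> - N)\<close> with \<open>\<theta> = t d/dt\<close>.  Their centre map is \<open>2 \<theta> f / (a N)\<close> and their
  support function \<open>r t\<^sup>2\<close>.
\<close>

locale product_model =
  fixes I :: "real set" and \<Omega> :: "(real^'k::finite) set" and G :: "real^'k \<Rightarrow> real^('k option)"
    and E :: "real^'k \<Rightarrow> real" and B B1 B2 :: "real \<Rightarrow> real" and a N r :: real
  assumes I: "open I" "I \<subseteq> {0<..}" and \<Omega>: "open \<Omega>"
    and G: "smooth_on \<Omega> G" and E: "smooth_on \<Omega> E"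
    and B: "smooth_on I B" "smooth_on I B1"
    and B1: "\<And>t. t \<in> I \<Longrightarrow> (B has_real_derivative B1 t) (at t)"
    and B2: "\<And>t. t \<in> I \<Longrightarrow> (B1 has_real_derivative B2 t) (at t)"
    and ode: "\<And>t. t \<in> I \<Longrightarrow> t\<^sup>2 * B2 t = (a + N - 1) * (t * B1 t) - a * N * B t"
    and nz: "a \<noteq> 0" "N \<noteq> 0" "r \<noteq> 0"
begin

definition H where "H u = append_coord (G u) (E u)"
definition e :: "real^('k option option)" where "e = append_coord 0 1"
definition f where "f z = (z $ None powr a) *\<^sub>R H (rest_coords z) + B (z $ None) *\<^sub>R e"
definition ft where
  "ft z = (a * z $ None powr (a - 1)) *\<^sub>R H (rest_coords z) + B1 (z $ None) *\<^sub>R e"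
text \<open>The \<open>e\<close>-component of \<open>(f - 2 \<theta> f / (a N)) / (r t^2)\<close>
  with \<open>\<theta> = t d/dt\<close>; the factor of \<open>H\<close> in \<open>\<xi>\<close> is
  the other component of the same expression.\<close>

definition q where "q t = (B t - 2 * t * B1 t / (a * N)) / (r * t\<^sup>2)"
definition \<xi> where
  "\<xi> z = ((1 - 2 / N) / r * z $ None powr (a - 2)) *\<^sub>R H (rest_coords z) + q (z $ None) *\<^sub>R e"
text \<open>Characterized by \<open>\<theta> f - a f = \<delta> e\<close>. Where it vanishes, the
  position vector is proportional to the t-derivative and the frame degenerates.\<close>

definition \<delta> where "\<delta> t = t * B1 t - a * B t"
abbreviation V where "V \<equiv> product_domain I \<Omega>"

lemma V_D: "z \<in> V \<Longrightarrow> z $ None \<in> I \<and> 0 < z $ None \<and> rest_coords z \<in> \<Omega>"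
  using I(2) by (auto simp: product_domain_def)

lemma open_V: "open V" by (rule open_product_domain[OF I(1) \<Omega>])

lemma H_smooth: "smooth_on \<Omega> H"
  unfolding H_def[abs_def] by (rule smooth_on_append_coord[OF \<Omega> G E])

lemma powr_smooth: "smooth_on I (\<lambda>t. c * t powr b)"
  by (intro smooth_on_mult I smooth_on_const smooth_on_powr smooth_on_ident) (use I(2) in auto)

lemma q_smooth: "smooth_on I q"
proof -
  have id: "smooth_on I (\<lambda>t. t)" by (rule smooth_on_ident[OF I(1)])
  have n: "smooth_on I (\<lambda>t. B t - (2 / (a * N)) * (t * B1 t))"
    by (intro smooth_on_diff smooth_on_mult smooth_on_const I B id)
  have d: "smooth_on I (\<lambda>t. r * (t * t))"
    by (intro smooth_on_mult smooth_on_const I id)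
  have "smooth_on I (\<lambda>t. (B t - (2 / (a * N)) * (t * B1 t)) / (r * (t * t)))"
    by (rule smooth_on_divide[OF I(1) n d]) (use I(2) nz in auto)
  moreover have "q = (\<lambda>t. (B t - (2 / (a * N)) * (t * B1 t)) / (r * (t * t)))"
    by (simp add: q_def fun_eq_iff power2_eq_square)
  ultimately show ?thesis by simp
qed

lemma f_smooth: "smooth_on V f"
  unfolding f_def[abs_def]
  using smooth_on_product_form[OF I(1) \<Omega> powr_smooth[of 1 a] B(1) H_smooth, of e] by simp

lemma \<xi>_smooth: "smooth_on V \<xi>"
  unfolding \<xi>_def[abs_def]
  using smooth_on_product_form[OF I(1) \<Omega> powr_smooth[of "(1 - 2 / N) / r" "a - 2"] q_smooth H_smooth, of e] by simp

lemma dpowr: "t \<in> I \<Longrightarrow> ((\<lambda>t. c * t powr b) has_real_derivative (c * b * t powr (b - 1))) (at t)"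
  using I(2) by (auto intro!: derivative_eq_intros)

lemma Hd: "u \<in> \<Omega> \<Longrightarrow> H differentiable at u"
  using smooth_on_differentiable[OF H_smooth] .

lemma fd: "z \<in> V \<Longrightarrow> f differentiable at z"
  using smooth_on_differentiable[OF f_smooth] .

lemma partial_f:
  assumes "z \<in> V"
  shows "partial None f z = ft z"
    and "partial (Some i) f z = (z $ None powr a) *\<^sub>R partial i H (rest_coords z)"
proof -
  have t: "z $ None \<in> I" "rest_coords z \<in> \<Omega>" using V_D[OF assms] by auto
  note p = partial_product_form[where \<alpha> = "\<lambda>t. 1 * t powr a", OF dpowr[OF t(1)] B1[OF t(1)] Hd[OF t(2)], where e = e]
  show "partial None f z = ft z"
    using p(1) unfolding f_def[abs_def] ft_def by simp
  show "partial (Some i) f z = (z $ None powr a) *\<^sub>R partial i H (rest_coords z)"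
    using p(2) unfolding f_def[abs_def] by simp
qed

lemma t_powr:
  fixes t b :: real
  shows "0 < t \<Longrightarrow> t powr (b - 1) = t powr b / t" "0 < t \<Longrightarrow> t powr (b - 2) = t powr b / t\<^sup>2"
  by (simp_all add: powr_diff)

text \<open>Here the differential equation for \<open>B\<close> is used: once \<open>B2\<close> is
  eliminated, \<open>B\<close> cancels, and the derivative of \<open>q\<close> is the same multiple
  of \<open>B1\<close> that relates the \<open>H\<close>-components of the t-derivatives of
  \<open>\<xi>\<close> and \<open>f\<close>. This makes d/dt an eigendirection of S.\<close>

lemma q_deriv:
  assumes t: "t \<in> I"
  shows "(q has_real_derivative ((1 - 2 / a) * (1 - 2 / N) / (r * t\<^sup>2) * B1 t)) (at t)"
proof -
  have t0: "t > 0" using t I(2) by auto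
  let ?n = "B t - 2 * t * B1 t / (a * N)"
  have "(q has_real_derivative (((B1 t - 2 * (B1 t + t * B2 t) / (a * N)) * (r * t\<^sup>2) - ?n * (r * (2 * t))) / (r * t\<^sup>2 * (r * t\<^sup>2)))) (at t)"
    unfolding q_def[abs_def]
    using t0 nz by (auto intro!: derivative_eq_intros B1[OF t] B2[OF t] simp: field_simps)
  moreover have "((B1 t - 2 * (B1 t + t * B2 t) / (a * N)) * (r * t\<^sup>2) - ?n * (r * (2 * t))) / (r * t\<^sup>2 * (r * t\<^sup>2))
      = (1 - 2 / a) * (1 - 2 / N) / (r * t\<^sup>2) * B1 t"
  proof -
    have b2: "t * B2 t = ((a + N - 1) * (t * B1 t) - a * N * B t) / t"
      using ode[OF t] t0 by (simp add: field_simps power2_eq_square)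
    show ?thesis unfolding b2 using t0 nz by (simp add: field_simps power2_eq_square)
  qed
  ultimately show ?thesis by simp
qed

lemma partial_\<xi>:
  assumes "z \<in> V"
  shows "partial None \<xi> z = ((1 - 2 / a) * (1 - 2 / N) / (r * (z $ None)\<^sup>2)) *\<^sub>R ft z"
    and "partial (Some i) \<xi> z = ((1 - 2 / N) / (r * (z $ None)\<^sup>2)) *\<^sub>R partial (Some i) f z"
proof -
  have t: "z $ None \<in> I" "rest_coords z \<in> \<Omega>" "0 < z $ None" using V_D[OF assms] by auto
  note p = partial_product_form[OF dpowr[OF t(1), of "(1 - 2 / N) / r" "a - 2"] q_deriv[OF t(1)] Hd[OF t(2)], where e = e]
  have "(1 - 2 / N) / r * (a - 2) * z $ None powr (a - 2 - 1)
      = (1 - 2 / a) * (1 - 2 / N) / (r * (z $ None)\<^sup>2) * (a * z $ None powr (a - 1))"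
  proof -
    have "z $ None powr (a - 2 - 1) = z $ None powr a / (z $ None)\<^sup>2 / z $ None"
      using t_powr(1)[OF t(3), of "a - 2"] t_powr(2)[OF t(3), of a] by (simp only:)
    then show ?thesis
      unfolding t_powr(1)[OF t(3), of a] using t(3) nz by (simp only: ) (simp add: field_simps power2_eq_square)
  qed
  then show "partial None \<xi> z = ((1 - 2 / a) * (1 - 2 / N) / (r * (z $ None)\<^sup>2)) *\<^sub>R ft z"
    using p(1) unfolding \<xi>_def[abs_def] ft_def by (simp add: scaleR_add_right)
  show "partial (Some i) \<xi> z = ((1 - 2 / N) / (r * (z $ None)\<^sup>2)) *\<^sub>R partial (Some i) f z"
    using p(2) partial_f(2)[OF assms] unfolding \<xi>_def[abs_def] using t(3) by (simp add: t_powr)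
qed

text \<open>The factors between the derivatives of \<open>\<xi>\<close> and those of
  \<open>f\<close>, with the sign of the Weingarten formula. They are related by the constant factor
  \<open>1 - 2 / a\<close>.\<close>

definition l0 where "l0 t = - ((1 - 2 / a) * (1 - 2 / N) / (r * t\<^sup>2))"
definition l1 where "l1 t = - ((1 - 2 / N) / (r * t\<^sup>2))"

lemma weingarten_model:
  assumes z: "z \<in> V"
  shows "frechet_derivative \<xi> (at z) X =
    - frechet_derivative f (at z) (diagonal_shape (l0 (z $ None)) (l1 (z $ None)) *v X)"
  unfolding frechet_derivative_partial[OF fd[OF z]]
    frechet_derivative_partial[OF smooth_on_differentiable[OF \<xi>_smooth z]] diagonal_shape_mult
  by (simp add: sum_UNIV_option partial_\<xi>[OF z] partial_f(1)[OF z] l0_def l1_def sum_negf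
      mult.commute del: scaleR_right.sum)

lemma D_None: "z \<in> V \<Longrightarrow> frechet_derivative f (at z) (c *\<^sub>R axis None 1) = c *\<^sub>R ft z"
  unfolding frechet_derivative_partial[OF fd]
  by (simp add: sum_UNIV_option partial_f(1) axis_def)

lemma centre:
  assumes z: "z \<in> V"
  shows "f z = frechet_derivative f (at z) ((2 * z $ None / (a * N)) *\<^sub>R axis None 1) + (r * (z $ None)\<^sup>2) *\<^sub>R \<xi> z"
proof -
  have t: "0 < z $ None" using V_D[OF z] by auto
  have 1: "2 * z $ None / (a * N) * (a * z $ None powr (a - 1)) + (r * (z $ None)\<^sup>2) * ((1 - 2 / N) / r * z $ None powr (a - 2)) = z $ None powr a"
    using t nz by (simp add: t_powr field_simps power2_eq_square)
  have 2: "2 * z $ None / (a * N) * B1 (z $ None) + (r * (z $ None)\<^sup>2) * q (z $ None) = B (z $ None)"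
    using t nz by (simp add: q_def field_simps)
  show ?thesis
    unfolding D_None[OF z] unfolding f_def ft_def \<xi>_def 1[symmetric] 2[symmetric]
    by (simp only: scaleR_add_left scaleR_add_right scaleR_scaleR add_ac)
qed

text \<open>Recovers the normal from \<open>f\<close> and t alone. A hypersurface whose normal obeys
  the same formula and which is linearly equivalent to \<open>f\<close> with the same t thus has the
  corresponding normal.\<close>

lemma \<xi>_eq:
  assumes z: "z \<in> V"
  shows "\<xi> z = (1 / (r * (z $ None)\<^sup>2)) *\<^sub>R (f z - (2 * z $ None / (a * N)) *\<^sub>R partial None f z)"
proof -
  have t: "0 < z $ None" using V_D[OF z] by auto
  have "f z - (2 * z $ None / (a * N)) *\<^sub>R partial None f z = (r * (z $ None)\<^sup>2) *\<^sub>R \<xi> z"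
    using centre[OF z] unfolding D_None[OF z] partial_f(1)[OF z] by (metis add_diff_cancel_left')
  then show ?thesis using t nz by simp
qed

text \<open>The coefficient of the t-derivative in \<open>\<xi>\<close> after the position vector
  has been eliminated by \<open>a f = \<theta> f - \<delta> e\<close>.\<close>

definition \<kappa> where "\<kappa> t = (1 - 2 / N) * t / (a * r * t\<^sup>2)"

lemma \<xi>_e:
  assumes z: "z \<in> V"
  shows "\<xi> z = (- \<delta> (z $ None) / (a * r * (z $ None)\<^sup>2)) *\<^sub>R e + \<kappa> (z $ None) *\<^sub>R ft z"
proof -
  have t: "0 < z $ None" using V_D[OF z] by auto
  have 1: "(1 - 2 / N) / r * z $ None powr (a - 2) = \<kappa> (z $ None) * (a * z $ None powr (a - 1))"
    using t nz by (simp add: \<kappa>_def t_powr field_simps power2_eq_square)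
  have 2: "q (z $ None) = - \<delta> (z $ None) / (a * r * (z $ None)\<^sup>2) + \<kappa> (z $ None) * B1 (z $ None)"
    using t nz by (simp add: \<kappa>_def q_def \<delta>_def field_simps power2_eq_square)
  show ?thesis unfolding \<xi>_def ft_def 1 2
    by (simp only: scaleR_add_left scaleR_add_right scaleR_scaleR add_ac)
qed

text \<open>Modulo the t-derivative, \<open>\<xi>\<close> is a multiple of \<open>e\<close>, whose
  only entry is in the component \<open>None\<close>. There remain the rows of the frame of
  \<open>G\<close> with its own position vector as transversal field, scaled by
  \<open>a t^(a-1)\<close> for the position vector and by \<open>t^a\<close> for the
  derivatives.\<close>

lemma det_frame_model:
  assumes z: "z \<in> V"
  shows "det (frame f \<xi> z) = - \<delta> (z $ None) / (r * (z $ None) ^ 3) *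
    ((z $ None powr a) ^ (CARD('k) + 1) * det (frame G G (rest_coords z)))"
proof -
  let ?t = "z $ None" and ?u = "rest_coords z"
  have t: "0 < ?t" "?u \<in> \<Omega>" using V_D[OF z] by auto
  have Gd: "G differentiable at ?u" and Ed: "E differentiable at ?u"
    using smooth_on_differentiable[OF G t(2)] smooth_on_differentiable[OF E t(2)] .
  have pH: "partial i H ?u = append_coord (partial i G ?u) (partial i E ?u)" for i
    unfolding H_def[abs_def] partial_def
    using frechet_derivative_eqI[OF has_derivative_append_coord[OF Gd[unfolded frechet_derivative_works] Ed[unfolded frechet_derivative_works]]]
    by simp
  have "\<xi> z = (- \<delta> ?t / (a * r * ?t\<^sup>2)) *\<^sub>R e + frechet_derivative f (at z) (\<kappa> ?t *\<^sub>R axis None 1)"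
    unfolding D_None[OF z] by (rule \<xi>_e[OF z])
  then have 1: "det (frame f \<xi> z) = - \<delta> ?t / (a * r * ?t\<^sup>2) * det (frame f (\<lambda>z. e) z)"
    by (rule det_frame_transversal[OF fd[OF z]])
  define c where "c = (\<lambda>x::'k option. case x of None \<Rightarrow> a * ?t powr (a - 1) | Some i \<Rightarrow> ?t powr a)"
  have "det (frame f (\<lambda>z. e) z) = det (\<chi> x y. frame f (\<lambda>z. e) z $ Some x $ Some y)"
    by (subst det_option_row) (simp_all add: e_def)
  also have "(\<chi> x y. frame f (\<lambda>z. e) z $ Some x $ Some y) = (\<chi> x. c x *s frame G G ?u $ x)"
    by (simp add: vec_eq_iff split_option_all partial_f[OF z] c_def ft_def H_def e_def pH)
  also have "det \<dots> = (\<Prod>x\<in>UNIV. c x) * det (frame G G ?u)"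
    by (subst det_rows_mul) simp
  also have "(\<Prod>x\<in>UNIV. c x) = a * ?t powr (a - 1) * (?t powr a) ^ CARD('k)"
    by (simp add: prod_UNIV_option c_def)
  finally show ?thesis unfolding 1 using t(1) nz
    by (simp add: t_powr field_simps power2_eq_square power3_eq_cube)
qed

text \<open>Modulo tangent vectors, \<open>e\<close> and the derivatives of \<open>f\<close> are multiples of \<open>\<xi>\<close>.\<close>

context
  fixes z :: "real^('k option)" and s g :: "'k \<Rightarrow> 'k \<Rightarrow> real" and Y :: "'k \<Rightarrow> 'k \<Rightarrow> real^'k"
  assumes z: "z \<in> V" and \<delta>: "\<delta> (z $ None) \<noteq> 0" and det: "det (frame G G (rest_coords z)) \<noteq> 0"
    and H2: "\<And>i j. partial i (partial j H) (rest_coords z) = s i j *\<^sub>R H (rest_coords z) +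
        frechet_derivative H (at (rest_coords z)) (Y i j) + g i j *\<^sub>R e"
begin

lemma det_frame_model_nz: "det (frame f \<xi> z) \<noteq> 0"
  using det_frame_model[OF z] \<delta> det nz V_D[OF z] by simp

lemma e_tangent:
  "e = (- a * r * (z $ None)\<^sup>2 / \<delta> (z $ None)) *\<^sub>R \<xi> z +
    frechet_derivative f (at z) ((a * r * (z $ None)\<^sup>2 / \<delta> (z $ None) * \<kappa> (z $ None)) *\<^sub>R axis None 1)"
proof -
  have t: "0 < z $ None" using V_D[OF z] by auto
  have 1: "(- a * r * (z $ None)\<^sup>2 / \<delta> (z $ None)) * (- \<delta> (z $ None) / (a * r * (z $ None)\<^sup>2)) = 1"
    using t nz \<delta> by simp
  show ?thesis
    unfolding D_None[OF z] \<xi>_e[OF z] scaleR_add_right scaleR_scaleR 1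
    by (simp add: scaleR_add_left[symmetric])
qed

lemma e_scaled:
  "c *\<^sub>R e = (c * (- (a * r * (z $ None)\<^sup>2 / \<delta> (z $ None)))) *\<^sub>R \<xi> z +
    (c * (a * r * (z $ None)\<^sup>2 / \<delta> (z $ None) * \<kappa> (z $ None))) *\<^sub>R ft z"
  by (rule trans[OF arg_cong[OF e_tangent, of "\<lambda>x. c *\<^sub>R x"]])
    (simp add: D_None[OF z] scaleR_add_right scaleR_diff_right)

text \<open>\<open>s\<close> and \<open>g\<close> measure the second derivatives of \<open>H\<close>
  in the transversal directions \<open>H\<close> and \<open>e\<close>. The hypersphere model has
  \<open>g = 0\<close> and \<open>s\<close> the centroaffine metric of \<open>G\<close>; the
  logarithmic model has \<open>s = 0\<close> and \<open>g\<close> a multiple of the Hessian.\<close>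

lemma metric_model_Some:
  "affine_metric f \<xi> z $ Some i $ Some j =
     r * (z $ None)\<^sup>2 / \<delta> (z $ None) * (s i j * (z $ None * B1 (z $ None)) - a * z $ None powr a * g i j)"
proof -
  let ?t = "z $ None" and ?u = "rest_coords z" and ?D = "frechet_derivative f (at z)"
  let ?m = "a * r * ?t\<^sup>2 / \<delta> ?t" and ?p = "z $ None powr a"
  have t: "0 < ?t" "?t \<in> I" "?u \<in> \<Omega>" using V_D[OF z] by auto
  have lin: "linear ?D" using linear_frechet_derivative[OF fd[OF z]] .
  have "partial (Some i) (partial (Some j) f) z = partial (Some i) (\<lambda>z. (1 * z $ None powr a) *\<^sub>R partial j H (rest_coords z) + (0::real) *\<^sub>R e) z"
    by (rule partial_cong[OF open_V z]) (simp add: partial_f)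
  also have "\<dots> = (1 * ?p) *\<^sub>R partial i (partial j H) ?u"
    by (rule partial_product_form(2)[OF dpowr[OF t(2)] DERIV_const])
      (rule smooth_on_differentiable[OF smooth_on_partial[OF H_smooth] t(3)])
  finally have p: "partial (Some i) (partial (Some j) f) z = ?p *\<^sub>R partial i (partial j H) ?u" by simp
  \<comment> \<open>The direction \<open>H\<close> is traded for the t-derivative, which is tangent,
    and a multiple of \<open>e\<close>, which \<open>e_scaled\<close> expresses by
    \<open>\<xi>\<close>.\<close>
  have pH: "?p *\<^sub>R H ?u = (?t / a) *\<^sub>R ft z - (?t / a * B1 ?t) *\<^sub>R e"
    unfolding ft_def using t nz by (simp add: scaleR_add_right t_powr)
  have DH: "?p *\<^sub>R frechet_derivative H (at ?u) Y' = ?D (append_coord Y' 0)" for Y'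
    unfolding frechet_derivative_partial[OF fd[OF z]] frechet_derivative_partial[OF Hd[OF t(3)]]
    by (simp add: sum_UNIV_option partial_f(2)[OF z] scaleR_sum_right mult.commute)
  have "partial (Some i) (partial (Some j) f) z =
      (s i j * ?t / a) *\<^sub>R ft z + ?D (append_coord (Y i j) 0) + (?p * g i j - s i j * ?t / a * B1 ?t) *\<^sub>R e"
  proof -
    have "partial (Some i) (partial (Some j) f) z =
        s i j *\<^sub>R (?p *\<^sub>R H ?u) + ?p *\<^sub>R frechet_derivative H (at ?u) (Y i j) + (?p * g i j) *\<^sub>R e"
      unfolding p by (simp only: H2 scaleR_add_right scaleR_scaleR mult.commute)
    then show ?thesis unfolding DH pH by (simp add: algebra_simps)
  qed
  also have "\<dots> = ((?p * g i j - s i j * ?t / a * B1 ?t) * (- ?m)) *\<^sub>R \<xi> z +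
      ?D (append_coord (Y i j) 0 + (s i j * ?t / a) *\<^sub>R axis None 1 + ((?p * g i j - s i j * ?t / a * B1 ?t) * (?m * \<kappa> ?t)) *\<^sub>R axis None 1)"
    unfolding linear_add[OF lin] D_None[OF z] e_scaled by (simp only: add_ac)
  finally have "affine_metric f \<xi> z $ Some i $ Some j = (?p * g i j - s i j * ?t / a * B1 ?t) * (- ?m)"
    by (rule affine_metric_eqI[OF fd[OF z] det_frame_model_nz])
  also have "\<dots> = r * ?t\<^sup>2 / \<delta> ?t * (s i j * (?t * B1 ?t) - a * ?p * g i j)"
    using nz \<delta> by (simp add: field_simps)
  finally show ?thesis .
qed

text \<open>Differentiation in t only rescales the u-derivatives: the mixed second derivative is
  \<open>a / t\<close> times a tangent vector.\<close>

lemma metric_model_mixed: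
  "affine_metric f \<xi> z $ Some i $ None = 0" "affine_metric f \<xi> z $ None $ Some i = 0"
proof -
  let ?t = "z $ None" and ?u = "rest_coords z" and ?D = "frechet_derivative f (at z)"
  have t: "0 < ?t" "?t \<in> I" "?u \<in> \<Omega>" using V_D[OF z] by auto
  have D: "?D (c *\<^sub>R axis (Some i) 1) = (c * ?t powr a) *\<^sub>R partial i H ?u" for c
    unfolding frechet_derivative_partial[OF fd[OF z]]
    by (simp add: sum_UNIV_option partial_f(2)[OF z] axis_def if_distrib[of "\<lambda>x. _ * x"] if_distrib[of "\<lambda>x. x *\<^sub>R _"] cong: if_cong)
  have "partial (Some i) (partial None f) z = partial (Some i) ft z"
    by (rule partial_cong[OF open_V z]) (simp add: partial_f)
  also have "\<dots> = (a * ?t powr (a - 1)) *\<^sub>R partial i H ?u"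
    unfolding ft_def[abs_def] by (rule partial_product_form(2)[OF dpowr[OF t(2)] B2[OF t(2)] Hd[OF t(3)]])
  also have "\<dots> = 0 *\<^sub>R \<xi> z + ?D ((a / ?t) *\<^sub>R axis (Some i) 1)"
    unfolding D using t by (simp add: t_powr)
  finally show "affine_metric f \<xi> z $ Some i $ None = 0"
    by (rule affine_metric_eqI[OF fd[OF z] det_frame_model_nz])
  have "partial None (partial (Some i) f) z = partial None (\<lambda>z. (1 * z $ None powr a) *\<^sub>R partial i H (rest_coords z) + (0::real) *\<^sub>R e) z"
    by (rule partial_cong[OF open_V z]) (simp add: partial_f)
  also have "\<dots> = (1 * a * ?t powr (a - 1)) *\<^sub>R partial i H ?u + 0 *\<^sub>R e"
    by (rule partial_product_form(1)[OF dpowr[OF t(2)] DERIV_const])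
      (rule smooth_on_differentiable[OF smooth_on_partial[OF H_smooth] t(3)])
  also have "\<dots> = 0 *\<^sub>R \<xi> z + ?D ((a / ?t) *\<^sub>R axis (Some i) 1)"
    unfolding D using t by (simp add: t_powr)
  finally show "affine_metric f \<xi> z $ None $ Some i = 0"
    by (rule affine_metric_eqI[OF fd[OF z] det_frame_model_nz])
qed

text \<open>By the equation for \<open>B\<close>, the second t-derivative is
  \<open>(a - 1) / t\<close> times the first plus \<open>N \<delta> / t^2\<close> times
  \<open>e\<close>. The factor \<open>\<delta>\<close> cancels against the one that relates
  \<open>e\<close> to \<open>\<xi>\<close>, which leaves a constant.\<close>

lemma metric_model_None: "affine_metric f \<xi> z $ None $ None = - a * N * r"
proof -
  let ?t = "z $ None" and ?u = "rest_coords z" and ?D = "frechet_derivative f (at z)"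
  have t: "0 < ?t" "?t \<in> I" "?u \<in> \<Omega>" using V_D[OF z] by auto
  have lin: "linear ?D" using linear_frechet_derivative[OF fd[OF z]] .
  let ?m = "a * r * ?t\<^sup>2 / \<delta> ?t"
  have "partial None (partial None f) z = partial None ft z"
    by (rule partial_cong[OF open_V z]) (simp add: partial_f)
  also have "\<dots> = (a * (a - 1) * ?t powr (a - 1 - 1)) *\<^sub>R H ?u + B2 ?t *\<^sub>R e"
    unfolding ft_def[abs_def] by (rule partial_product_form(1)[OF dpowr[OF t(2)] B2[OF t(2)] Hd[OF t(3)]])
  also have "\<dots> = ((a - 1) / ?t) *\<^sub>R ft z + (N * \<delta> ?t / ?t\<^sup>2) *\<^sub>R e"
  proof -
    have 1: "a * (a - 1) * ?t powr (a - 1 - 1) = (a - 1) / ?t * (a * ?t powr (a - 1))"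
      using t by (simp add: t_powr field_simps power2_eq_square)
    have 2: "B2 ?t = (a - 1) / ?t * B1 ?t + N * \<delta> ?t / ?t\<^sup>2"
    proof -
      have b: "B2 ?t = ((a + N - 1) * (?t * B1 ?t) - a * N * B ?t) / ?t\<^sup>2"
        using t ode[OF t(2)] by (simp add: eq_divide_eq mult.commute)
      show ?thesis unfolding b using t(1) by (simp add: \<delta>_def field_simps power2_eq_square)
    qed
    show ?thesis unfolding ft_def 1 2 by (simp only: scaleR_add_left scaleR_add_right scaleR_scaleR add_ac)
  qed
  also have "\<dots> = ((N * \<delta> ?t / ?t\<^sup>2) * (- ?m)) *\<^sub>R \<xi> z +
      ?D (((a - 1) / ?t) *\<^sub>R axis None 1 + ((N * \<delta> ?t / ?t\<^sup>2) * (?m * \<kappa> ?t)) *\<^sub>R axis None 1)"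
    unfolding linear_add[OF lin] D_None[OF z] e_scaled by (simp only: add_ac)
  finally have "affine_metric f \<xi> z $ None $ None = (N * \<delta> ?t / ?t\<^sup>2) * (- ?m)"
    by (rule affine_metric_eqI[OF fd[OF z] det_frame_model_nz])
  then show ?thesis using nz \<delta> t by (simp add: field_simps)
qed

end

end

section \<open>Charts and atlases\<close>

lemma second_countable_euclidean:
  "second_countable (euclidean :: 'a::second_countable_topology topology)"
proof -
  obtain \<B> :: "'a set set" where \<B>: "countable \<B>" "topological_basis \<B>"
    using ex_countable_basis by blast
  show ?thesis
    unfolding second_countable_def
  proof (intro exI conjI ballI allI impI)
    show "countable \<B>" by (rule \<B>(1))
    show "openin euclidean W" if "W \<in> \<B>" for W using topological_basis_open[OF \<B>(2) that] by simp
    fix U and x :: 'a assume "openin euclidean U \<and> x \<in> U"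
    then have "open U" "x \<in> U" by auto
    then obtain W where "W \<in> \<B>" "x \<in> W" "W \<subseteq> U" using topological_basisE[OF \<B>(2)] by blast
    then show "\<exists>V\<in>\<B>. x \<in> V \<and> V \<subseteq> U" by blast
  qed
qed

lemma second_countable_prod_topology:
  assumes "second_countable X" "second_countable Y"
  shows "second_countable (prod_topology X Y)"
proof -
  obtain \<B> \<C> where \<B>: "countable \<B>" "\<And>V. V \<in> \<B> \<Longrightarrow> openin X V"
      "\<And>U x. openin X U \<Longrightarrow> x \<in> U \<Longrightarrow> \<exists>V \<in> \<B>. x \<in> V \<and> V \<subseteq> U"
    and \<C>: "countable \<C>" "\<And>V. V \<in> \<C> \<Longrightarrow> openin Y V"
      "\<And>U x. openin Y U \<Longrightarrow> x \<in> U \<Longrightarrow> \<exists>V \<in> \<C>. x \<in> V \<and> V \<subseteq> U"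
    using assms unfolding second_countable_def by metis
  show ?thesis
    unfolding second_countable_def
  proof (intro exI conjI ballI allI impI)
    show "countable ((\<lambda>(V, W). V \<times> W) ` (\<B> \<times> \<C>))" using \<B>(1) \<C>(1) by blast
    show "openin (prod_topology X Y) V" if "V \<in> (\<lambda>(V, W). V \<times> W) ` (\<B> \<times> \<C>)" for V
      using that \<B>(2) \<C>(2) by (auto simp: openin_prod_Times_iff)
    fix U p assume "openin (prod_topology X Y) U \<and> p \<in> U"
    then obtain V W where VW: "openin X V" "openin Y W" "fst p \<in> V" "snd p \<in> W" "V \<times> W \<subseteq> U"
      unfolding openin_prod_topology_alt by (metis prod.collapse)
    then obtain V' W' where "V' \<in> \<B>" "fst p \<in> V'" "V' \<subseteq> V" "W' \<in> \<C>" "snd p \<in> W'" "W' \<subseteq> W"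
      using \<B>(3) \<C>(3) by metis
    then show "\<exists>V\<in>(\<lambda>(V, W). V \<times> W) ` (\<B> \<times> \<C>). p \<in> V \<and> V \<subseteq> U"
      using VW(5) by (intro bexI[of _ "V' \<times> W'"]) (auto simp: mem_Times_iff)
  qed
qed

text \<open>Identifies the inverse of the homeomorphism with \<open>inv_into\<close>, in terms of
  which \<open>local_rep\<close> is defined.\<close>

lemma topological_chart_homeomorphic_maps:
  assumes "topological_chart X c"
  shows "homeomorphic_maps (subtopology X (fst c)) (top_of_set (chart_image c)) (snd c) (inv_into (fst c) (snd c))"
    and "inj_on (snd c) (fst c)" "fst c \<subseteq> topspace X"
proof -
  have h: "homeomorphic_map (subtopology X (fst c)) (top_of_set (chart_image c)) (snd c)"
    and sub: "fst c \<subseteq> topspace X"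
    using assms openin_subset unfolding topological_chart_def by blast+
  show "fst c \<subseteq> topspace X" by (rule sub)
  have top: "topspace (subtopology X (fst c)) = fst c" using sub by auto
  show inj: "inj_on (snd c) (fst c)" using homeomorphic_imp_injective_map[OF h] unfolding top .
  obtain g where g: "homeomorphic_maps (subtopology X (fst c)) (top_of_set (chart_image c)) (snd c) g"
    using h homeomorphic_map_maps by blast
  have "g y = inv_into (fst c) (snd c) y" if "y \<in> chart_image c" for y
  proof -
    have "g y \<in> topspace (subtopology X (fst c))" "snd c (g y) = y"
      using g that unfolding homeomorphic_maps_def continuous_map_def by auto
    then show ?thesis using inv_into_f_f[OF inj, of "g y"] top by simp
  qed
  then show "homeomorphic_maps (subtopology X (fst c)) (top_of_set (chart_image c)) (snd c) (inv_into (fst c) (snd c))"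
    by (intro homeomorphic_maps_eq[OF g]) simp_all
qed

lemma topological_chartI:
  assumes "openin X U" "open V"
    and "homeomorphic_maps (subtopology X U) (top_of_set V) \<phi> \<psi>"
  shows "topological_chart X (U, \<phi>)" "chart_image (U, \<phi>) = V"
    "\<And>z. z \<in> V \<Longrightarrow> inv_into U \<phi> z = \<psi> z"
proof -
  have top: "topspace (subtopology X U) = U" using openin_subset[OF assms(1)] by auto
  have h: "homeomorphic_map (subtopology X U) (top_of_set V) \<phi>"
    using assms(3) homeomorphic_map_maps by blast
  have "\<phi> ` U = V" using homeomorphic_imp_surjective_map[OF h] unfolding top by simp
  then show im: "chart_image (U, \<phi>) = V" by (simp add: chart_image_def)
  then show "topological_chart X (U, \<phi>)" using assms h by (simp add: topological_chart_def)
  have inj: "inj_on \<phi> U" using homeomorphic_imp_injective_map[OF h] unfolding top .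
  fix z assume z: "z \<in> V"
  have "\<psi> z \<in> topspace (subtopology X U)" "\<phi> (\<psi> z) = z"
    using assms(3) z unfolding homeomorphic_maps_def continuous_map_def by auto
  then show "inv_into U \<phi> z = \<psi> z" using inv_into_f_f[OF inj, of "\<psi> z"] top by simp
qed

lemma open_chart_image_subset:
  assumes "topological_chart X c" "openin X W" "W \<subseteq> fst c"
  shows "open (snd c ` W)"
proof -
  have h: "homeomorphic_map (subtopology X (fst c)) (top_of_set (chart_image c)) (snd c)"
    and o: "open (chart_image c)" using assms unfolding topological_chart_def by blast+
  have "openin (subtopology X (fst c)) W"
    using assms(2,3) openin_subtopology_Int2 by (metis inf.absorb2 openin_subtopology_Int inf_commute)
  then have "openin (top_of_set (chart_image c)) (snd c ` W)"
    using homeomorphic_imp_open_map[OF h] unfolding open_map_def by blast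
  then show ?thesis using o openin_open_trans by blast
qed

lemma oriented_manifold_domain_atlas:
  fixes V :: "(real^'n::finite) set"
  assumes "open V"
  shows "oriented_manifold (top_of_set V) (domain_atlas V)"
proof -
  have inv: "inv_into V id x = x" if "x \<in> V" for x :: "real^'n"
    using inv_into_f_f[of id V x] that by simp
  have rep: "local_rep (V, id) id x = x" if "x \<in> V" for x :: "real^'n" by (simp add: local_rep_def inv that)
  have chart: "topological_chart (top_of_set V) (V, id)"
    using assms by (simp add: topological_chart_def chart_image_def subtopology_subtopology)
  have "smooth_on V (local_rep (V, id) id :: real^'n \<Rightarrow> real^'n)"
    by (rule smooth_on_cong[OF assms rep[symmetric] smooth_on_ident[OF assms]])
  moreover have "0 < det (matrix (frechet_derivative (local_rep (V, id) id) (at z)))" if "z \<in> V" for z :: "real^'n"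
  proof -
    have "frechet_derivative (local_rep (V, id) id) (at z) = frechet_derivative (\<lambda>x. x) (at z)"
      by (rule frechet_derivative_cong_open[OF assms that rep])
    moreover have "det (matrix (id :: real^'n \<Rightarrow> real^'n)) = 1" by (rule matrix_id)
    ultimately show ?thesis by (simp add: id_def)
  qed
  ultimately show ?thesis
    using chart second_countable_subtopology[OF second_countable_euclidean]
    by (simp add: oriented_manifold_def domain_atlas_def smooth_transition_def positive_transition_def Hausdorff_space_subtopology)
qed

lemma local_rep_domain: "z \<in> V \<Longrightarrow> local_rep (V, id) f z = f z"
  using inv_into_f_f[of id V z] by (simp add: local_rep_def)

context
  fixes I :: "real set" and Y :: "'q topology"
  assumes I: "open I"
begin

text \<open>The explicit inverse reduces coordinate expressions on the product to those on the
  second factor.\<close>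

lemma line_product_chart:
  fixes c :: "('q, 'n::finite) chart"
  assumes c: "topological_chart Y c"
  defines "d \<equiv> (I \<times> fst c, \<lambda>(t, q). append_coord (snd c q) t)"
  shows "topological_chart (prod_topology (top_of_set I) Y) d"
    "chart_image d = product_domain I (chart_image c)"
    "\<And>z. z \<in> product_domain I (chart_image c) \<Longrightarrow>
       inv_into (I \<times> fst c) (\<lambda>(t, q). append_coord (snd c q) t) z = (z $ None, inv_into (fst c) (snd c) (rest_coords z))"
proof -
  let ?P = "prod_topology (top_of_set I) Y" and ?U = "I \<times> fst c" and ?V = "product_domain I (chart_image c)"
  let ?g = "inv_into (fst c) (snd c)"
  note h = topological_chart_homeomorphic_maps[OF c]
  have o: "openin Y (fst c)" "open (chart_image c)" using c by (auto simp: topological_chart_def)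
  have top: "topspace (subtopology Y (fst c)) = fst c" using h(3) by auto
  have U: "openin ?P ?U" using o(1) by (auto simp: openin_prod_Times_iff)
  have sub: "subtopology ?P ?U = prod_topology (top_of_set I) (subtopology Y (fst c))"
    by (simp add: subtopology_Times subtopology_subtopology)
  have cg: "continuous_map (top_of_set (chart_image c)) (subtopology Y (fst c)) ?g"
    and cc: "continuous_map (subtopology Y (fst c)) (top_of_set (chart_image c)) (snd c)"
    and gc: "\<And>q. q \<in> fst c \<Longrightarrow> ?g (snd c q) = q" and cg': "\<And>y. y \<in> chart_image c \<Longrightarrow> snd c (?g y) = y"
    using h(1) top by (auto simp: homeomorphic_maps_def)
  have hm: "homeomorphic_maps (subtopology ?P ?U) (top_of_set ?V) (\<lambda>(t, q). append_coord (snd c q) t)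
      (\<lambda>z. (z $ None, ?g (rest_coords z)))"
    unfolding homeomorphic_maps_def sub
  proof (intro conjI ballI)
    have 1: "continuous_map (prod_topology (top_of_set I) (subtopology Y (fst c))) euclidean (\<lambda>p. fst p :: real)"
      using continuous_map_fst continuous_map_into_fulltopology by fastforce
    have 2: "continuous_map (prod_topology (top_of_set I) (subtopology Y (fst c))) euclidean (\<lambda>p. snd c (snd p))"
      using continuous_map_compose[OF continuous_map_snd cc] continuous_map_into_fulltopology
      by (fastforce simp: o_def)
    have 3: "continuous_map (prod_topology (top_of_set I) (subtopology Y (fst c))) (prod_topology euclidean euclidean)
      (\<lambda>p. (snd c (snd p), fst p :: real))"
      using continuous_map_pairedI[OF 2 1] .
    have 4: "continuous_map (prod_topology euclidean euclidean) euclidean (\<lambda>p::(real^'n) \<times> real. append_coord (fst p) (snd p))"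
      using linear_continuous_on[OF linear_append_coord[THEN linear_conv_bounded_linear[THEN iffD1]]] by simp
    have "continuous_map (prod_topology (top_of_set I) (subtopology Y (fst c))) euclidean
      (\<lambda>p. append_coord (snd c (snd p)) (fst p))"
      using continuous_map_compose[OF 3 4] by (simp add: o_def)
    moreover have "append_coord (snd c q) t \<in> ?V" if "t \<in> I" "q \<in> fst c" for t q
      using that by (auto simp: product_domain_def chart_image_def)
    ultimately show "continuous_map (prod_topology (top_of_set I) (subtopology Y (fst c))) (top_of_set ?V)
        (\<lambda>(t, q). append_coord (snd c q) t)"
      by (auto simp: continuous_map_in_subtopology case_prod_unfold)
    have "continuous_map (top_of_set ?V) (top_of_set I) (\<lambda>z. z $ None)"
      by (auto simp: continuous_map_in_subtopology product_domain_def
          intro!: linear_continuous_on bounded_linear_vec_nth)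
    moreover have 5: "continuous_map (top_of_set ?V) (top_of_set (chart_image c)) rest_coords"
      by (auto simp: continuous_map_in_subtopology product_domain_def
          intro!: linear_continuous_on bounded_linear_rest_coords)
    have "continuous_map (top_of_set ?V) (subtopology Y (fst c)) (\<lambda>z. ?g (rest_coords z))"
      using continuous_map_compose[OF 5 cg] by (simp add: o_def)
    ultimately show "continuous_map (top_of_set ?V) (prod_topology (top_of_set I) (subtopology Y (fst c)))
      (\<lambda>z. (z $ None, ?g (rest_coords z)))"
      by (rule continuous_map_pairedI)
  next
    fix p assume "p \<in> topspace (prod_topology (top_of_set I) (subtopology Y (fst c)))"
    then show "(\<lambda>z. (z $ None, ?g (rest_coords z))) ((\<lambda>(t, q). append_coord (snd c q) t) p) = p"
      using top gc by (auto simp: case_prod_unfold)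
  next
    fix z assume "z \<in> topspace (top_of_set ?V)"
    then show "(\<lambda>(t, q). append_coord (snd c q) t) (z $ None, ?g (rest_coords z)) = z"
      using cg' by (auto simp: product_domain_def)
  qed
  note res = topological_chartI[OF U open_product_domain[OF I o(2)] hm]
  show "topological_chart ?P d" "chart_image d = ?V" using res(1,2) by (simp_all add: d_def)
  show "inv_into ?U (\<lambda>(t, q). append_coord (snd c q) t) z = (z $ None, ?g (rest_coords z))" if "z \<in> ?V" for z
    by (rule res(3)[OF that])
qed

lemma local_rep_line_product:
  fixes c :: "('q, 'n::finite) chart"
  assumes "topological_chart Y c" "z \<in> product_domain I (chart_image c)"
  shows "local_rep (I \<times> fst c, \<lambda>(t, q). append_coord (snd c q) t) F z = F (z $ None, inv_into (fst c) (snd c) (rest_coords z))"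
  using line_product_chart(3)[OF assms] by (simp add: local_rep_def)

text \<open>A transition map of product charts is one of the second factor together with the
  identity in t, so the Jacobian determinants agree and positivity is inherited.\<close>

lemma oriented_manifold_line_product:
  fixes B :: "('q, 'n::finite) chart set"
  assumes B: "oriented_manifold Y B"
  shows "oriented_manifold (prod_topology (top_of_set I) Y) (line_product_atlas I B)"
proof -
  let ?P = "prod_topology (top_of_set I) Y"
  define E where "E c = (I \<times> fst c, \<lambda>(t, q). append_coord (snd c q) t)" for c :: "('q, 'n) chart"
  have atlas: "line_product_atlas I B = E ` B" by (simp add: line_product_atlas_def E_def)
  have tc: "topological_chart Y c" if "c \<in> B" for c using B that by (simp add: oriented_manifold_def)
  have "Hausdorff_space ?P"
    using B by (simp add: oriented_manifold_def Hausdorff_space_prod_topology Hausdorff_space_subtopology)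
  moreover have "second_countable ?P"
    using B by (simp add: oriented_manifold_def second_countable_prod_topology
        second_countable_subtopology[OF second_countable_euclidean])
  moreover have "(\<Union>c\<in>line_product_atlas I B. fst c) = topspace ?P"
  proof -
    have "(\<Union>c\<in>line_product_atlas I B. fst c) = I \<times> (\<Union>c\<in>B. fst c)" by (auto simp: atlas E_def)
    then show ?thesis using B by (simp add: oriented_manifold_def)
  qed
  moreover have "topological_chart ?P d" if "d \<in> line_product_atlas I B" for d
    using that line_product_chart(1)[OF tc] by (auto simp: atlas E_def)
  moreover have "smooth_transition (E c) (E d) \<and> positive_transition (E c) (E d)" if cd: "c \<in> B" "d \<in> B" for c d
  proof -
    let ?W = "snd c ` (fst c \<inter> fst d)" and ?\<tau> = "local_rep c (snd d)"
    have st: "smooth_on ?W ?\<tau>" and pt: "\<And>z. z \<in> ?W \<Longrightarrow> 0 < det (matrix (frechet_derivative ?\<tau> (at z)))"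
      using B cd by (auto simp: oriented_manifold_def smooth_transition_def positive_transition_def)
    have "openin Y (fst c \<inter> fst d)"
      using tc[OF cd(1)] tc[OF cd(2)] by (simp add: topological_chart_def openin_Int)
    then have oW: "open ?W" by (intro open_chart_image_subset[OF tc[OF cd(1)]]) auto
    have dom: "snd (E c) ` (fst (E c) \<inter> fst (E d)) = product_domain I ?W" (is "_ = ?D")
    proof safe
      fix t q assume "(t, q) \<in> fst (E c)" "(t, q) \<in> fst (E d)"
      then show "snd (E c) (t, q) \<in> ?D" by (auto simp: E_def product_domain_def)
    next
      fix z assume "z \<in> ?D"
      then obtain q where "q \<in> fst c \<inter> fst d" "rest_coords z = snd c q" "z $ None \<in> I"
        by (auto simp: product_domain_def)
      then show "z \<in> snd (E c) ` (fst (E c) \<inter> fst (E d))"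
        by (intro image_eqI[of _ _ "(z $ None, q)"]) (simp_all add: E_def flip: \<open>rest_coords z = snd c q\<close>)
    qed
    have oD: "open ?D" by (rule open_product_domain[OF I oW])
    have WD: "?D \<subseteq> product_domain I (chart_image c)" by (auto simp: product_domain_def chart_image_def)
    have rep: "local_rep (E c) (snd (E d)) z = append_coord (?\<tau> (rest_coords z)) (z $ None)" if "z \<in> ?D" for z
      using local_rep_line_product[OF tc[OF cd(1)], of z "snd (E d)"] that WD
      by (auto simp: E_def local_rep_def)
    have sr: "smooth_on ?D (\<lambda>z. ?\<tau> (rest_coords z))"
      by (rule smooth_on_compose[OF st oD oW smooth_on_bounded_linear[OF bounded_linear_rest_coords oD]])
        (simp add: product_domain_def)
    have sa: "smooth_on ?D (\<lambda>z. append_coord (?\<tau> (rest_coords z)) (z $ None))"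
      by (intro smooth_on_append_coord oD sr smooth_on_bounded_linear[OF bounded_linear_vec_nth])
    have "smooth_on ?D (local_rep (E c) (snd (E d)))"
      by (rule smooth_on_cong[OF oD _ sa]) (simp add: rep)
    moreover have "0 < det (matrix (frechet_derivative (local_rep (E c) (snd (E d))) (at z)))" if z: "z \<in> ?D" for z
    proof -
      have u: "rest_coords z \<in> ?W" using z by (simp add: product_domain_def)
      let ?D\<tau> = "frechet_derivative ?\<tau> (at (rest_coords z))"
      have "((\<lambda>z. ?\<tau> (rest_coords z)) has_derivative (\<lambda>X. ?D\<tau> (rest_coords X))) (at z)"
        using diff_chain_at[OF bounded_linear_imp_has_derivative[OF bounded_linear_rest_coords] smooth_on_has_derivative[OF st u]]
        by (simp add: o_def)
      then have D: "((\<lambda>z. append_coord (?\<tau> (rest_coords z)) (z $ None)) has_derivative (\<lambda>X. append_coord (?D\<tau> (rest_coords X)) (X $ None))) (at z)"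
        by (rule has_derivative_append_coord[OF _ bounded_linear_imp_has_derivative[OF bounded_linear_vec_nth]])
      have lin: "linear ?D\<tau>" using smooth_on_differentiable[OF st u] linear_frechet_derivative by blast
      have eq: "frechet_derivative (local_rep (E c) (snd (E d))) (at z) = (\<lambda>X. append_coord (?D\<tau> (rest_coords X)) (X $ None))"
        by (rule trans[OF frechet_derivative_cong_open[OF oD z] frechet_derivative_eqI[OF D]]) (rule rep)
      let ?M = "matrix (\<lambda>X. append_coord (?D\<tau> (rest_coords X)) (X $ None))"
      have r: "rest_coords (axis (Some i) 1 :: real^('n option)) = axis i 1" for i
        by (simp add: vec_eq_iff axis_def)
      have "det ?M = ?M $ None $ None * det (\<chi> i j. ?M $ Some i $ Some j)"
        by (rule det_option_row) (simp add: matrix_def axis_def)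
      also have "(\<chi> i j. ?M $ Some i $ Some j) = matrix ?D\<tau>" by (simp add: matrix_def vec_eq_iff r)
      also have "?M $ None $ None = 1" by (simp add: matrix_def)
      finally show ?thesis unfolding eq using pt[OF u] by simp
    qed
    ultimately show ?thesis by (simp add: smooth_transition_def positive_transition_def dom)
  qed
  ultimately show ?thesis by (auto simp: oriented_manifold_def atlas)
qed

end

section \<open>Block metrics\<close>

definition block_metric :: "real \<Rightarrow> real^'k^'k \<Rightarrow> real^('k::finite option)^('k option)" where
  "block_metric \<alpha> Q = (\<chi> a b. case (a, b) of (None, None) \<Rightarrow> \<alpha> | (Some i, Some j) \<Rightarrow> Q $ i $ j | _ \<Rightarrow> 0)"

lemma block_metric_nth [simp]:
  "block_metric \<alpha> Q $ None $ None = \<alpha>" "block_metric \<alpha> Q $ Some i $ Some j = Q $ i $ j"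
  "block_metric \<alpha> Q $ None $ Some j = 0" "block_metric \<alpha> Q $ Some i $ None = 0"
  by (simp_all add: block_metric_def)

lemma block_metricI:
  assumes "M $ None $ None = \<alpha>" "\<And>i. M $ Some i $ None = 0" "\<And>i. M $ None $ Some i = 0"
    "\<And>i j. M $ Some i $ Some j = Q $ i $ j"
  shows "M = block_metric \<alpha> Q"
  using assms by (simp add: vec_eq_iff split_option_all)

lemma det_block_metric: "det (block_metric \<alpha> Q) = \<alpha> * det Q"
  by (subst det_option_row) simp_all

lemma positive_definite_block_metric:
  "positive_definite (block_metric \<alpha> Q) \<longleftrightarrow> 0 < \<alpha> \<and> positive_definite Q"
proof -
  have tr: "transpose (block_metric \<alpha> Q) = block_metric \<alpha> Q \<longleftrightarrow> transpose Q = Q"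
    by (auto simp: vec_eq_iff split_option_all transpose_def)
  have v: "v \<bullet> (block_metric \<alpha> Q *v v) = \<alpha> * (v $ None)\<^sup>2 + rest_coords v \<bullet> (Q *v rest_coords v)" for v
    by (simp add: inner_vec_def matrix_vector_mult_def sum_UNIV_option power2_eq_square)
  have "(\<forall>v. v \<noteq> 0 \<longrightarrow> 0 < v \<bullet> (block_metric \<alpha> Q *v v)) \<longleftrightarrow> 0 < \<alpha> \<and> (\<forall>w. w \<noteq> 0 \<longrightarrow> 0 < w \<bullet> (Q *v w))"
  proof safe
    assume *: "\<forall>v. v \<noteq> 0 \<longrightarrow> 0 < v \<bullet> (block_metric \<alpha> Q *v v)"
    show "0 < \<alpha>" using *[rule_format, of "append_coord 0 1"] by (simp add: v)
    show "0 < w \<bullet> (Q *v w)" if "w \<noteq> 0" for w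
      using *[rule_format, of "append_coord w 0"] that by (simp add: v)
  next
    fix u :: "real^('a option)"
    assume a: "0 < \<alpha>" and *: "\<forall>w. w \<noteq> 0 \<longrightarrow> 0 < w \<bullet> (Q *v w)" and "u \<noteq> 0"
    then have ne: "rest_coords u \<noteq> 0 \<or> u $ None \<noteq> 0"
      by (metis append_coord_0 append_rest)
    have "0 \<le> rest_coords u \<bullet> (Q *v rest_coords u)"
      using * by (cases "rest_coords u = 0") (auto intro: less_imp_le)
    moreover have "0 \<le> \<alpha> * (u $ None)\<^sup>2" using a by simp
    ultimately show "0 < u \<bullet> (block_metric \<alpha> Q *v u)"
      unfolding v using ne a * by (cases "rest_coords u = 0") (auto intro: add_nonneg_pos)
  qed
  then show ?thesis by (auto simp: positive_definite_def tr)
qed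

lemma positive_definite_cmult:
  fixes Q :: "real^'k^'k"
  assumes "0 < c"
  shows "positive_definite (\<chi> i j. c * Q $ i $ j) \<longleftrightarrow> positive_definite Q"
proof -
  have "(\<chi> i j. c * Q $ i $ j) *v v = c *\<^sub>R (Q *v v)" for v
    by (simp add: vec_eq_iff matrix_vector_mult_def sum_distrib_left mult_ac)
  moreover have "transpose (\<chi> i j. c * Q $ i $ j) = (\<chi> i j. c * Q $ i $ j) \<longleftrightarrow> transpose Q = Q"
    using assms by (simp add: vec_eq_iff transpose_def)
  ultimately show ?thesis using assms by (simp add: positive_definite_def zero_less_mult_iff)
qed

lemma positive_definite_det_nz:
  fixes Q :: "real^'k^'k"
  assumes "positive_definite Q"
  shows "det Q \<noteq> 0"
proof -
  have "Q *v v = 0 \<Longrightarrow> v = 0" for v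
    using assms unfolding positive_definite_def by (metis inner_zero_right less_irrefl)
  then have "inj ((*v) Q)" by (simp add: linear_injective_0)
  then show ?thesis using det_nz_iff_inj[of "(*v) Q"] by simp
qed

lemma warped_metric_block:
  "warped_metric F g z = block_metric 1 (\<chi> i j. exp (2 * F (z $ None)) * g (rest_coords z) $ i $ j)"
  by (simp add: vec_eq_iff split_option_all warped_metric_def)

lemma det_diagonal_shape: "det (diagonal_shape l0 l1 :: real^('k::finite option)^('k option)) = l0 * l1 ^ CARD('k)"
  by (subst det_diagonal) (simp_all add: diagonal_shape_def prod_UNIV_option)

text \<open>Each volume condition below contains one free factor: the frame contributes
  \<open>R\<close> itself and the metric the root of a power of \<open>R\<close>.\<close>

lemma ex_root: "0 < C \<Longrightarrow> \<exists>R>0. R * sqrt (R ^ k) = (C::real)"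
proof -
  assume C: "0 < C"
  let ?R = "C powr (2 / (2 + real k))"
  have "?R * sqrt (?R ^ k) = ?R powr (1 + k / 2)"
    using C by (simp add: powr_add powr_half_sqrt[symmetric] powr_realpow[symmetric] powr_powr mult.commute)
  also have "\<dots> = C" using C by (simp add: powr_powr field_simps)
  finally show ?thesis using C by (intro exI[of _ ?R]) simp
qed

context product_model begin

lemma congruent_patch_model:
  assumes L: "det L \<noteq> 0" and T: "det T \<noteq> 0" "\<And>z. z \<in> V \<Longrightarrow> (2 * z $ None / (a * N)) *\<^sub>R ft z = T *v f z"
    and N2: "N \<noteq> 2"
    and det: "\<And>z. z \<in> V \<Longrightarrow> det (frame f \<xi> z) \<noteq> 0"
    and met: "\<And>z. z \<in> V \<Longrightarrow> positive_definite (affine_metric f \<xi> z)"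
    and vol: "\<And>z. z \<in> V \<Longrightarrow> \<bar>det L\<bar> * \<bar>det (frame f \<xi> z)\<bar> = sqrt \<bar>det (affine_metric f \<xi> z)\<bar>"
  shows "congruent_patch V (\<lambda>z. L *v f z) (\<lambda>z. L *v \<xi> z) (L ** T ** matrix_inv L)
    (\<lambda>z. l0 (z $ None)) (\<lambda>z. l1 (z $ None))"
proof (rule congruent_patchI[OF open_V f_smooth \<xi>_smooth L T(1) det weingarten_model])
  fix z assume z: "z \<in> V"
  have t: "z $ None > 0" using V_D[OF z] by simp
  show "f z = frechet_derivative f (at z) ((2 * z $ None / (a * N)) *\<^sub>R axis None 1) + (r * (z $ None)\<^sup>2) *\<^sub>R \<xi> z \<and>
      r * (z $ None)\<^sup>2 \<noteq> 0 \<and> frechet_derivative f (at z) ((2 * z $ None / (a * N)) *\<^sub>R axis None 1) = T *v f z"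
    using centre[OF z] t nz by (simp add: D_None[OF z] T(2)[OF z])
  show "positive_definite (affine_metric f \<xi> z)" by (rule met[OF z])
  then show "det (affine_metric f \<xi> z) \<noteq> 0 \<and> \<bar>det L\<bar> * \<bar>det (frame f \<xi> z)\<bar> = sqrt \<bar>det (affine_metric f \<xi> z)\<bar>"
    using positive_definite_det_nz vol[OF z] by blast
  \<comment> \<open>The eigenvalues are related by the factor \<open>1 - 2 / a\<close>, which is
    never one, and \<open>N \<noteq> 2\<close> keeps the multiple eigenvalue away from zero.\<close>
  have "(1 - 2 / a) * x = x \<longleftrightarrow> x = 0" for x using nz by (auto simp: field_simps)
  moreover have "(1 - 2 / N) / (r * (z $ None)\<^sup>2) \<noteq> 0" using N2 nz t by (simp add: field_simps)
  ultimately have "l0 (z $ None) \<noteq> l1 (z $ None)"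
    unfolding l0_def l1_def by (metis minus_equation_iff times_divide_eq_right)
  from this dim_eigenspace_diagonal_shape[OF this, where 'k = 'k]
  show "l0 (z $ None) \<noteq> l1 (z $ None) \<and>
      dim (eigenspace (diagonal_shape (l0 (z $ None)) (l1 (z $ None)) :: real^('k option)^('k option)) (l0 (z $ None))) = 1 \<and>
      dim (eigenspace (diagonal_shape (l0 (z $ None)) (l1 (z $ None)) :: real^('k option)^('k option)) (l1 (z $ None))) = CARD('k option) - 1"
    by (simp add: card_UNIV_option)
qed

end

section \<open>First family: models over an affine hypersphere\<close>

locale hypersphere_form =
  fixes I :: "real set" and \<Omega> :: "(real^'k::finite) set" and G :: "real^'k \<Rightarrow> real^('k option)" and a N r :: real
  assumes openI: "open I" and Ipos: "I \<subseteq> {0<..}" and open\<Omega>: "open \<Omega>" and smoothG: "smooth_on \<Omega> G"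
    and a0: "a \<noteq> 0" and N0: "N \<noteq> 0" and r0: "r \<noteq> 0"
begin

sublocale product_model I \<Omega> G "\<lambda>_. 0" "\<lambda>t. t powr N / N" "\<lambda>t. t powr (N - 1)" "\<lambda>t. (N - 1) * t powr (N - 2)" a N r
proof
  have p: "smooth_on I (\<lambda>t. t powr b)" for b
    by (rule smooth_on_powr[OF openI smooth_on_ident[OF openI]]) (use Ipos in auto)
  show "smooth_on I (\<lambda>t. t powr (N - 1))" by (rule p)
  show "smooth_on I (\<lambda>t. t powr N / N)"
    using smooth_on_mult[OF openI p smooth_on_const[of I "1 / N"]] by simp
  fix t assume "t \<in> I"
  then have t: "t > 0" using Ipos by auto
  show "((\<lambda>t. t powr N / N) has_real_derivative t powr (N - 1)) (at t)"
    using t N0 by (auto intro!: derivative_eq_intros)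
  show "((\<lambda>t. t powr (N - 1)) has_real_derivative (N - 1) * t powr (N - 2)) (at t)"
    using t by (auto intro!: derivative_eq_intros)
  show "t\<^sup>2 * ((N - 1) * t powr (N - 2)) = (a + N - 1) * (t * t powr (N - 1)) - a * N * (t powr N / N)"
    using t N0 by (simp add: powr_diff field_simps)
qed (use smooth_on_const openI Ipos open\<Omega> smoothG a0 N0 r0 in auto)

lemma \<delta>_eq: "0 < t \<Longrightarrow> \<delta> t = t powr N * (1 - a / N)"
  unfolding \<delta>_def by (simp add: powr_diff field_simps)

lemma f_eq: "f z = hypersphere_model (- a / 2) N G (z $ None, rest_coords z)"
  unfolding f_def H_def e_def by (simp add: hypersphere_model_def append_coord_add append_coord_scaleR)

end

text \<open>Kept apart from \<open>hypersphere_form\<close> because in the classification the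
  nondegeneracy of the frame of \<open>G\<close> is itself deduced from the determinant formula
  available there.\<close>

locale hypersphere_chart = hypersphere_form I \<Omega> G a N r
  for I :: "real set" and \<Omega> :: "(real^'k::finite) set" and G a N r +
  assumes aN: "a \<noteq> N" and frameG: "\<And>u. u \<in> \<Omega> \<Longrightarrow> det (frame G G u) \<noteq> 0"
begin

lemma det_frame_hypersphere:
  assumes z: "z \<in> V"
  shows "\<bar>det (frame f \<xi> z)\<bar> = \<bar>1 - a / N\<bar> / \<bar>r\<bar> * z $ None powr (N + a * (CARD('k) + 1) - 3) * \<bar>det (frame G G (rest_coords z))\<bar>"
proof -
  let ?t = "z $ None"
  have t: "?t > 0" using V_D[OF z] by auto
  have "(?t powr a) ^ (CARD('k) + 1) = ?t powr (a * (CARD('k) + 1))"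
    by (subst powr_realpow[symmetric]) (use t in \<open>simp_all add: powr_powr add.commute\<close>)
  moreover have "?t powr N * ?t powr (a * (CARD('k) + 1)) / ?t ^ 3 = ?t powr (N + a * (CARD('k) + 1) - 3)"
    using t by (simp add: powr_add powr_diff)
  ultimately show ?thesis
    unfolding det_frame_model[OF z] \<delta>_eq[OF t] using t
    by (simp add: abs_mult mult_ac divide_simps)
qed

text \<open>The Gauss formula of \<open>G\<close> for its position vector as transversal field,
  padded by a zero in the additional component.\<close>

lemma H2:
  assumes u: "u \<in> \<Omega>"
  shows "partial i (partial j H) u = affine_metric G G u $ i $ j *\<^sub>R H u +
    frechet_derivative H (at u) (rest_coords (frame_coeff G G u (partial i (partial j G) u))) + 0 *\<^sub>R e"
proof -
  have Gd: "G differentiable at x" if "x \<in> \<Omega>" for x using smooth_on_differentiable[OF smoothG that] .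
  have D: "frechet_derivative (\<lambda>x. append_coord (F x) 0) (at x) X = append_coord (frechet_derivative F (at x) X) 0"
    if "F differentiable at x" for F :: "real^'k \<Rightarrow> real^('k option)" and x X
    using frechet_derivative_eqI[OF bounded_linear.has_derivative[OF bounded_linear_append_coord_left that[unfolded frechet_derivative_works]]]
    by simp
  have 1: "partial j H x = append_coord (partial j G x) 0" if "x \<in> \<Omega>" for x
    unfolding H_def[abs_def] partial_def D[OF Gd[OF that]] ..
  have "partial i (partial j H) u = partial i (\<lambda>x. append_coord (partial j G x) 0) u"
    by (rule partial_cong[OF open\<Omega> u 1])
  also have "\<dots> = append_coord (partial i (partial j G) u) 0"
    unfolding partial_def[of i] by (rule D[OF smooth_on_differentiable[OF smooth_on_partial[OF smoothG] u]])
  also have "\<dots> = append_coord (affine_metric G G u $ i $ j *\<^sub>R G u + frechet_derivative G (at u) (rest_coords (frame_coeff G G u (partial i (partial j G) u)))) 0"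
    using frame_coeff_expand[OF Gd[OF u] frameG[OF u], of "partial i (partial j G) u"] by (simp add: affine_metric_def)
  finally show ?thesis
    unfolding H_def[abs_def] D[OF Gd[OF u]] by (simp add: append_coord_add append_coord_scaleR)
qed

lemma det_frame_hypersphere_nz: "z \<in> V \<Longrightarrow> det (frame f \<xi> z) \<noteq> 0"
  using det_frame_hypersphere[of z] V_D[of z] frameG[of "rest_coords z"] nz aN by (auto simp: field_simps)

lemma metric_hypersphere:
  assumes z: "z \<in> V"
  shows "affine_metric f \<xi> z = block_metric (- a * N * r)
    (\<chi> i j. (r * N / (N - a) * (z $ None)\<^sup>2) * affine_metric G G (rest_coords z) $ i $ j)"
proof -
  let ?t = "z $ None"
  have t: "?t > 0" "rest_coords z \<in> \<Omega>" using V_D[OF z] by auto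
  have \<delta>: "\<delta> ?t \<noteq> 0" unfolding \<delta>_eq[OF t(1)] using t nz aN by (simp add: field_simps)
  note m = z \<delta> frameG[OF t(2)] H2[OF t(2)]
  show ?thesis
  proof (rule block_metricI)
    show "affine_metric f \<xi> z $ None $ None = - a * N * r" by (rule metric_model_None[OF m])
    show "affine_metric f \<xi> z $ Some i $ None = 0" "affine_metric f \<xi> z $ None $ Some i = 0" for i
      by (rule metric_model_mixed[OF m])+
    show "affine_metric f \<xi> z $ Some i $ Some j =
      (\<chi> i j. (r * N / (N - a) * (z $ None)\<^sup>2) * affine_metric G G (rest_coords z) $ i $ j) $ i $ j" for i j
      unfolding metric_model_Some[OF m] \<delta>_eq[OF t(1)] using t nz aN by (simp add: powr_diff divide_simps) 
  qed
qed

lemma det_metric_hypersphere: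
  assumes z: "z \<in> V"
  shows "sqrt \<bar>det (affine_metric f \<xi> z)\<bar> = z $ None ^ CARD('k) *
    sqrt (\<bar>a * N * r\<bar> * \<bar>r * N / (N - a)\<bar> ^ CARD('k) * \<bar>det (affine_metric G G (rest_coords z))\<bar>)"
proof -
  have t: "z $ None > 0" using V_D[OF z] by auto
  have "\<bar>det (affine_metric f \<xi> z)\<bar> = (z $ None ^ CARD('k))\<^sup>2 *
    (\<bar>a * N * r\<bar> * \<bar>r * N / (N - a)\<bar> ^ CARD('k) * \<bar>det (affine_metric G G (rest_coords z))\<bar>)"
    unfolding metric_hypersphere[OF z] det_block_metric det_cmult
    using t by (simp add: abs_mult power_mult_distrib power_divide power_abs mult_ac flip: power_mult)
  then show ?thesis using t by (simp add: real_sqrt_mult)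
qed

lemma congruent_patch_hypersphere:
  assumes L: "det L \<noteq> 0" and N2: "N \<noteq> 2" and vol_exp: "N + a * (CARD('k) + 1) = CARD('k) + 3"
    and r: "a * N * r < 0"
    and pos: "\<And>u. u \<in> \<Omega> \<Longrightarrow> positive_definite (\<chi> i j. r * N / (N - a) * affine_metric G G u $ i $ j)"
    and vol: "\<And>u. u \<in> \<Omega> \<Longrightarrow> \<bar>det L\<bar> * \<bar>1 - a / N\<bar> / \<bar>r\<bar> * \<bar>det (frame G G u)\<bar> =
      sqrt (\<bar>a * N * r\<bar> * \<bar>r * N / (N - a)\<bar> ^ CARD('k) * \<bar>det (affine_metric G G u)\<bar>)"
  shows "congruent_patch V (\<lambda>z. L *v f z) (\<lambda>z. L *v \<xi> z) (L ** diagonal_shape (2 / a) (2 / N) ** matrix_inv L)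
    (\<lambda>z. l0 (z $ None)) (\<lambda>z. l1 (z $ None))"
proof (rule congruent_patch_model[OF L])
  show "det (diagonal_shape (2 / a) (2 / N) :: real^('k option option)^('k option option)) \<noteq> 0"
    using nz by (simp add: det_diagonal_shape)
  show "N \<noteq> 2" by fact
  fix z assume z: "z \<in> V"
  have t: "z $ None > 0" "rest_coords z \<in> \<Omega>" using V_D[OF z] by auto
  \<comment> \<open>The operator \<open>2 \<theta> / (a N)\<close> multiplies \<open>t^a\<close> by
    \<open>2 / N\<close> and \<open>t^N\<close> by \<open>2 / a\<close>, so the centre map is a
    diagonal image of \<open>f\<close>.\<close>
  show "(2 * z $ None / (a * N)) *\<^sub>R ft z = diagonal_shape (2 / a) (2 / N) *v f z"
    unfolding diagonal_shape_mult ft_def f_def H_def e_def using t nz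
    by (simp add: append_coord_scaleR append_coord_add powr_diff field_simps)
  show "det (frame f \<xi> z) \<noteq> 0" by (rule det_frame_hypersphere_nz[OF z])
  have t2: "0 < (z $ None)\<^sup>2" using t by simp
  have eq: "(\<chi> i j. r * N / (N - a) * (z $ None)\<^sup>2 * affine_metric G G (rest_coords z) $ i $ j) =
     (\<chi> i j. (z $ None)\<^sup>2 * (\<chi> i j. r * N / (N - a) * affine_metric G G (rest_coords z) $ i $ j) $ i $ j)"
    by (simp add: vec_eq_iff mult_ac)
  show "positive_definite (affine_metric f \<xi> z)"
    unfolding metric_hypersphere[OF z] positive_definite_block_metric eq positive_definite_cmult[OF t2]
    by (rule conjI[OF _ pos[OF t(2)]]) (use r in simp)
  \<comment> \<open>Both volumes now carry the same power of t, and what is left of the volume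
    condition is \<open>vol\<close> on \<open>\<Omega>\<close>.\<close>
  have "N + a * (CARD('k) + 1) - 3 = CARD('k)" using vol_exp by simp
  then have "\<bar>det (frame f \<xi> z)\<bar> = \<bar>1 - a / N\<bar> / \<bar>r\<bar> * z $ None ^ CARD('k) * \<bar>det (frame G G (rest_coords z))\<bar>"
    unfolding det_frame_hypersphere[OF z] using t by (simp add: powr_realpow)
  then show "\<bar>det L\<bar> * \<bar>det (frame f \<xi> z)\<bar> = sqrt \<bar>det (affine_metric f \<xi> z)\<bar>"
    unfolding det_metric_hypersphere[OF z] vol[OF t(2), symmetric] by (simp add: mult_ac)
qed

end

section \<open>Second family: models over a solution of the Monge-Ampere equation\<close>

locale monge_ampere_chart =
  fixes I :: "real set" and \<Omega> :: "(real^'k::finite) set" and F :: "real^'k \<Rightarrow> real" and a \<phi>0 r :: real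
  assumes openI: "open I" and Ipos: "I \<subseteq> {0<..}" and open\<Omega>: "open \<Omega>" and smoothF: "smooth_on \<Omega> F"
    and a0: "a \<noteq> 0" and r0: "r \<noteq> 0" and \<phi>0: "\<phi>0 \<noteq> 0"
begin

text \<open>For \<open>N = a\<close> the equation for \<open>B\<close> has a double root and admits
  \<open>t^a ln t\<close>; multiples of \<open>t^a\<close> can be absorbed into \<open>F\<close>.
  The factor \<open>1 / a\<close> of the logarithm is the \<open>- 1 / (2 K1)\<close> of the model,
  as \<open>a = - 2 K1\<close>.\<close>

sublocale product_model I \<Omega> "\<lambda>u. append_coord u 1" "\<lambda>u. \<phi>0 * F u" "\<lambda>t. \<phi>0 / a * (t powr a * ln t)"
  "\<lambda>t. \<phi>0 / a * (a * (t powr (a - 1) * ln t) + t powr (a - 1))"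
  "\<lambda>t. \<phi>0 / a * (a * (a - 1) * t powr (a - 2) * ln t + (2 * a - 1) * t powr (a - 2))" a a r
proof
  have p: "smooth_on I (\<lambda>t. t powr b)" for b
    by (rule smooth_on_powr[OF openI smooth_on_ident[OF openI]]) (use Ipos in auto)
  have l: "smooth_on I ln"
    by (rule smooth_on_ln[OF openI smooth_on_ident[OF openI]]) (use Ipos in auto)
  show "smooth_on I (\<lambda>t. \<phi>0 / a * (t powr a * ln t))"
    by (intro smooth_on_mult smooth_on_const p l openI)
  show "smooth_on I (\<lambda>t. \<phi>0 / a * (a * (t powr (a - 1) * ln t) + t powr (a - 1)))"
    by (intro smooth_on_mult smooth_on_add smooth_on_const p l openI)
  show "smooth_on \<Omega> (\<lambda>u. append_coord u 1)" "smooth_on \<Omega> (\<lambda>u. \<phi>0 * F u)"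
    by (intro smooth_on_append_coord smooth_on_mult smooth_on_ident smooth_on_const open\<Omega> smoothF)+
  fix t assume "t \<in> I"
  then have t: "t > 0" using Ipos by auto
  show "((\<lambda>t. \<phi>0 / a * (t powr a * ln t)) has_real_derivative \<phi>0 / a * (a * (t powr (a - 1) * ln t) + t powr (a - 1))) (at t)"
    using t a0 by (auto intro!: derivative_eq_intros simp: powr_diff field_simps)
  show "((\<lambda>t. \<phi>0 / a * (a * (t powr (a - 1) * ln t) + t powr (a - 1))) has_real_derivative
      \<phi>0 / a * (a * (a - 1) * t powr (a - 2) * ln t + (2 * a - 1) * t powr (a - 2))) (at t)"
  proof -
    have P: "((\<lambda>t. t powr b) has_real_derivative b * t powr (b - 1)) (at t)" for b
      using t by (auto intro!: derivative_eq_intros)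
    have l: "(ln has_real_derivative inverse t) (at t)" using t by (auto intro!: derivative_eq_intros simp: inverse_eq_divide)
    have p2: "t powr (a - 1 - 1) = t powr (a - 2)" "inverse t * t powr (a - 1) = t powr (a - 2)"
      using t by (simp_all add: powr_diff power2_eq_square field_simps)
    show ?thesis
      by (rule DERIV_cong[OF DERIV_cmult[OF DERIV_add[OF DERIV_cmult[OF DERIV_mult[OF P l]] P]]])
        (simp only: p2, simp add: algebra_simps)
  qed
  show "t\<^sup>2 * (\<phi>0 / a * (a * (a - 1) * t powr (a - 2) * ln t + (2 * a - 1) * t powr (a - 2))) =
      (a + a - 1) * (t * (\<phi>0 / a * (a * (t powr (a - 1) * ln t) + t powr (a - 1)))) - a * a * (\<phi>0 / a * (t powr a * ln t))"
    using t a0 by (simp add: powr_diff field_simps power2_eq_square)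
qed (use openI Ipos open\<Omega> a0 r0 in auto)

lemma \<delta>_eq: "0 < t \<Longrightarrow> \<delta> t = \<phi>0 / a * t powr a"
  unfolding \<delta>_def using nz by (simp add: powr_diff field_simps)

lemma f_eq: "f z = monge_ampere_model (- a / 2) \<phi>0 F (z $ None, rest_coords z)"
  unfolding f_def H_def e_def using a0 by (simp add: monge_ampere_model_def append_coord_add append_coord_scaleR field_simps)

lemma frame_affine: "det (frame (\<lambda>u. append_coord u 1) (\<lambda>u. append_coord u 1) (u :: real^'k)) = 1"
proof -
  have D: "((\<lambda>u::real^'k. append_coord u 1) has_derivative (\<lambda>X. append_coord X 0)) (at u)"
    by (rule has_derivative_append_coord) (auto intro!: derivative_eq_intros)
  let ?M = "frame (\<lambda>u. append_coord u 1) (\<lambda>u. append_coord u 1) u"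
  have "det ?M = ?M $ None $ None * det (\<chi> i j. ?M $ Some i $ Some j)"
    by (rule det_option_col) (simp add: partial_eqI[OF D])
  also have "(\<chi> i j. ?M $ Some i $ Some j) = mat 1"
    by (simp add: vec_eq_iff partial_eqI[OF D] mat_def axis_def)
  finally show ?thesis by simp
qed

lemma det_frame_monge_ampere:
  assumes z: "z \<in> V"
  shows "\<bar>det (frame f \<xi> z)\<bar> = \<bar>\<phi>0 / a\<bar> / \<bar>r\<bar> * z $ None powr (a * (CARD('k) + 2) - 3)"
proof -
  let ?t = "z $ None"
  have t: "?t > 0" using V_D[OF z] by auto
  have "(?t powr a) ^ (CARD('k) + 1) = ?t powr (a * (CARD('k) + 1))"
    by (subst powr_realpow[symmetric]) (use t in \<open>simp_all add: powr_powr add.commute\<close>)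
  moreover have "?t powr a * ?t powr (a * (CARD('k) + 1)) / ?t ^ 3 = ?t powr (a * (CARD('k) + 2) - 3)"
    using t by (simp add: powr_diff powr_add[symmetric] algebra_simps)
  ultimately show ?thesis
    unfolding det_frame_model[OF z] \<delta>_eq[OF t] frame_affine using t
    by (simp add: abs_mult mult_ac divide_simps)
qed

text \<open>\<open>H\<close> is a graph over the affine hyperplane of the vectors
  \<open>append_coord u 1\<close>, so its second derivatives are vertical.\<close>

lemma H2:
  assumes u: "u \<in> \<Omega>"
  shows "partial i (partial j H) u = 0 *\<^sub>R H u + frechet_derivative H (at u) 0 + (\<phi>0 * hessian F u $ i $ j) *\<^sub>R e"
proof -
  have Fd: "F differentiable at x" if "x \<in> \<Omega>" for x using smooth_on_differentiable[OF smoothF that] .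
  have D1: "((\<lambda>u::real^'k. append_coord u 1) has_derivative (\<lambda>X. append_coord X 0)) (at x)" for x
    by (rule has_derivative_append_coord) (auto intro!: derivative_eq_intros)
  have D: "(H has_derivative (\<lambda>X. append_coord (append_coord X 0) (\<phi>0 * frechet_derivative F (at x) X))) (at x)" if "x \<in> \<Omega>" for x
    unfolding H_def[abs_def]
    by (rule has_derivative_append_coord[OF D1])
      (intro has_derivative_mult_right Fd[OF that, unfolded frechet_derivative_works])
  have "H differentiable at u" using D[OF u] by (rule differentiableI)
  then have lin: "linear (frechet_derivative H (at u))" by (rule linear_frechet_derivative)
  have "partial i (partial j H) u = partial i (\<lambda>x. append_coord (append_coord (axis j 1) 0) (\<phi>0 * partial j F x)) u"
  proof (rule partial_cong[OF open\<Omega> u])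
    fix x assume x: "x \<in> \<Omega>"
    show "partial j H x = append_coord (append_coord (axis j 1) 0) (\<phi>0 * partial j F x)"
      unfolding partial_eqI[OF D[OF x]] partial_def[of j F] ..
  qed
  also have "\<dots> = append_coord 0 (\<phi>0 * partial i (partial j F) u)"
  proof (rule partial_eqI[THEN trans])
    show "((\<lambda>x. append_coord (append_coord (axis j 1) 0) (\<phi>0 * partial j F x)) has_derivative
       (\<lambda>X. append_coord 0 (\<phi>0 * frechet_derivative (partial j F) (at u) X))) (at u)"
      by (intro has_derivative_append_coord has_derivative_const has_derivative_mult_right
          smooth_on_has_derivative[OF smooth_on_partial[OF smoothF] u])
  qed (simp add: partial_def)
  finally show ?thesis
    by (simp add: linear_0[OF lin] hessian_def e_def append_coord_scaleR)
qed

lemma metric_monge_ampere: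
  assumes z: "z \<in> V"
  shows "det (frame f \<xi> z) \<noteq> 0"
    and "affine_metric f \<xi> z = block_metric (- a * a * r)
    (\<chi> i j. (- a * a * r * (z $ None)\<^sup>2) * hessian F (rest_coords z) $ i $ j)"
proof -
  let ?t = "z $ None"
  have t: "?t > 0" "rest_coords z \<in> \<Omega>" using V_D[OF z] by auto
  have \<delta>: "\<delta> ?t \<noteq> 0" unfolding \<delta>_eq[OF t(1)] using t nz \<phi>0 by simp
  have fr: "det (frame (\<lambda>u. append_coord u 1) (\<lambda>u. append_coord u 1) (rest_coords z)) \<noteq> 0"
    unfolding frame_affine by simp
  note m = z \<delta> fr H2[OF t(2)]
  show "det (frame f \<xi> z) \<noteq> 0" by (rule det_frame_model_nz[OF m])
  show "affine_metric f \<xi> z = block_metric (- a * a * r)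
    (\<chi> i j. (- a * a * r * (z $ None)\<^sup>2) * hessian F (rest_coords z) $ i $ j)"
  proof (rule block_metricI)
    show "affine_metric f \<xi> z $ None $ None = - a * a * r" by (rule metric_model_None[OF m])
    show "affine_metric f \<xi> z $ Some i $ None = 0" "affine_metric f \<xi> z $ None $ Some i = 0" for i
      by (rule metric_model_mixed[OF m])+
    show "affine_metric f \<xi> z $ Some i $ Some j =
      (\<chi> i j. (- a * a * r * (z $ None)\<^sup>2) * hessian F (rest_coords z) $ i $ j) $ i $ j" for i j
      unfolding metric_model_Some[OF m] \<delta>_eq[OF t(1)] using t nz \<phi>0 by (simp add: divide_simps)
  qed
qed

lemma det_metric_monge_ampere:
  assumes z: "z \<in> V"
  shows "sqrt \<bar>det (affine_metric f \<xi> z)\<bar> = z $ None ^ CARD('k) *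
    sqrt (\<bar>a * a * r\<bar> ^ (CARD('k) + 1) * \<bar>det (hessian F (rest_coords z))\<bar>)"
proof -
  have t: "z $ None > 0" using V_D[OF z] by auto
  have "\<bar>det (affine_metric f \<xi> z)\<bar> = (z $ None ^ CARD('k))\<^sup>2 *
    (\<bar>a * a * r\<bar> ^ (CARD('k) + 1) * \<bar>det (hessian F (rest_coords z))\<bar>)"
    unfolding metric_monge_ampere(2)[OF z] det_block_metric det_cmult
    using t by (simp add: abs_mult power_mult_distrib power_divide power_abs mult_ac flip: power_mult)
  then show ?thesis using t by (simp add: real_sqrt_mult)
qed

text \<open>The action of \<open>2 \<theta> / a^2\<close> on \<open>t^a\<close> and
  \<open>t^a ln t\<close>: a Jordan block, whose nilpotent part sends the component
  \<open>Some None\<close>, which is the entry 1 of \<open>G\<close>, to the component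
  \<open>None\<close>.\<close>

definition T0 :: "real^('k option option)^('k option option)" where
  "T0 = (\<chi> x y. if x = y then 2 / a else if x = None \<and> y = Some None then 2 * \<phi>0 / a ^ 3 else 0)"

lemma T0_mult: "T0 *v w = (2 / a) *\<^sub>R w + (2 * \<phi>0 / a ^ 3 * w $ Some None) *\<^sub>R e"
  by (simp add: vec_eq_iff split_option_all T0_def matrix_vector_mult_def sum_UNIV_option e_def
      if_distrib[of "\<lambda>x. x * _"] cong: if_cong)

lemma det_T0: "det T0 \<noteq> 0"
proof -
  have "det T0 = T0 $ None $ None * det (\<chi> i j. T0 $ Some i $ Some j)"
    by (rule det_option_col) (simp add: T0_def)
  also have "(\<chi> i j. T0 $ Some i $ Some j) = (diagonal_shape (2 / a) (2 / a) :: real^('k option)^('k option))"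
    by (simp add: vec_eq_iff T0_def diagonal_shape_def)
  finally show ?thesis using nz by (simp add: det_diagonal_shape T0_def)
qed

lemma congruent_patch_monge_ampere:
  assumes L: "det L \<noteq> 0" and a2: "a \<noteq> 2" and vol_exp: "a * (CARD('k) + 2) = CARD('k) + 3"
    and r: "r < 0" and pos: "\<And>u. u \<in> \<Omega> \<Longrightarrow> positive_definite (hessian F u) \<and> det (hessian F u) = 1"
    and vol: "\<bar>det L\<bar> * \<bar>\<phi>0 / a\<bar> / \<bar>r\<bar> = sqrt (\<bar>a * a * r\<bar> ^ (CARD('k) + 1))"
  shows "congruent_patch V (\<lambda>z. L *v f z) (\<lambda>z. L *v \<xi> z) (L ** T0 ** matrix_inv L)
    (\<lambda>z. l0 (z $ None)) (\<lambda>z. l1 (z $ None))"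
proof (rule congruent_patch_model[OF L det_T0])
  show "a \<noteq> 2" by fact
  fix z assume z: "z \<in> V"
  have t: "z $ None > 0" "rest_coords z \<in> \<Omega>" using V_D[OF z] by auto
  have 1: "2 * z $ None / (a * a) * (a * z $ None powr (a - 1)) = 2 / a * z $ None powr a"
    using t nz by (simp add: powr_diff)
  show "(2 * z $ None / (a * a)) *\<^sub>R ft z = T0 *v f z"
  proof -
    have 2: "2 * z $ None / (a * a) * (\<phi>0 / a * (a * (z $ None powr (a - 1) * ln (z $ None)) + z $ None powr (a - 1))) =
       2 / a * (\<phi>0 / a * (z $ None powr a * ln (z $ None))) + 2 * \<phi>0 / a ^ 3 * z $ None powr a"
      using t nz by (simp add: powr_diff field_simps power3_eq_cube)
    have 3: "f z $ Some None = z $ None powr a" unfolding f_def H_def e_def by simp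
    show ?thesis unfolding T0_mult 3 unfolding ft_def f_def scaleR_add_right scaleR_scaleR 1 2
      by (simp add: scaleR_add_left)
  qed
  show "det (frame f \<xi> z) \<noteq> 0" by (rule metric_monge_ampere(1)[OF z])
  have "0 < - a * a * r" using r nz by (simp add: zero_less_mult_iff mult_less_0_iff) (metis not_square_less_zero linorder_neqE_linordered_idom)
  moreover then have "0 < - a * a * r * (z $ None)\<^sup>2" using t by (simp add: zero_less_mult_iff mult_less_0_iff)
  ultimately show "positive_definite (affine_metric f \<xi> z)"
    unfolding metric_monge_ampere(2)[OF z] positive_definite_block_metric
    using pos[OF t(2)] positive_definite_cmult by blast
  have "a * (CARD('k) + 2) - 3 = CARD('k)" using vol_exp by simp
  then have "\<bar>det (frame f \<xi> z)\<bar> = \<bar>\<phi>0 / a\<bar> / \<bar>r\<bar> * z $ None ^ CARD('k)"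
    unfolding det_frame_monge_ampere[OF z] using t by (simp add: powr_realpow)
  then show "\<bar>det L\<bar> * \<bar>det (frame f \<xi> z)\<bar> = sqrt \<bar>det (affine_metric f \<xi> z)\<bar>"
    unfolding det_metric_monge_ampere[OF z] pos[OF t(2), THEN conjunct2] abs_one mult_1_right vol[symmetric]
    by (simp only: ) (simp add: mult_ac)
qed

end

section \<open>Proper affine hyperspheres centred at the origin\<close>

context
  fixes G :: "real^'k::finite \<Rightarrow> real^('k option)" and u and c :: real
  assumes Gd: "G differentiable at u" and c: "c \<noteq> 0"
begin

lemma det_frame_scaled: "det (frame G (\<lambda>u. c *\<^sub>R G u) u) = c * det (frame G G u)"
  using det_frame_transversal[OF Gd, of "\<lambda>u. c *\<^sub>R G u" c G 0]
    linear_0[OF linear_frechet_derivative[OF Gd]] by simp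

lemma affine_metric_scaled:
  assumes "det (frame G G u) \<noteq> 0"
  shows "affine_metric G (\<lambda>u. c *\<^sub>R G u) u = (\<chi> i j. (1 / c) * affine_metric G G u $ i $ j)"
proof -
  have d: "det (frame G (\<lambda>u. c *\<^sub>R G u) u) \<noteq> 0" using det_frame_scaled assms c by simp
  have "frame_coeff G (\<lambda>u. c *\<^sub>R G u) u w =
     append_coord (rest_coords (frame_coeff G G u w)) ((1 / c) * frame_coeff G G u w $ None)" for w
    by (rule frame_coeff_eqI[OF Gd d]) (use frame_coeff_expand[OF Gd assms, of w] c in simp)
  then show ?thesis by (simp add: affine_metric_def vec_eq_iff)
qed

end

text \<open>A proper hypersphere centred at the origin has a multiple of the position vector as
  affine normal. Its data are rewritten in terms of the centroaffine frame and metric, in which the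
  product model is expressed.\<close>

lemma affine_normal_hypersphere:
  assumes \<Omega>: "open \<Omega>" and an: "affine_normal_on \<Omega> G \<eta>" and \<eta>': "\<forall>u\<in>\<Omega>. \<eta> u = (- \<mu>) *\<^sub>R G u" and \<mu>: "\<mu> \<noteq> 0"
    and u: "u \<in> \<Omega>"
  shows "smooth_on \<Omega> G" "det (frame G G u) \<noteq> 0"
    "affine_metric G G u = (\<chi> i j. (- \<mu>) * affine_metric G \<eta> u $ i $ j)"
    "\<bar>\<mu>\<bar> * \<bar>det (frame G G u)\<bar> = sqrt \<bar>det (affine_metric G \<eta> u)\<bar>"
proof -
  note \<eta> = bspec[OF \<eta>']
  show G: "smooth_on \<Omega> G" using an by (simp add: affine_normal_on_def immersion_on_def)
  have Gd: "G differentiable at u" by (rule smooth_on_differentiable[OF G u])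
  have f: "frame G \<eta> u = frame G (\<lambda>u. (- \<mu>) *\<^sub>R G u) u" by (rule frame_cong[OF \<Omega> u]) (simp_all only: \<eta>)
  have m: "affine_metric G \<eta> u = affine_metric G (\<lambda>u. (- \<mu>) *\<^sub>R G u) u" by (rule affine_metric_cong[OF \<Omega> u]) (simp_all only: \<eta>)
  have "det (frame G \<eta> u) \<noteq> 0"
    by (rule det_frame_nz[OF _ _ u]) (use an in \<open>auto simp: affine_normal_on_def\<close>)
  moreover have d: "det (frame G \<eta> u) = - \<mu> * det (frame G G u)"
    unfolding f using det_frame_scaled[OF Gd, of "- \<mu>"] \<mu> by simp
  ultimately show nz: "det (frame G G u) \<noteq> 0" by auto
  show "affine_metric G G u = (\<chi> i j. (- \<mu>) * affine_metric G \<eta> u $ i $ j)"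
    unfolding m using affine_metric_scaled[OF Gd _ nz, of "- \<mu>"] \<mu> by (simp add: vec_eq_iff)
  show "\<bar>\<mu>\<bar> * \<bar>det (frame G G u)\<bar> = sqrt \<bar>det (affine_metric G \<eta> u)\<bar>"
  proof -
    have "\<bar>\<mu>\<bar> * \<bar>det (frame G G u)\<bar> = \<bar>det (frame G \<eta> u)\<bar>" unfolding d by (simp add: abs_mult)
    also have "\<dots> = sqrt \<bar>det (affine_metric G \<eta> u)\<bar>" using an u by (simp add: affine_normal_on_def)
    finally show ?thesis .
  qed
qed

text \<open>The opposite translation, with \<open>- \<mu>\<close> times the position vector as
  affine normal. \<open>vol\<close> is its volume normalization in centroaffine terms: the frame is
  scaled by \<open>\<mu>\<close> in one row, the metric by \<open>1 / \<mu>\<close> in all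
  \<open>CARD('k)\<close> rows, up to sign.\<close>

lemma adapted_hypersphereI:
  fixes G :: "real^'k::finite \<Rightarrow> real^('k option)"
  assumes \<Omega>: "open \<Omega>" and G: "smooth_on \<Omega> G" and \<mu>: "\<mu> \<noteq> 0"
    and nz: "\<And>u. u \<in> \<Omega> \<Longrightarrow> det (frame G G u) \<noteq> 0"
    and pos: "\<And>u. u \<in> \<Omega> \<Longrightarrow> positive_definite (\<chi> i j. (- 1 / \<mu>) * affine_metric G G u $ i $ j)"
    and vol: "\<And>u. u \<in> \<Omega> \<Longrightarrow> \<bar>\<mu>\<bar> * \<bar>det (frame G G u)\<bar> = sqrt (\<bar>1 / \<mu>\<bar> ^ CARD('k) * \<bar>det (affine_metric G G u)\<bar>)"
    and sgn: "\<mu> * l1 * ((real CARD('k option) + 2) * l0 + real CARD('k option) * l1) < 0"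
  shows "adapted_hypersphere l0 l1 (top_of_set \<Omega>) (domain_atlas \<Omega>) G"
proof -
  let ?\<eta> = "\<lambda>u. (- \<mu>) *\<^sub>R G u"
  let ?g = "local_rep (\<Omega>, id) G" and ?e = "local_rep (\<Omega>, id) ?\<eta>"
  have \<mu>': "- \<mu> \<noteq> 0" using \<mu> by simp
  have Gd: "G differentiable at u" if "u \<in> \<Omega>" for u by (rule smooth_on_differentiable[OF G that])
  have \<eta>s: "smooth_on \<Omega> ?\<eta>" by (intro smooth_on_scaleR \<Omega> smooth_on_const G)
  have \<eta>d: "?\<eta> differentiable at u" if "u \<in> \<Omega>" for u by (rule smooth_on_differentiable[OF \<eta>s that])
  have d: "det (frame G ?\<eta> u) = - \<mu> * det (frame G G u)" if "u \<in> \<Omega>" for u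
    by (rule det_frame_scaled[OF Gd[OF that] \<mu>'])
  have dnz: "det (frame G ?\<eta> u) \<noteq> 0" if "u \<in> \<Omega>" for u using d[OF that] nz[OF that] \<mu> by simp
  have m: "affine_metric G ?\<eta> u = (\<chi> i j. (- 1 / \<mu>) * affine_metric G G u $ i $ j)" if "u \<in> \<Omega>" for u
    using affine_metric_scaled[OF Gd[OF that] \<mu>' nz[OF that]] by simp
  have D\<eta>: "frechet_derivative ?\<eta> (at u) X = - frechet_derivative G (at u) (mat \<mu> *v X)" if "u \<in> \<Omega>" for u X
  proof -
    have lin: "linear (frechet_derivative G (at u))" by (rule linear_frechet_derivative[OF Gd[OF that]])
    have "mat \<mu> *v X = \<mu> *\<^sub>R X"
      by (simp add: vec_eq_iff mat_def matrix_vector_mult_def if_distrib[of "\<lambda>x. x * _"] cong: if_cong)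
    moreover have "frechet_derivative ?\<eta> (at u) = (\<lambda>X. (- \<mu>) *\<^sub>R frechet_derivative G (at u) X)"
      by (intro frechet_derivative_eqI has_derivative_scaleR_right Gd[OF that, unfolded frechet_derivative_works])
    ultimately show ?thesis by (simp add: linear_cmul[OF lin])
  qed
  have fr: "inj (frechet_derivative G (at u)) \<and> ?\<eta> u \<notin> range (frechet_derivative G (at u))" if "u \<in> \<Omega>" for u
    by (rule iffD1[OF det_frame_nz_iff[OF Gd[OF that]] dnz[OF that]])
  have volume: "\<bar>det (frame G ?\<eta> u)\<bar> = sqrt \<bar>det (affine_metric G ?\<eta> u)\<bar>" if "u \<in> \<Omega>" for u
    unfolding d[OF that] m[OF that] det_cmult using vol[OF that] by (simp add: abs_mult power_abs power_divide)
  have eqa: "frame_coeff G ?\<eta> u (partial i ?\<eta> u) $ None = 0" and sh: "shape_operator G ?\<eta> u = mat \<mu>" if "u \<in> \<Omega>" for u i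
    by (rule shape_operator_eqI[OF Gd[OF that] \<eta>d[OF that] dnz[OF that] D\<eta>[OF that]])+
  have an: "affine_normal_on \<Omega> G ?\<eta>"
    unfolding affine_normal_on_def immersion_on_def transversal_on_def
    using G \<eta>s fr eqa volume positive_definite_det_nz[OF pos] m by auto
  have rg: "G u = ?g u" and re: "?\<eta> u = ?e u" if "u \<in> \<Omega>" for u using local_rep_domain[OF that] by metis+
  have "affine_normal_on \<Omega> ?g ?e" by (rule affine_normal_on_cong[OF \<Omega> _ _ an], erule rg, erule re)
  moreover have "shape_operator ?g ?e u = mat \<mu>" if "u \<in> \<Omega>" for u
    by (rule trans[OF shape_operator_cong[OF \<Omega> that, symmetric] sh[OF that]], erule rg, erule re)
  moreover have "affine_metric ?g ?e u = (\<chi> i j. (- 1 / \<mu>) * affine_metric G G u $ i $ j)" if "u \<in> \<Omega>" for u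
    by (rule trans[OF affine_metric_cong[OF \<Omega> that, symmetric] m[OF that]], erule rg, erule re)
  moreover have "chart_image (\<Omega>, id) = \<Omega>" by (simp add: chart_image_def)
  ultimately have "proper_affine_hypersphere (top_of_set \<Omega>) (domain_atlas \<Omega>) G ?\<eta> \<mu>"
    "positive_blaschke_metric (domain_atlas \<Omega>) G ?\<eta>"
    using oriented_manifold_domain_atlas[OF \<Omega>] \<mu> pos
    by (simp_all add: proper_affine_hypersphere_def blaschke_immersion_def positive_blaschke_metric_def domain_atlas_def)
  moreover have "\<forall>q\<in>topspace (top_of_set \<Omega>). G q + (1 / \<mu>) *\<^sub>R ?\<eta> q = 0" using \<mu> by simp
  ultimately show ?thesis
    unfolding adapted_hypersphere_def Let_def using sgn by blast
qed

text \<open>The bordered matrix \<open>M\<close> with corner 1 is reduced in two ways,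
  \<open>P\<close> clearing its column \<open>None\<close> and \<open>Q\<close> its row
  \<open>None\<close>. Both sides are the resulting Schur complements.\<close>

lemma det_identity_minus_rank_one:
  fixes u :: "real^'k::finite"
  shows "det (\<chi> i j. (if i = j then 1 else 0) - \<kappa> * u $ i * u $ j) = 1 - \<kappa> * (u \<bullet> u)"
proof -
  define M :: "real^('k option)^('k option)" where
    "M = (\<chi> a. case a of None \<Rightarrow> append_coord (\<kappa> *\<^sub>R u) 1 | Some i \<Rightarrow> append_coord (axis i 1) (u $ i))"
  define P :: "real^('k option)^('k option)" where
    "P = (\<chi> a. case a of None \<Rightarrow> append_coord 0 1 | Some i \<Rightarrow> append_coord (axis i 1) (- u $ i))"
  define Q :: "real^('k option)^('k option)" where
    "Q = (\<chi> a. case a of None \<Rightarrow> append_coord (- \<kappa> *\<^sub>R u) 1 | Some i \<Rightarrow> append_coord (axis i 1) 0)"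
  have mat1: "(\<chi> i. axis i 1) = (mat 1 :: real^'k^'k)" by (simp add: vec_eq_iff mat_def axis_def)
  have sum1: "(\<Sum>k\<in>UNIV. axis i 1 $ k * g k) = g i" for i :: 'k and g :: "'k \<Rightarrow> real"
    by (simp add: axis_def if_distrib[of "\<lambda>x. x * _"] cong: if_cong)
  have sum2: "(\<Sum>k\<in>UNIV. g k * axis k 1 $ i) = g i" for i :: 'k and g :: "'k \<Rightarrow> real"
    by (simp add: axis_def if_distrib[of "\<lambda>x. _ * x"] cong: if_cong)
  have "det P = 1" by (subst det_option_row) (simp_all add: P_def mat1)
  moreover have "det (P ** M) = det (\<chi> i j. (if i = j then 1 else 0) - \<kappa> * u $ i * u $ j)"
  proof (subst det_option_col)
    show "(P ** M) $ Some i $ None = 0" for i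
      by (simp add: P_def M_def matrix_matrix_mult_def sum_UNIV_option sum1)
    have "(P ** M) $ None $ None = 1"
      by (simp add: P_def M_def matrix_matrix_mult_def sum_UNIV_option)
    moreover have "(P ** M) $ Some i $ Some j = (if i = j then 1 else 0) - \<kappa> * u $ i * u $ j" for i j
      by (simp add: P_def M_def matrix_matrix_mult_def sum_UNIV_option sum1) (simp add: axis_def)
    ultimately show "(P ** M) $ None $ None * det (\<chi> i j. (P ** M) $ Some i $ Some j) =
       det (\<chi> i j. (if i = j then 1 else 0) - \<kappa> * u $ i * u $ j)" by simp
  qed
  moreover have "det Q = 1" by (subst det_option_col) (simp_all add: Q_def mat1)
  moreover have "det (Q ** M) = 1 - \<kappa> * (u \<bullet> u)"
  proof (subst det_option_row)
    show "(Q ** M) $ None $ Some j = 0" for j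
      by (simp add: Q_def M_def matrix_matrix_mult_def sum_UNIV_option sum_negf sum2)
    have "(Q ** M) $ None $ None = 1 - \<kappa> * (u \<bullet> u)"
      by (simp add: Q_def M_def matrix_matrix_mult_def sum_UNIV_option sum_negf inner_vec_def sum_distrib_left mult.assoc)
    moreover have "(\<chi> i j. (Q ** M) $ Some i $ Some j) = (mat 1 :: real^'k^'k)"
      by (simp add: Q_def M_def matrix_matrix_mult_def sum_UNIV_option sum1 mat1)
    ultimately show "(Q ** M) $ None $ None * det (\<chi> i j. (Q ** M) $ Some i $ Some j) = 1 - \<kappa> * (u \<bullet> u)"
      by simp
  qed
  ultimately show ?thesis by (simp add: det_mul)
qed

text \<open>The sphere (\<open>\<epsilon> = -1\<close>) and the hyperboloid (\<open>\<epsilon> = 1\<close>) as graphs over the unit ball.\<close>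

lemma adapted_hypersphere_quadric:
  fixes \<epsilon> :: real
  assumes \<epsilon>: "\<epsilon> = 1 \<or> \<epsilon> = -1"
    and sgn: "0 < \<epsilon> * (l1 * ((real CARD('k option) + 2) * l0 + real CARD('k option) * l1))"
  shows "adapted_hypersphere l0 l1 (top_of_set (ball 0 1)) (domain_atlas (ball 0 1))
    (\<lambda>u :: real^'k::finite. append_coord u ((1 + \<epsilon> * (u \<bullet> u)) powr (1 / 2)))"
proof -
  define w where "w u = (1 + \<epsilon> * (u \<bullet> u)) powr (1 / 2)" for u :: "real^'k"
  define G where "G u = append_coord u (w u)" for u
  define e :: "real^('k option)" where "e = append_coord 0 1"
  let ?\<Omega> = "ball 0 1 :: (real^'k) set"
  have \<epsilon>2: "\<epsilon> * \<epsilon> = 1" using \<epsilon> by auto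
  have pos1: "1 + \<epsilon> * (u \<bullet> u) > 0" if "u \<in> ?\<Omega>" for u
  proof -
    have "u \<bullet> u < 1" using that by (simp add: dot_square_norm power_less_one_iff)
    then show ?thesis using \<epsilon> by (auto simp: add_pos_nonneg)
  qed
  have wpos: "w u > 0" and wsq: "w u * w u = 1 + \<epsilon> * (u \<bullet> u)" if "u \<in> ?\<Omega>" for u
    using pos1[OF that] by (simp_all add: w_def powr_add[symmetric])
  have inner: "smooth_on ?\<Omega> (\<lambda>u. u \<bullet> u)"
    unfolding smooth_on_def by (intro allI Ck_on_bilinear[OF bounded_bilinear_inner])
      (simp_all add: smooth_on_ident[unfolded smooth_on_def, rule_format])
  have ws: "smooth_on ?\<Omega> w"
    unfolding w_def[abs_def]
    by (rule smooth_on_powr[OF open_ball _ pos1]) (intro smooth_on_add smooth_on_mult smooth_on_const open_ball inner)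
  have Gs: "smooth_on ?\<Omega> G"
    unfolding G_def[abs_def] by (intro smooth_on_append_coord smooth_on_ident open_ball ws)
  have Dw: "(w has_derivative (\<lambda>X. \<epsilon> * (u \<bullet> X) / w u)) (at u)" if "u \<in> ?\<Omega>" for u
  proof -
    have "((\<lambda>u. 1 + \<epsilon> * (u \<bullet> u)) has_derivative (\<lambda>X. \<epsilon> * (u \<bullet> X + X \<bullet> u))) (at u)"
      by (auto intro!: derivative_eq_intros)
    moreover have "((\<lambda>x. x powr (1 / 2)) has_derivative (\<lambda>X. (1 / 2) * (1 + \<epsilon> * (u \<bullet> u)) powr (1 / 2 - 1) * X)) (at (1 + \<epsilon> * (u \<bullet> u)))"
      by (rule has_real_derivative_powr[OF pos1[OF that], unfolded has_field_derivative_def])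
    ultimately have "(w has_derivative (\<lambda>X. (1 / 2) * (1 + \<epsilon> * (u \<bullet> u)) powr (1 / 2 - 1) * (\<epsilon> * (u \<bullet> X + X \<bullet> u)))) (at u)"
      unfolding w_def[abs_def] using diff_chain_at by (fastforce simp: o_def)
    moreover have "(1 + \<epsilon> * (u \<bullet> u)) powr (1 / 2 - 1) = 1 / w u"
      using pos1[OF that] by (simp add: w_def powr_minus_divide[symmetric])
    ultimately show ?thesis by (simp add: inner_commute field_simps)
  qed
  have DG: "(G has_derivative (\<lambda>X. append_coord X (\<epsilon> * (u \<bullet> X) / w u))) (at u)" if "u \<in> ?\<Omega>" for u
    unfolding G_def[abs_def] by (rule has_derivative_append_coord[OF has_derivative_ident Dw[OF that]])
  have Gd: "G differentiable at u" if "u \<in> ?\<Omega>" for u by (rule smooth_on_differentiable[OF Gs that])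
  have DG': "frechet_derivative G (at u) X = append_coord X (\<epsilon> * (u \<bullet> X) / w u)" if "u \<in> ?\<Omega>" for u X
    by (simp add: frechet_derivative_eqI[OF DG[OF that]])
  \<comment> \<open>Since \<open>w - \<epsilon> (u \<bullet> u) / w = 1 / w\<close>, the position
    vector is vertical modulo the tangent vector belonging to \<open>u\<close>.\<close>
  have Ge: "G u = (1 / w u) *\<^sub>R e + frechet_derivative G (at u) u" if "u \<in> ?\<Omega>" for u
    unfolding DG'[OF that] using wpos[OF that] wsq[OF that]
    by (simp add: G_def e_def append_coord_scaleR append_coord_add field_simps)
  have detG: "det (frame G G u) = 1 / w u" if "u \<in> ?\<Omega>" for u
  proof -
    have "det (frame G G u) = 1 / w u * det (frame G (\<lambda>u. e) u)"
      by (rule det_frame_transversal[OF Gd[OF that]]) (rule Ge[OF that])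
    also have "det (frame G (\<lambda>u. e) u) = 1 * det (\<chi> i j. frame G (\<lambda>u. e) u $ Some i $ Some j)"
      by (subst det_option_row) (simp_all add: e_def)
    also have "(\<chi> i j. frame G (\<lambda>u. e) u $ Some i $ Some j) = mat 1"
      by (simp add: partial_eqI[OF DG[OF that]] vec_eq_iff mat_def axis_def)
    finally show ?thesis by simp
  qed
  have detG0: "det (frame G G u) \<noteq> 0" if "u \<in> ?\<Omega>" for u using detG[OF that] wpos[OF that] by simp
  define P :: "real^'k \<Rightarrow> real^'k^'k" where
    "P u = (\<chi> i j. (if i = j then 1 else 0) - \<epsilon> / (w u * w u) * u $ i * u $ j)" for u
  have met: "affine_metric G G u = (\<chi> i j. \<epsilon> * P u $ i $ j)" if u: "u \<in> ?\<Omega>" for u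
  proof -
    have "affine_metric G G u $ i $ j = \<epsilon> * P u $ i $ j" for i j
    proof -
      have pj: "partial j G x = append_coord (axis j 1) (\<epsilon> * x $ j / w x)" if "x \<in> ?\<Omega>" for x
        by (simp add: partial_eqI[OF DG[OF that]] inner_axis)
      let ?w2 = "\<lambda>X. \<epsilon> * (X $ j * w u - u $ j * (\<epsilon> * (u \<bullet> X) / w u)) / (w u * w u)"
      have "((\<lambda>x. \<epsilon> * x $ j / w x) has_derivative ?w2) (at u)"
        by (rule has_derivative_eq_rhs)
          (auto intro!: derivative_eq_intros bounded_linear_imp_has_derivative[OF bounded_linear_vec_nth] Dw[OF u]
            simp: wpos[OF u, THEN less_imp_neq, symmetric] fun_eq_iff field_simps)
      then have "((\<lambda>x. append_coord (axis j 1) (\<epsilon> * x $ j / w x)) has_derivative (\<lambda>X. append_coord 0 (?w2 X))) (at u)"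
        by (rule has_derivative_append_coord[OF has_derivative_const])
      then have "partial i (\<lambda>x. append_coord (axis j 1) (\<epsilon> * x $ j / w x)) u = append_coord 0 (?w2 (axis i 1))"
        by (rule partial_eqI)
      then have "partial i (partial j G) u = append_coord 0 (?w2 (axis i 1))"
        by (simp only: partial_cong[OF open_ball u pj])
      \<comment> \<open>The second derivative is vertical, and \<open>Ge\<close> turns it into a
        multiple of \<open>G u\<close> plus a tangent vector.\<close>
      also have "\<dots> = (?w2 (axis i 1) * w u) *\<^sub>R G u + frechet_derivative G (at u) (- (?w2 (axis i 1) * w u) *\<^sub>R u)"
      proof -
        have lin: "linear (frechet_derivative G (at u))" by (rule linear_frechet_derivative[OF Gd[OF u]])
        show ?thesis
          unfolding linear_cmul[OF lin] using wpos[OF u]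
          by (subst Ge[OF u]) (simp add: e_def append_coord_scaleR scaleR_add_right)
      qed
      finally have "affine_metric G G u $ i $ j = ?w2 (axis i 1) * w u"
        by (rule affine_metric_eqI[OF Gd[OF u] detG0[OF u]])
      also have "\<dots> = \<epsilon> * P u $ i $ j"
      proof -
        have e: "u \<bullet> axis i 1 = u $ i" "axis i (1::real) $ j = (if i = j then 1 else 0)"
          by (simp_all add: inner_axis) (simp add: axis_def)
        show ?thesis unfolding P_def e using wpos[OF u] by (simp add: field_simps)
      qed
      finally show ?thesis .
    qed
    then show ?thesis by (simp add: vec_eq_iff)
  qed
  have detP: "det (P u) = 1 / (w u * w u)" if "u \<in> ?\<Omega>" for u
  proof -
    have e: "\<epsilon> / (w u * w u) * (u \<bullet> u) = (w u * w u - 1) / (w u * w u)" unfolding wsq[OF that] by simp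
    show ?thesis unfolding P_def det_identity_minus_rank_one e using wpos[OF that]
      by (simp add: field_simps)
  qed
  have posP: "positive_definite (P u)" if u: "u \<in> ?\<Omega>" for u
    unfolding positive_definite_def
  proof (intro conjI allI impI)
    show "transpose (P u) = P u" by (simp add: P_def transpose_def vec_eq_iff mult_ac)
    fix v :: "real^'k" assume v: "v \<noteq> 0"
    have "(P u *v v) $ i = v $ i - \<epsilon> / (w u * w u) * u $ i * (u \<bullet> v)" for i :: 'k
    proof -
      have "(P u *v v) $ i = (\<Sum>j\<in>UNIV. (if i = j then v $ j else 0) - \<epsilon> / (w u * w u) * u $ i * (u $ j * v $ j))"
        unfolding matrix_vector_mult_def vec_lambda_beta
        by (rule sum.cong) (simp_all add: P_def algebra_simps)
      also have "\<dots> = v $ i - \<epsilon> / (w u * w u) * u $ i * (u \<bullet> v)"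
        unfolding sum_subtractf sum_distrib_left[symmetric] inner_vec_def by simp
      finally show ?thesis .
    qed
    then have "P u *v v = v - (\<epsilon> / (w u * w u) * (u \<bullet> v)) *\<^sub>R u"
      by (simp add: vec_eq_iff mult_ac)
    then have vPv: "v \<bullet> (P u *v v) = v \<bullet> v - \<epsilon> * (u \<bullet> v)\<^sup>2 / (w u * w u)"
      by (simp add: inner_diff_right inner_commute power2_eq_square)
    have W: "0 < w u * w u" using wpos[OF u] by simp
    have vv: "0 < v \<bullet> v" using v by simp
    have "\<epsilon> * (u \<bullet> v)\<^sup>2 < (v \<bullet> v) * (w u * w u)"
      using \<epsilon>
    proof
      assume e1: "\<epsilon> = 1"
      have "(u \<bullet> v)\<^sup>2 \<le> (u \<bullet> u) * (v \<bullet> v)" by (rule Cauchy_Schwarz_ineq)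
      also have "\<dots> < (v \<bullet> v) * (w u * w u)" unfolding wsq[OF u] e1 using vv by (simp add: algebra_simps)
      finally show ?thesis using e1 by simp
    next
      assume "\<epsilon> = -1"
      then have "\<epsilon> * (u \<bullet> v)\<^sup>2 \<le> 0" by simp
      also have "0 < (v \<bullet> v) * (w u * w u)" using W vv by simp
      finally show ?thesis .
    qed
    then show "0 < v \<bullet> (P u *v v)" unfolding vPv using W by (simp add: field_simps)
  qed
  \<comment> \<open>With \<open>\<mu> = - \<epsilon>\<close> the affine normal is
    \<open>\<epsilon> G\<close>, pointing to the centre for the sphere and away from it for the
    hyperboloid.\<close>
  have "adapted_hypersphere l0 l1 (top_of_set ?\<Omega>) (domain_atlas ?\<Omega>) G"
  proof (rule adapted_hypersphereI[OF open_ball Gs, where \<mu> = "- \<epsilon>"])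
    show "- \<epsilon> \<noteq> 0" using \<epsilon> by auto
    show "- \<epsilon> * l1 * ((real CARD('k option) + 2) * l0 + real CARD('k option) * l1) < 0"
      using sgn by (simp add: mult_ac)
    fix u assume u: "u \<in> ?\<Omega>"
    show "det (frame G G u) \<noteq> 0" by (rule detG0[OF u])
    have "(\<chi> i j. - 1 / - \<epsilon> * affine_metric G G u $ i $ j) = P u"
      unfolding met[OF u] using \<epsilon> by (auto simp: vec_eq_iff)
    then show "positive_definite (\<chi> i j. - 1 / - \<epsilon> * affine_metric G G u $ i $ j)" using posP[OF u] by simp
    have "\<bar>\<epsilon>\<bar> = 1" using \<epsilon> by auto
    then show "\<bar>- \<epsilon>\<bar> * \<bar>det (frame G G u)\<bar> = sqrt (\<bar>1 / - \<epsilon>\<bar> ^ CARD('k) * \<bar>det (affine_metric G G u)\<bar>)"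
      unfolding met[OF u] det_cmult detP[OF u] detG[OF u]
      using wpos[OF u] by (simp add: abs_mult power_abs real_sqrt_divide)
  qed
  then show ?thesis by (simp add: G_def[abs_def] w_def[abs_def])
qed

section \<open>The model hypersurfaces satisfy the assumptions\<close>

lemma K0_cmult: "c \<noteq> 0 \<Longrightarrow> K0 (c * l0) (c * l1) = K0 l0 l1"
  and K1_cmult: "c \<noteq> 0 \<Longrightarrow> K1 (c * l0) (c * l1) = K1 l0 l1"
  by (simp_all add: K0_def K1_def right_diff_distrib[symmetric])

text \<open>The eigenvalues of the models are proportional to \<open>1 / t^2\<close>, and
  \<open>C\<close> is the factor that the volume condition dictates. \<open>F\<close> and
  \<open>\<Xi>\<close> are maps on the whole product; each chart only has to exhibit expressions
  that agree with them.\<close>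

lemma line_product_hypersurfaceI:
  fixes B :: "('q, 'k::finite) chart set" and F :: "real \<times> 'q \<Rightarrow> real^('k option option)"
  assumes I: "open I" "I \<subseteq> {0<..}" and Y: "oriented_manifold Y B" and T: "det T \<noteq> 0" and C: "C * l1 \<noteq> 0"
    and patch: "\<And>c. c \<in> B \<Longrightarrow> \<exists>f \<xi>. (\<forall>z\<in>product_domain I (chart_image c).
         f z = F (z $ None, inv_into (fst c) (snd c) (rest_coords z)) \<and>
         \<xi> z = \<Xi> (z $ None, inv_into (fst c) (snd c) (rest_coords z))) \<and>
        congruent_patch (product_domain I (chart_image c)) f \<xi> T (\<lambda>z. C * l0 / (z $ None)\<^sup>2) (\<lambda>z. C * l1 / (z $ None)\<^sup>2)"
  shows "centre_congruent_hypersurface (prod_topology (top_of_set I) Y) (line_product_atlas I B) F \<Xi>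
    (\<lambda>(t, q). C * l0 / t\<^sup>2) (\<lambda>(t, q). C * l1 / t\<^sup>2)"
  unfolding centre_congruent_hypersurface_iff
proof (intro conjI ballI exI)
  show "oriented_manifold (prod_topology (top_of_set I) Y) (line_product_atlas I B)"
    by (rule oriented_manifold_line_product[OF I(1) Y])
  show "(case p of (t, q) \<Rightarrow> C * l1 / t\<^sup>2) \<noteq> 0" if "p \<in> topspace (prod_topology (top_of_set I) Y)" for p
    using that C I(2) by auto
  show "invertible T" using T invertible_det_nz by blast
  fix d assume "d \<in> line_product_atlas I B"
  then obtain c where c: "c \<in> B" and d: "d = (I \<times> fst c, \<lambda>(t, q). append_coord (snd c q) t)"
    by (auto simp: line_product_atlas_def)
  have tc: "topological_chart Y c" using Y c by (simp add: oriented_manifold_def)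
  let ?V = "product_domain I (chart_image c)"
  have oV: "open ?V" using tc by (intro open_product_domain I) (simp add: topological_chart_def)
  have rep: "local_rep d H z = H (z $ None, inv_into (fst c) (snd c) (rest_coords z))" if "z \<in> ?V" for z and H :: "real \<times> 'q \<Rightarrow> 'z"
    unfolding d by (rule local_rep_line_product[OF I(1) tc that])
  have im: "chart_image d = ?V" unfolding d by (rule line_product_chart(2)[OF I(1) tc])
  obtain f \<xi> where f: "\<And>z. z \<in> ?V \<Longrightarrow> f z = local_rep d F z" and \<xi>: "\<And>z. z \<in> ?V \<Longrightarrow> \<xi> z = local_rep d \<Xi> z"
    and p: "congruent_patch ?V f \<xi> T (\<lambda>z. C * l0 / (z $ None)\<^sup>2) (\<lambda>z. C * l1 / (z $ None)\<^sup>2)"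
    using patch[OF c] by (auto simp: rep)
  have k: "C * l / (z $ None)\<^sup>2 = local_rep d (\<lambda>(t, q). C * l / t\<^sup>2) z" if "z \<in> ?V" for z l
    by (simp add: rep[OF that])
  show "congruent_patch (chart_image d) (local_rep d F) (local_rep d \<Xi>) T
      (local_rep d (\<lambda>(t, q). C * l0 / t\<^sup>2)) (local_rep d (\<lambda>(t, q). C * l1 / t\<^sup>2))"
    unfolding im by (rule congruent_patch_cong[OF oV _ _ _ _ p], erule f, erule \<xi>, erule k, erule k)
qed

text \<open>The exponents are determined by \<open>l0\<close> and \<open>l1\<close>; the free
  parameter is \<open>r\<close> in \<open>\<rho> = r t^2\<close>. Its sign is forced by positivity
  of h in the direction of t, its size by the volume condition, which involves
  \<open>det L\<close>.\<close>

lemma converse_hypersphere: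
  fixes L :: "real^('k::finite option option)^('k option option)" and B :: "('q, 'k) chart set"
  assumes n: "n = real CARD('k option)" and l: "l0 \<noteq> l1" "l1 \<noteq> 0" "l0 + l1 < 0" "(n + 2) * l0 + n * l1 \<noteq> 0"
    and N: "NN n l0 l1 \<noteq> 0" and g2: "adapted_hypersphere l0 l1 Y B g2"
    and I: "open I" "I \<subseteq> {0<..}" and L: "invertible L"
  shows "\<exists>C \<xi>. 0 < C \<and> centre_congruent_hypersurface (prod_topology (top_of_set I) Y) (line_product_atlas I B)
    (\<lambda>x. L *v hypersphere_model (K1 l0 l1) (NN n l0 l1) g2 x) \<xi> (\<lambda>(t, q). C * l0 / t\<^sup>2) (\<lambda>(t, q). C * l1 / t\<^sup>2)"
proof -
  let ?m = "CARD('k)"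
  define d where "d = l0 - l1"
  define a where "a = - 2 * K1 l0 l1"
  define N where "N = NN n l0 l1"
  have d: "d \<noteq> 0" using l by (simp add: d_def)
  have nm: "n = real ?m + 1" using n by (simp add: card_UNIV_option)
  have n0: "n > 0" using nm by simp
  have a: "a = - 2 * l1 / d" by (simp add: a_def K1_def d_def)
  have Nd: "N = ((n - 2) * l1 + (n + 2) * l0) / d"
    by (simp add: N_def NN_def K0_def K1_def d_def add_divide_distrib)
  have a0: "a \<noteq> 0" using a d l by simp
  have N0: "N \<noteq> 0" using N N_def by simp
  \<comment> \<open>Links \<open>N \<noteq> 2\<close> to \<open>l0 + l1 \<noteq> 0\<close>; the same
    identity decides the sign of \<open>C\<close>.\<close>
  have N2: "N - 2 = n * (l0 + l1) / d" using d by (simp add: Nd d_def field_simps)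
  have N2': "N \<noteq> 2" using N2 l n0 d by auto
  have Na: "N - a = ((n + 2) * l0 + n * l1) / d" using d by (simp add: Nd a field_simps)
  have aN: "a \<noteq> N" using Na l d by auto
  \<comment> \<open>The definition of \<open>NN\<close> makes the volume exponents match identically
    in \<open>l0\<close> and \<open>l1\<close>.\<close>
  have vol_exp: "N + a * (?m + 1) = ?m + 3"
  proof -
    have l0: "l0 = l1 + d" by (simp add: d_def)
    show ?thesis unfolding Nd a using d nm by (simp add: l0 field_simps)
  qed
  obtain \<eta> \<mu> where hyp: "proper_affine_hypersphere Y B g2 \<eta> \<mu>"
    and centre: "\<And>q. q \<in> topspace Y \<Longrightarrow> g2 q + (1 / \<mu>) *\<^sub>R \<eta> q = 0"
    and posm: "positive_blaschke_metric B g2 \<eta>" and sgn: "\<mu> * l1 * ((n + 2) * l0 + n * l1) < 0"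
    using g2 unfolding adapted_hypersphere_def Let_def n by blast
  have Y: "oriented_manifold Y B" and \<mu>: "\<mu> \<noteq> 0"
    using hyp by (auto simp: proper_affine_hypersphere_def blaschke_immersion_def)
  have L0: "det L \<noteq> 0" using L invertible_det_nz by blast
  \<comment> \<open>Obtained by solving the volume condition: with \<open>\<bar>r\<bar> = R\<close>
    the powers of \<open>R\<close> collect to \<open>R * sqrt (R ^ (?m + 1))\<close>.\<close>
  define K where "K = \<bar>det L\<bar> * \<bar>1 - a / N\<bar> / (sqrt (\<bar>a * N\<bar> * \<bar>N / (N - a)\<bar> ^ ?m * \<bar>\<mu>\<bar> ^ ?m) * \<bar>\<mu>\<bar>)"
  have K: "0 < K" using L0 a0 N0 aN \<mu> by (simp add: K_def field_simps)
  obtain R where R: "0 < R" "R * sqrt (R ^ (?m + 1)) = K" using ex_root[OF K] by blast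
  \<comment> \<open>The sign makes \<open>- a * N * r\<close>, the metric coefficient of the
    t-direction, positive.\<close>
  define r where "r = - sgn (a * N) * R"
  have r0: "r \<noteq> 0" and absr: "\<bar>r\<bar> = R" using R a0 N0 by (simp_all add: r_def abs_mult sgn_if)
  have aNr: "a * N * r < 0"
  proof -
    have "a * N * r = - \<bar>a * N\<bar> * R" unfolding r_def by (simp add: sgn_if abs_if)
    then show ?thesis using a0 N0 R by (simp add: mult_less_0_iff)
  qed
  \<comment> \<open>Read off from the requirement that the multiple eigenvalue be
    \<open>C * l1 / t^2\<close>. Its positivity is where \<open>l0 + l1 < 0\<close> enters.\<close>
  define C where "C = - (1 - 2 / N) / (r * l1)"
  have C: "0 < C"
  proof -
    have "C = - (N - 2) * a / (a * N * r * l1)" using a0 N0 r0 l by (simp add: C_def field_simps)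
    also have "\<dots> = 2 * n * (l0 + l1) / (d * d * (a * N * r))" using d l a0 N0 r0 unfolding N2 by (subst (1) a) (simp add: field_simps)
    also have "\<dots> > 0"
    proof -
      have "d * d * (a * N * r) < 0" using mult_pos_neg[OF _ aNr] d not_real_square_gt_zero by blast
      moreover have "2 * n * (l0 + l1) < 0" using n0 l by (simp add: mult_pos_neg)
      ultimately show ?thesis by (rule divide_neg_neg[rotated])
    qed
    finally show ?thesis .
  qed
  have C1: "C * l1 = - ((1 - 2 / N) / r)" using l r0 N0 by (simp add: C_def field_simps)
  \<comment> \<open>With \<open>C\<close> fixed by the multiple eigenvalue, the simple one fits
    because \<open>1 - 2 / a = l0 / l1\<close>.\<close>
  have C0: "C * l0 = - ((1 - 2 / a) * (1 - 2 / N) / r)"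
  proof -
    have "1 - 2 / a = l0 / l1" using l d by (simp add: a d_def field_simps)
    then show ?thesis using l(2) r0 N0 unfolding C_def by (simp only:) (simp add: field_simps)
  qed
  define q where "q t = (t powr N / N - 2 * t * t powr (N - 1) / (a * N)) / (r * t\<^sup>2)" for t
  define \<Xi> where "\<Xi> = (\<lambda>(t, y). L *v (((1 - 2 / N) / r * t powr (a - 2)) *\<^sub>R append_coord (g2 y) 0 + q t *\<^sub>R append_coord 0 1))"
  let ?T = "L ** diagonal_shape (2 / a) (2 / N) ** matrix_inv L"
  have "det (L ** matrix_inv L) = 1" using matrix_inv_mult[OF L0] by simp
  then have T: "det ?T \<noteq> 0" using L0 a0 N0 by (auto simp: det_mul det_diagonal_shape)
  have "centre_congruent_hypersurface (prod_topology (top_of_set I) Y) (line_product_atlas I B)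
    (\<lambda>x. L *v hypersphere_model (K1 l0 l1) (NN n l0 l1) g2 x) \<Xi> (\<lambda>(t, q). C * l0 / t\<^sup>2) (\<lambda>(t, q). C * l1 / t\<^sup>2)"
  proof (rule line_product_hypersurfaceI[OF I Y T])
    show "C * l1 \<noteq> 0" using C l by simp
    fix c assume c: "c \<in> B"
    let ?\<Omega> = "chart_image c" and ?G = "local_rep c g2" and ?\<eta> = "local_rep c \<eta>"
    have tc: "topological_chart Y c" using Y c by (simp add: oriented_manifold_def)
    have \<Omega>: "open ?\<Omega>" using tc by (simp add: topological_chart_def)
    have inv: "inv_into (fst c) (snd c) u \<in> topspace Y" if "u \<in> ?\<Omega>" for u
      using inv_into_into[of u "snd c" "fst c"] that topological_chart_homeomorphic_maps(3)[OF tc]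
      by (auto simp: chart_image_def)
    have \<eta>: "?\<eta> u = (- \<mu>) *\<^sub>R ?G u" if "u \<in> ?\<Omega>" for u
    proof -
      let ?y = "inv_into (fst c) (snd c) u"
      have "(1 / \<mu>) *\<^sub>R \<eta> ?y = - g2 ?y" using centre[OF inv[OF that]] by (simp add: add_eq_0_iff)
      then have "\<mu> *\<^sub>R ((1 / \<mu>) *\<^sub>R \<eta> ?y) = \<mu> *\<^sub>R (- g2 ?y)" by simp
      then show ?thesis using \<mu> by (simp add: local_rep_def)
    qed
    then have \<eta>': "\<forall>u\<in>?\<Omega>. ?\<eta> u = (- \<mu>) *\<^sub>R ?G u" by blast
    have an: "affine_normal_on ?\<Omega> ?G ?\<eta>"
      using hyp c by (simp add: proper_affine_hypersphere_def blaschke_immersion_def)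
    note hs = affine_normal_hypersphere[OF \<Omega> an \<eta>' \<mu>]
    have pos: "positive_definite (affine_metric ?G ?\<eta> u)" if "u \<in> ?\<Omega>" for u
      using posm c that by (simp add: positive_blaschke_metric_def)
    have smooth: "smooth_on ?\<Omega> ?G" using an by (simp add: affine_normal_on_def immersion_on_def)
    interpret M: hypersphere_chart I ?\<Omega> ?G a N r
      by unfold_locales (use I \<Omega> smooth a0 N0 r0 aN hs(2) in auto)
    have cp: "congruent_patch M.V (\<lambda>z. L *v M.f z) (\<lambda>z. L *v M.\<xi> z) ?T (\<lambda>z. M.l0 (z $ None)) (\<lambda>z. M.l1 (z $ None))"
    proof (rule M.congruent_patch_hypersphere[OF L0 N2' vol_exp aNr])
      fix u assume u: "u \<in> ?\<Omega>"
      \<comment> \<open>Positivity of h in the directions of u: \<open>a (N - a)\<close> has the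
        sign of \<open>- l1 ((n + 2) l0 + n l1)\<close>, so \<open>a N r < 0\<close> combines with
        the sign condition in \<open>adapted_hypersphere\<close>.\<close>
      have "0 < - (r * N / (N - a) * \<mu>)"
      proof -
        have "r * N / (N - a) * \<mu> = (a * N * r) * (\<mu> / (a * (N - a)))" using a0 aN by (simp add: field_simps)
        also have "\<mu> / (a * (N - a)) = (d * d) * - (\<mu> * l1 * ((n + 2) * l0 + n * l1)) / (2 * (l1 * ((n + 2) * l0 + n * l1))\<^sup>2)"
        proof -
          define p where "p = (n + 2) * l0 + n * l1"
          have "p \<noteq> 0" using l by (simp add: p_def)
          moreover have E: "a * (N - a) = - 2 * l1 * p / (d * d)" unfolding Na p_def[symmetric] by (subst a) simp
          ultimately show ?thesis unfolding p_def[symmetric] E using d l(2)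
            by (simp add: power2_eq_square mult_ac)
        qed
        also have "(a * N * r) * \<dots> < 0"
        proof (rule mult_neg_pos[OF aNr divide_pos_pos])
          show "0 < d * d * - (\<mu> * l1 * ((n + 2) * l0 + n * l1))" 
          proof (rule mult_pos_pos)
            show "0 < d * d" using d not_real_square_gt_zero by blast
          qed (use sgn in simp)
          show "0 < 2 * (l1 * ((n + 2) * l0 + n * l1))\<^sup>2" using l by simp
        qed
        finally show ?thesis by simp
      qed
      moreover have "(\<chi> i j. r * N / (N - a) * affine_metric ?G ?G u $ i $ j) =
         (\<chi> i j. - (r * N / (N - a) * \<mu>) * affine_metric ?G ?\<eta> u $ i $ j)"
        unfolding hs(3)[OF u] by (simp add: vec_eq_iff)
      ultimately show "positive_definite (\<chi> i j. r * N / (N - a) * affine_metric ?G ?G u $ i $ j)"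
        using positive_definite_cmult pos[OF u] by metis
      let ?D = "\<bar>det (frame ?G ?G u)\<bar>" and ?h = "\<bar>det (affine_metric ?G ?\<eta> u)\<bar>"
      have h: "sqrt ?h = \<bar>\<mu>\<bar> * ?D" using hs(4)[OF u] by simp
      have "\<bar>det (affine_metric ?G ?G u)\<bar> = \<bar>\<mu>\<bar> ^ ?m * ?h"
        unfolding hs(3)[OF u] det_cmult by (simp add: abs_mult power_abs)
      then have "\<bar>a * N * r\<bar> * \<bar>r * N / (N - a)\<bar> ^ ?m * \<bar>det (affine_metric ?G ?G u)\<bar> =
         (\<bar>a * N\<bar> * \<bar>N / (N - a)\<bar> ^ ?m * \<bar>\<mu>\<bar> ^ ?m) * R ^ (?m + 1) * ?h"
        unfolding absr[symmetric] by (simp add: abs_mult power_mult_distrib power_divide mult_ac)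
      then have "sqrt (\<bar>a * N * r\<bar> * \<bar>r * N / (N - a)\<bar> ^ ?m * \<bar>det (affine_metric ?G ?G u)\<bar>) =
         sqrt (\<bar>a * N\<bar> * \<bar>N / (N - a)\<bar> ^ ?m * \<bar>\<mu>\<bar> ^ ?m) * sqrt (R ^ (?m + 1)) * (\<bar>\<mu>\<bar> * ?D)"
        unfolding h[symmetric] by (simp only: real_sqrt_mult)
      also have "\<dots> = \<bar>det L\<bar> * \<bar>1 - a / N\<bar> / \<bar>r\<bar> * ?D"
      proof -
        let ?s = "sqrt (\<bar>a * N\<bar> * \<bar>N / (N - a)\<bar> ^ ?m * \<bar>\<mu>\<bar> ^ ?m)"
        have s: "0 < ?s" using a0 N0 aN \<mu> by simp
        have "R * sqrt (R ^ (?m + 1)) * (?s * \<bar>\<mu>\<bar>) = \<bar>det L\<bar> * \<bar>1 - a / N\<bar>"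
        proof -
          have c: "y \<noteq> 0 \<Longrightarrow> x / y * y = x" for x y :: real by simp
          have "0 < ?s * \<bar>\<mu>\<bar>" using s \<mu> by (intro mult_pos_pos) auto
          from c[OF less_imp_neq[OF this, symmetric]] show ?thesis unfolding R(2) K_def .
        qed
        then show ?thesis unfolding absr using R(1) by (simp add: field_simps)
      qed
      finally show "\<bar>det L\<bar> * \<bar>1 - a / N\<bar> / \<bar>r\<bar> * ?D = sqrt (\<bar>a * N * r\<bar> * \<bar>r * N / (N - a)\<bar> ^ ?m * \<bar>det (affine_metric ?G ?G u)\<bar>)" ..
    qed
    have ev: "(\<lambda>z. M.l0 (z $ None)) = (\<lambda>z. C * l0 / (z $ None)\<^sup>2)" "(\<lambda>z. M.l1 (z $ None)) = (\<lambda>z. C * l1 / (z $ None)\<^sup>2)"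
      unfolding M.l0_def M.l1_def C0 C1 by (simp_all add: fun_eq_iff)
    note cp = cp[unfolded ev]
    moreover have "L *v M.f z = L *v hypersphere_model (K1 l0 l1) (NN n l0 l1) g2 (z $ None, inv_into (fst c) (snd c) (rest_coords z))" for z
      unfolding M.f_eq by (simp add: hypersphere_model_def local_rep_def a_def N_def)
    moreover have "L *v M.\<xi> z = \<Xi> (z $ None, inv_into (fst c) (snd c) (rest_coords z))" for z
      unfolding M.\<xi>_def M.q_def M.H_def M.e_def unfolding \<Xi>_def q_def local_rep_def by simp
    ultimately show "\<exists>f \<xi>. (\<forall>z\<in>product_domain I ?\<Omega>.
         f z = L *v hypersphere_model (K1 l0 l1) (NN n l0 l1) g2 (z $ None, inv_into (fst c) (snd c) (rest_coords z)) \<and>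
         \<xi> z = \<Xi> (z $ None, inv_into (fst c) (snd c) (rest_coords z))) \<and>
        congruent_patch (product_domain I ?\<Omega>) f \<xi> ?T (\<lambda>z. C * l0 / (z $ None)\<^sup>2) (\<lambda>z. C * l1 / (z $ None)\<^sup>2)"
      by - (rule exI[of _ "\<lambda>z. L *v M.f z"], rule exI[of _ "\<lambda>z. L *v M.\<xi> z"], intro conjI ballI cp, simp_all)
  qed
  then show ?thesis using C by blast
qed

text \<open>The relation between the eigenvalues pins the exponent down to
  \<open>(n + 2) / (n + 1)\<close>, which lies strictly between 0 and 2, and together with
  \<open>l0 + l1 < 0\<close> it forces \<open>l1 < 0\<close>. These signs make \<open>C\<close>
  positive.\<close>

lemma converse_monge_ampere:
  fixes L :: "real^('k::finite option option)^('k option option)" and F :: "real^'k \<Rightarrow> real"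
  assumes n: "n = real CARD('k option)" and l: "l0 \<noteq> l1" "l1 \<noteq> 0" "l0 + l1 < 0" "(n + 2) * l0 + n * l1 = 0"
    and \<Omega>: "open \<Omega>" and \<phi>0: "\<phi>0 \<noteq> 0" and F: "convex_monge_ampere_solution \<Omega> F"
    and I: "open I" "I \<subseteq> {0<..}" and L: "invertible L"
  shows "\<exists>C \<xi>. 0 < C \<and> centre_congruent_hypersurface (prod_topology (top_of_set I) (top_of_set \<Omega>)) (line_product_atlas I (domain_atlas \<Omega>))
    (\<lambda>x. L *v monge_ampere_model (K1 l0 l1) \<phi>0 F x) \<xi> (\<lambda>(t, q). C * l0 / t\<^sup>2) (\<lambda>(t, q). C * l1 / t\<^sup>2)"
proof -
  let ?m = "CARD('k)"
  define a where "a = - 2 * K1 l0 l1"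
  have nm: "n = real ?m + 1" using n by (simp add: card_UNIV_option)
  have n0: "n > 0" using nm by simp
  have l0: "l0 = - n * l1 / (n + 2)" using l(4) n0 by (simp add: field_simps)
  have a: "a = (n + 2) / (n + 1)"
  proof -
    have "l0 - l1 = - (2 * (n + 1) * l1) / (n + 2)" unfolding l0 using n0 by (simp add: field_simps)
    then have "a = - 2 * (l1 / (- (2 * (n + 1) * l1) / (n + 2)))" unfolding a_def K1_def by (simp only:)
    also have "\<dots> = (n + 2) / (n + 1)" using n0 l(2) by (simp add: divide_simps) (simp add: algebra_simps)
    finally show ?thesis .
  qed
  have a0: "a > 0" unfolding a using n0 by simp
  have a2: "a < 2" unfolding a using n0 by (simp add: field_simps)
  have l1: "l1 < 0"
  proof -
    have "l0 + l1 = 2 * l1 / (n + 2)" unfolding l0 using n0 by (simp add: field_simps)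
    then show ?thesis using l(3) n0 by (simp add: divide_less_0_iff)
  qed
  have vol_exp: "a * (?m + 2) = ?m + 3" unfolding a using nm by (simp add: field_simps)
  have L0: "det L \<noteq> 0" using L invertible_det_nz by blast
  define K where "K = \<bar>det L\<bar> * \<bar>\<phi>0 / a\<bar> / sqrt ((a * a) ^ (?m + 1))"
  have K: "0 < K" using L0 a0 \<phi>0 by (simp add: K_def)
  obtain R where R: "0 < R" "R * sqrt (R ^ (?m + 1)) = K" using ex_root[OF K] by blast
  \<comment> \<open>Both blocks of the metric carry the factor \<open>- a * a * r\<close>, so
    \<open>r\<close> has to be negative.\<close>
  define r where "r = - R"
  have r0: "r < 0" and absr: "\<bar>r\<bar> = R" using R by (simp_all add: r_def)
  define C where "C = - (1 - 2 / a) / (r * l1)"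
  have C: "0 < C"
  proof -
    have "1 - 2 / a < 0" using a0 a2 by simp
    moreover have "0 < r * l1" using r0 l1 by (simp add: mult_neg_neg)
    ultimately show ?thesis unfolding C_def by (intro divide_pos_pos) auto
  qed
  have C1: "C * l1 = - ((1 - 2 / a) / r)" using l r0 a0 by (simp add: C_def field_simps)
  have C0: "C * l0 = - ((1 - 2 / a) * (1 - 2 / a) / r)"
  proof -
    have "l0 / l1 = - n / (n + 2)" unfolding l0 using l by simp
    moreover have "1 - 2 / a = - n / (n + 2)" unfolding a using n0 by (simp add: field_simps)
    ultimately have "1 - 2 / a = l0 / l1" by simp
    then show ?thesis using l r0 by (simp add: C_def)
  qed
  have Fs: "smooth_on \<Omega> F" and hess: "\<And>u. u \<in> \<Omega> \<Longrightarrow> positive_definite (hessian F u) \<and> det (hessian F u) = 1"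
    using F by (auto simp: convex_monge_ampere_solution_def)
  interpret M: monge_ampere_chart I \<Omega> F a \<phi>0 r
    by unfold_locales (use I \<Omega> Fs a0 r0 \<phi>0 in auto)
  let ?T = "L ** M.T0 ** matrix_inv L"
  define \<Xi> where "\<Xi> = (\<lambda>(t, y). L *v M.\<xi> (append_coord y t))"
  have "det (L ** matrix_inv L) = 1" using matrix_inv_mult[OF L0] by simp
  then have T: "det ?T \<noteq> 0" using L0 M.det_T0 by (auto simp: det_mul)
  have "centre_congruent_hypersurface (prod_topology (top_of_set I) (top_of_set \<Omega>)) (line_product_atlas I (domain_atlas \<Omega>))
    (\<lambda>x. L *v monge_ampere_model (K1 l0 l1) \<phi>0 F x) \<Xi> (\<lambda>(t, q). C * l0 / t\<^sup>2) (\<lambda>(t, q). C * l1 / t\<^sup>2)"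
  proof (rule line_product_hypersurfaceI[OF I oriented_manifold_domain_atlas[OF \<Omega>] T])
    show "C * l1 \<noteq> 0" using C l by simp
    fix c assume "c \<in> domain_atlas \<Omega>"
    then have c: "c = (\<Omega>, id)" by (simp add: domain_atlas_def)
    have im: "chart_image c = \<Omega>" by (simp add: c chart_image_def)
    have inv: "inv_into (fst c) (snd c) u = u" if "u \<in> \<Omega>" for u
      using inv_into_f_f[of id \<Omega> u] that by (simp add: c)
    have cp: "congruent_patch M.V (\<lambda>z. L *v M.f z) (\<lambda>z. L *v M.\<xi> z) ?T (\<lambda>z. M.l0 (z $ None)) (\<lambda>z. M.l1 (z $ None))"
    proof (rule M.congruent_patch_monge_ampere[OF L0 _ vol_exp r0 hess])
      show "a \<noteq> 2" using a2 by simp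
      have A: "R * sqrt (R ^ (?m + 1)) * sqrt ((a * a) ^ (?m + 1)) = \<bar>det L\<bar> * \<bar>\<phi>0 / a\<bar>"
        unfolding R(2) K_def using a0 by simp
      have B: "sqrt (\<bar>a * a * r\<bar> ^ (?m + 1)) = sqrt (R ^ (?m + 1)) * sqrt ((a * a) ^ (?m + 1))"
        unfolding absr[symmetric] real_sqrt_mult[symmetric] using a0 by (simp add: abs_mult power_mult_distrib mult_ac)
      show "\<bar>det L\<bar> * \<bar>\<phi>0 / a\<bar> / \<bar>r\<bar> = sqrt (\<bar>a * a * r\<bar> ^ (?m + 1))"
        unfolding B absr A[symmetric] using R(1) by simp
    qed
    have ev: "(\<lambda>z. M.l0 (z $ None)) = (\<lambda>z. C * l0 / (z $ None)\<^sup>2)" "(\<lambda>z. M.l1 (z $ None)) = (\<lambda>z. C * l1 / (z $ None)\<^sup>2)"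
      unfolding M.l0_def M.l1_def C0 C1 by (simp_all add: fun_eq_iff)
    note cp = cp[unfolded ev]
    moreover have "L *v M.f z = L *v monge_ampere_model (K1 l0 l1) \<phi>0 F (z $ None, inv_into (fst c) (snd c) (rest_coords z))" if "z \<in> M.V" for z
      using M.V_D[OF that] unfolding M.f_eq by (simp add: inv a_def)
    moreover have "L *v M.\<xi> z = \<Xi> (z $ None, inv_into (fst c) (snd c) (rest_coords z))" if "z \<in> M.V" for z
      using M.V_D[OF that] by (simp add: inv \<Xi>_def)
    ultimately show "\<exists>f \<xi>. (\<forall>z\<in>product_domain I (chart_image c).
         f z = L *v monge_ampere_model (K1 l0 l1) \<phi>0 F (z $ None, inv_into (fst c) (snd c) (rest_coords z)) \<and>
         \<xi> z = \<Xi> (z $ None, inv_into (fst c) (snd c) (rest_coords z))) \<and>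
        congruent_patch (product_domain I (chart_image c)) f \<xi> ?T (\<lambda>z. C * l0 / (z $ None)\<^sup>2) (\<lambda>z. C * l1 / (z $ None)\<^sup>2)"
      unfolding im by - (rule exI[of _ "\<lambda>z. L *v M.f z"], rule exI[of _ "\<lambda>z. L *v M.\<xi> z"], intro conjI ballI cp, simp_all)
  qed
  then show ?thesis using C by blast
qed

section \<open>Existence\<close>

lemma convex_monge_ampere_solution_quadratic:
  "convex_monge_ampere_solution UNIV (\<lambda>u :: real^'k::finite. (u \<bullet> u) / 2)"
proof -
  let ?F = "\<lambda>u :: real^'k. (u \<bullet> u) / 2"
  have D: "(?F has_derivative (\<lambda>X. u \<bullet> X)) (at u)" for u
    by (auto intro!: derivative_eq_intros simp: inner_commute)
  have p: "partial j ?F = (\<lambda>u. u $ j)" for j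
    by (simp add: fun_eq_iff partial_eqI[OF D] inner_axis)
  have "hessian ?F u = mat 1" for u
    unfolding hessian_def p
    by (simp add: partial_eqI[OF bounded_linear_imp_has_derivative[OF bounded_linear_vec_nth]] vec_eq_iff mat_def axis_def eq_commute)
  moreover have "positive_definite (mat 1 :: real^'k^'k)" by (simp add: positive_definite_def)
  moreover have "smooth_on UNIV (\<lambda>u :: real^'k. (1/2) * (u \<bullet> u))"
    unfolding smooth_on_def by (intro allI Ck_on_bilinear[OF bounded_bilinear_mult] Ck_on_bilinear[OF bounded_bilinear_inner])
      (simp_all add: smooth_on_ident[unfolded smooth_on_def, rule_format] Ck_on_const)
  ultimately show ?thesis by (simp add: convex_monge_ampere_solution_def)
qed

text \<open>Examples come from the converse constructions, over a quadric or over the potential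
  \<open>(u \<bullet> u) / 2\<close>. They realize the eigenvalues up to the factor
  \<open>C / t^2\<close>, which equals one at \<open>t = sqrt C\<close>.\<close>

lemma existence:
  fixes n :: real
  assumes n: "n = real CARD('k::finite option)" and l: "l0 \<noteq> l1" "l1 \<noteq> 0" "l0 + l1 < 0" and N: "NN n l0 l1 \<noteq> 0"
  shows "\<exists>(X :: (real \<times> (real^'k)) topology) (A :: (real \<times> (real^'k), 'k option) chart set) f \<xi> \<kappa>0 \<kappa>1.
    centre_congruent_hypersurface X A f \<xi> \<kappa>0 \<kappa>1 \<and> (\<exists>p\<in>topspace X. \<kappa>0 p = l0 \<and> \<kappa>1 p = l1)"
proof -
  let ?I = "{0<..} :: real set" and ?L = "mat 1 :: real^('k option option)^('k option option)"
  have L: "invertible ?L" by (simp add: invertible_det_nz)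
  have "\<exists>\<Omega> f \<xi> C. 0 < C \<and> (0 :: real^'k) \<in> \<Omega> \<and>
     centre_congruent_hypersurface (prod_topology (top_of_set ?I) (top_of_set \<Omega>)) (line_product_atlas ?I (domain_atlas \<Omega>))
      f \<xi> (\<lambda>(t, q). C * l0 / t\<^sup>2) (\<lambda>(t, q). C * l1 / t\<^sup>2)"
  proof (cases "(n + 2) * l0 + n * l1 = 0")
    case True
    show ?thesis
      using converse_monge_ampere[OF n l True open_UNIV one_neq_zero convex_monge_ampere_solution_quadratic
          open_greaterThan subset_refl L] UNIV_I[of "0 :: real^'k"] by blast
  next
    case False
    \<comment> \<open>Hyperboloid or sphere, according to the sign that
      \<open>adapted_hypersphere\<close> demands.\<close>
    define \<epsilon> where "\<epsilon> = sgn (l1 * ((n + 2) * l0 + n * l1))"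
    have \<epsilon>: "\<epsilon> = 1 \<or> \<epsilon> = -1" "0 < \<epsilon> * (l1 * ((n + 2) * l0 + n * l1))"
    proof -
      have p: "l1 * ((n + 2) * l0 + n * l1) \<noteq> 0" using False l by simp
      then show "\<epsilon> = 1 \<or> \<epsilon> = -1" unfolding \<epsilon>_def by (simp only: sgn_if) auto
      show "0 < \<epsilon> * (l1 * ((n + 2) * l0 + n * l1))" unfolding \<epsilon>_def sgn_mult_self_eq sgn_mult_abs
        using p by (metis abs_sgn mult.commute zero_less_abs_iff)
    qed
    show ?thesis
      using converse_hypersphere[OF n l False N adapted_hypersphere_quadric[OF \<epsilon>(1) \<epsilon>(2)[unfolded n]]
          open_greaterThan subset_refl L] centre_in_ball[of "0 :: real^'k" 1, THEN iffD2, OF zero_less_one] by blast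
  qed
  then obtain \<Omega> f \<xi> C where C: "0 < C" and 0: "(0 :: real^'k) \<in> \<Omega>"
    and cc: "centre_congruent_hypersurface (prod_topology (top_of_set ?I) (top_of_set \<Omega>)) (line_product_atlas ?I (domain_atlas \<Omega>))
      f \<xi> (\<lambda>(t, q). C * l0 / t\<^sup>2) (\<lambda>(t, q). C * l1 / t\<^sup>2)" by blast
  have "(sqrt C, 0) \<in> topspace (prod_topology (top_of_set ?I) (top_of_set \<Omega>))" using C 0 by simp
  moreover have "(\<lambda>(t, q). C * l / t\<^sup>2) (sqrt C, 0 :: real^'k) = l" for l using C by simp
  ultimately show ?thesis using cc by blast
qed

section \<open>Linear algebra\<close>

lemma exists_common_kernel:
  fixes p q :: "real^'n::finite"
  assumes "CARD('n) \<ge> 3"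
  obtains X where "X \<noteq> 0" "p \<bullet> X = 0" "q \<bullet> X = 0"
proof -
  have "dim {p, q} \<le> card {p, q}" by (rule dim_le_card) (auto intro: span_base)
  also have "\<dots> \<le> 2" by (simp add: card_insert_if)
  finally have "dim (span {p, q}) < DIM(real^'n)" using assms by simp
  then obtain X where X: "X \<noteq> 0" "\<And>y. y \<in> span (span {p, q}) \<Longrightarrow> orthogonal X y"
    using orthogonal_to_subspace_exists[of "span {p, q}"] by (metis dim_span)
  have "p \<in> span (span {p, q})" "q \<in> span (span {p, q})" by (simp_all add: span_base)
  then have "orthogonal X p" "orthogonal X q" using X(2) by blast+
  then show ?thesis using that[of X] X(1) by (simp add: orthogonal_def inner_commute)
qed

text \<open>The multiplicities add up to the dimension, so the two eigenspaces span and
  \<open>S - l1\<close> has the line of \<open>e\<close> as its image. The covector \<open>b\<close>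
  gives the coefficient of \<open>e\<close> in the projection along the other eigenspace.\<close>

lemma rank_one_representation:
  fixes S :: "real^'n^'n"
  assumes l: "l0 \<noteq> l1" and d0: "dim (eigenspace S l0) = 1" and d1: "dim (eigenspace S l1) = CARD('n) - 1"
  obtains e b where "e \<noteq> 0" "b \<bullet> e = 1" "\<And>X. S *v X = l1 *\<^sub>R X + ((l0 - l1) * (b \<bullet> X)) *\<^sub>R e"
proof -
  have sub: "subspace (eigenspace S l)" for l
    unfolding subspace_def eigenspace_def
    by (simp add: matrix_vector_right_distrib matrix_vector_mult_scaleR scaleR_add_right)
  have "\<not> eigenspace S l0 \<subseteq> {0}" using d0 dim_eq_0[of "eigenspace S l0"] by linarith
  then obtain e where e: "e \<in> eigenspace S l0" "e \<noteq> 0" by blast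
  have E0: "eigenspace S l0 \<subseteq> span {e}"
  proof -
    have "dim (span {e}) = 1" using e by simp
    moreover have "span {e} \<subseteq> eigenspace S l0" using e sub by (simp add: span_minimal)
    ultimately have "span {e} = eigenspace S l0"
      using subspace_dim_equal[of "span {e}" "eigenspace S l0"] sub d0 by simp
    then show ?thesis by simp
  qed
  have int: "eigenspace S l0 \<inter> eigenspace S l1 = {0}"
    using l subspace_0[OF sub] by (auto simp: eigenspace_def)
  let ?sum = "{x + y |x y. x \<in> eigenspace S l0 \<and> y \<in> eigenspace S l1}"
  have "dim ?sum = CARD('n)"
    using dim_sums_Int[OF sub[of l0] sub[of l1]] int d0 d1 zero_less_card_finite[where 'a = 'n] by simp
  then have "span ?sum = UNIV" using dim_eq_full[of ?sum] by simp
  moreover have "span ?sum = ?sum" unfolding span_eq_iff by (rule subspace_sums[OF sub sub])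
  ultimately have "?sum = UNIV" by (simp only:)
  define M where "M X = S *v X - l1 *\<^sub>R X" for X
  have M: "\<exists>c. M X = c *\<^sub>R e" for X
  proof -
    obtain x y where "X = x + y" "x \<in> eigenspace S l0" "y \<in> eigenspace S l1"
      using \<open>?sum = UNIV\<close> by blast
    moreover then obtain c where "x = c *\<^sub>R e" using E0 by (auto simp: span_singleton)
    ultimately have "M X = ((l0 - l1) * c) *\<^sub>R e"
      by (simp add: M_def eigenspace_def matrix_vector_right_distrib algebra_simps)
    then show ?thesis by blast
  qed
  \<comment> \<open>Obtained by pairing \<open>S *v X - l1 *\<^sub>R X\<close> with \<open>e\<close>
    and dividing by \<open>(l0 - l1) (e \<bullet> e)\<close>.\<close>
  define b where "b = (1 / ((l0 - l1) * (e \<bullet> e))) *\<^sub>R (e v* S - l1 *\<^sub>R e)"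
  have bX: "(l0 - l1) * (b \<bullet> X) = (e \<bullet> M X) / (e \<bullet> e)" for X
    using l e by (simp add: b_def M_def inner_diff_left inner_diff_right dot_lmul_matrix)
  have "S *v X = l1 *\<^sub>R X + ((l0 - l1) * (b \<bullet> X)) *\<^sub>R e" for X
  proof -
    obtain c where c: "M X = c *\<^sub>R e" using M by blast
    then have "(l0 - l1) * (b \<bullet> X) = c" using e by (simp add: bX)
    then show ?thesis using c by (simp add: M_def algebra_simps)
  qed
  moreover have "b \<bullet> e = 1"
  proof -
    have "M e = (l0 - l1) *\<^sub>R e" using e by (simp add: M_def eigenspace_def algebra_simps)
    then have "(l0 - l1) * (b \<bullet> e) = l0 - l1" using e by (simp add: bX)
    then show ?thesis using l by simp
  qed
  ultimately show ?thesis using that e by blast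
qed

text \<open>Eigenvectors for distinct eigenvalues are independent, so there are no more eigenvalues
  than the dimension.\<close>

lemma finite_eigenvalues:
  fixes T :: "real^'n^'n"
  shows "finite {\<sigma>. \<exists>w. w \<noteq> 0 \<and> T *v w = \<sigma> *\<^sub>R w}" (is "finite ?E")
proof (rule ccontr)
  assume "infinite ?E"
  then obtain A where A: "finite A" "card A = Suc CARD('n)" "A \<subseteq> ?E"
    using infinite_arbitrarily_large by blast
  have "\<forall>\<sigma>\<in>?E. \<exists>w. w \<noteq> 0 \<and> T *v w = \<sigma> *\<^sub>R w" by blast
  from bchoice[OF this] obtain w where w: "\<And>\<sigma>. \<sigma> \<in> ?E \<Longrightarrow> w \<sigma> \<noteq> 0 \<and> T *v w \<sigma> = \<sigma> *\<^sub>R w \<sigma>" by blast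
  have ind: "\<forall>\<sigma>\<in>B. c \<sigma> = 0" if "finite B" "B \<subseteq> ?E" "(\<Sum>\<sigma>\<in>B. c \<sigma> *\<^sub>R w \<sigma>) = 0" for B and c :: "real \<Rightarrow> real"
    using that
  proof (induction B arbitrary: c rule: finite_induct)
    case (insert \<tau> B)
    let ?s = "\<Sum>\<sigma>\<in>B. c \<sigma> *\<^sub>R w \<sigma>"
    have s: "c \<tau> *\<^sub>R w \<tau> + ?s = 0" using insert by simp
    have lin: "linear ((*v) T)" by simp
    \<comment> \<open>Applying \<open>T - \<tau>\<close> removes the newly inserted eigenvector and
      multiplies each of the others by a nonzero factor.\<close>
    have "T *v (c \<tau> *\<^sub>R w \<tau> + ?s) - \<tau> *\<^sub>R (c \<tau> *\<^sub>R w \<tau> + ?s) = (\<Sum>\<sigma>\<in>B. (c \<sigma> * (\<sigma> - \<tau>)) *\<^sub>R w \<sigma>)"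
    proof -
      have "T *v ?s = (\<Sum>\<sigma>\<in>B. (c \<sigma> * \<sigma>) *\<^sub>R w \<sigma>)"
        unfolding linear_sum[OF lin]
      proof (rule sum.cong)
        fix \<sigma> assume "\<sigma> \<in> B"
        then have "T *v w \<sigma> = \<sigma> *\<^sub>R w \<sigma>" using w[of \<sigma>] insert.prems(1) by blast
        then show "T *v (c \<sigma> *\<^sub>R w \<sigma>) = (c \<sigma> * \<sigma>) *\<^sub>R w \<sigma>" by (simp add: matrix_vector_mult_scaleR)
      qed simp
      moreover have "T *v (c \<tau> *\<^sub>R w \<tau>) = \<tau> *\<^sub>R (c \<tau> *\<^sub>R w \<tau>)"
        using w[of \<tau>] insert.prems by (simp add: matrix_vector_mult_scaleR mult.commute)
      ultimately show ?thesis
        by (simp add: matrix_vector_right_distrib scaleR_add_right scaleR_sum_right sum_subtractf[symmetric]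
            right_diff_distrib scaleR_diff_left mult.commute)
    qed
    then have "(\<Sum>\<sigma>\<in>B. (c \<sigma> * (\<sigma> - \<tau>)) *\<^sub>R w \<sigma>) = 0" unfolding s by simp
    then have "\<forall>\<sigma>\<in>B. c \<sigma> * (\<sigma> - \<tau>) = 0" using insert.IH[of "\<lambda>\<sigma>. c \<sigma> * (\<sigma> - \<tau>)"] insert.prems by simp
    then have B: "\<forall>\<sigma>\<in>B. c \<sigma> = 0" using insert.hyps by auto
    then have "?s = 0" by simp
    then have "c \<tau> *\<^sub>R w \<tau> = 0" using s by simp
    then have "c \<tau> = 0" using w[of \<tau>] insert.prems by simp
    then show ?case using B by simp
  qed simp
  have inj: "inj_on w A"
  proof (rule inj_onI)
    fix \<sigma> \<tau> assume st: "\<sigma> \<in> A" "\<tau> \<in> A" and eq: "w \<sigma> = w \<tau>"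
    note ws = w[OF subsetD[OF A(3) st(1)]] and wt = w[OF subsetD[OF A(3) st(2)]]
    have "\<sigma> *\<^sub>R w \<sigma> = \<tau> *\<^sub>R w \<sigma>" using ws wt unfolding eq by metis
    then show "\<sigma> = \<tau>" using ws by simp
  qed
  have "independent (w ` A)"
    unfolding independent_explicit
  proof (intro conjI allI impI ballI)
    show "finite (w ` A)" using A by simp
    fix u v assume u: "(\<Sum>v\<in>w ` A. u v *\<^sub>R v) = 0" and v: "v \<in> w ` A"
    have "(\<Sum>\<sigma>\<in>A. u (w \<sigma>) *\<^sub>R w \<sigma>) = 0" using u by (simp add: sum.reindex[OF inj])
    then have "\<forall>\<sigma>\<in>A. u (w \<sigma>) = 0" by (rule ind[OF A(1,3)])
    then show "u v = 0" using v by blast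
  qed
  then have "card (w ` A) \<le> CARD('n)" using independent_bound[of "w ` A"] by simp
  then show False using A by (simp add: card_image[OF inj])
qed

lemma rank_le_one:
  fixes M :: "real^'n^'m"
  assumes "\<not> (\<exists>v w. independent {M *v v, M *v w} \<and> M *v v \<noteq> M *v w)"
  obtains v \<phi> where "\<And>w. M *v w = (\<phi> \<bullet> w) *\<^sub>R v"
proof (cases "\<forall>w. M *v w = 0")
  case True
  then show ?thesis using that[of 0 0] by simp
next
  case False
  then obtain w0 where v: "M *v w0 \<noteq> 0" by blast
  let ?v = "M *v w0"
  have "M *v w = (((1 / (?v \<bullet> ?v)) *\<^sub>R (?v v* M)) \<bullet> w) *\<^sub>R ?v" for w
  proof -
    have "M *v w \<in> span {?v}"
    proof (rule ccontr)
      assume *: "M *v w \<notin> span {?v}"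
      then have "independent (insert (M *v w) {?v})" using v by (simp add: independent_insert)
      moreover have "M *v w \<noteq> ?v" using * by (auto simp: span_base)
      ultimately show False using assms by blast
    qed
    then obtain c where c: "M *v w = c *\<^sub>R ?v" by (auto simp: span_singleton)
    then show ?thesis using v by (simp add: dot_lmul_matrix)
  qed
  then show ?thesis by (rule that)
qed

section \<open>The structure of the endomorphism \<open>T\<close>\<close>

text \<open>The part \<open>c\<close> of the derivative orthogonal to \<open>R\<close> is tested
  against itself: the function \<open>c \<bullet> f x\<close> vanishes near \<open>z\<close>, hence
  so does its derivative.\<close>

lemma derivative_in_subspace:
  fixes f :: "'a::real_normed_vector \<Rightarrow> 'b::euclidean_space"
  assumes "open U" "z \<in> U" "\<And>x. x \<in> U \<Longrightarrow> f x \<in> R" "subspace R" "f differentiable at z"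
  shows "frechet_derivative f (at z) X \<in> R"
proof -
  let ?D = "frechet_derivative f (at z)"
  obtain y c where y: "y \<in> span R" and c: "\<And>w. w \<in> span R \<Longrightarrow> orthogonal c w" and eq: "?D X = y + c"
    using orthogonal_subspace_decomp_exists[of R "?D X"] by metis
  have D: "((\<lambda>x. c \<bullet> f x) has_derivative (\<lambda>X. c \<bullet> ?D X)) (at z)"
    by (rule bounded_linear.has_derivative[OF bounded_linear_inner_right assms(5)[unfolded frechet_derivative_works]])
  have "((\<lambda>x. c \<bullet> f x) has_derivative (\<lambda>X. 0)) (at z)"
  proof (rule has_derivative_transform_within_open[OF has_derivative_const[of 0] assms(1,2)])
    fix x assume "x \<in> U"
    then show "0 = c \<bullet> f x" using c[OF span_base[OF assms(3)]] by (simp add: orthogonal_def)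
  qed
  then have "c \<bullet> ?D X = 0" using has_derivative_unique[OF D] by metis
  moreover have "c \<bullet> y = 0" using c[OF y] by (simp add: orthogonal_def)
  ultimately have "c = 0" by (simp add: eq inner_add_right)
  moreover have "y \<in> R" using y assms(4) span_eq_iff[of R] by blast
  ultimately show ?thesis using eq by simp
qed

text \<open>Dimension at least three ensures that two covectors on the tangent space, in particular
  \<open>b\<close> and the differential of \<open>\<rho>\<close>, have a common nonzero null
  vector.\<close>

locale congruent_surface =
  fixes V :: "(real^'n::finite) set" and f \<xi> :: "real^'n \<Rightarrow> real^('n option)" and T and l0 l1 :: "real^'n \<Rightarrow> real"
  assumes patch: "congruent_patch V f \<xi> T l0 l1" and V: "open V" and T: "det T \<noteq> 0"
    and l1: "\<And>z. z \<in> V \<Longrightarrow> l1 z \<noteq> 0" and dim3: "CARD('n) \<ge> 3"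
begin

abbreviation "D z \<equiv> frechet_derivative f (at z)"
abbreviation "S z \<equiv> shape_operator f \<xi> z"
abbreviation "h z \<equiv> affine_metric f \<xi> z"

definition \<rho> where "\<rho> z = support_function f \<xi> z"
definition Z where "Z z = rest_coords (frame_coeff f \<xi> z (f z))"

lemma an: "affine_normal_on V f \<xi>" and ca: "centroaffine_on V f"
  using patch by (auto simp: congruent_patch_def)

lemma smooth: "smooth_on V f" "smooth_on V \<xi>"
  using an by (auto simp: affine_normal_on_def immersion_on_def)

context
  fixes z assumes z: "z \<in> V"
begin

lemma fd: "f differentiable at z" and \<xi>d: "\<xi> differentiable at z"
  using smooth smooth_on_differentiable z by blast+

lemma lin: "linear (D z)" by (rule linear_frechet_derivative[OF fd])

lemma det: "det (frame f \<xi> z) \<noteq> 0"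
  by (rule det_frame_nz[OF _ _ z]) (use an in \<open>auto simp: affine_normal_on_def\<close>)

lemma D_eq_0_iff: "D z X = 0 \<longleftrightarrow> X = 0"
  using an z linear_injective_0[OF lin] linear_0[OF lin] by (auto simp: affine_normal_on_def immersion_on_def)

lemma f_notin: "f z \<notin> range (D z)"
  using ca z by (auto simp: centroaffine_on_def transversal_on_def)

lemma coeff_unique: "D z X + s *\<^sub>R \<xi> z = D z Y + t *\<^sub>R \<xi> z \<longleftrightarrow> X = Y \<and> s = t"
proof
  assume eq: "D z X + s *\<^sub>R \<xi> z = D z Y + t *\<^sub>R \<xi> z"
  have "frame_coeff f \<xi> z (D z X + s *\<^sub>R \<xi> z) = append_coord X s"
    by (rule frame_coeff_eqI[OF fd det]) simp
  moreover have "frame_coeff f \<xi> z (D z Y + t *\<^sub>R \<xi> z) = append_coord Y t"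
    by (rule frame_coeff_eqI[OF fd det]) simp
  ultimately show "X = Y \<and> s = t" unfolding eq by simp
qed simp

lemma pos: "X \<noteq> 0 \<Longrightarrow> 0 < X \<bullet> (h z *v X)"
  using patch z by (auto simp: congruent_patch_def positive_definite_def)

lemma D\<xi>: "frechet_derivative \<xi> (at z) X = - D z (S z *v X)"
  by (rule weingarten[OF fd \<xi>d det]) (use an z in \<open>simp add: affine_normal_on_def\<close>)

lemma f_eq: "f z = D z (Z z) + \<rho> z *\<^sub>R \<xi> z"
  by (rule trans[OF frame_coeff_expand[OF fd det, of "f z"]])
    (simp only: Z_def \<rho>_def support_function_def add.commute)

lemma c_eq: "T *v f z = f z - \<rho> z *\<^sub>R \<xi> z"
  using patch z by (auto simp: congruent_patch_def centre_map_def \<rho>_def)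

lemma Tf: "T *v f z = D z (Z z)"
  unfolding c_eq by (subst f_eq) simp

lemma \<rho>_nz: "\<rho> z \<noteq> 0"
  using f_eq f_notin by (metis add.right_neutral rangeI scaleR_zero_left)

lemma Z_nz: "Z z \<noteq> 0"
proof
  assume "Z z = 0"
  then have "T *v f z = 0" using Tf linear_0[OF lin] by simp
  moreover have "inj ((*v) T)" using T inj_matrix_vector_mult invertible_det_nz by blast
  ultimately have "f z = 0" by (metis injD matrix_vector_mult_0_right)
  then show False using f_notin linear_0[OF lin] by (metis rangeI)
qed

end

lemma \<rho>_smooth: "smooth_on V \<rho>" and Z_smooth: "smooth_on V Z"
proof -
  have c: "smooth_on V (\<lambda>z. frame_coeff f \<xi> z (f z))"
    by (rule smooth_on_frame_coeff[OF V smooth(1,2,1) det])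
  show "smooth_on V \<rho>"
    unfolding \<rho>_def[abs_def] support_function_def by (rule smooth_on_vec_nth[OF V c])
  show "smooth_on V Z"
    unfolding Z_def[abs_def] by (rule smooth_on_linear_image[OF bounded_linear_rest_coords V c])
qed

abbreviation "D\<rho> z \<equiv> frechet_derivative \<rho> (at z)"

lemma TD:
  assumes z: "z \<in> V"
  shows "T *v D z X = D z X + \<rho> z *\<^sub>R D z (S z *v X) - D\<rho> z X *\<^sub>R \<xi> z"
proof -
  have "((\<lambda>z. f z - \<rho> z *\<^sub>R \<xi> z) has_derivative (\<lambda>X. D z X - (\<rho> z *\<^sub>R frechet_derivative \<xi> (at z) X + D\<rho> z X *\<^sub>R \<xi> z))) (at z)"
    by (intro has_derivative_diff has_derivative_scaleR smooth_on_has_derivative[OF _ z] smooth \<rho>_smooth)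
  then have "((\<lambda>z. T *v f z) has_derivative (\<lambda>X. D z X - (\<rho> z *\<^sub>R frechet_derivative \<xi> (at z) X + D\<rho> z X *\<^sub>R \<xi> z))) (at z)"
    by (rule has_derivative_transform_within_open[OF _ V z]) (simp add: c_eq)
  then have "frechet_derivative (\<lambda>z. T *v f z) (at z) X = D z X - (\<rho> z *\<^sub>R frechet_derivative \<xi> (at z) X + D\<rho> z X *\<^sub>R \<xi> z)"
    by (simp add: frechet_derivative_eqI)
  then show ?thesis
    unfolding frechet_derivative_linear_image[OF fd[OF z]] D\<xi>[OF z] by (simp add: algebra_simps)
qed

text \<open>Both sides are the \<open>\<xi>\<close>-component of \<open>T *v D z X\<close>, computed
  once by the Gauss formula for the tangent field \<open>T f\<close> and once by
  \<open>TD\<close>.\<close>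

lemma hZ:
  assumes z: "z \<in> V"
  shows "X \<bullet> (h z *v Z z) = - D\<rho> z X"
proof -
  have "frame_coeff f \<xi> z (frechet_derivative (\<lambda>z. T *v f z) (at z) X) $ None = X \<bullet> (h z *v Z z)"
    by (rule gauss[OF V z smooth(1) Z_smooth det[OF z] Tf])
  moreover have "frame_coeff f \<xi> z (T *v D z X) = append_coord (X + \<rho> z *\<^sub>R (S z *v X)) (- D\<rho> z X)"
    by (rule frame_coeff_eqI[OF fd[OF z] det[OF z]])
      (simp add: TD[OF z] linear_add[OF lin[OF z]] linear_cmul[OF lin[OF z]])
  ultimately show ?thesis unfolding frechet_derivative_linear_image[OF fd[OF z]] by simp
qed

definition \<alpha> where "\<alpha> z = 1 + \<rho> z * l1 z"

text \<open>\<open>\<alpha>\<close> is the factor that cancels all multiples of \<open>D z X\<close>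
  in \<open>TD\<close>, so that only the two directions \<open>D z e\<close> and
  \<open>\<xi> z\<close> survive in the last equation.\<close>

lemma shape:
  assumes z: "z \<in> V"
  obtains e b where "e \<noteq> 0" "b \<bullet> e = 1" "l0 z \<noteq> l1 z" "S z *v e = l0 z *\<^sub>R e"
    "\<And>X. S z *v X = l1 z *\<^sub>R X + ((l0 z - l1 z) * (b \<bullet> X)) *\<^sub>R e"
    "\<And>X. T *v D z X - \<alpha> z *\<^sub>R D z X = (\<rho> z * (l0 z - l1 z) * (b \<bullet> X)) *\<^sub>R D z e - D\<rho> z X *\<^sub>R \<xi> z"
proof -
  have l: "l0 z \<noteq> l1 z" "dim (eigenspace (S z) (l0 z)) = 1" "dim (eigenspace (S z) (l1 z)) = CARD('n) - 1"
    using patch z by (auto simp: congruent_patch_def)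
  obtain e b where eb: "e \<noteq> 0" "b \<bullet> e = 1" and S: "\<And>X. S z *v X = l1 z *\<^sub>R X + ((l0 z - l1 z) * (b \<bullet> X)) *\<^sub>R e"
    using rank_one_representation[OF l] by metis
  have "T *v D z X - \<alpha> z *\<^sub>R D z X = (\<rho> z * (l0 z - l1 z) * (b \<bullet> X)) *\<^sub>R D z e - D\<rho> z X *\<^sub>R \<xi> z" for X
    unfolding TD[OF z] S \<alpha>_def
    by (simp add: linear_add[OF lin[OF z]] linear_diff[OF lin[OF z]] linear_cmul[OF lin[OF z]] algebra_simps)
  moreover have "S z *v e = l0 z *\<^sub>R e" unfolding S using eb(2) by (simp add: algebra_simps)
  ultimately show ?thesis using that eb S l(1) by blast
qed

lemma D\<rho>_inner:
  assumes z: "z \<in> V"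
  shows "D\<rho> z X = (\<chi> i. D\<rho> z (axis i 1)) \<bullet> X"
  using frechet_derivative_partial[OF smooth_on_differentiable[OF \<rho>_smooth z], of X]
  by (simp add: partial_def inner_vec_def mult.commute)

lemma tangent_eigenvector:
  assumes z: "z \<in> V"
  obtains X where "X \<noteq> 0" "T *v D z X = \<alpha> z *\<^sub>R D z X"
proof -
  obtain e b where eq: "\<And>X. T *v D z X - \<alpha> z *\<^sub>R D z X = (\<rho> z * (l0 z - l1 z) * (b \<bullet> X)) *\<^sub>R D z e - D\<rho> z X *\<^sub>R \<xi> z"
    using shape[OF z] by metis
  obtain X where "X \<noteq> 0" "b \<bullet> X = 0" "(\<chi> i. D\<rho> z (axis i 1)) \<bullet> X = 0"
    using exists_common_kernel[OF dim3] by metis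
  then show ?thesis using that[of X] eq[of X] D\<rho>_inner[OF z, of X] by simp
qed

lemma \<alpha>_eigenvalue: "z \<in> V \<Longrightarrow> \<exists>w. w \<noteq> 0 \<and> T *v w = \<alpha> z *\<^sub>R w"
  using tangent_eigenvector D_eq_0_iff by metis

lemma \<alpha>_nz: "z \<in> V \<Longrightarrow> \<alpha> z \<noteq> 0"
proof
  assume z: "z \<in> V" and "\<alpha> z = 0"
  then obtain w where "w \<noteq> 0" "T *v w = 0" using \<alpha>_eigenvalue by (metis scaleR_zero_left)
  moreover have "inj ((*v) T)" using T inj_matrix_vector_mult invertible_det_nz by blast
  ultimately show False by (metis injD matrix_vector_mult_0_right)
qed

text \<open>
  The value \<open>\<sigma> = \<alpha> z\<close> is characterized by \<open>(1 - \<sigma>) id + \<rho> S\<close> having rank at most one at \<open>z\<close>, a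
  closed condition; as \<open>\<alpha>\<close> takes values in the finite spectrum of \<open>T\<close>, it is locally constant.
\<close>

definition rank_cond where
  "rank_cond \<sigma> z \<longleftrightarrow> (\<forall>X Y i k.
     ((1 - \<sigma>) *\<^sub>R X + \<rho> z *\<^sub>R (S z *v X)) $ i * ((1 - \<sigma>) *\<^sub>R Y + \<rho> z *\<^sub>R (S z *v Y)) $ k =
     ((1 - \<sigma>) *\<^sub>R X + \<rho> z *\<^sub>R (S z *v X)) $ k * ((1 - \<sigma>) *\<^sub>R Y + \<rho> z *\<^sub>R (S z *v Y)) $ i)"

text \<open>The operator is \<open>\<alpha> z - \<sigma>\<close> times the identity plus a rank one
  term that vanishes on the kernel of \<open>b\<close>. As this kernel has dimension at least two,
  the minors vanish only for \<open>\<sigma> = \<alpha> z\<close>.\<close>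

lemma rank_cond_iff:
  assumes z: "z \<in> V"
  shows "rank_cond \<sigma> z \<longleftrightarrow> \<sigma> = \<alpha> z"
proof -
  obtain e b where S: "\<And>X. S z *v X = l1 z *\<^sub>R X + ((l0 z - l1 z) * (b \<bullet> X)) *\<^sub>R e"
    using shape[OF z] by metis
  have M: "(1 - \<sigma>) *\<^sub>R X + \<rho> z *\<^sub>R (S z *v X) = (\<alpha> z - \<sigma>) *\<^sub>R X + (\<rho> z * (l0 z - l1 z) * (b \<bullet> X)) *\<^sub>R e" for X
    unfolding S \<alpha>_def by (simp add: algebra_simps)
  show ?thesis
  proof
    assume "\<sigma> = \<alpha> z"
    then show "rank_cond \<sigma> z" unfolding rank_cond_def M by simp
  next
    assume r: "rank_cond \<sigma> z"
    show "\<sigma> = \<alpha> z"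
    proof (rule ccontr)
      assume ne: "\<sigma> \<noteq> \<alpha> z"
      \<comment> \<open>Two orthogonal nonzero vectors in the kernel of \<open>b\<close>; vanishing
        minors would make them parallel.\<close>
      obtain X where X: "X \<noteq> 0" "b \<bullet> X = 0" using exists_common_kernel[OF dim3, of b b] by metis
      obtain Y where Y: "Y \<noteq> 0" "b \<bullet> Y = 0" "X \<bullet> Y = 0" using exists_common_kernel[OF dim3, of b X] by metis
      have "(\<alpha> z - \<sigma>) * X $ i * ((\<alpha> z - \<sigma>) * Y $ k) = (\<alpha> z - \<sigma>) * X $ k * ((\<alpha> z - \<sigma>) * Y $ i)" for i k
        using r[unfolded rank_cond_def M, rule_format, of X i Y k] X Y by simp
      then have XY: "X $ i * Y $ k = X $ k * Y $ i" for i k using ne by (simp add: mult_ac)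
      obtain i where i: "X $ i \<noteq> 0" using X(1) by (auto simp: vec_eq_iff)
      have "X $ i * (Y \<bullet> Y) = (\<Sum>k\<in>UNIV. X $ i * Y $ k * Y $ k)"
        by (simp add: inner_vec_def sum_distrib_left mult.assoc)
      also have "\<dots> = Y $ i * (X \<bullet> Y)"
        unfolding XY by (simp add: inner_vec_def sum_distrib_left mult_ac)
      finally show False using i Y by simp
    qed
  qed
qed

lemma open_not_rank_cond: "open {z \<in> V. \<not> rank_cond \<sigma> z}"
proof -
  let ?m = "\<lambda>X i z. ((1 - \<sigma>) *\<^sub>R X + \<rho> z *\<^sub>R (S z *v X)) $ i"
  have Sc: "smooth_on V (\<lambda>z. S z $ k $ i)" for k i
    unfolding shape_operator_def
    by simp (intro smooth_on_minus V smooth_on_vec_nth smooth_on_frame_coeff smooth smooth_on_partial det)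
  have mc: "continuous_on V (?m X i)" for X i
    unfolding matrix_vector_mult_def
    by simp (intro continuous_intros smooth_on_continuous[OF Sc] smooth_on_continuous[OF \<rho>_smooth])
  have "open {z \<in> V. ?m X i z * ?m Y k z \<noteq> ?m X k z * ?m Y i z}" for X Y i k
  proof -
    have "continuous_on V (\<lambda>z. ?m X i z * ?m Y k z - ?m X k z * ?m Y i z)"
      by (intro continuous_on_diff continuous_on_mult mc)
    then have "open (V \<inter> (\<lambda>z. ?m X i z * ?m Y k z - ?m X k z * ?m Y i z) -` (- {0}))"
      by (rule continuous_open_preimage[OF _ V]) auto
    moreover have "V \<inter> (\<lambda>z. ?m X i z * ?m Y k z - ?m X k z * ?m Y i z) -` (- {0}) =
       {z \<in> V. ?m X i z * ?m Y k z \<noteq> ?m X k z * ?m Y i z}" by auto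
    ultimately show ?thesis by simp
  qed
  then have "open (\<Union>X. \<Union>Y. \<Union>i. \<Union>k. {z \<in> V. ?m X i z * ?m Y k z \<noteq> ?m X k z * ?m Y i z})" by blast
  moreover have "{z \<in> V. \<not> rank_cond \<sigma> z} = (\<Union>X. \<Union>Y. \<Union>i. \<Union>k. {z \<in> V. ?m X i z * ?m Y k z \<noteq> ?m X k z * ?m Y i z})"
    unfolding rank_cond_def by blast
  ultimately show ?thesis by simp
qed

lemma \<alpha>_locally_constant:
  assumes z0: "z0 \<in> V"
  shows "\<exists>\<epsilon>>0. ball z0 \<epsilon> \<subseteq> V \<and> (\<forall>z\<in>ball z0 \<epsilon>. \<alpha> z = \<alpha> z0)"
proof -
  let ?E = "{\<sigma>. \<exists>w. w \<noteq> 0 \<and> T *v w = \<sigma> *\<^sub>R w}"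
  \<comment> \<open>Finitely many other eigenvalues have to be excluded, each on an open
    set.\<close>
  let ?U = "V \<inter> (\<Inter>\<sigma>\<in>?E - {\<alpha> z0}. {z \<in> V. \<not> rank_cond \<sigma> z})"
  have "open ?U" by (intro open_Int V open_INT finite_Diff finite_eigenvalues ballI open_not_rank_cond)
  moreover have "z0 \<in> ?U" using z0 rank_cond_iff[OF z0] by auto
  ultimately obtain \<epsilon> where \<epsilon>: "0 < \<epsilon>" "ball z0 \<epsilon> \<subseteq> ?U" by (rule openE)
  have "\<alpha> z = \<alpha> z0" if "z \<in> ball z0 \<epsilon>" for z
  proof (rule ccontr)
    assume "\<alpha> z \<noteq> \<alpha> z0"
    moreover have z: "z \<in> V" using that \<epsilon> by blast
    ultimately have "\<not> rank_cond (\<alpha> z) z" using that \<epsilon> \<alpha>_eigenvalue[OF z] by blast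
    then show False using rank_cond_iff[OF z] by blast
  qed
  then show ?thesis using \<epsilon> by blast
qed

end

context congruent_surface begin

text \<open>
  A vector \<open>w \<noteq> 0\<close> that is tangent to the surface at every point of an open set would be a
  direction in which the metric vanishes.
\<close>

lemma eigenspace_not_tangent:
  assumes U: "open U" "U \<subseteq> V" "z0 \<in> U"
  obtains z1 w where "z1 \<in> U" "T *v w = \<alpha> z0 *\<^sub>R w" "w \<notin> range (D z1)"
proof (rule ccontr)
  assume "\<not> thesis"
  then have *: "\<And>z w. z \<in> U \<Longrightarrow> T *v w = \<alpha> z0 *\<^sub>R w \<Longrightarrow> w \<in> range (D z)" using that by blast
  have z0: "z0 \<in> V" using U by blast
  obtain X0 where X0: "X0 \<noteq> 0" "T *v D z0 X0 = \<alpha> z0 *\<^sub>R D z0 X0" using tangent_eigenvector[OF z0] .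
  define w where "w = D z0 X0"
  define X where "X z = rest_coords (frame_coeff f \<xi> z w)" for z
  have fU: "smooth_on U f" "smooth_on U \<xi>" using smooth smooth_on_subset U(2) by blast+
  have detU: "det (frame f \<xi> z) \<noteq> 0" if "z \<in> U" for z using det U(2) that by blast
  have Xs: "smooth_on U X"
    unfolding X_def[abs_def]
    by (intro smooth_on_linear_image[OF bounded_linear_rest_coords] U(1) smooth_on_frame_coeff fU smooth_on_const detU)
  have wX: "w = D z (X z)" if z: "z \<in> U" for z
  proof -
    have zV: "z \<in> V" using z U(2) by blast
    obtain Y where Y: "w = D z Y" using *[OF z, of w] X0(2) unfolding w_def by blast
    show ?thesis unfolding X_def Y frame_coeff_tangent[OF fd[OF zV] det[OF zV]] by simp
  qed
  \<comment> \<open>The constant field \<open>w\<close> has derivative zero, and it equals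
    \<open>D z (X z)\<close> with \<open>X\<close> smooth. So the Gauss formula yields
    \<open>h(X0, X0) = 0\<close>.\<close>
  have "frame_coeff f \<xi> z0 (frechet_derivative (\<lambda>_. w) (at z0) X0) $ None = X0 \<bullet> (h z0 *v X z0)"
    by (rule gauss[OF U(1,3) fU(1) Xs detU[OF U(3)] wX])
  moreover have "frame_coeff f \<xi> z0 0 = 0" using linear_0[OF linear_frame_coeff] .
  moreover have "X z0 = X0"
    unfolding X_def w_def frame_coeff_tangent[OF fd[OF z0] det[OF z0]] by simp
  ultimately have "X0 \<bullet> (h z0 *v X0) = 0" by simp
  then show False using pos[OF z0 X0(1)] by simp
qed

lemma T_f:
  assumes z: "z \<in> V"
  shows "T *v f z - \<alpha> z *\<^sub>R f z = D z ((1 - \<alpha> z) *\<^sub>R Z z) + (- \<alpha> z * \<rho> z) *\<^sub>R \<xi> z"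
proof -
  have "\<alpha> z *\<^sub>R f z = \<alpha> z *\<^sub>R D z (Z z) + (\<alpha> z * \<rho> z) *\<^sub>R \<xi> z"
    by (subst f_eq[OF z]) (simp add: scaleR_add_right)
  then show ?thesis unfolding Tf[OF z] linear_cmul[OF lin[OF z]] by (simp add: algebra_simps)
qed

lemma \<alpha>_ne_1: "z \<in> V \<Longrightarrow> \<alpha> z \<noteq> 1"
  using \<rho>_nz l1 by (simp add: \<alpha>_def)

text \<open>Modulo the transversal vector \<open>w\<close>, which \<open>T - \<alpha>\<close>
  annihilates, every vector is tangent; hence the image of \<open>T - \<alpha>\<close> lies in the
  span of \<open>D z e\<close> and \<open>\<xi> z\<close>. If the image has dimension two, this span
  is the same plane for all z in an open set. It contains \<open>\<xi> z\<close> and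
  \<open>T f - \<alpha> f\<close>, then \<open>D z (Z z)\<close> because
  \<open>\<alpha> \<noteq> 1\<close>, and finally \<open>f z\<close>. But a plane cannot contain
  tangent spaces of dimension at least three.\<close>

lemma rank_one:
  assumes z0: "z0 \<in> V"
  obtains v \<phi> where "\<And>w. T *v w = \<alpha> z0 *\<^sub>R w + (\<phi> \<bullet> w) *\<^sub>R v"
proof -
  define M where "M = T - mat (\<alpha> z0)"
  have mat: "mat c *v w = c *\<^sub>R w" for c and w :: "real^'n option"
    by (simp add: vec_eq_iff mat_def matrix_vector_mult_def if_distrib[of "\<lambda>x. x * _"] cong: if_cong)
  have M: "M *v w = T *v w - \<alpha> z0 *\<^sub>R w" for w
    by (simp add: M_def matrix_vector_mult_diff_rdistrib mat)
  have "\<not> (\<exists>v w. independent {M *v v, M *v w} \<and> M *v v \<noteq> M *v w)"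
  proof
    assume "\<exists>v w. independent {M *v v, M *v w} \<and> M *v v \<noteq> M *v w"
    then obtain v1 v2 where ind: "independent {M *v v1, M *v v2}" "M *v v1 \<noteq> M *v v2" by blast
    let ?R = "span {M *v v1, M *v v2}"
    have dimR: "dim ?R = 2" using ind by (simp add: dim_eq_card_independent)
    obtain \<epsilon> where \<epsilon>: "0 < \<epsilon>" "ball z0 \<epsilon> \<subseteq> V" "\<And>z. z \<in> ball z0 \<epsilon> \<Longrightarrow> \<alpha> z = \<alpha> z0"
      using \<alpha>_locally_constant[OF z0] by blast
    obtain z1 w where z1: "z1 \<in> ball z0 \<epsilon>" "T *v w = \<alpha> z0 *\<^sub>R w" "w \<notin> range (D z1)"
      using eigenspace_not_tangent[OF open_ball \<epsilon>(2)] \<epsilon>(1) by (metis centre_in_ball)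
    \<comment> \<open>Transversality of \<open>w\<close> is an open condition, expressed by a
      nonzero \<open>\<xi>\<close>-component.\<close>
    define U where "U = ball z0 \<epsilon> \<inter> (\<lambda>z. frame_coeff f \<xi> z w $ None) -` (- {0})"
    have "smooth_on V (\<lambda>z. frame_coeff f \<xi> z w $ None)"
      by (intro smooth_on_vec_nth V smooth_on_frame_coeff smooth smooth_on_const det)
    then have "continuous_on (ball z0 \<epsilon>) (\<lambda>z. frame_coeff f \<xi> z w $ None)"
      using smooth_on_continuous continuous_on_subset \<epsilon>(2) by blast
    then have oU: "open U" unfolding U_def by (rule continuous_open_preimage) auto
    have UV: "U \<subseteq> V" using \<epsilon>(2) by (auto simp: U_def)
    have z1V: "z1 \<in> V" using z1 \<epsilon> by blast
    have "frame_coeff f \<xi> z1 w $ None \<noteq> 0"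
    proof
      assume "frame_coeff f \<xi> z1 w $ None = 0"
      then have "w = D z1 (rest_coords (frame_coeff f \<xi> z1 w))"
        using frame_coeff_expand[OF fd[OF z1V] det[OF z1V], of w] by simp
      then show False using z1(3) by blast
    qed
    then have z1U: "z1 \<in> U" using z1 by (simp add: U_def)
    have fR: "f z \<in> ?R" if "z \<in> U" for z
    proof -
      have z: "z \<in> V" and \<alpha>z: "\<alpha> z = \<alpha> z0" and wz: "frame_coeff f \<xi> z w $ None \<noteq> 0"
        using that \<epsilon>(2,3) by (auto simp: U_def)
      obtain e b where eq: "\<And>X. T *v D z X - \<alpha> z *\<^sub>R D z X = (\<rho> z * (l0 z - l1 z) * (b \<bullet> X)) *\<^sub>R D z e - D\<rho> z X *\<^sub>R \<xi> z"
        using shape[OF z] by metis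
      let ?W = "span {D z e, \<xi> z}"
      have MW: "M *v x \<in> ?W" for x
      proof -
        let ?s = "frame_coeff f \<xi> z x $ None / frame_coeff f \<xi> z w $ None"
        have lc: "linear (\<lambda>x. frame_coeff f \<xi> z x $ None)"
          using linear_frame_coeff[of f \<xi> z] by (simp add: linear_iff)
        have "frame_coeff f \<xi> z (x - ?s *\<^sub>R w) $ None = 0"
          unfolding linear_diff[OF lc] linear_cmul[OF lc] using wz by simp
        then obtain X where X: "x - ?s *\<^sub>R w = D z X"
          using frame_coeff_expand[OF fd[OF z] det[OF z], of "x - ?s *\<^sub>R w"] by auto
        \<comment> \<open>Subtracting a multiple of \<open>w\<close>, on which \<open>M\<close>
          vanishes, replaces \<open>x\<close> by a tangent vector.\<close>
        have "M *v x = M *v (x - ?s *\<^sub>R w)"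
          using z1(2) by (simp add: M matrix_vector_mult_diff_distrib matrix_vector_mult_scaleR algebra_simps)
        also have "\<dots> = (\<rho> z * (l0 z - l1 z) * (b \<bullet> X)) *\<^sub>R D z e - D\<rho> z X *\<^sub>R \<xi> z"
          unfolding X M \<alpha>z[symmetric] by (rule eq)
        also have "\<dots> \<in> ?W" by (intro span_diff span_scale span_base) auto
        finally show ?thesis .
      qed
      have "?R = ?W"
      proof (rule subspace_dim_equal)
        show "?R \<subseteq> ?W" by (rule span_minimal) (auto simp: MW)
        have "dim ?W \<le> card {D z e, \<xi> z}" by (simp add: dim_le_card')
        also have "\<dots> \<le> 2" by (simp add: card_insert_if)
        finally show "dim ?W \<le> dim ?R" using dimR by simp
      qed auto
      moreover have "D z e \<in> ?W" "\<xi> z \<in> ?W" by (simp_all add: span_base)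
      moreover have "T *v f z \<in> ?W"
      proof -
        have "M *v f z \<in> ?W" by (rule MW)
        then have "D z ((1 - \<alpha> z) *\<^sub>R Z z) + (- \<alpha> z * \<rho> z) *\<^sub>R \<xi> z \<in> ?W"
          unfolding M \<alpha>z[symmetric] T_f[OF z] .
        then have "D z ((1 - \<alpha> z) *\<^sub>R Z z) + (- \<alpha> z * \<rho> z) *\<^sub>R \<xi> z - (- \<alpha> z * \<rho> z) *\<^sub>R \<xi> z \<in> ?W"
          by (intro span_diff span_scale) (simp_all add: span_base)
        then have "D z ((1 - \<alpha> z) *\<^sub>R Z z) \<in> ?W" by simp
        then have "(1 / (1 - \<alpha> z)) *\<^sub>R D z ((1 - \<alpha> z) *\<^sub>R Z z) \<in> ?W" by (rule span_scale)
        then show ?thesis using \<alpha>_ne_1[OF z] by (simp add: Tf[OF z] linear_cmul[OF lin[OF z]])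
      qed
      ultimately have "D z (Z z) + \<rho> z *\<^sub>R \<xi> z \<in> ?R" unfolding Tf[OF z] by (simp add: span_add span_scale)
      then show ?thesis unfolding f_eq[OF z, symmetric] .
    qed
    have "range (D z1) \<subseteq> ?R"
      using derivative_in_subspace[OF oU z1U fR subspace_span fd[OF z1V]] by blast
    then have "dim (range (D z1)) \<le> 2" using dim_subset dimR by metis
    moreover have "dim (range (D z1)) = CARD('n)"
    proof -
      have "dim (D z1 ` UNIV) = dim (UNIV :: (real^'n) set)"
        by (rule dim_image_eq[OF lin[OF z1V]])
          (use an z1V in \<open>simp add: affine_normal_on_def immersion_on_def\<close>)
      then show ?thesis by simp
    qed
    ultimately show False using dim3 by simp
  qed
  then obtain v \<phi> where v: "\<And>w. M *v w = (\<phi> \<bullet> w) *\<^sub>R v" using rank_le_one[of M] by metis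
  show ?thesis by (rule that[of \<phi> v]) (use v in \<open>simp add: M algebra_simps\<close>)
qed

end

text \<open>The position vector is tangent to the orbits of the linear flow \<open>exp (s T)\<close>.\<close>

locale flow_surface = congruent_surface V f \<xi> T l0 l1
  for V :: "(real^'n::finite) set" and f \<xi> T l0 l1 +
  fixes a :: real and v \<phi> :: "real^('n option)"
  assumes a: "\<And>z. z \<in> V \<Longrightarrow> \<alpha> z = a" and T_eq: "\<And>w. T *v w = a *\<^sub>R w + (\<phi> \<bullet> w) *\<^sub>R v"
begin

definition \<beta> where "\<beta> = a + \<phi> \<bullet> v"

lemma T_v: "T *v v = \<beta> *\<^sub>R v" and \<phi>_T: "\<phi> \<bullet> (T *v w) = \<beta> * (\<phi> \<bullet> w)"
  unfolding T_eq \<beta>_def by (simp_all add: algebra_simps inner_add_right)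

text \<open>This is \<open>(T - a) (T - \<beta>) = 0\<close>: the image of \<open>T - a\<close> is
  spanned by \<open>v\<close>, which is an eigenvector for \<open>\<beta>\<close>.\<close>

lemma T_T: "T *v (T *v w) = (a + \<beta>) *\<^sub>R (T *v w) - (a * \<beta>) *\<^sub>R w"
proof -
  have "T *v (T *v w) = a *\<^sub>R (T *v w) + (\<phi> \<bullet> w) *\<^sub>R (T *v v)"
    by (subst (2) T_eq) (simp add: matrix_vector_right_distrib matrix_vector_mult_scaleR)
  also have "(\<phi> \<bullet> w) *\<^sub>R (T *v v) = \<beta> *\<^sub>R (T *v w - a *\<^sub>R w)"
    unfolding T_v by (simp add: T_eq)
  finally show ?thesis by (simp add: algebra_simps)
qed

context
  fixes z assumes z: "z \<in> V"
begin

lemma a_nz: "a \<noteq> 0" "a \<noteq> 1" using \<alpha>_nz[OF z] \<alpha>_ne_1[OF z] a[OF z] by simp_all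

lemma \<rho>_l1: "\<rho> z * l1 z = a - 1" using a[OF z] by (simp add: \<alpha>_def)

text \<open>The vector \<open>T f - a f\<close> equals \<open>\<phi> \<bullet> f z\<close> times
  \<open>v\<close> and has the nonzero \<open>\<xi>\<close>-component
  \<open>- a \<rho>\<close>.\<close>

lemma \<phi>_f: "\<phi> \<bullet> f z \<noteq> 0" and v_nz: "v \<noteq> 0"
proof -
  have "(\<phi> \<bullet> f z) *\<^sub>R v = D z ((1 - a) *\<^sub>R Z z) + (- a * \<rho> z) *\<^sub>R \<xi> z"
    using T_f[OF z] unfolding a[OF z] T_eq by simp
  moreover have "D z ((1 - a) *\<^sub>R Z z) + (- a * \<rho> z) *\<^sub>R \<xi> z \<noteq> D z 0 + 0 *\<^sub>R \<xi> z"
    unfolding coeff_unique[OF z] using a_nz \<rho>_nz[OF z] by simp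
  ultimately have "(\<phi> \<bullet> f z) *\<^sub>R v \<noteq> 0" using linear_0[OF lin[OF z]] by simp
  then show "\<phi> \<bullet> f z \<noteq> 0" "v \<noteq> 0" by auto
qed

lemma \<beta>_nz: "\<beta> \<noteq> 0"
proof
  assume "\<beta> = 0"
  then have "T *v v = T *v 0" using T_v by simp
  moreover have "inj ((*v) T)" using T inj_matrix_vector_mult invertible_det_nz by blast
  ultimately show False using v_nz injD by metis
qed

text \<open>Tangential parts and \<open>\<xi>\<close>-components are compared in identities whose
  other side is a multiple of \<open>v\<close>. On tangent vectors \<open>\<phi>\<close> and the
  differential of \<open>\<rho>\<close> are both multiples of \<open>b\<close>, and
  \<open>Z z\<close> is a multiple of \<open>e\<close>; the quadratic relation for \<open>T\<close>,
  applied to \<open>f\<close>, then yields \<open>D\<rho> z (Z z)\<close> and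
  \<open>l0 z\<close>.\<close>

lemma radial_derivatives:
  shows "D\<rho> z (Z z) = a * \<beta> * \<rho> z" "\<rho> z * l0 z = - (1 - a) * (1 - \<beta>)"
    "D\<rho> z X * (\<phi> \<bullet> f z) = a * \<rho> z * (\<phi> \<bullet> D z X)"
proof -
  obtain e b where e: "e \<noteq> 0" "b \<bullet> e = 1" and l: "l0 z \<noteq> l1 z" and Se: "S z *v e = l0 z *\<^sub>R e"
    and eq: "\<And>X. T *v D z X - \<alpha> z *\<^sub>R D z X = (\<rho> z * (l0 z - l1 z) * (b \<bullet> X)) *\<^sub>R D z e - D\<rho> z X *\<^sub>R \<xi> z"
    using shape[OF z] by metis
  let ?k = "\<rho> z * (l0 z - l1 z)"
  have k: "?k \<noteq> 0" using \<rho>_nz[OF z] l by simp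
  note lin = lin[OF z]
  have eq': "(\<phi> \<bullet> D z X) *\<^sub>R v = D z ((?k * (b \<bullet> X)) *\<^sub>R e) + (- D\<rho> z X) *\<^sub>R \<xi> z" for X
    using eq[of X] unfolding a[OF z] T_eq by (simp add: linear_cmul[OF lin])
  have lD\<rho>: "linear (D\<rho> z)" by (rule linear_frechet_derivative[OF smooth_on_differentiable[OF \<rho>_smooth z]])
  let ?p = "\<phi> \<bullet> D z e"
  have p0: "?p \<noteq> 0"
  proof
    assume "?p = 0"
    then have "D z (?k *\<^sub>R e) + (- D\<rho> z e) *\<^sub>R \<xi> z = D z 0 + 0 *\<^sub>R \<xi> z" using eq'[of e] e(2) linear_0[OF lin] by simp
    then show False unfolding coeff_unique[OF z] using k e(1) by simp
  qed
  \<comment> \<open>For \<open>?Y\<close> in the kernel of \<open>b\<close>, the vector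
    \<open>(T - a)\<close> applied to \<open>D z ?Y\<close> has no component along
    \<open>D z e\<close>, but \<open>v\<close> has one. So this multiple of \<open>v\<close> is
    zero, and with it both forms vanish on \<open>?Y\<close>.\<close>
  have prp: "\<phi> \<bullet> D z X = (b \<bullet> X) * ?p \<and> D\<rho> z X = (b \<bullet> X) * D\<rho> z e" for X
  proof -
    let ?Y = "X - (b \<bullet> X) *\<^sub>R e"
    have bY: "b \<bullet> ?Y = 0" using e(2) by (simp add: inner_diff_right)
    have "(\<phi> \<bullet> D z ?Y) *\<^sub>R (?p *\<^sub>R v) = ?p *\<^sub>R ((\<phi> \<bullet> D z ?Y) *\<^sub>R v)" by (simp add: mult.commute)
    then have "D z ((\<phi> \<bullet> D z ?Y * ?k) *\<^sub>R e) + (- (\<phi> \<bullet> D z ?Y) * D\<rho> z e) *\<^sub>R \<xi> z = D z 0 + (- ?p * D\<rho> z ?Y) *\<^sub>R \<xi> z"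
      unfolding eq' bY using e(2) by (simp add: linear_0[OF lin] linear_cmul[OF lin] scaleR_diff_right scaleR_add_right)
    then have "(\<phi> \<bullet> D z ?Y * ?k) *\<^sub>R e = 0" and s: "(\<phi> \<bullet> D z ?Y) * D\<rho> z e = ?p * D\<rho> z ?Y"
      unfolding coeff_unique[OF z] by simp_all
    then have \<phi>Y: "\<phi> \<bullet> D z ?Y = 0" using k e(1) by simp
    then have \<rho>Y: "D\<rho> z ?Y = 0" using s p0 by simp
    show ?thesis using \<phi>Y \<rho>Y
      by (simp add: linear_diff[OF lin] linear_cmul[OF lin] linear_diff[OF lD\<rho>] linear_cmul[OF lD\<rho>] inner_diff_right)
  qed
  \<comment> \<open>\<open>T f - a f\<close> and the image of \<open>D z e\<close> under
    \<open>T - a\<close> are multiples of the same \<open>v\<close>. Their tangential parts are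
    \<open>(1 - a) Z\<close> and a multiple of \<open>e\<close>.\<close>
  have Ze: "Z z = ((b \<bullet> Z z)) *\<^sub>R e"
  proof -
    have "(\<phi> \<bullet> f z) *\<^sub>R (?p *\<^sub>R v) = ?p *\<^sub>R ((\<phi> \<bullet> f z) *\<^sub>R v)" by (simp add: mult.commute)
    moreover have "(\<phi> \<bullet> f z) *\<^sub>R v = D z ((1 - a) *\<^sub>R Z z) + (- a * \<rho> z) *\<^sub>R \<xi> z"
      using T_f[OF z] unfolding a[OF z] T_eq by simp
    ultimately have "D z ((\<phi> \<bullet> f z * ?k) *\<^sub>R e) + (- (\<phi> \<bullet> f z) * D\<rho> z e) *\<^sub>R \<xi> z =
       D z ((?p * (1 - a)) *\<^sub>R Z z) + (- ?p * a * \<rho> z) *\<^sub>R \<xi> z"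
      unfolding eq' using e(2) by (simp add: linear_cmul[OF lin] scaleR_add_right scaleR_diff_right mult.assoc)
    then have c: "(\<phi> \<bullet> f z * ?k) *\<^sub>R e = (?p * (1 - a)) *\<^sub>R Z z" unfolding coeff_unique[OF z] by simp
    let ?c = "\<phi> \<bullet> f z * ?k / (?p * (1 - a))"
    have "(1 / (?p * (1 - a))) *\<^sub>R ((\<phi> \<bullet> f z * ?k) *\<^sub>R e) = Z z" unfolding c using p0 a_nz by simp
    then have Zc: "Z z = ?c *\<^sub>R e" by simp
    then have "b \<bullet> Z z = ?c" using e(2) by simp
    then show ?thesis using Zc by simp
  qed
  then have SZ: "S z *v Z z = l0 z *\<^sub>R Z z"
    using Se by (metis matrix_vector_mult_scaleR scaleR_left_commute)
  \<comment> \<open>\<open>TD\<close> in the direction \<open>Z z\<close>, on which S acts by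
    \<open>l0 z\<close>; the left side will be reduced by \<open>T_T\<close>.\<close>
  have "T *v (T *v f z) = T *v f z + (\<rho> z * l0 z) *\<^sub>R (T *v f z) - D\<rho> z (Z z) *\<^sub>R \<xi> z"
    using TD[OF z, of "Z z"] unfolding SZ Tf[OF z, symmetric] linear_cmul[OF lin] by simp
  then have "(a + \<beta>) *\<^sub>R D z (Z z) - (a * \<beta>) *\<^sub>R (D z (Z z) + \<rho> z *\<^sub>R \<xi> z) =
      D z (Z z) + (\<rho> z * l0 z) *\<^sub>R D z (Z z) - D\<rho> z (Z z) *\<^sub>R \<xi> z"
    unfolding T_T unfolding Tf[OF z] f_eq[OF z, symmetric] .
  then have "D z ((a + \<beta> - a * \<beta>) *\<^sub>R Z z) + (- a * \<beta> * \<rho> z) *\<^sub>R \<xi> z =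
      D z ((1 + \<rho> z * l0 z) *\<^sub>R Z z) + (- D\<rho> z (Z z)) *\<^sub>R \<xi> z"
    unfolding linear_cmul[OF lin] by (simp add: algebra_simps)
  then have 1: "(a + \<beta> - a * \<beta>) *\<^sub>R Z z = (1 + \<rho> z * l0 z) *\<^sub>R Z z" and 2: "D\<rho> z (Z z) = a * \<beta> * \<rho> z"
    unfolding coeff_unique[OF z] by simp_all
  show "D\<rho> z (Z z) = a * \<beta> * \<rho> z" by (rule 2)
  have "a + \<beta> - a * \<beta> = 1 + \<rho> z * l0 z" using 1 Z_nz[OF z] by simp
  then show "\<rho> z * l0 z = - (1 - a) * (1 - \<beta>)" by (simp add: algebra_simps)
  have "\<beta> * (\<phi> \<bullet> f z) = (b \<bullet> Z z) * ?p"
    using prp[of "Z z"] \<phi>_T[of "f z"] unfolding Tf[OF z] by simp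
  note 3 = this
  have 4: "a * \<beta> * \<rho> z = (b \<bullet> Z z) * D\<rho> z e" using prp[of "Z z"] 2 by simp
  \<comment> \<open>Both forms are multiples of \<open>b\<close>, so their ratio may be computed
    along \<open>Z z\<close>.\<close>
  have "\<beta> * (D\<rho> z X * (\<phi> \<bullet> f z)) = D\<rho> z X * (\<beta> * (\<phi> \<bullet> f z))" by simp
  also have "\<dots> = (b \<bullet> X) * ?p * ((b \<bullet> Z z) * D\<rho> z e)" unfolding 3 using prp[of X] by simp
  also have "\<dots> = \<beta> * (a * \<rho> z * (\<phi> \<bullet> D z X))" unfolding 4[symmetric] using prp[of X] by simp
  finally have "\<beta> * (D\<rho> z X * (\<phi> \<bullet> f z)) = \<beta> * (a * \<rho> z * (\<phi> \<bullet> D z X))" .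
  then show "D\<rho> z X * (\<phi> \<bullet> f z) = a * \<rho> z * (\<phi> \<bullet> D z X)" using \<beta>_nz by simp
qed

lemma sign: "a * \<beta> * \<rho> z < 0"
  using hZ[OF z, of "Z z"] pos[OF z Z_nz[OF z]] radial_derivatives(1) by simp

end

end

section \<open>Coordinates adapted to the flow\<close>

text \<open>On a convex domain \<open>y\<close> keeps its sign and differential identities integrate
  to identities on all of \<open>V\<close>.\<close>

locale flow_chart = flow_surface V f \<xi> T l0 l1 a v \<phi>
  for V :: "(real^('k::finite option)) set" and f \<xi> T l0 l1 a v \<phi> +
  fixes z0 assumes convexV: "convex V" and z0: "z0 \<in> V"
begin

definition x0 where "x0 = \<phi> \<bullet> f z0"
definition y where "y z = \<phi> \<bullet> f z / x0"

lemma x0: "x0 \<noteq> 0" unfolding x0_def by (rule \<phi>_f[OF z0])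

lemma a_nz': "a \<noteq> 0" "a \<noteq> 1" and \<beta>_nz': "\<beta> \<noteq> 0" and v_nz': "v \<noteq> 0"
  using a_nz[OF z0] \<beta>_nz[OF z0] v_nz[OF z0] by auto

lemma \<phi>f_y: "\<phi> \<bullet> f z = x0 * y z" using x0 by (simp add: y_def)

lemma y_z0: "y z0 = 1" using x0 by (simp add: y_def x0_def)

lemma y_smooth: "smooth_on V y"
proof -
  have "smooth_on V (\<lambda>z. (1 / x0) * (\<phi> \<bullet> f z))"
    by (intro smooth_on_mult V smooth_on_const smooth_on_linear_image[OF bounded_linear_inner_right] smooth)
  then show ?thesis by (simp add: y_def[abs_def])
qed

lemma Dy:
  assumes z: "z \<in> V"
  shows "(y has_derivative (\<lambda>X. \<phi> \<bullet> D z X / x0)) (at z)"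
proof -
  have "((\<lambda>z. (1 / x0) *\<^sub>R (\<phi> \<bullet> f z)) has_derivative (\<lambda>X. (1 / x0) *\<^sub>R (\<phi> \<bullet> D z X))) (at z)"
    by (intro has_derivative_scaleR_right bounded_linear.has_derivative[OF bounded_linear_inner_right]
        smooth_on_has_derivative[OF smooth(1) z])
  then show ?thesis by (simp add: y_def[abs_def])
qed

lemma y_pos: "z \<in> V \<Longrightarrow> y z > 0"
proof (rule ccontr)
  assume z: "z \<in> V" and "\<not> y z > 0"
  have "connected (y ` V)"
    by (rule connected_continuous_image[OF smooth_on_continuous[OF y_smooth] convex_connected[OF convexV]])
  then have "{y z..y z0} \<subseteq> y ` V" using z z0 by (intro connected_contains_Icc) auto
  moreover have "0 \<in> {y z..y z0}" using \<open>\<not> y z > 0\<close> y_z0 by simp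
  ultimately obtain z' where "z' \<in> V" "y z' = 0" by (metis imageE subsetD)
  then show False using \<phi>_f[of z'] \<phi>f_y[of z'] by simp
qed

text \<open>The third relation in \<open>radial_derivatives\<close> states that the logarithmic
  differential of \<open>\<rho>\<close> is \<open>a\<close> times that of \<open>y\<close>.\<close>

lemma \<rho>_y: "z \<in> V \<Longrightarrow> \<rho> z = \<rho> z0 * y z powr a"
proof -
  assume z: "z \<in> V"
  have "\<exists>c. \<forall>z\<in>V. \<rho> z * y z powr (- a) = c"
  proof (rule has_derivative_zero_constant[OF convexV])
    fix z assume z: "z \<in> V"
    have yp: "y z > 0" by (rule y_pos[OF z])
    have P: "((\<lambda>t. t powr (- a)) has_derivative (\<lambda>X. (- a * y z powr (- a - 1)) * X)) (at (y z))"
      by (rule has_real_derivative_powr[OF yp, unfolded has_field_derivative_def])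
    have p: "((\<lambda>z. y z powr (- a)) has_derivative (\<lambda>X. (- a * y z powr (- a - 1)) * (\<phi> \<bullet> D z X / x0))) (at z)"
      using diff_chain_at[OF Dy[OF z] P] by (simp add: o_def)
    have "((\<lambda>z. \<rho> z * y z powr (- a)) has_derivative
        (\<lambda>X. \<rho> z * ((- a * y z powr (- a - 1)) * (\<phi> \<bullet> D z X / x0)) + D\<rho> z X * y z powr (- a))) (at z)"
      by (rule has_derivative_mult[OF smooth_on_has_derivative[OF \<rho>_smooth z] p])
    moreover have "\<rho> z * ((- a * y z powr (- a - 1)) * (\<phi> \<bullet> D z X / x0)) + D\<rho> z X * y z powr (- a) = 0" for X
    proof -
      have "D\<rho> z X * (x0 * y z) = a * \<rho> z * (\<phi> \<bullet> D z X)" using radial_derivatives(3)[OF z, of X] \<phi>f_y by simp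
      then have "D\<rho> z X = a * \<rho> z * (\<phi> \<bullet> D z X) / (x0 * y z)" using x0 yp by (simp add: eq_divide_eq)
      then show ?thesis using x0 yp by (simp add: powr_diff field_simps)
    qed
    ultimately show "((\<lambda>z. \<rho> z * y z powr (- a)) has_derivative (\<lambda>h. 0)) (at z within V)"
      by (simp add: has_derivative_at_withinI)
  qed
  then have "\<rho> z * y z powr (- a) = \<rho> z0 * y z0 powr (- a)" using z z0 by metis
  then have "\<rho> z / y z powr a = \<rho> z0" by (simp add: y_z0 powr_minus_divide)
  then show ?thesis using y_pos[OF z] by (simp add: field_simps)
qed

text \<open>
  Linear coordinates \<open>((Q, \<psi>), \<omega>)\<close> for the decomposition of the ambient space into the tangent
  directions annihilated by \<open>\<phi>\<close>, the position vector \<open>f z0\<close>, and the vector \<open>v\<close>.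
\<close>

lemma ambient_coordinates:
  obtains L0 :: "real^('k option option)^('k option option)" where "det L0 \<noteq> 0"
    "L0 *v f z0 = append_coord (append_coord 0 1) 0" "L0 *v v = append_coord 0 1"
    "\<And>X. \<phi> \<bullet> D z0 X = 0 \<Longrightarrow> (L0 *v D z0 X) $ None = 0 \<and> (L0 *v D z0 X) $ Some None = 0"
    "\<And>w. \<phi> \<bullet> w = x0 * (L0 *v w) $ Some None + (\<phi> \<bullet> v) * (L0 *v w) $ None"
proof -
  note lin = lin[OF z0]
  define c where "c = (\<chi> i. \<phi> \<bullet> D z0 (axis i 1))"
  have c: "c \<bullet> X = \<phi> \<bullet> D z0 X" for X
    unfolding frechet_derivative_partial[OF fd[OF z0], of X] inner_vec_def[of c]
    by (simp add: c_def inner_sum_right partial_def mult.commute)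
  have "\<phi> \<bullet> D z0 (Z z0) = \<beta> * x0" using \<phi>_T[of "f z0"] by (simp add: Tf[OF z0] x0_def)
  then have c0: "c \<noteq> 0" using c[of "Z z0"] \<beta>_nz' x0 by auto
  \<comment> \<open>The null space of \<open>\<phi>\<close> in the tangent space is a hyperplane,
    since \<open>\<phi>\<close> does not vanish on \<open>Z z0\<close>. An isometry identifies it
    with \<open>real^'k\<close>.\<close>
  have "dim (UNIV :: (real^'k) set) = dim {X. c \<bullet> X = 0}"
    by (simp add: dim_hyperplane[OF c0] card_UNIV_option)
  then obtain j :: "real^'k \<Rightarrow> real^('k option)" where j: "linear j" "j ` UNIV = {X. c \<bullet> X = 0}" "\<And>u. norm (j u) = norm u"
    using isometry_subspaces[OF subspace_UNIV subspace_hyperplane[of c]] by (metis UNIV_I)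
  define B where "B w = D z0 (j (rest_coords (rest_coords w))) + (w $ Some None) *\<^sub>R f z0 + (w $ None) *\<^sub>R v" for w
  have linB: "linear B"
    unfolding B_def
    by (rule linearI)
      (simp_all add: linear_add[OF lin] linear_cmul[OF lin] linear_add[OF j(1)] linear_cmul[OF j(1)] algebra_simps
        linear_add[OF bounded_linear.linear[OF bounded_linear_rest_coords]]
        linear_cmul[OF bounded_linear.linear[OF bounded_linear_rest_coords]])
  have \<phi>j: "\<phi> \<bullet> D z0 (j u) = 0" for u using rangeI[of j u] c[of "j u"] by (simp add: j(2))
  have \<phi>B: "\<phi> \<bullet> B w = x0 * w $ Some None + (\<phi> \<bullet> v) * w $ None" for w
    by (simp add: B_def inner_add_right \<phi>j x0_def mult.commute)
  have "B w = 0 \<Longrightarrow> w = 0" for w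
  proof -
    assume Bw: "B w = 0"
    let ?u = "rest_coords (rest_coords w)" and ?s = "w $ Some None" and ?r = "w $ None"
    \<comment> \<open>\<open>T f - a f\<close> at \<open>z0\<close> expresses \<open>v\<close> in
      the frame, so a vanishing combination can be compared componentwise; pairing its tangential
      part with \<open>c\<close> then isolates the coefficient of \<open>Z z0\<close>.\<close>
    have x0v: "x0 *\<^sub>R v = D z0 ((1 - a) *\<^sub>R Z z0) + (- a * \<rho> z0) *\<^sub>R \<xi> z0"
      using T_f[OF z0] unfolding a[OF z0] T_eq x0_def by simp
    have "x0 *\<^sub>R B w = D z0 (x0 *\<^sub>R j ?u) + (x0 * ?s) *\<^sub>R (D z0 (Z z0) + \<rho> z0 *\<^sub>R \<xi> z0) + ?r *\<^sub>R (x0 *\<^sub>R v)"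
      by (simp add: B_def linear_cmul[OF lin] scaleR_add_right mult.commute f_eq[OF z0, symmetric])
    also have "\<dots> = D z0 (x0 *\<^sub>R j ?u + (x0 * ?s + ?r * (1 - a)) *\<^sub>R Z z0) + ((x0 * ?s - ?r * a) * \<rho> z0) *\<^sub>R \<xi> z0"
      unfolding x0v by (simp add: linear_add[OF lin] linear_cmul[OF lin] algebra_simps del: scaleR_diff_left)
        (simp add: linear_diff[OF lin] linear_cmul[OF lin] algebra_simps)
    finally have "D z0 (x0 *\<^sub>R j ?u + (x0 * ?s + ?r * (1 - a)) *\<^sub>R Z z0) + ((x0 * ?s - ?r * a) * \<rho> z0) *\<^sub>R \<xi> z0 = D z0 0 + 0 *\<^sub>R \<xi> z0"
      using Bw by (simp add: linear_0[OF lin])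
    then have 1: "x0 *\<^sub>R j ?u + (x0 * ?s + ?r * (1 - a)) *\<^sub>R Z z0 = 0" and 2: "x0 * ?s = ?r * a"
      unfolding coeff_unique[OF z0] using \<rho>_nz[OF z0] by auto
    have "c \<bullet> (x0 *\<^sub>R j ?u + (x0 * ?s + ?r * (1 - a)) *\<^sub>R Z z0) = 0" unfolding 1 by simp
    then have "(x0 * ?s + ?r * (1 - a)) * (\<beta> * x0) = 0"
      using \<open>\<phi> \<bullet> D z0 (Z z0) = \<beta> * x0\<close> by (simp add: inner_add_right c \<phi>j)
    then have "x0 * ?s + ?r * (1 - a) = 0" using \<beta>_nz' x0 by simp
    then have r: "?r = 0" using 2 by (simp add: algebra_simps)
    then have s: "?s = 0" using 2 x0 by simp
    have "j ?u = 0" using 1 r s x0 by simp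
    then have "?u = 0" using j(3)[of ?u] by simp
    then show "w = 0" using r s by (simp add: vec_eq_iff split_option_all)
  qed
  then have "inj B" using linear_injective_0[OF linB] by blast
  then have detB: "det (matrix B) \<noteq> 0" using det_nz_iff_inj[OF linB] by simp
  define L0 where "L0 = matrix_inv (matrix B)"
  have Bm: "matrix B *v w = B w" for w by (metis linB matrix_vector_mul(2))
  have LB: "L0 *v B w = w" and BL: "B (L0 *v w) = w" for w
  proof -
    have "L0 *v (matrix B *v w) = w" "matrix B *v (L0 *v w) = w"
      using matrix_inv_mult[OF detB] by (simp_all add: matrix_vector_mul_assoc L0_def)
    then show "L0 *v B w = w" "B (L0 *v w) = w" by (simp_all only: Bm)
  qed
  show ?thesis
  proof
    have "det (matrix B ** L0) = 1" using matrix_inv_mult[OF detB] by (simp add: L0_def)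
    then show "det L0 \<noteq> 0" by (auto simp: det_mul)
    have j0: "j 0 = 0" by (rule linear_0[OF j(1)])
    have "B (append_coord (append_coord 0 1) 0) = f z0" by (simp add: B_def j0 linear_0[OF lin])
    then show "L0 *v f z0 = append_coord (append_coord 0 1) 0" using LB by metis
    have "rest_coords (0 :: real^('k option)) = 0" by (simp add: vec_eq_iff)
    then have "B (append_coord 0 1) = v" by (simp add: B_def j0 linear_0[OF lin])
    then show "L0 *v v = append_coord 0 1" using LB by metis
    show "(L0 *v D z0 X) $ None = 0 \<and> (L0 *v D z0 X) $ Some None = 0" if X: "\<phi> \<bullet> D z0 X = 0" for X
    proof -
      obtain u where "X = j u" using X j(2) c by (metis (mono_tags, lifting) imageE mem_Collect_eq)
      then have "B (append_coord (append_coord u 0) 0) = D z0 X" by (simp add: B_def)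
      then have "L0 *v D z0 X = append_coord (append_coord u 0) 0" using LB by metis
      then show ?thesis by simp
    qed
    show "\<phi> \<bullet> w = x0 * (L0 *v w) $ Some None + (\<phi> \<bullet> v) * (L0 *v w) $ None" for w
      using \<phi>B[of "L0 *v w"] BL by simp
  qed
qed

end

text \<open>\<open>\<sigma>\<close> and \<open>\<tau>\<close> are the scales of u and t, left open
  until the metric and, in the logarithmic case, the Hessian determinant are normalized.\<close>

locale flow_coordinates = flow_chart V f \<xi> T l0 l1 a v \<phi> z0
  for V :: "(real^('k::finite option)) set" and f \<xi> T l0 l1 a v \<phi> z0 +
  fixes L0 :: "real^('k option option)^('k option option)" and \<sigma> \<tau> :: real
  assumes detL0: "det L0 \<noteq> 0" and L0_f: "L0 *v f z0 = append_coord (append_coord 0 1) 0"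
    and L0_v: "L0 *v v = append_coord 0 1"
    and L0_D: "\<And>X. \<phi> \<bullet> D z0 X = 0 \<Longrightarrow> (L0 *v D z0 X) $ None = 0 \<and> (L0 *v D z0 X) $ Some None = 0"
    and L0_\<phi>: "\<And>w. \<phi> \<bullet> w = x0 * (L0 *v w) $ Some None + (\<phi> \<bullet> v) * (L0 *v w) $ None"
    and \<sigma>: "0 < \<sigma>" and \<tau>: "0 < \<tau>"
begin

definition Q where "Q w = rest_coords (rest_coords (L0 *v w))"
definition \<psi> where "\<psi> w = (L0 *v w) $ Some None"
definition \<omega> where "\<omega> w = (L0 *v w) $ None"

lemma bounded_linear_coordinates: "bounded_linear Q" "bounded_linear \<psi>" "bounded_linear \<omega>"
  unfolding Q_def[abs_def] \<psi>_def[abs_def] \<omega>_def[abs_def]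
  by (intro bounded_linear_compose[OF bounded_linear_rest_coords] bounded_linear_compose[OF bounded_linear_vec_nth]
      matrix_vector_mul_bounded_linear)+

lemma coordinates_0: "Q w = 0 \<Longrightarrow> \<psi> w = 0 \<Longrightarrow> \<omega> w = 0 \<Longrightarrow> w = 0"
proof -
  assume "Q w = 0" "\<psi> w = 0" "\<omega> w = 0"
  then have "L0 *v w = L0 *v 0" by (simp add: Q_def \<psi>_def \<omega>_def vec_eq_iff split_option_all)
  moreover have "inj ((*v) L0)" using detL0 inj_matrix_vector_mult invertible_det_nz by blast
  ultimately show "w = 0" by (metis injD)
qed

lemma coordinates_T:
  "Q (T *v w) = a *\<^sub>R Q w" "\<psi> (T *v w) = a * \<psi> w" "\<omega> (T *v w) = a * \<omega> w + \<phi> \<bullet> w"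
  unfolding T_eq Q_def \<psi>_def \<omega>_def
  by (simp_all add: matrix_vector_right_distrib matrix_vector_mult_scaleR L0_v vec_eq_iff)

text \<open>Along the flow \<open>Q (f z)\<close> grows with rate \<open>a\<close> and
  \<open>y\<close> with rate \<open>\<beta>\<close>, so the first component is invariant. The square
  of the second is proportional to \<open>y powr a\<close>, that is, to
  \<open>\<rho>\<close>.\<close>

definition \<Psi> where
  "\<Psi> z = append_coord ((\<sigma> * y z powr (- a / \<beta>)) *\<^sub>R Q (f z)) (\<tau> * y z powr (a / 2))"

lemma \<Psi>_smooth: "smooth_on V \<Psi>"
  unfolding \<Psi>_def[abs_def]
  by (intro smooth_on_append_coord smooth_on_scaleR smooth_on_mult smooth_on_const smooth_on_powr V y_smooth y_pos
      smooth_on_linear_image[OF bounded_linear_coordinates(1)] smooth)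

lemma D\<Psi>:
  assumes z: "z \<in> V"
  shows "frechet_derivative \<Psi> (at z) X = append_coord
    ((\<sigma> * y z powr (- a / \<beta>)) *\<^sub>R (Q (D z X) - (a / \<beta> * (\<phi> \<bullet> D z X) / (x0 * y z)) *\<^sub>R Q (f z)))
    (\<tau> * (a / 2) * y z powr (a / 2) * (\<phi> \<bullet> D z X) / (x0 * y z))"
proof -
  have yp: "y z > 0" by (rule y_pos[OF z])
  have p: "((\<lambda>z. c * y z powr b) has_derivative (\<lambda>X. c * (b * y z powr (b - 1) * (\<phi> \<bullet> D z X / x0)))) (at z)" for b c
  proof -
    have P: "((\<lambda>t. t powr b) has_derivative (\<lambda>X. (b * y z powr (b - 1)) * X)) (at (y z))"
      by (rule has_real_derivative_powr[OF yp, unfolded has_field_derivative_def])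
    show ?thesis
      using has_derivative_mult_right[OF diff_chain_at[OF Dy[OF z] P], of c] by (simp add: o_def)
  qed
  have q: "((\<lambda>z. Q (f z)) has_derivative (\<lambda>X. Q (D z X))) (at z)"
    by (rule bounded_linear.has_derivative[OF bounded_linear_coordinates(1) smooth_on_has_derivative[OF smooth(1) z]])
  have "(\<Psi> has_derivative (\<lambda>X. append_coord
     ((\<sigma> * y z powr (- a / \<beta>)) *\<^sub>R Q (D z X) + (\<sigma> * (- a / \<beta> * y z powr (- a / \<beta> - 1) * (\<phi> \<bullet> D z X / x0))) *\<^sub>R Q (f z))
     (\<tau> * (a / 2 * y z powr (a / 2 - 1) * (\<phi> \<bullet> D z X / x0))))) (at z)"
    unfolding \<Psi>_def[abs_def] by (intro has_derivative_append_coord has_derivative_scaleR p q)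
  note frechet_derivative_eqI[OF this]
  then have "frechet_derivative \<Psi> (at z) X = append_coord
     ((\<sigma> * y z powr (- a / \<beta>)) *\<^sub>R Q (D z X) + (\<sigma> * (- a / \<beta> * y z powr (- a / \<beta> - 1) * (\<phi> \<bullet> D z X / x0))) *\<^sub>R Q (f z))
     (\<tau> * (a / 2 * y z powr (a / 2 - 1) * (\<phi> \<bullet> D z X / x0)))" by simp
  moreover have "y z powr (b - 1) = y z powr b / y z" for b using yp by (simp add: powr_diff)
  ultimately show ?thesis by (simp add: scaleR_diff_right mult_ac)
qed

lemma \<Psi>_z0: "\<Psi> z0 = append_coord 0 \<tau>"
proof -
  have "Q (f z0) = 0" unfolding Q_def L0_f by simp
  then show ?thesis by (simp add: \<Psi>_def y_z0)
qed

lemma D\<Psi>_inj: "inj (frechet_derivative \<Psi> (at z0))"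
proof -
  have lin\<Psi>: "linear (frechet_derivative \<Psi> (at z0))"
    by (rule linear_frechet_derivative[OF smooth_on_differentiable[OF \<Psi>_smooth z0]])
  have "X = 0" if "frechet_derivative \<Psi> (at z0) X = 0" for X
  proof -
    have "\<tau> * (a / 2) * (\<phi> \<bullet> D z0 X) / x0 = 0"
      and q: "\<sigma> *\<^sub>R (Q (D z0 X) - (a / \<beta> * (\<phi> \<bullet> D z0 X) / x0) *\<^sub>R Q (f z0)) = 0"
      using that unfolding D\<Psi>[OF z0] by (simp_all add: y_z0)
    then have \<phi>0: "\<phi> \<bullet> D z0 X = 0" using \<tau> a_nz' x0 by simp
    then have "Q (D z0 X) = 0" using q \<sigma> by simp
    then have "D z0 X = 0" using L0_D[OF \<phi>0] by (intro coordinates_0) (simp_all add: \<psi>_def \<omega>_def)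
    then show "X = 0" using D_eq_0_iff[OF z0] by blast
  qed
  then show ?thesis using linear_injective_0[OF lin\<Psi>] by blast
qed

lemma D\<Psi>_Z:
  assumes z: "z \<in> V"
  shows "frechet_derivative \<Psi> (at z) (Z z) = (a * \<beta> / 2 * \<Psi> z $ None) *\<^sub>R axis None 1"
proof -
  have "\<phi> \<bullet> D z (Z z) = \<beta> * (x0 * y z)" using \<phi>_T[of "f z"] by (simp add: Tf[OF z] \<phi>f_y)
  moreover have "Q (D z (Z z)) = a *\<^sub>R Q (f z)" using coordinates_T(1)[of "f z"] by (simp add: Tf[OF z])
  ultimately show ?thesis
    unfolding D\<Psi>[OF z] append_coord_axis using x0 y_pos[OF z] \<beta>_nz'
    by (simp add: \<Psi>_def append_coord_scaleR)
qed

lemma box: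
  obtains U I \<Omega> \<Phi> where "open U" "U \<subseteq> V" "z0 \<in> U" "open_interval I" "I \<subseteq> {0<..}" "open \<Omega>" "\<Omega> \<noteq> {}"
    "homeomorphism U (product_domain I \<Omega>) \<Psi> \<Phi>" "smooth_on (product_domain I \<Omega>) \<Phi>"
    "\<And>z. z \<in> U \<Longrightarrow> inj (frechet_derivative \<Psi> (at z))"
proof -
  obtain U W \<Phi> where UW: "open U" "U \<subseteq> V" "z0 \<in> U" "open W" "\<Psi> z0 \<in> W" "homeomorphism U W \<Psi> \<Phi>"
    "smooth_on W \<Phi>" and inj: "\<And>x. x \<in> U \<Longrightarrow> inj (frechet_derivative \<Psi> (at x))"
    using smooth_on_local_inverse[OF \<Psi>_smooth V z0 D\<Psi>_inj] by metis
  obtain \<epsilon> where \<epsilon>: "0 < \<epsilon>" "ball (\<Psi> z0) \<epsilon> \<subseteq> W" using UW(4,5) by (rule openE)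
  \<comment> \<open>The bound by \<open>\<tau>\<close> keeps the interval positive; half of
    \<open>\<epsilon>\<close> for each factor keeps the box inside the ball.\<close>
  define \<delta> where "\<delta> = min (\<epsilon> / 2) \<tau>"
  have \<delta>: "0 < \<delta>" "\<delta> \<le> \<epsilon> / 2" "\<delta> \<le> \<tau>" using \<epsilon> \<tau> by (auto simp: \<delta>_def)
  let ?I = "{\<tau> - \<delta><..<\<tau> + \<delta>}" and ?\<Omega> = "ball 0 \<delta> :: (real^'k) set"
  have W: "product_domain ?I ?\<Omega> \<subseteq> W"
  proof
    fix z :: "real^('k option)" assume "z \<in> product_domain ?I ?\<Omega>"
    then have z: "\<bar>z $ None - \<tau>\<bar> < \<delta>" "norm (rest_coords z) < \<delta>" by (auto simp: product_domain_def)
    have "z - \<Psi> z0 = append_coord (rest_coords z) 0 + append_coord 0 (z $ None - \<tau>)"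
      unfolding \<Psi>_z0 by (simp add: vec_option_eq_iff)
    then have "norm (z - \<Psi> z0) \<le> norm (append_coord (rest_coords z) 0) + norm (append_coord (0 :: real^'k) (z $ None - \<tau>))"
      by (simp add: norm_triangle_ineq)
    also have "norm (append_coord (rest_coords z) 0) = norm (rest_coords z)"
      by (simp add: norm_eq_sqrt_inner inner_vec_def sum_UNIV_option)
    also have "norm (append_coord (0 :: real^'k) (z $ None - \<tau>)) = \<bar>z $ None - \<tau>\<bar>"
      by (simp add: norm_eq_sqrt_inner inner_vec_def sum_UNIV_option)
    finally have "norm (z - \<Psi> z0) < \<epsilon>" using z \<delta> by linarith
    then show "z \<in> W" using \<epsilon>(2) by (auto simp: dist_norm norm_minus_commute)
  qed
  let ?P = "product_domain ?I ?\<Omega>"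
  have oP: "open ?P" by (rule open_product_domain) auto
  let ?U = "\<Phi> ` ?P"
  have gf: "\<Phi> (\<Psi> x) = x" if "x \<in> U" for x using UW(6) that by (simp add: homeomorphism_def)
  have fg: "\<Psi> (\<Phi> w) = w" if "w \<in> W" for w using UW(6) that by (simp add: homeomorphism_def)
  have imW: "\<Phi> ` W = U" using UW(6) by (simp add: homeomorphism_def)
  have U': "?U = U \<inter> \<Psi> -` ?P" 
  proof (intro equalityI subsetI)
    fix x assume "x \<in> ?U"
    then show "x \<in> U \<inter> \<Psi> -` ?P" using W fg imW by auto
  next
    fix x assume "x \<in> U \<inter> \<Psi> -` ?P"
    then show "x \<in> ?U" using gf by (metis IntE image_eqI vimageE)
  qed
  have "continuous_on U \<Psi>" using UW(6) by (simp add: homeomorphism_def)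
  then have oU: "open ?U" unfolding U' by (rule continuous_open_preimage[OF _ UW(1) oP])
  have "homeomorphism ?U ?P \<Psi> \<Phi>"
  proof (rule homeomorphism_of_subsets[OF UW(6)])
    show "?U \<subseteq> U" unfolding U' by blast
    show "?P \<subseteq> W" by (rule W)
    have "\<Psi> (\<Phi> w) = w" if "w \<in> ?P" for w using W fg that by blast
    then show "\<Psi> ` ?U = ?P" by (simp add: image_image)
  qed
  moreover have "z0 \<in> ?U" unfolding U' using UW(3) \<delta> by (simp add: \<Psi>_z0 product_domain_def)
  moreover have "?U \<subseteq> V" using U' UW(2) by blast
  moreover have "open_interval ?I" using \<delta> by (auto simp: open_interval_def is_interval_oo)
  moreover have "?I \<subseteq> {0<..}" using \<delta> by auto
  moreover have "smooth_on ?P \<Phi>" by (rule smooth_on_subset[OF UW(7) W])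
  moreover have "inj (frechet_derivative \<Psi> (at z))" if "z \<in> ?U" for z using that inj U' by blast
  moreover have "?\<Omega> \<noteq> {}" using \<delta> by simp
  ultimately show ?thesis using that[of ?U ?I ?\<Omega> \<Phi>] oU by blast
qed

end

lemma positive_definite_congruence:
  fixes Q J :: "real^'n^'n"
  assumes "positive_definite Q" "det J \<noteq> 0"
  shows "positive_definite (transpose J ** Q ** J)"
  unfolding positive_definite_def
proof (intro conjI allI impI)
  show "transpose (transpose J ** Q ** J) = transpose J ** Q ** J"
    using assms(1) by (simp add: positive_definite_def matrix_transpose_mul matrix_mul_assoc)
  fix w :: "real^'n" assume w: "w \<noteq> 0"
  have "inj ((*v) J)" using assms(2) inj_matrix_vector_mult invertible_det_nz by blast
  then have "J *v w \<noteq> 0" using w by (metis injD matrix_vector_mult_0_right)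
  moreover have "w \<bullet> ((transpose J ** Q ** J) *v w) = (J *v w) \<bullet> (Q *v (J *v w))"
    by (simp add: matrix_vector_mul_assoc[symmetric]) (metis dot_lmul_matrix inner_commute transpose_matrix_vector)
  ultimately show "0 < w \<bullet> ((transpose J ** Q ** J) *v w)"
    using assms(1) by (simp add: positive_definite_def)
qed

text \<open>The segment from the identity to \<open>Q\<close> consists of positive definite
  matrices, on which the determinant has no zero, and it starts with determinant one.\<close>

lemma det_positive_definite:
  fixes Q :: "real^'n^'n"
  assumes "positive_definite Q"
  shows "0 < det Q"
proof (rule ccontr)
  assume neg: "\<not> 0 < det Q"
  define P where "P s = (\<chi> i j. (1 - s) * (if i = j then 1 else 0) + s * Q $ i $ j)" for s :: real
  have pos: "positive_definite (P s)" if s: "0 \<le> s" "s \<le> 1" for s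
    unfolding positive_definite_def
  proof (intro conjI allI impI)
    have "Q $ i $ j = Q $ j $ i" for i j
      using assms unfolding positive_definite_def by (metis (no_types, lifting) transpose_def vec_lambda_beta)
    then show "transpose (P s) = P s" by (simp add: P_def transpose_def vec_eq_iff)
    fix v :: "real^'n" assume v: "v \<noteq> 0"
    have "(P s *v v) $ i = ((1 - s) *\<^sub>R v + s *\<^sub>R (Q *v v)) $ i" for i
    proof -
      have "(P s *v v) $ i = (\<Sum>j\<in>UNIV. (if i = j then (1 - s) * v $ j else 0) + s * (Q $ i $ j * v $ j))"
        unfolding matrix_vector_mult_def vec_lambda_beta
        by (rule sum.cong) (simp_all add: P_def algebra_simps)
      then show ?thesis by (simp add: sum.distrib sum_distrib_left[symmetric] matrix_vector_mult_def)
    qed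
    then have "P s *v v = (1 - s) *\<^sub>R v + s *\<^sub>R (Q *v v)" by (simp add: vec_eq_iff)
    then have e: "v \<bullet> (P s *v v) = (1 - s) * (v \<bullet> v) + s * (v \<bullet> (Q *v v))" by (simp add: inner_add_right)
    have Qv: "0 < v \<bullet> (Q *v v)" using assms v by (simp add: positive_definite_def)
    show "0 < v \<bullet> (P s *v v)"
    proof (cases "s = 0")
      case False
      then show ?thesis unfolding e using s Qv v by (intro add_nonneg_pos) auto
    qed (use e v in simp)
  qed
  have "P 0 = mat 1" "P 1 = Q" by (simp_all add: P_def mat_def vec_eq_iff)
  then have "det (P 0) = 1" "det (P 1) \<le> 0" using neg by simp_all
  moreover have "continuous_on {0..1} (\<lambda>s. det (P s))"
    unfolding det_def P_def by (simp del: vec_lambda_eta) (intro continuous_intros)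
  ultimately obtain s where "0 \<le> s" "s \<le> 1" "det (P s) = 0"
    using IVT2'[of "\<lambda>s. det (P s)" 1 0 0] by auto
  then show False using positive_definite_det_nz[OF pos] by blast
qed

section \<open>The hypersurface in flow coordinates\<close>

locale flow_box = flow_coordinates V f \<xi> T l0 l1 a v \<phi> z0 L0 \<sigma> \<tau>
  for V :: "(real^('k::finite option)) set" and f \<xi> T l0 l1 a v \<phi> z0 L0 \<sigma> \<tau> +
  fixes U :: "(real^('k option)) set" and I :: "real set" and \<Omega> :: "(real^'k) set" and \<Phi>
  assumes U: "open U" "U \<subseteq> V" "z0 \<in> U" and I: "open_interval I" "I \<subseteq> {0<..}" and \<Omega>: "open \<Omega>" "\<Omega> \<noteq> {}"
    and hom: "homeomorphism U (product_domain I \<Omega>) \<Psi> \<Phi>" and \<Phi>_smooth: "smooth_on (product_domain I \<Omega>) \<Phi>"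
    and D\<Psi>_inj: "\<And>z. z \<in> U \<Longrightarrow> inj (frechet_derivative \<Psi> (at z))"
begin

abbreviation "P \<equiv> product_domain I \<Omega>"
definition F where "F w = f (\<Phi> w)"
definition X where "X w = \<xi> (\<Phi> w)"
definition A where "A = 2 / \<beta>"
definition N where "N = 2 / a"
text \<open>Chosen so that \<open>\<rho> = r t^2\<close>, as in the product model.\<close>

definition r where "r = \<rho> z0 / \<tau>\<^sup>2"

lemma openI: "open I" using I by (simp add: open_interval_def)

lemma open_P: "open P" by (rule open_product_domain[OF openI \<Omega>(1)])

lemma P_D: "w \<in> P \<Longrightarrow> w $ None \<in> I \<and> 0 < w $ None \<and> rest_coords w \<in> \<Omega>"
  using I(2) by (auto simp: product_domain_def)

lemma \<Phi>_U: "w \<in> P \<Longrightarrow> \<Phi> w \<in> U" and \<Psi>_\<Phi>: "w \<in> P \<Longrightarrow> \<Psi> (\<Phi> w) = w"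
  using hom by (auto simp: homeomorphism_def)

lemma \<Phi>_V: "w \<in> P \<Longrightarrow> \<Phi> w \<in> V" using \<Phi>_U U(2) by blast

lemma AN_nz: "A \<noteq> 0" "N \<noteq> 0" "r \<noteq> 0" "a * \<beta> / 2 = 2 / (A * N)"
  using a_nz' \<beta>_nz' \<rho>_nz[OF z0] \<tau> by (auto simp: A_def N_def r_def)

lemma ANr: "A * N * r < 0"
proof -
  have "A * N * r = (4 / ((a * \<beta>)\<^sup>2 * \<tau>\<^sup>2)) * (a * \<beta> * \<rho> z0)"
    using a_nz' \<beta>_nz' by (simp add: A_def N_def r_def field_simps power2_eq_square)
  also have "\<dots> < 0"
  proof (rule mult_pos_neg)
    have "0 < (a * \<beta>)\<^sup>2 * \<tau>\<^sup>2" using a_nz' \<beta>_nz' \<tau> by simp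
    then show "0 < 4 / ((a * \<beta>)\<^sup>2 * \<tau>\<^sup>2)" by simp
    show "a * \<beta> * \<rho> z0 < 0" by (rule sign[OF z0])
  qed
  finally show ?thesis .
qed

lemma y_\<Phi>:
  assumes w: "w \<in> P"
  shows "y (\<Phi> w) = (w $ None / \<tau>) powr N"
proof -
  have yp: "0 < y (\<Phi> w)" by (rule y_pos[OF \<Phi>_V[OF w]])
  have "w $ None = \<tau> * y (\<Phi> w) powr (a / 2)"
    using arg_cong[OF \<Psi>_\<Phi>[OF w], of "\<lambda>x. x $ None"] by (simp add: \<Psi>_def)
  then have "w $ None / \<tau> = y (\<Phi> w) powr (a / 2)" using \<tau> by simp
  then show ?thesis using yp a_nz' by (simp add: N_def powr_powr)
qed

lemma \<phi>_F: "w \<in> P \<Longrightarrow> \<phi> \<bullet> F w = x0 * (w $ None / \<tau>) powr N"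
  by (simp add: F_def \<phi>f_y y_\<Phi>)

lemma Q_F:
  assumes w: "w \<in> P"
  shows "Q (F w) = ((w $ None / \<tau>) powr A / \<sigma>) *\<^sub>R rest_coords w"
proof -
  have yp: "0 < y (\<Phi> w)" by (rule y_pos[OF \<Phi>_V[OF w]])
  have "rest_coords w = (\<sigma> * y (\<Phi> w) powr (- a / \<beta>)) *\<^sub>R Q (F w)"
    using arg_cong[OF \<Psi>_\<Phi>[OF w], of rest_coords] by (simp add: \<Psi>_def F_def)
  then have "(y (\<Phi> w) powr (a / \<beta>) / \<sigma>) *\<^sub>R rest_coords w = Q (F w)"
    using \<sigma> yp by (simp add: powr_minus_divide)
  moreover have "y (\<Phi> w) powr (a / \<beta>) = (w $ None / \<tau>) powr A"
    unfolding y_\<Phi>[OF w] powr_powr using a_nz' by (simp add: A_def N_def)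
  ultimately show ?thesis by simp
qed

lemma \<rho>_\<Phi>: "w \<in> P \<Longrightarrow> \<rho> (\<Phi> w) = r * (w $ None)\<^sup>2"
proof -
  assume w: "w \<in> P"
  have "((w $ None / \<tau>) powr N) powr a = (w $ None / \<tau>)\<^sup>2"
    using P_D[OF w] \<tau> a_nz' by (simp add: powr_powr N_def)
  then show ?thesis
    unfolding \<rho>_y[OF \<Phi>_V[OF w]] y_\<Phi>[OF w] by (simp add: r_def power_divide)
qed

lemma D\<Psi>_\<Phi>:
  assumes w: "w \<in> P"
  shows "frechet_derivative \<Psi> (at (\<Phi> w)) (frechet_derivative \<Phi> (at w) Y) = Y"
proof -
  have "((\<lambda>w. \<Psi> (\<Phi> w)) has_derivative (\<lambda>Y. frechet_derivative \<Psi> (at (\<Phi> w)) (frechet_derivative \<Phi> (at w) Y))) (at w)"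
    using diff_chain_at[OF smooth_on_has_derivative[OF \<Phi>_smooth w] smooth_on_has_derivative[OF \<Psi>_smooth \<Phi>_V[OF w]]]
    by (simp add: o_def)
  moreover have "((\<lambda>w. \<Psi> (\<Phi> w)) has_derivative (\<lambda>Y. Y)) (at w)"
    by (rule has_derivative_transform_within_open[OF has_derivative_ident open_P w]) (simp add: \<Psi>_\<Phi>)
  ultimately show ?thesis using has_derivative_unique by metis
qed

lemma det_D\<Phi>: "w \<in> P \<Longrightarrow> det (matrix (frechet_derivative \<Phi> (at w))) \<noteq> 0"
proof -
  assume w: "w \<in> P"
  have lin: "linear (frechet_derivative \<Phi> (at w))"
    by (rule linear_frechet_derivative[OF smooth_on_differentiable[OF \<Phi>_smooth w]])
  have "inj (frechet_derivative \<Phi> (at w))" by (rule inj_on_inverseI) (rule D\<Psi>_\<Phi>[OF w])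
  then show ?thesis using det_nz_iff_inj[OF lin] by simp
qed

lemma F_smooth: "smooth_on P F"
  unfolding F_def[abs_def] by (rule smooth_on_compose[OF smooth(1) open_P V \<Phi>_smooth]) (rule \<Phi>_V)

lemma Fd: "w \<in> P \<Longrightarrow> F differentiable at w" by (rule smooth_on_differentiable[OF F_smooth])

text \<open>\<open>T f\<close> is the image of \<open>Z\<close>, and in these coordinates
  \<open>Z\<close> is \<open>(a \<beta> / 2) t d/dt\<close>. So \<open>F\<close> satisfies a linear
  ordinary differential equation in t for each u.\<close>

lemma partial_F:
  assumes w: "w \<in> P"
  shows "partial None F w = (2 / (a * \<beta> * w $ None)) *\<^sub>R (T *v F w)"
proof -
  let ?z = "\<Phi> w" and ?n = "frechet_derivative \<Phi> (at w) (axis None 1)"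
  let ?c = "2 / (a * \<beta> * w $ None)"
  have z: "?z \<in> V" by (rule \<Phi>_V[OF w])
  have lin\<Psi>: "linear (frechet_derivative \<Psi> (at ?z))"
    by (rule linear_frechet_derivative[OF smooth_on_differentiable[OF \<Psi>_smooth z]])
  have "frechet_derivative \<Psi> (at ?z) (?c *\<^sub>R Z ?z) = axis None 1"
    unfolding linear_cmul[OF lin\<Psi>] D\<Psi>_Z[OF z] \<Psi>_\<Phi>[OF w] using P_D[OF w] a_nz' \<beta>_nz' by simp
  then have "?n = ?c *\<^sub>R Z ?z" using D\<Psi>_inj[OF \<Phi>_U[OF w]] D\<Psi>_\<Phi>[OF w] by (metis injD)
  moreover have "frechet_derivative F (at w) (axis None 1) = D ?z ?n"
    unfolding F_def[abs_def]
    by (rule frechet_derivative_reparam[OF V smooth(1) open_P w \<Phi>_smooth _ w], erule \<Phi>_V)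
  ultimately show ?thesis
    unfolding partial_def by (simp add: linear_cmul[OF lin[OF z]] Tf[OF z] F_def)
qed

text \<open>The formula \<open>\<xi>_eq\<close> of the product model with exponents \<open>A\<close>
  and \<open>N\<close>: once \<open>F\<close> is identified with a model, the affine normals
  correspond.\<close>

lemma X_eq:
  assumes w: "w \<in> P"
  shows "X w = (1 / (r * (w $ None)\<^sup>2)) *\<^sub>R (F w - (2 * w $ None / (A * N)) *\<^sub>R partial None F w)"
proof -
  have t: "0 < w $ None" using P_D[OF w] by simp
  have "(2 * w $ None / (A * N)) *\<^sub>R partial None F w = T *v F w"
    unfolding partial_F[OF w] using t a_nz' \<beta>_nz' by (simp add: A_def N_def)
  then have "F w - (2 * w $ None / (A * N)) *\<^sub>R partial None F w = (r * (w $ None)\<^sup>2) *\<^sub>R X w"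
    unfolding F_def X_def \<rho>_\<Phi>[OF w, symmetric] using c_eq[OF \<Phi>_V[OF w]] by simp
  then show ?thesis using t AN_nz by simp
qed

lemma box_geometry:
  assumes w: "w \<in> P"
  shows "det (frame F X w) \<noteq> 0" "positive_definite (affine_metric F X w)"
    "\<bar>det (frame F X w)\<bar> = sqrt \<bar>det (affine_metric F X w)\<bar>"
proof -
  let ?J = "matrix (frechet_derivative \<Phi> (at w))" and ?z = "\<Phi> w"
  have z: "?z \<in> V" by (rule \<Phi>_V[OF w])
  have J: "det ?J \<noteq> 0" by (rule det_D\<Phi>[OF w])
  have df: "det (frame F X w) = det ?J * det (frame f \<xi> ?z)"
    unfolding F_def[abs_def] X_def[abs_def] by (rule det_frame_reparam[OF V smooth(1) open_P w \<Phi>_smooth], rule \<Phi>_V)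
  have am: "affine_metric F X w = transpose ?J ** h ?z ** ?J"
    unfolding F_def[abs_def] X_def[abs_def]
    by (rule affine_metric_reparam[OF V smooth(1) open_P w \<Phi>_smooth _ det[OF z] J], rule \<Phi>_V)
  show "det (frame F X w) \<noteq> 0" using df J det[OF z] by simp
  show "positive_definite (affine_metric F X w)"
    unfolding am using patch z J by (intro positive_definite_congruence) (auto simp: congruent_patch_def)
  have "\<bar>det (frame f \<xi> ?z)\<bar> = sqrt \<bar>det (h ?z)\<bar>" using an z by (simp add: affine_normal_on_def)
  moreover have "\<bar>det (affine_metric F X w)\<bar> = (det ?J)\<^sup>2 * \<bar>det (h ?z)\<bar>"
    unfolding am by (simp add: det_mul abs_mult power2_eq_square)
  ultimately show "\<bar>det (frame F X w)\<bar> = sqrt \<bar>det (affine_metric F X w)\<bar>"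
    unfolding df by (simp add: abs_mult real_sqrt_mult)
qed

lemma constant_along_flow:
  fixes g :: "real^('k option) \<Rightarrow> real"
  assumes g: "smooth_on P g" and g0: "\<And>w. w \<in> P \<Longrightarrow> partial None g w = 0"
  obtains \<theta> where "smooth_on \<Omega> \<theta>" "\<And>w. w \<in> P \<Longrightarrow> g w = \<theta> (rest_coords w)"
proof -
  obtain t1 where t1: "t1 \<in> I" using I by (auto simp: open_interval_def)
  define \<theta> where "\<theta> u = g (append_coord u t1)" for u
  have PI: "append_coord u s \<in> P" if "u \<in> \<Omega>" "s \<in> I" for u s using that by (simp add: product_domain_def)
  have "smooth_on \<Omega> \<theta>"
    unfolding \<theta>_def[abs_def]
    by (rule smooth_on_compose[OF g \<Omega>(1) open_P]) (intro smooth_on_append_coord \<Omega> smooth_on_ident smooth_on_const, rule PI, simp_all add: t1)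
  moreover have "g w = \<theta> (rest_coords w)" if w: "w \<in> P" for w
  proof -
    let ?u = "rest_coords w"
    have cI: "convex I" using I by (simp add: open_interval_def is_interval_convex)
    have "\<exists>c. \<forall>s\<in>I. g (append_coord ?u s) = c"
    proof (rule has_derivative_zero_constant[OF cI])
      fix s assume s: "s \<in> I"
      have u: "append_coord ?u s \<in> P" using PI P_D[OF w] s by simp
      have D: "((\<lambda>s. append_coord ?u s) has_derivative (\<lambda>x. append_coord 0 x)) (at s)"
        by (rule has_derivative_append_coord) (auto intro!: derivative_eq_intros)
      let ?Dg = "frechet_derivative g (at (append_coord ?u s))"
      have dg: "(g has_derivative ?Dg) (at (append_coord ?u s))" by (rule smooth_on_has_derivative[OF g u])
      have "((\<lambda>s. g (append_coord ?u s)) has_derivative (\<lambda>x. ?Dg (append_coord 0 x))) (at s)"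
        using diff_chain_at[OF D dg] by (simp add: o_def)
      moreover have "?Dg (append_coord 0 x) = 0" for x
      proof -
        have "append_coord 0 x = x *\<^sub>R (axis None 1 :: real^('k option))"
          unfolding append_coord_axis by (simp add: append_coord_scaleR)
        then show ?thesis using g0[OF u] linear_cmul[OF has_derivative_linear[OF dg]] by (simp add: partial_def)
      qed
      ultimately show "((\<lambda>s. g (append_coord ?u s)) has_derivative (\<lambda>h. 0)) (at s within I)"
        by (simp add: has_derivative_at_withinI)
    qed
    then have "g (append_coord ?u (w $ None)) = g (append_coord ?u t1)" using t1 P_D[OF w] by metis
    then show ?thesis by (simp add: \<theta>_def)
  qed
  ultimately show ?thesis using that by blast
qed

lemma powr_None:
  assumes w: "w \<in> P"
  shows "((\<lambda>w. w $ None powr b) has_derivative (\<lambda>Y. (b * w $ None powr (b - 1)) * Y $ None)) (at w)"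
    "((\<lambda>w. ln (w $ None)) has_derivative (\<lambda>Y. inverse (w $ None) * Y $ None)) (at w)"
proof -
  have t: "0 < w $ None" using P_D[OF w] by simp
  have n: "((\<lambda>w. w $ None) has_derivative (\<lambda>Y. Y $ None)) (at w)"
    by (rule bounded_linear_imp_has_derivative[OF bounded_linear_vec_nth])
  show "((\<lambda>w. w $ None powr b) has_derivative (\<lambda>Y. (b * w $ None powr (b - 1)) * Y $ None)) (at w)"
    using diff_chain_at[OF n has_real_derivative_powr[OF t, of b, unfolded has_field_derivative_def]] by (simp add: o_def)
  have l: "(ln has_real_derivative inverse (w $ None)) (at (w $ None))"
    using t by (auto intro!: derivative_eq_intros simp: inverse_eq_divide)
  show "((\<lambda>w. ln (w $ None)) has_derivative (\<lambda>Y. inverse (w $ None) * Y $ None)) (at w)"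
    using diff_chain_at[OF n l[unfolded has_field_derivative_def]] by (simp add: o_def)
qed

lemma powr_None_smooth: "smooth_on P (\<lambda>w. w $ None powr b)" "smooth_on P (\<lambda>w. ln (w $ None))"
  using P_D by (auto intro!: smooth_on_powr smooth_on_ln open_P smooth_on_bounded_linear[OF bounded_linear_vec_nth])

text \<open>By \<open>partial_F\<close> the function \<open>l (F w)\<close> of t satisfies
  \<open>t l' = A l + (2 c / (a \<beta>)) t^A\<close>, so the function \<open>g\<close> below is
  independent of t. An eigencovector has \<open>c = 0\<close>; the logarithm stems from the
  nilpotent part of \<open>T\<close>.\<close>

lemma flow_component:
  fixes l :: "real^('k option option) \<Rightarrow> real"
  assumes l: "bounded_linear l" and lT: "\<And>w. w \<in> P \<Longrightarrow> l (T *v F w) = a * l (F w) + c * w $ None powr A"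
  obtains \<theta> where "smooth_on \<Omega> \<theta>"
    "\<And>w. w \<in> P \<Longrightarrow> l (F w) = w $ None powr A * (\<theta> (rest_coords w) + 2 * c / (a * \<beta>) * ln (w $ None))"
proof -
  define g where "g w = w $ None powr (- A) * l (F w) - 2 * c / (a * \<beta>) * ln (w $ None)" for w
  have lF: "smooth_on P (\<lambda>w. l (F w))" by (rule smooth_on_linear_image[OF l open_P F_smooth])
  have gs: "smooth_on P g"
    unfolding g_def[abs_def]
    by (intro smooth_on_diff smooth_on_mult open_P powr_None_smooth lF smooth_on_const)
  have g0: "partial None g w = 0" if w: "w \<in> P" for w
  proof -
    have t: "0 < w $ None" using P_D[OF w] by simp
    have dl: "((\<lambda>w. l (F w)) has_derivative (\<lambda>Y. l (frechet_derivative F (at w) Y))) (at w)"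
      by (rule bounded_linear.has_derivative[OF l smooth_on_has_derivative[OF F_smooth w]])
    have "(g has_derivative (\<lambda>Y. (w $ None powr (- A) * l (frechet_derivative F (at w) Y) +
        (- A * w $ None powr (- A - 1)) * Y $ None * l (F w)) - 2 * c / (a * \<beta>) * (inverse (w $ None) * Y $ None))) (at w)"
      unfolding g_def[abs_def]
      by (intro has_derivative_diff has_derivative_mult has_derivative_mult_right powr_None[OF w] dl)
    from partial_eqI[OF this, of None]
    have "partial None g w = w $ None powr (- A) * l (partial None F w) - A * w $ None powr (- A - 1) * l (F w)
       - 2 * c / (a * \<beta>) * inverse (w $ None)"
      by (simp add: partial_def axis_def)
    also have "l (partial None F w) = 2 / (a * \<beta> * w $ None) * (a * l (F w) + c * w $ None powr A)"
      unfolding partial_F[OF w] linear_cmul[OF bounded_linear.linear[OF l]] lT[OF w] by simp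
    also have "w $ None powr (- A - 1) = w $ None powr (- A) / w $ None" using t by (simp add: powr_diff)
    also have "w $ None powr (- A) * (2 / (a * \<beta> * w $ None) * (a * l (F w) + c * w $ None powr A)) -
        A * (w $ None powr (- A) / w $ None) * l (F w) - 2 * c / (a * \<beta>) * inverse (w $ None) = 0"
      using t a_nz' \<beta>_nz' by (simp add: A_def powr_minus_divide field_simps)
    finally show ?thesis .
  qed
  obtain \<theta> where \<theta>: "smooth_on \<Omega> \<theta>" "\<And>w. w \<in> P \<Longrightarrow> g w = \<theta> (rest_coords w)"
    using constant_along_flow[OF gs g0] by metis
  have "l (F w) = w $ None powr A * (\<theta> (rest_coords w) + 2 * c / (a * \<beta>) * ln (w $ None))" if w: "w \<in> P" for w
  proof -
    have "w $ None powr (- A) * l (F w) = \<theta> (rest_coords w) + 2 * c / (a * \<beta>) * ln (w $ None)"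
      using \<theta>(2)[OF w] by (simp add: g_def)
    then show ?thesis using P_D[OF w] by (simp add: powr_minus_divide field_simps)
  qed
  then show ?thesis using that \<theta>(1) by blast
qed

lemma exponent_zero:
  assumes "\<And>t. t \<in> I \<Longrightarrow> c * t powr b = d" "c \<noteq> 0"
  shows "b = 0"
proof (rule ccontr)
  assume b: "b \<noteq> 0"
  obtain t1 \<epsilon> where t1: "t1 \<in> I" "0 < \<epsilon>" "ball t1 \<epsilon> \<subseteq> I"
    using I openE[OF openI] by (metis ex_in_conv open_interval_def)
  then have t2: "t1 + \<epsilon> / 2 \<in> I" by (intro subsetD[OF t1(3)]) (simp add: dist_real_def)
  have "t1 > 0" using t1 I by auto
  have "c * t1 powr b = c * (t1 + \<epsilon> / 2) powr b" using assms(1) t1(1) t2 by metis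
  then have "t1 powr b = (t1 + \<epsilon> / 2) powr b" using assms(2) by simp
  then have "b * ln t1 = b * ln (t1 + \<epsilon> / 2)" using \<open>t1 > 0\<close> t1(2) by (simp add: powr_def)
  then have "ln t1 = ln (t1 + \<epsilon> / 2)" using b by simp
  then show False using \<open>t1 > 0\<close> t1(2) by simp
qed

text \<open>The hypothesis \<open>vol\<close> is \<open>N + n A = n + 2\<close>; it compares the powers of \<open>t\<close> in the two volume forms.\<close>

lemma eigenvalue_relations:
  assumes vol: "N + A * (CARD('k) + 1) = CARD('k) + 3" and n: "n = real CARD('k option)" and z: "z \<in> V"
  shows "K1 (l0 z) (l1 z) = - A / 2" "NN n (l0 z) (l1 z) = N"
    "(n + 2) * l0 z + n * l1 z = l1 z * (2 / A) * (A - N)" "l0 z + l1 z < 0"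
proof -
  have nm: "n = real CARD('k) + 1" using n by (simp add: card_UNIV_option)
  have Nn: "N = n + 2 - n * A" using vol nm by (simp add: algebra_simps)
  have \<beta>: "\<beta> = 2 / A" using \<beta>_nz' by (simp add: A_def)
  have l1': "\<rho> z * l1 z = a - 1" by (rule \<rho>_l1[OF z])
  \<comment> \<open>Both eigenvalues carry the factor \<open>a - 1\<close>; eliminating it leaves a
    ratio that depends on \<open>\<beta>\<close> alone.\<close>
  have "\<rho> z * l0 z = (1 - \<beta>) * (a - 1)" using radial_derivatives(2)[OF z] by (simp add: algebra_simps)
  also have "\<dots> = \<rho> z * ((1 - \<beta>) * l1 z)" unfolding l1'[symmetric] by simp
  finally have "\<rho> z * l0 z = \<rho> z * ((1 - \<beta>) * l1 z)" .
  then have l0': "l0 z = (1 - \<beta>) * l1 z" using \<rho>_nz[OF z] by simp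
  have d: "l0 z - l1 z = - \<beta> * l1 z" by (simp add: l0' algebra_simps)
  have l1nz: "l1 z \<noteq> 0" by (rule l1[OF z])
  show K1: "K1 (l0 z) (l1 z) = - A / 2" unfolding K1_def d using l1nz \<beta>_nz' by (simp add: A_def)
  have K0: "K0 (l0 z) (l1 z) = 1 - A / 2"
    unfolding K0_def d unfolding l0' using l1nz \<beta>_nz' by (simp add: A_def field_simps)
  show "NN n (l0 z) (l1 z) = N" unfolding NN_def K0 K1 Nn by (simp add: field_simps)
  show "(n + 2) * l0 z + n * l1 z = l1 z * (2 / A) * (A - N)"
    unfolding l0' \<beta> Nn using AN_nz by (simp add: field_simps)
  \<comment> \<open>\<open>A = 1\<close> would give \<open>N = 2\<close>, hence
    \<open>a = 1\<close>, contrary to \<open>l1 z \<noteq> 0\<close>.\<close>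
  have A1: "A \<noteq> 1"
  proof
    assume "A = 1"
    then have "N = 2" using Nn by simp
    then show False using a_nz' by (simp add: N_def divide_eq_eq)
  qed
  have s: "\<beta> * a * \<rho> z < 0" using sign[OF z] by (simp add: mult.commute)
  have "\<rho> z * (l0 z + l1 z) = (2 - \<beta>) * (\<rho> z * l1 z)" unfolding l0' by (simp add: algebra_simps)
  also have "\<dots> = (2 - \<beta>) * (a - 1)" by (simp only: l1')
  \<comment> \<open>The volume relation makes both factors multiples of \<open>A - 1\<close>, so
    that a square appears.\<close>
  also have "\<dots> = n * (A - 1)\<^sup>2 * (\<beta> * a) / 2"
  proof -
    have "2 - \<beta> = \<beta> * (A - 1)" unfolding \<beta> using AN_nz by (simp add: field_simps)
    moreover have "a * N = 2" using a_nz' by (simp add: N_def)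
    then have "a - 1 = a * (n * (A - 1)) / 2" unfolding Nn by (simp add: algebra_simps)
    ultimately show ?thesis by (simp add: power2_eq_square)
  qed
  finally have e: "\<rho> z * (l0 z + l1 z) = n * (A - 1)\<^sup>2 * (\<beta> * a) / 2" .
  \<comment> \<open>One more factor \<open>\<rho> z\<close> produces the negative quantity
    \<open>\<beta> * a * \<rho> z\<close> on the right and a square on the left.\<close>
  have "\<rho> z * \<rho> z * (l0 z + l1 z) = n * (A - 1)\<^sup>2 / 2 * (\<beta> * a * \<rho> z)"
    unfolding mult.assoc[of "\<rho> z"] e by simp
  also have "\<dots> < 0" using A1 nm by (intro mult_pos_neg[OF _ s]) simp
  finally show "l0 z + l1 z < 0"
    by (metis linorder_not_less mult_nonneg_nonneg zero_le_square)
qed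

end

context flow_box begin

section \<open>The normal forms\<close>

text \<open>The formula for the normal is linear in the immersion, so \<open>L F = g\<close> implies
  that \<open>L\<close> maps \<open>X\<close> to \<open>\<zeta>\<close>. The model inherits the
  metric, and its volume identity carries \<open>\<bar>det L\<bar>\<close>; evaluated in the model
  this becomes an equation on the base.\<close>

lemma model_geometry:
  assumes L: "det L \<noteq> 0" and g: "\<And>w. w \<in> P \<Longrightarrow> L *v F w = g w"
    and \<zeta>: "\<And>w. w \<in> P \<Longrightarrow> \<zeta> w = (1 / (r * (w $ None)\<^sup>2)) *\<^sub>R (g w - (2 * w $ None / (A * N)) *\<^sub>R partial None g w)"
    and w: "w \<in> P"
  shows "affine_metric g \<zeta> w = affine_metric F X w" "det (frame g \<zeta> w) \<noteq> 0"
    "\<bar>det (frame g \<zeta> w)\<bar> = \<bar>det L\<bar> * sqrt \<bar>det (affine_metric g \<zeta> w)\<bar>"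
proof -
  have \<zeta>': "L *v X x = \<zeta> x" if x: "x \<in> P" for x
  proof -
    have "partial None g x = partial None (\<lambda>x. L *v F x) x"
      by (rule partial_cong[OF open_P x, symmetric]) (rule g)
    also have "\<dots> = L *v partial None F x" by (rule partial_linear_image[OF Fd[OF x]])
    finally show ?thesis
      unfolding X_eq[OF x] \<zeta>[OF x] g[OF x, symmetric]
      by (simp add: matrix_vector_mult_scaleR matrix_vector_mult_diff_distrib)
  qed
  have fr: "frame g \<zeta> w = frame F X w ** transpose L"
    by (rule trans[OF frame_cong[OF open_P w, symmetric] frame_linear_image[OF Fd[OF w]]], erule g, erule \<zeta>')
  show am: "affine_metric g \<zeta> w = affine_metric F X w"
    by (rule trans[OF affine_metric_cong[OF open_P w, symmetric]
          affine_metric_linear_image[OF L open_P w F_smooth box_geometry(1)[OF w]]], erule g, erule \<zeta>')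
  show "det (frame g \<zeta> w) \<noteq> 0" unfolding fr using L box_geometry(1)[OF w] by (simp add: det_mul)
  show "\<bar>det (frame g \<zeta> w)\<bar> = \<bar>det L\<bar> * sqrt \<bar>det (affine_metric g \<zeta> w)\<bar>"
    unfolding am box_geometry(3)[OF w, symmetric] unfolding fr by (simp add: det_mul abs_mult mult.commute)
qed

lemma append_coord_P: "u \<in> \<Omega> \<Longrightarrow> t \<in> I \<Longrightarrow> append_coord u t \<in> P"
  by (simp add: product_domain_def)

lemma scaled_powr: "w \<in> P \<Longrightarrow> \<tau> powr b * (w $ None / \<tau>) powr b = w $ None powr b"
  using P_D[of w] \<tau> by (simp add: powr_divide)

text \<open>Letting t vary splits a volume identity into one for exponents and one for coefficients;
  the latter is the equation satisfied by the base.\<close>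

lemma volume_exponent:
  assumes "\<And>t. t \<in> I \<Longrightarrow> c * t powr b = d * t ^ k" "c \<noteq> 0"
  shows "b = k" "c = d"
proof -
  have eq: "c * t powr (b - k) = d" if "t \<in> I" for t
  proof -
    have t: "0 < t" using that I by auto
    have "c * t powr (b - k) = c * t powr b / t ^ k" using t by (simp add: powr_diff powr_realpow)
    then show ?thesis unfolding assms(1)[OF that] using t by simp
  qed
  show "b = k" using exponent_zero[OF eq assms(2)] by simp
  moreover obtain t where "t \<in> I" using I by (auto simp: open_interval_def)
  ultimately show "c = d" using eq[of t] I by auto
qed

lemma warped_ln:
  assumes w: "w \<in> P" and M: "affine_metric F X w = block_metric 1 (\<chi> i j. (w $ None)\<^sup>2 * g (rest_coords w) $ i $ j)"
  shows "affine_metric F X w = warped_metric ln g w" "positive_definite (g (rest_coords w))"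
proof -
  have t: "0 < w $ None" using P_D[OF w] by simp
  have "exp (2 * ln (w $ None)) = (w $ None)\<^sup>2" using t by (simp add: exp_double)
  then show "affine_metric F X w = warped_metric ln g w" unfolding M warped_metric_block by simp
  have "0 < (w $ None)\<^sup>2" using t by simp
  from positive_definite_cmult[OF this] show "positive_definite (g (rest_coords w))"
    using box_geometry(2)[OF w] unfolding M positive_definite_block_metric by blast
qed

text \<open>Since u is a rescaled \<open>Q\<close>, the base comes out as a graph:
  \<open>\<psi>\<close> contributes the remaining component \<open>\<theta>\<close> of
  \<open>G\<close>.\<close>

lemma hypersphere_normal_form:
  assumes AN: "A \<noteq> N" and ANr1: "A * N * r = - 1"
  shows "N + A * (CARD('k) + 1) = CARD('k) + 3"
    and "\<exists>g. riemannian_metric_on \<Omega> g \<and> (\<forall>w\<in>P. affine_metric F X w = warped_metric ln g w)"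
    and "n = real CARD('k option) \<Longrightarrow> z \<in> V \<Longrightarrow>
      \<exists>g2 (L :: real^('k option option)^('k option option)).
        adapted_hypersphere (l0 z) (l1 z) (top_of_set \<Omega>) (domain_atlas \<Omega>) g2 \<and> invertible L \<and>
        (\<forall>w\<in>P. L *v F w = hypersphere_model (K1 (l0 z) (l1 z)) (NN n (l0 z) (l1 z)) g2 (w $ None, rest_coords w))"
proof -
  have nz: "A \<noteq> 0" "N \<noteq> 0" "r \<noteq> 0" using AN_nz by auto
  have lT: "\<psi> (T *v F w) = a * \<psi> (F w) + 0 * w $ None powr A" for w by (simp add: coordinates_T)
  obtain \<theta> where \<theta>: "smooth_on \<Omega> \<theta>"
    "\<And>w. w \<in> P \<Longrightarrow> \<psi> (F w) = w $ None powr A * (\<theta> (rest_coords w) + 2 * 0 / (a * \<beta>) * ln (w $ None))"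
    using flow_component[OF bounded_linear_coordinates(2) lT] by metis
  define G where "G u = append_coord u (\<theta> u)" for u
  have Gs: "smooth_on \<Omega> G"
    unfolding G_def[abs_def] by (intro smooth_on_append_coord \<Omega> smooth_on_ident \<theta>(1))
  \<comment> \<open>The ambient coordinates of the model: \<open>Q\<close> rescaled to remove
    \<open>\<sigma>\<close> and \<open>\<tau>\<close>, then \<open>\<psi>\<close>, and
    \<open>\<phi>\<close> normalized so that the last component of \<open>F\<close> becomes
    \<open>t^N / N\<close>.\<close>
  define B where "B w = append_coord (append_coord ((\<sigma> * \<tau> powr A) *\<^sub>R Q w) (\<psi> w)) (\<tau> powr N / (x0 * N) * (\<phi> \<bullet> w))" for w
  note lc = bounded_linear.linear[OF bounded_linear_coordinates(1)] bounded_linear.linear[OF bounded_linear_coordinates(2)]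
  have linB: "linear B"
    by (rule linearI)
      (simp_all add: B_def linear_add[OF lc(1)] linear_cmul[OF lc(1)] linear_add[OF lc(2)] linear_cmul[OF lc(2)]
        append_coord_add append_coord_scaleR inner_add_right algebra_simps add_divide_distrib)
  have "B w = 0 \<Longrightarrow> w = 0" for w
  proof -
    assume "B w = 0"
    then have w: "Q w = 0" "\<psi> w = 0" "\<phi> \<bullet> w = 0" using \<sigma> \<tau> x0 nz by (simp_all add: B_def)
    \<comment> \<open>\<open>A \<noteq> N\<close> means \<open>a \<noteq> \<beta>\<close>, and then
      \<open>\<phi>\<close> involves the coordinate \<open>\<omega>\<close>.\<close>
    have "\<phi> \<bullet> v \<noteq> 0" using AN a_nz' \<beta>_nz' by (auto simp: \<beta>_def A_def N_def)
    moreover have "(\<phi> \<bullet> v) * \<omega> w = 0" using L0_\<phi>[of w] w(2,3) by (simp add: \<psi>_def \<omega>_def)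
    ultimately show "w = 0" using coordinates_0 w by simp
  qed
  then have "inj B" using linear_injective_0[OF linB] by blast
  define L where "L = matrix B"
  have L: "det L \<noteq> 0" using det_nz_iff_inj[OF linB] \<open>inj B\<close> by (simp add: L_def)
  have Lw: "L *v w = B w" for w by (metis L_def linB matrix_vector_mul(2))
  interpret M0: hypersphere_form I \<Omega> G A N r
    using openI I(2) \<Omega>(1) Gs nz by unfold_locales auto
  have LF: "L *v F w = M0.f w" if w: "w \<in> P" for w
  proof -
    have "\<sigma> * \<tau> powr A * ((w $ None / \<tau>) powr A / \<sigma>) = w $ None powr A"
      using scaled_powr[OF w, of A] \<sigma> by (simp add: mult.commute)
    moreover have "\<tau> powr N / (x0 * N) * (x0 * (w $ None / \<tau>) powr N) = w $ None powr N / N"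
      using scaled_powr[OF w, of N] x0 by simp
    ultimately show ?thesis
      unfolding M0.f_eq Lw B_def Q_F[OF w] \<phi>_F[OF w] \<theta>(2)[OF w]
      by (simp add: hypersphere_model_def G_def append_coord_scaleR)
  qed
  note geo = model_geometry[OF L LF M0.\<xi>_eq]
  \<comment> \<open>The nonzero determinant of the frame of the model contains
    \<open>det (frame G G u)\<close> as a factor.\<close>
  have frG: "det (frame G G u) \<noteq> 0" if u: "u \<in> \<Omega>" for u
  proof -
    obtain t where "t \<in> I" using I by (auto simp: open_interval_def)
    then have w: "append_coord u t \<in> P" by (rule append_coord_P[OF u])
    show ?thesis using geo(2)[OF _ _ w] M0.det_frame_model[OF w] by auto
  qed
  interpret M: hypersphere_chart I \<Omega> G A N r
    using AN frG by unfold_locales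
  \<comment> \<open>The factor between the centroaffine metric of \<open>G\<close> and the metric of
    the base; \<open>A * N * r = - 1\<close> brings it to a form that shows its sign.\<close>
  define q where "q = r * N / (N - A)"
  have q: "q = 1 / (A * (A - N))" "q \<noteq> 0"
  proof -
    have "(A - N) / (N - A) = - 1" using AN by (simp add: divide_eq_eq)
    moreover have "q * (A * (A - N)) = A * N * r * ((A - N) / (N - A))" by (simp add: q_def)
    ultimately have "q * (A * (A - N)) = 1" unfolding ANr1 by simp
    then show "q = 1 / (A * (A - N))" using AN nz by (simp add: eq_divide_eq)
    then show "q \<noteq> 0" using AN nz by simp
  qed
  define c where "c = \<bar>1 - A / N\<bar> / \<bar>r\<bar>"
  have c: "0 < c" using AN nz by (simp add: c_def)
  define s where "s = sqrt (\<bar>q\<bar> ^ CARD('k))"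
  have s: "0 < s" using q(2) by (simp add: s_def)
  have vol: "N + A * (CARD('k) + 1) - 3 = CARD('k) \<and>
      c * \<bar>det (frame G G u)\<bar> = \<bar>det L\<bar> * s * sqrt \<bar>det (affine_metric G G u)\<bar>" if u: "u \<in> \<Omega>" for u
  proof -
    have "c * \<bar>det (frame G G u)\<bar> * t powr (N + A * (CARD('k) + 1) - 3) =
       \<bar>det L\<bar> * s * sqrt \<bar>det (affine_metric G G u)\<bar> * t ^ CARD('k)" if t: "t \<in> I" for t
    proof -
      note w = append_coord_P[OF u t]
      show ?thesis
        using geo(3)[OF _ _ w] unfolding M.det_frame_hypersphere[OF w] M.det_metric_hypersphere[OF w] ANr1 q_def[symmetric]
        by (simp add: c_def s_def real_sqrt_mult mult_ac)
    qed
    from volume_exponent[OF this] show ?thesis using c frG[OF u] by simp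
  qed
  obtain u0 where u0: "u0 \<in> \<Omega>" using \<Omega> by blast
  from vol[OF u0] show vexp: "N + A * (CARD('k) + 1) = CARD('k) + 3" by simp
  define g where "g u = (\<chi> i j. q * affine_metric G G u $ i $ j)" for u
  have met: "affine_metric F X w = block_metric 1 (\<chi> i j. (w $ None)\<^sup>2 * g (rest_coords w) $ i $ j)" if w: "w \<in> P" for w
    using geo(1)[OF _ _ w] unfolding M.metric_hypersphere[OF w] using ANr1
    by (simp add: g_def q_def mult_ac)
  have pos: "positive_definite (g u)" if u: "u \<in> \<Omega>" for u
  proof -
    obtain t where "t \<in> I" using I by (auto simp: open_interval_def)
    then have w: "append_coord u t \<in> P" by (rule append_coord_P[OF u])
    show ?thesis using warped_ln(2)[where g = g, OF w met[OF w]] by simp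
  qed
  have gs: "smooth_on \<Omega> g"
  proof (rule smooth_on_vec[OF \<Omega>(1)], rule smooth_on_vec[OF \<Omega>(1)])
    fix i j
    have "smooth_on \<Omega> (\<lambda>u. frame_coeff G G u (partial i (partial j G) u))"
      by (rule smooth_on_frame_coeff[OF \<Omega>(1) Gs Gs]) (intro smooth_on_partial Gs, erule frG)
    then have "smooth_on \<Omega> (\<lambda>u. q * frame_coeff G G u (partial i (partial j G) u) $ None)"
      by (intro smooth_on_mult smooth_on_const smooth_on_vec_nth \<Omega>)
    then show "smooth_on \<Omega> (\<lambda>u. g u $ i $ j)" by (simp add: g_def affine_metric_def)
  qed
  show "\<exists>g. riemannian_metric_on \<Omega> g \<and> (\<forall>w\<in>P. affine_metric F X w = warped_metric ln g w)"
    using gs pos warped_ln(1)[where g = g, OF _ met] by (auto simp: riemannian_metric_on_def)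
  assume n: "n = real CARD('k option)" and z: "z \<in> V"
  note ev = eigenvalue_relations[OF vexp n z]
  have "0 < c / (\<bar>det L\<bar> * s)" using c s L by simp
  then obtain R where R: "0 < R" "R * sqrt (R ^ CARD('k)) = c / (\<bar>det L\<bar> * s)" using ex_root by blast
  \<comment> \<open>\<open>R\<close> solves the volume normalization of the hypersphere, and the
    sign makes \<open>- 1 / \<mu>\<close> a positive multiple of \<open>q\<close>, so that the
    metric of \<open>G\<close> becomes positive definite.\<close>
  define \<mu> where "\<mu> = - sgn (A * (A - N)) * R"
  have sg: "A * (A - N) \<noteq> 0" using nz AN by simp
  have "\<bar>sgn (A * (A - N))\<bar> = 1" unfolding abs_sgn_eq using sg by simp
  then have "\<bar>\<mu>\<bar> = R" unfolding \<mu>_def abs_mult abs_minus_cancel using R by simp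
  then have \<mu>: "\<mu> \<noteq> 0" "\<bar>\<mu>\<bar> = R" using R by auto
  have \<mu>q: "- 1 / \<mu> = (\<bar>A * (A - N)\<bar> / R) * q"
    unfolding q(1) using sg R by (simp add: \<mu>_def sgn_if abs_if field_simps)
  have "adapted_hypersphere (l0 z) (l1 z) (top_of_set \<Omega>) (domain_atlas \<Omega>) G"
  proof (rule adapted_hypersphereI[OF \<Omega>(1) Gs \<mu>(1) frG])
    fix u assume u: "u \<in> \<Omega>"
    have "(\<chi> i j. (- 1 / \<mu>) * affine_metric G G u $ i $ j) = (\<chi> i j. (\<bar>A * (A - N)\<bar> / R) * g u $ i $ j)"
      unfolding \<mu>q by (simp add: g_def mult.assoc)
    moreover have "0 < \<bar>A * (A - N)\<bar> / R" using sg R by simp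
    ultimately show "positive_definite (\<chi> i j. (- 1 / \<mu>) * affine_metric G G u $ i $ j)"
      using positive_definite_cmult pos[OF u] by metis
    have "sqrt (\<bar>1 / \<mu>\<bar> ^ CARD('k) * \<bar>det (affine_metric G G u)\<bar>) = sqrt \<bar>det (affine_metric G G u)\<bar> / sqrt (R ^ CARD('k))"
      by (simp add: \<mu>(2) power_divide real_sqrt_mult real_sqrt_divide)
    also have "sqrt \<bar>det (affine_metric G G u)\<bar> = R * sqrt (R ^ CARD('k)) * \<bar>det (frame G G u)\<bar>"
      unfolding R(2) using vol[OF u] s L by (simp add: field_simps)
    finally show "\<bar>\<mu>\<bar> * \<bar>det (frame G G u)\<bar> = sqrt (\<bar>1 / \<mu>\<bar> ^ CARD('k) * \<bar>det (affine_metric G G u)\<bar>)"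
      using R(1) by (simp add: \<mu>(2))
  next
    have "A * (A - N) * sgn (A * (A - N)) = \<bar>A * (A - N)\<bar>" by (rule abs_sgn[symmetric])
    then have "\<mu> * (A * (A - N)) = - (R * \<bar>A * (A - N)\<bar>)" by (simp add: \<mu>_def algebra_simps)
    moreover have "\<mu> * l1 z * ((n + 2) * l0 z + n * l1 z) = (2 * (l1 z)\<^sup>2 / A\<^sup>2) * (\<mu> * (A * (A - N)))"
      unfolding ev(3) using nz by (simp add: power2_eq_square)
    moreover have "0 < (2 * (l1 z)\<^sup>2 / A\<^sup>2) * (R * \<bar>A * (A - N)\<bar>)"
      using R sg nz l1[OF z] by (intro mult_pos_pos divide_pos_pos) simp_all
    ultimately show "\<mu> * l1 z * ((real CARD('k option) + 2) * l0 z + real CARD('k option) * l1 z) < 0"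
      unfolding n[symmetric] by simp
  qed
  moreover have "invertible L" using L invertible_det_nz by blast
  moreover have "L *v F w = hypersphere_model (K1 (l0 z) (l1 z)) (NN n (l0 z) (l1 z)) G (w $ None, rest_coords w)" if "w \<in> P" for w
    unfolding LF[OF that] M0.f_eq ev(1,2) by simp
  ultimately show "\<exists>g2 (L :: real^('k option option)^('k option option)).
        adapted_hypersphere (l0 z) (l1 z) (top_of_set \<Omega>) (domain_atlas \<Omega>) g2 \<and> invertible L \<and>
        (\<forall>w\<in>P. L *v F w = hypersphere_model (K1 (l0 z) (l1 z)) (NN n (l0 z) (l1 z)) g2 (w $ None, rest_coords w))"
    by blast
qed


text \<open>For \<open>a = \<beta>\<close> the covector \<open>\<phi>\<close> is proportional to
  \<open>\<psi>\<close>, and \<open>\<omega>\<close> is a generalized eigencovector, to which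
  \<open>T\<close> adds \<open>\<phi>\<close>. The scale in \<open>\<sigma>vol\<close> turns the
  constant value of the Hessian determinant into one.\<close>

lemma monge_ampere_normal_form:
  assumes AN: "A = N" and ANr1: "A * N * r = - 1"
    and \<sigma>vol: "\<bar>det L0\<bar> * \<tau> powr A * (\<sigma> * \<tau> powr A) ^ CARD('k) = \<bar>x0\<bar> * \<tau> powr (- A) * A ^ 4 / 2"
  shows "N + A * (CARD('k) + 1) = CARD('k) + 3"
    and "\<exists>g. riemannian_metric_on \<Omega> g \<and> (\<forall>w\<in>P. affine_metric F X w = warped_metric ln g w)"
    and "\<exists>\<phi>0 \<F> (L :: real^('k option option)^('k option option)).
        \<phi>0 \<noteq> 0 \<and> convex_monge_ampere_solution \<Omega> \<F> \<and> invertible L \<and>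
        (\<forall>w\<in>P. L *v F w = monge_ampere_model (- A / 2) \<phi>0 \<F> (w $ None, rest_coords w))"
proof -
  have nz: "A \<noteq> 0" "r \<noteq> 0" using AN_nz by auto
  have Ar: "A * A * r = - 1" using ANr1 AN by simp
  have "a = \<beta>" using AN a_nz' \<beta>_nz' by (simp add: A_def N_def)
  then have a\<beta>: "a * \<beta> = 4 / A\<^sup>2" using \<beta>_nz' by (simp add: A_def power2_eq_square)
  have \<phi>\<psi>: "\<phi> \<bullet> w = x0 * \<psi> w" for w
    using L0_\<phi>[of w] \<open>a = \<beta>\<close> by (simp add: \<beta>_def \<psi>_def)
  have \<psi>F: "\<psi> (F w) = (w $ None / \<tau>) powr A" if "w \<in> P" for w
    using \<phi>_F[OF that] x0 by (simp add: \<phi>\<psi> AN)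
  \<comment> \<open>\<open>\<phi> \<bullet> F w\<close> is \<open>c\<close> times
    \<open>t^A\<close>; this is the inhomogeneous term passed to
    \<open>flow_component\<close>.\<close>
  define c where "c = x0 * \<tau> powr (- A)"
  have c0: "c \<noteq> 0" using x0 \<tau> by (simp add: c_def)
  have lT: "\<omega> (T *v F w) = a * \<omega> (F w) + c * w $ None powr A" if w: "w \<in> P" for w
    unfolding coordinates_T \<phi>\<psi> \<psi>F[OF w] using scaled_powr[OF w, of A] \<tau>
    by (simp add: c_def powr_minus_divide field_simps)
  obtain \<theta> where \<theta>: "smooth_on \<Omega> \<theta>"
    "\<And>w. w \<in> P \<Longrightarrow> \<omega> (F w) = w $ None powr A * (\<theta> (rest_coords w) + 2 * c / (a * \<beta>) * ln (w $ None))"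
    using flow_component[OF bounded_linear_coordinates(3) lT] by metis
  \<comment> \<open>The coefficient \<open>2 * c / (a * \<beta>)\<close> of the logarithm is
    \<open>c A^2 / 2\<close>, and in the model it has to be \<open>\<phi>0 / A\<close>.\<close>
  define \<phi>0 where "\<phi>0 = c * A ^ 3 / 2"
  have \<phi>0: "\<phi>0 \<noteq> 0" using c0 nz by (simp add: \<phi>0_def)
  define \<F> where "\<F> u = 1 / \<phi>0 * \<theta> u" for u
  have \<F>s: "smooth_on \<Omega> \<F>"
    unfolding \<F>_def[abs_def] by (intro smooth_on_mult smooth_on_const \<Omega> \<theta>(1))
  let ?d = "\<lambda>x. case x of None \<Rightarrow> 1 | Some None \<Rightarrow> \<tau> powr A | Some (Some i) \<Rightarrow> \<sigma> * \<tau> powr A"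
  \<comment> \<open>Rescales the groups of coordinates so that \<open>\<sigma>\<close> and the
    powers of \<open>\<tau>\<close> disappear.\<close>
  define E :: "real^('k option option)^('k option option)" where "E = (\<chi> x y. if x = y then ?d x else 0)"
  define L where "L = E ** L0"
  have "det E = (\<Prod>x\<in>UNIV. E $ x $ x)" by (rule det_diagonal) (simp add: E_def)
  also have "\<dots> = \<tau> powr A * (\<sigma> * \<tau> powr A) ^ CARD('k)" by (simp add: prod_UNIV_option E_def)
  finally have "\<bar>det L\<bar> = \<bar>det L0\<bar> * \<tau> powr A * (\<sigma> * \<tau> powr A) ^ CARD('k)"
    unfolding L_def det_mul using \<sigma> \<tau> by (simp add: abs_mult)
  then have detL: "\<bar>det L\<bar> = \<bar>c\<bar> * A ^ 4 / 2" unfolding \<sigma>vol by (simp add: c_def abs_mult)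
  then have L: "det L \<noteq> 0" using c0 nz by auto
  have Lw: "L *v w = append_coord (append_coord ((\<sigma> * \<tau> powr A) *\<^sub>R Q w) (\<tau> powr A * \<psi> w)) (\<omega> w)" for w
    unfolding L_def matrix_vector_mul_assoc[symmetric]
    by (simp add: vec_eq_iff split_option_all E_def matrix_vector_mult_def[of "\<chi> x y. _ x y"] Q_def \<psi>_def \<omega>_def
        if_distrib[of "\<lambda>x. x * _"] cong: if_cong)
  interpret M: monge_ampere_chart I \<Omega> \<F> A \<phi>0 r
    using openI I(2) \<Omega>(1) \<F>s nz \<phi>0 by unfold_locales auto
  have LF: "L *v F w = M.f w" if w: "w \<in> P" for w
  proof -
    have 1: "\<sigma> * \<tau> powr A * ((w $ None / \<tau>) powr A / \<sigma>) = w $ None powr A"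
      using scaled_powr[OF w, of A] \<sigma> by (simp add: mult.commute)
    have 2: "2 * c / (a * \<beta>) = \<phi>0 / A" unfolding a\<beta> \<phi>0_def using nz by (simp add: power2_eq_square power3_eq_cube)
    show ?thesis
      unfolding M.f_eq Lw Q_F[OF w] \<psi>F[OF w] \<theta>(2)[OF w] scaled_powr[OF w] scaleR_scaleR 1 2
      using \<phi>0 nz by (simp add: monge_ampere_model_def \<F>_def field_simps)
  qed
  have M\<xi>: "M.\<xi> w = (1 / (r * (w $ None)\<^sup>2)) *\<^sub>R (M.f w - (2 * w $ None / (A * N)) *\<^sub>R partial None M.f w)"
    if "w \<in> P" for w
    unfolding AN[symmetric] by (rule M.\<xi>_eq[OF that])
  note geo = model_geometry[OF L LF M\<xi>]
  \<comment> \<open>The coefficient on the left is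
    \<open>\<bar>\<phi>0 / A\<bar> / \<bar>r\<bar>\<close> with \<open>r = - 1 / A^2\<close>; by
    \<open>detL\<close> it equals \<open>\<bar>det L\<bar>\<close>.\<close>
  have vol: "A * (CARD('k) + 2) - 3 = CARD('k) \<and> \<bar>c\<bar> * A ^ 4 / 2 = \<bar>det L\<bar> * sqrt \<bar>det (hessian \<F> u)\<bar>"
    if u: "u \<in> \<Omega>" for u
  proof -
    have r: "\<bar>r\<bar> = 1 / A\<^sup>2"
    proof -
      have "r = - 1 / A\<^sup>2" using Ar nz by (simp add: field_simps power2_eq_square)
      then show ?thesis by simp
    qed
    have k: "\<bar>\<phi>0 / A\<bar> / \<bar>r\<bar> = \<bar>c\<bar> * A ^ 4 / 2"
      unfolding r \<phi>0_def using nz by (simp add: abs_mult power2_eq_square power3_eq_cube power4_eq_xxxx)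
    have "\<bar>c\<bar> * A ^ 4 / 2 * t powr (A * (CARD('k) + 2) - 3) = \<bar>det L\<bar> * sqrt \<bar>det (hessian \<F> u)\<bar> * t ^ CARD('k)"
      if t: "t \<in> I" for t
    proof -
      note w = append_coord_P[OF u t]
      show ?thesis
        using geo(3)[OF _ _ w] unfolding M.det_frame_monge_ampere[OF w] M.det_metric_monge_ampere[OF w] Ar k
        by (simp add: mult_ac)
    qed
    from volume_exponent[OF this] show ?thesis using c0 nz by simp
  qed
  obtain u0 where u0: "u0 \<in> \<Omega>" using \<Omega> by blast
  from vol[OF u0] show vexp: "N + A * (CARD('k) + 1) = CARD('k) + 3" unfolding AN by (simp add: algebra_simps)
  have met: "affine_metric F X w = block_metric 1 (\<chi> i j. (w $ None)\<^sup>2 * hessian \<F> (rest_coords w) $ i $ j)" if w: "w \<in> P" for w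
    using geo(1)[OF _ _ w] unfolding M.metric_monge_ampere(2)[OF w] using Ar by simp
  have pos: "positive_definite (hessian \<F> u)" if u: "u \<in> \<Omega>" for u
  proof -
    obtain t where "t \<in> I" using I by (auto simp: open_interval_def)
    then have w: "append_coord u t \<in> P" by (rule append_coord_P[OF u])
    show ?thesis using warped_ln(2)[where g = "hessian \<F>", OF w met[OF w]] by simp
  qed
  have "smooth_on \<Omega> (\<lambda>u. hessian \<F> u $ i $ j)" for i j
    unfolding hessian_def by (simp add: smooth_on_partial[OF smooth_on_partial[OF \<F>s]])
  then have "smooth_on \<Omega> (hessian \<F>)" by (intro smooth_on_vec[OF \<Omega>(1)])
  then show "\<exists>g. riemannian_metric_on \<Omega> g \<and> (\<forall>w\<in>P. affine_metric F X w = warped_metric ln g w)"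
    using pos warped_ln(1)[where g = "hessian \<F>", OF _ met] by (auto simp: riemannian_metric_on_def)
  \<comment> \<open>The volumes give the absolute value, positive definiteness gives the
    sign.\<close>
  have "det (hessian \<F> u) = 1" if u: "u \<in> \<Omega>" for u
  proof -
    have "sqrt \<bar>det (hessian \<F> u)\<bar> = 1" using vol[OF u] c0 nz unfolding detL by simp
    then show ?thesis using det_positive_definite[OF pos[OF u]] by simp
  qed
  then have "convex_monge_ampere_solution \<Omega> \<F>" using \<F>s pos by (simp add: convex_monge_ampere_solution_def)
  moreover have "invertible L" using L invertible_det_nz by blast
  moreover have "\<forall>w\<in>P. L *v F w = monge_ampere_model (- A / 2) \<phi>0 \<F> (w $ None, rest_coords w)"
    using LF M.f_eq by simp
  ultimately show "\<exists>\<phi>0 \<F> (L :: real^('k option option)^('k option option)).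
        \<phi>0 \<noteq> 0 \<and> convex_monge_ampere_solution \<Omega> \<F> \<and> invertible L \<and>
        (\<forall>w\<in>P. L *v F w = monge_ampere_model (- A / 2) \<phi>0 \<F> (w $ None, rest_coords w))"
    using \<phi>0 by blast
qed

end

section \<open>Classification\<close>

lemma congruent_patch_subset:
  "congruent_patch V f \<xi> T l0 l1 \<Longrightarrow> W \<subseteq> V \<Longrightarrow> congruent_patch W f \<xi> T l0 l1"
  unfolding congruent_patch_def affine_normal_on_def centroaffine_on_def immersion_on_def transversal_on_def
  by (meson smooth_on_subset subsetD)

text \<open>The common kernel of \<open>\<phi>\<close> and \<open>\<psi>\<close> determines \<open>a\<close>, and then the trace of \<open>T\<close> determines \<open>\<phi> \<bullet> v\<close>.\<close>

lemma rank_one_perturbation_unique: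
  fixes T :: "real^'n^'n"
  assumes T: "\<And>w. T *v w = a *\<^sub>R w + (\<phi> \<bullet> w) *\<^sub>R v" "\<And>w. T *v w = b *\<^sub>R w + (\<psi> \<bullet> w) *\<^sub>R u"
    and dim: "CARD('n::finite) \<ge> 3"
  shows "a + \<phi> \<bullet> v = b + \<psi> \<bullet> u"
proof -
  have tr: "(\<Sum>i\<in>UNIV. (T *v axis i 1) $ i) = CARD('n) * c + \<eta> \<bullet> w"
    if "\<And>x. T *v x = c *\<^sub>R x + (\<eta> \<bullet> x) *\<^sub>R w" for c :: real and \<eta> w
    unfolding that by (simp add: inner_axis sum.distrib) (simp add: inner_vec_def)
  obtain X where X: "X \<noteq> 0" "\<phi> \<bullet> X = 0" "\<psi> \<bullet> X = 0" using exists_common_kernel[OF dim] by blast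
  then have "a *\<^sub>R X = b *\<^sub>R X" using T[of X] by simp
  then have "a = b" using X(1) by simp
  then show ?thesis using tr[OF T(1)] tr[OF T(2)] by simp
qed

text \<open>The ball around \<open>z0\<close> serves two purposes: \<open>\<alpha>\<close> is
  constant on it, and it is convex. Both scale factors of the flow coordinates are fixed
  here.\<close>

lemma local_normal_form:
  fixes V :: "(real^('k::finite option)) set"
  assumes S: "congruent_surface V f \<xi> T l0 l1" and z0: "z0 \<in> V" and n: "n = real CARD('k option)"
  obtains U I and \<Omega> :: "(real^'k) set" and \<Psi> \<Phi> where "open U" "U \<subseteq> V" "z0 \<in> U" "open_interval I" "I \<subseteq> {0<..}" "open \<Omega>"
    "homeomorphism U (product_domain I \<Omega>) \<Psi> \<Phi>" "smooth_on (product_domain I \<Omega>) \<Phi>" "smooth_on U \<Psi>"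
    "\<exists>g. riemannian_metric_on \<Omega> g \<and>
       (\<forall>w\<in>product_domain I \<Omega>. affine_metric (\<lambda>w. f (\<Phi> w)) (\<lambda>w. \<xi> (\<Phi> w)) w = warped_metric ln g w)"
    "\<exists>a v \<phi>. (\<forall>w. T *v w = a *\<^sub>R w + (\<phi> \<bullet> w) *\<^sub>R v) \<and> K1 (l0 z0) (l1 z0) = - 1 / (a + \<phi> \<bullet> v)"
    "l0 z0 + l1 z0 < 0"
    "(n + 2) * l0 z0 + n * l1 z0 \<noteq> 0 \<longrightarrow> NN n (l0 z0) (l1 z0) \<noteq> 0 \<and>
      (\<exists>g2 (L :: real^('k option option)^('k option option)).
        adapted_hypersphere (l0 z0) (l1 z0) (top_of_set \<Omega>) (domain_atlas \<Omega>) g2 \<and> invertible L \<and>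
        (\<forall>w\<in>product_domain I \<Omega>. L *v f (\<Phi> w) =
           hypersphere_model (K1 (l0 z0) (l1 z0)) (NN n (l0 z0) (l1 z0)) g2 (w $ None, rest_coords w)))"
    "(n + 2) * l0 z0 + n * l1 z0 = 0 \<longrightarrow>
      (\<exists>\<phi>0 \<F> (L :: real^('k option option)^('k option option)).
        \<phi>0 \<noteq> 0 \<and> convex_monge_ampere_solution \<Omega> \<F> \<and> invertible L \<and>
        (\<forall>w\<in>product_domain I \<Omega>. L *v f (\<Phi> w) =
           monge_ampere_model (K1 (l0 z0) (l1 z0)) \<phi>0 \<F> (w $ None, rest_coords w)))"
proof -
  interpret S: congruent_surface V f \<xi> T l0 l1 by fact
  obtain \<epsilon> where \<epsilon>: "0 < \<epsilon>" "ball z0 \<epsilon> \<subseteq> V" "\<forall>z\<in>ball z0 \<epsilon>. S.\<alpha> z = S.\<alpha> z0"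
    using S.\<alpha>_locally_constant[OF z0] by blast
  obtain v \<phi> where Tw: "\<And>w. T *v w = S.\<alpha> z0 *\<^sub>R w + (\<phi> \<bullet> w) *\<^sub>R v" using S.rank_one[OF z0] by metis
  define a where "a = S.\<alpha> z0"
  define B where "B = ball z0 \<epsilon>"
  interpret C: flow_chart B f \<xi> T l0 l1 a v \<phi> z0
  proof unfold_locales
    show "congruent_patch B f \<xi> T l0 l1" unfolding B_def by (rule congruent_patch_subset[OF S.patch \<epsilon>(2)])
    show "l1 z \<noteq> 0" if "z \<in> B" for z using S.l1 \<epsilon>(2) that by (auto simp: B_def)
    show "S.\<alpha> z = a" if "z \<in> B" for z using \<epsilon>(3) that by (simp add: B_def a_def)
    show "T *v w = a *\<^sub>R w + (\<phi> \<bullet> w) *\<^sub>R v" for w using Tw by (simp add: a_def)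
  qed (use S.T S.dim3 \<epsilon>(1) in \<open>simp_all add: B_def\<close>)
  obtain L0 :: "real^('k option option)^('k option option)" where L0: "det L0 \<noteq> 0"
    "L0 *v f z0 = append_coord (append_coord 0 1) 0" "L0 *v v = append_coord 0 1"
    "\<And>X. \<phi> \<bullet> C.D z0 X = 0 \<Longrightarrow> (L0 *v C.D z0 X) $ None = 0 \<and> (L0 *v C.D z0 X) $ Some None = 0"
    "\<And>w. \<phi> \<bullet> w = C.x0 * (L0 *v w) $ Some None + (\<phi> \<bullet> v) * (L0 *v w) $ None"
    using C.ambient_coordinates by blast
  \<comment> \<open>Solves \<open>A N r = 4 \<rho>(z0) / (a \<beta> \<tau>^2) = - 1\<close>, which
    makes d/dt a unit field; the radicand is positive because
    \<open>a \<beta> \<rho> < 0\<close>.\<close>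
  define \<tau> where "\<tau> = sqrt (- (4 / (a * C.\<beta>) * C.\<rho> z0))"
  have "0 < - (4 / (a * C.\<beta>) * C.\<rho> z0)"
  proof -
    have "4 / (a * C.\<beta>) * C.\<rho> z0 = 4 / (a * C.\<beta>)\<^sup>2 * (a * C.\<beta> * C.\<rho> z0)"
      using C.a_nz' C.\<beta>_nz' by (simp add: power2_eq_square)
    also have "\<dots> < 0" using C.a_nz' C.\<beta>_nz' by (intro mult_pos_neg[OF _ C.sign[OF C.z0]]) simp
    finally show ?thesis by simp
  qed
  then have \<tau>: "0 < \<tau>" "\<tau>\<^sup>2 = - (4 / (a * C.\<beta>) * C.\<rho> z0)" by (simp_all add: \<tau>_def)
  define A where "A = 2 / C.\<beta>"
  \<comment> \<open>The value of \<open>(\<sigma> * \<tau> powr A) ^ CARD('k)\<close> prescribed by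
    the logarithmic case; in the other case any positive scale serves.\<close>
  define s where "s = \<bar>C.x0\<bar> * \<tau> powr (- A) * A ^ 4 / 2 / (\<bar>det L0\<bar> * \<tau> powr A)"
  have A0: "A \<noteq> 0" using C.\<beta>_nz' by (simp add: A_def)
  then have s: "0 < s" using C.x0 \<tau> L0(1) by (simp add: s_def)
  define \<sigma> where "\<sigma> = s powr (1 / CARD('k)) / \<tau> powr A"
  have "(\<sigma> * \<tau> powr A) ^ CARD('k) = s"
    using s \<tau>(1) by (simp add: \<sigma>_def powr_realpow[symmetric] powr_powr)
  then have \<sigma>vol: "\<bar>det L0\<bar> * \<tau> powr A * (\<sigma> * \<tau> powr A) ^ CARD('k) = \<bar>C.x0\<bar> * \<tau> powr (- A) * A ^ 4 / 2"
    using L0(1) \<tau>(1) by (simp add: s_def)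
  have \<sigma>: "0 < \<sigma>" using s \<tau> by (simp add: \<sigma>_def)
  interpret K: flow_coordinates B f \<xi> T l0 l1 a v \<phi> z0 L0 \<sigma> \<tau>
    by unfold_locales (fact L0 \<sigma> \<tau>(1))+
  obtain U I and \<Omega> :: "(real^'k) set" and \<Phi> where U: "open U" "U \<subseteq> B" "z0 \<in> U" "open_interval I" "I \<subseteq> {0<..}" "open \<Omega>" "\<Omega> \<noteq> {}"
    "homeomorphism U (product_domain I \<Omega>) K.\<Psi> \<Phi>" "smooth_on (product_domain I \<Omega>) \<Phi>"
    "\<And>z. z \<in> U \<Longrightarrow> inj (frechet_derivative K.\<Psi> (at z))"
    using K.box by blast
  interpret X: flow_box B f \<xi> T l0 l1 a v \<phi> z0 L0 \<sigma> \<tau> U I \<Omega> \<Phi>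
    by unfold_locales (fact U)+
  have XA: "X.A = A" by (simp add: X.A_def A_def)
  have FX: "X.F = (\<lambda>w. f (\<Phi> w))" "X.X = (\<lambda>w. \<xi> (\<Phi> w))" by (simp_all add: fun_eq_iff X.F_def X.X_def)
  have \<tau>2: "4 / (a * C.\<beta>) * C.\<rho> z0 = - (\<tau>\<^sup>2)" unfolding \<tau>(2) by simp
  have "X.A * X.N * X.r = 4 / (a * C.\<beta>) * C.\<rho> z0 / \<tau>\<^sup>2" by (simp add: X.A_def X.N_def X.r_def)
  also have "\<dots> = - 1" unfolding \<tau>2 using \<tau>(1) by simp
  finally have ANr: "X.A * X.N * X.r = - 1" .
  note hs = X.hypersphere_normal_form[OF _ ANr] and ma = X.monge_ampere_normal_form[OF _ ANr, unfolded XA, OF _ \<sigma>vol]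
  have vol: "X.N + X.A * (CARD('k) + 1) = CARD('k) + 3" using hs(1) ma(1) XA by metis
  note ev = X.eigenvalue_relations[OF vol n C.z0]
  have l1: "l1 z0 \<noteq> 0" by (rule C.l1[OF C.z0])
  \<comment> \<open>The expression is a nonzero multiple of \<open>A - N\<close>, so the two cases
    of the statement are a diagonalizable \<open>T\<close> and a Jordan block.\<close>
  have case_iff: "(n + 2) * l0 z0 + n * l1 z0 = 0 \<longleftrightarrow> X.A = X.N"
    unfolding ev(3) using l1 X.AN_nz by simp
  show ?thesis
  proof (rule that[OF U(1) _ U(3,4,5,6,8,9)])
    show "U \<subseteq> V" using U(2) \<epsilon>(2) by (auto simp: B_def)
    show "smooth_on U K.\<Psi>" by (rule smooth_on_subset[OF K.\<Psi>_smooth U(2)])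
    show "\<exists>g. riemannian_metric_on \<Omega> g \<and>
       (\<forall>w\<in>product_domain I \<Omega>. affine_metric (\<lambda>w. f (\<Phi> w)) (\<lambda>w. \<xi> (\<Phi> w)) w = warped_metric ln g w)"
      using hs(2) ma(2) XA unfolding FX by metis
    have "K1 (l0 z0) (l1 z0) = - 1 / C.\<beta>" unfolding ev(1) X.A_def by simp
    then have "K1 (l0 z0) (l1 z0) = - 1 / (a + \<phi> \<bullet> v)" by (simp only: C.\<beta>_def)
    then show "\<exists>a v \<phi>. (\<forall>w. T *v w = a *\<^sub>R w + (\<phi> \<bullet> w) *\<^sub>R v) \<and> K1 (l0 z0) (l1 z0) = - 1 / (a + \<phi> \<bullet> v)"
      using C.T_eq by blast
    show "l0 z0 + l1 z0 < 0" by (rule ev(4))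
    show "(n + 2) * l0 z0 + n * l1 z0 \<noteq> 0 \<longrightarrow> NN n (l0 z0) (l1 z0) \<noteq> 0 \<and>
      (\<exists>g2 (L :: real^('k option option)^('k option option)).
        adapted_hypersphere (l0 z0) (l1 z0) (top_of_set \<Omega>) (domain_atlas \<Omega>) g2 \<and> invertible L \<and>
        (\<forall>w\<in>product_domain I \<Omega>. L *v f (\<Phi> w) =
           hypersphere_model (K1 (l0 z0) (l1 z0)) (NN n (l0 z0) (l1 z0)) g2 (w $ None, rest_coords w)))"
    proof
      assume "(n + 2) * l0 z0 + n * l1 z0 \<noteq> 0"
      then have "X.A \<noteq> X.N" using case_iff by simp
      from hs(3)[OF this n C.z0] show "NN n (l0 z0) (l1 z0) \<noteq> 0 \<and>
      (\<exists>g2 (L :: real^('k option option)^('k option option)).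
        adapted_hypersphere (l0 z0) (l1 z0) (top_of_set \<Omega>) (domain_atlas \<Omega>) g2 \<and> invertible L \<and>
        (\<forall>w\<in>product_domain I \<Omega>. L *v f (\<Phi> w) =
           hypersphere_model (K1 (l0 z0) (l1 z0)) (NN n (l0 z0) (l1 z0)) g2 (w $ None, rest_coords w)))"
        unfolding FX using ev(2) X.AN_nz(2) by simp
    qed
    show "(n + 2) * l0 z0 + n * l1 z0 = 0 \<longrightarrow> (\<exists>\<phi>0 \<F> (L :: real^('k option option)^('k option option)).
        \<phi>0 \<noteq> 0 \<and> convex_monge_ampere_solution \<Omega> \<F> \<and> invertible L \<and>
        (\<forall>w\<in>product_domain I \<Omega>. L *v f (\<Phi> w) =
           monge_ampere_model (K1 (l0 z0) (l1 z0)) \<phi>0 \<F> (w $ None, rest_coords w)))"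
    proof
      assume "(n + 2) * l0 z0 + n * l1 z0 = 0"
      then have "A = X.N" using case_iff XA by simp
      from ma(3)[OF this] show "\<exists>\<phi>0 \<F> (L :: real^('k option option)^('k option option)).
        \<phi>0 \<noteq> 0 \<and> convex_monge_ampere_solution \<Omega> \<F> \<and> invertible L \<and>
        (\<forall>w\<in>product_domain I \<Omega>. L *v f (\<Phi> w) =
           monge_ampere_model (K1 (l0 z0) (l1 z0)) \<phi>0 \<F> (w $ None, rest_coords w))"
        unfolding FX ev(1) XA .
    qed
  qed
qed

text \<open>Flow coordinates become a chart of the given smooth structure after composition with a
  chart of the atlas. Its orientation is left open, in accordance with
  \<open>smooth_chart\<close>.\<close>

lemma smooth_chart_compose:
  fixes c0 :: "('m, 'n::finite) chart"
  assumes M: "oriented_manifold X \<A>" and c0: "c0 \<in> \<A>" and U: "open U" "U \<subseteq> chart_image c0" and P: "open P"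
    and hom: "homeomorphism U P \<Psi> \<Phi>" and s: "smooth_on U \<Psi>" "smooth_on P \<Phi>"
  defines "c \<equiv> ({q \<in> fst c0. snd c0 q \<in> U}, \<lambda>q. \<Psi> (snd c0 q))"
  shows "smooth_chart X \<A> c" "chart_image c = P"
    "\<And>H :: 'm \<Rightarrow> 'z. \<And>w. w \<in> P \<Longrightarrow> local_rep c H w = local_rep c0 H (\<Phi> w)"
proof -
  let ?W = "{q \<in> fst c0. snd c0 q \<in> U}" and ?inv = "inv_into (fst c0) (snd c0)"
  have tc: "topological_chart X c0" using M c0 by (simp add: oriented_manifold_def)
  note h0 = topological_chart_homeomorphic_maps[OF tc]
  have op0: "openin X (fst c0)" using tc by (simp add: topological_chart_def)
  have top0: "topspace (subtopology X (fst c0)) = fst c0" using h0(3) by auto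
  have cm: "continuous_map (subtopology X (fst c0)) (top_of_set (chart_image c0)) (snd c0)"
    using h0(1) by (simp add: homeomorphic_maps_def)
  have "openin (top_of_set (chart_image c0)) U" using U open_subset by blast
  from openin_continuous_map_preimage[OF cm this] have "openin (subtopology X (fst c0)) ?W" unfolding top0 .
  then have opW: "openin X ?W" by (rule openin_trans_full[OF _ op0])
  have im: "snd c0 ` ?W = U" using U(2) by (auto simp: chart_image_def)
  have "homeomorphic_maps (subtopology (subtopology X (fst c0)) ?W) (subtopology (top_of_set (chart_image c0)) U) (snd c0) ?inv"
  proof (rule homeomorphic_maps_subtopologies[OF h0(1)])
    have "fst c0 \<inter> ?W = ?W" by blast
    then show "snd c0 ` (topspace (subtopology X (fst c0)) \<inter> ?W) = topspace (top_of_set (chart_image c0)) \<inter> U"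
      unfolding top0 using im U(2) by auto
  qed
  moreover have "fst c0 \<inter> ?W = ?W" "chart_image c0 \<inter> U = U" using U(2) by auto
  ultimately have h1: "homeomorphic_maps (subtopology X ?W) (top_of_set U) (snd c0) ?inv"
    by (simp add: subtopology_subtopology)
  have h2: "homeomorphic_maps (top_of_set U) (top_of_set P) \<Psi> \<Phi>"
    using hom by (auto simp: homeomorphic_maps_def homeomorphism_def)
  have h: "homeomorphic_maps (subtopology X ?W) (top_of_set P) (\<lambda>q. \<Psi> (snd c0 q)) (\<lambda>w. ?inv (\<Phi> w))"
    using homeomorphic_maps_compose[OF conjI[OF h1 h2]] by (simp add: o_def)
  note tI = topological_chartI[OF opW P h]
  have tcc: "topological_chart X c" unfolding c_def by (rule tI(1))
  show imc: "chart_image c = P" unfolding c_def by (rule tI(2))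
  have inv: "inv_into (fst c) (snd c) w = ?inv (\<Phi> w)" if "w \<in> P" for w using tI(3)[OF that] by (simp add: c_def)
  show rep: "local_rep c H w = local_rep c0 H (\<Phi> w)" if "w \<in> P" for H :: "'m \<Rightarrow> 'z" and w
    by (simp add: local_rep_def inv[OF that])
  have repn: "local_rep c H w = local_rep c0 H (\<Phi> w)" if "w \<in> P" for H :: "'m \<Rightarrow> real^'n" and w
    by (simp add: local_rep_def inv[OF that])
  have \<Phi>U: "\<Phi> w \<in> U" "\<Psi> (\<Phi> w) = w" if "w \<in> P" for w using hom that by (auto simp: homeomorphism_def)
  have \<Phi>\<Psi>: "\<Phi> (\<Psi> x) = x" if "x \<in> U" for x using hom that by (auto simp: homeomorphism_def)
  have "smooth_transition c d \<and> smooth_transition d c" if d: "d \<in> \<A>" for d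
  proof
    have td: "topological_chart X d" using M d by (simp add: oriented_manifold_def)
    have tr: "smooth_on (snd c0 ` (fst c0 \<inter> fst d)) (local_rep c0 (snd d))"
      "smooth_on (snd d ` (fst d \<inter> fst c0)) (local_rep d (snd c0))"
      using M c0 d by (auto simp: oriented_manifold_def smooth_transition_def)
    have od: "openin X (fst d)" using td by (simp add: topological_chart_def)
    have fc: "fst c = ?W" "snd c = (\<lambda>q. \<Psi> (snd c0 q))" by (simp_all add: c_def)
    have oc: "openin X (fst c)" using opW by (simp add: fc)
    let ?S = "snd c ` (fst c \<inter> fst d)"
    have oS: "open ?S" by (rule open_chart_image_subset[OF tcc openin_Int[OF oc od]]) simp
    have SP: "?S \<subseteq> P" using imc by (auto simp: chart_image_def)
    have oS0: "open (snd c0 ` (fst c0 \<inter> fst d))" by (rule open_chart_image_subset[OF tc openin_Int[OF op0 od]]) simp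
    have im: "\<Phi> w \<in> snd c0 ` (fst c0 \<inter> fst d)" if "w \<in> ?S" for w
      using that \<Phi>\<Psi> by (auto simp: fc)
    have "smooth_on ?S (\<lambda>w. local_rep c0 (snd d) (\<Phi> w))"
      by (rule smooth_on_compose[OF tr(1) oS oS0 smooth_on_subset[OF s(2) SP]]) (rule im)
    then show "smooth_transition c d"
      unfolding smooth_transition_def
      by (rule smooth_on_cong[OF oS, rotated]) (rule repn[symmetric], erule subsetD[OF SP])
    let ?R = "snd d ` (fst d \<inter> fst c)"
    have oR: "open ?R" by (rule open_chart_image_subset[OF td openin_Int[OF od oc]]) simp
    have RU: "?R \<subseteq> snd d ` (fst d \<inter> fst c0)" by (auto simp: fc)
    have dU: "local_rep d (snd c0) w \<in> U" if w: "w \<in> ?R" for w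
    proof -
      obtain q where q: "q \<in> fst d" "q \<in> fst c" "w = snd d q" using w by blast
      then have "inv_into (fst d) (snd d) w = q"
        using inv_into_f_f[OF topological_chart_homeomorphic_maps(2)[OF td]] by simp
      then show ?thesis using q by (simp add: local_rep_def fc)
    qed
    have "smooth_on ?R (\<lambda>w. \<Psi> (local_rep d (snd c0) w))"
      by (rule smooth_on_compose[OF s(1) oR U(1) smooth_on_subset[OF tr(2) RU]]) (rule dU)
    moreover have "(\<lambda>w. \<Psi> (local_rep d (snd c0) w)) = local_rep d (snd c)" by (simp add: local_rep_def fc fun_eq_iff)
    ultimately show "smooth_transition d c" unfolding smooth_transition_def by simp
  qed
  then show "smooth_chart X \<A> c" using tcc by (simp add: smooth_chart_def)
qed


text \<open>Names the conclusion of the classification at a point, in the form to which it is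
  unfolded at the end.\<close>

definition normal_form_chart where
  "normal_form_chart n X \<A> f \<xi> p l0 l1 c I (\<Omega> :: (real^'k::finite) set) F g \<longleftrightarrow>
     smooth_chart X \<A> c \<and> p \<in> fst c \<and>
     open_interval I \<and> I \<subseteq> {0<..} \<and> open \<Omega> \<and> chart_image c = product_domain I \<Omega> \<and>
     smooth_on I F \<and> riemannian_metric_on \<Omega> g \<and>
     (\<forall>z\<in>chart_image c. affine_metric (local_rep c f) (local_rep c \<xi>) z = warped_metric F g z) \<and>
     ((n + 2) * l0 + n * l1 \<noteq> 0 \<longrightarrow>
        NN n l0 l1 \<noteq> 0 \<and>
        (\<exists>g2 (L :: real^('k option option)^('k option option)) b.
           adapted_hypersphere l0 l1 (top_of_set \<Omega>) (domain_atlas \<Omega>) g2 \<and> invertible L \<and>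
           (\<forall>z\<in>chart_image c. L *v local_rep c f z + b =
              hypersphere_model (K1 l0 l1) (NN n l0 l1) g2 (z $ None, rest_coords z)))) \<and>
     ((n + 2) * l0 + n * l1 = 0 \<longrightarrow>
        (\<exists>\<phi>0 \<F> (L :: real^('k option option)^('k option option)) b.
           \<phi>0 \<noteq> 0 \<and> convex_monge_ampere_solution \<Omega> \<F> \<and> invertible L \<and>
           (\<forall>z\<in>chart_image c. L *v local_rep c f z + b =
              monge_ampere_model (K1 l0 l1) \<phi>0 \<F> (z $ None, rest_coords z))))"

text \<open>The third conclusion retains \<open>T\<close>, the object shared by all charts, and so
  makes \<open>K1\<close> comparable at different points.\<close>

lemma classification_at:
  fixes \<A> :: "('m, 'k::finite option) chart set"
  assumes dim: "CARD('k) \<ge> 2" and n: "n = real CARD('k option)" and M: "oriented_manifold X \<A>"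
    and \<kappa>1: "\<forall>p\<in>topspace X. \<kappa>1 p \<noteq> 0" and T: "invertible T"
    and patch: "\<forall>c\<in>\<A>. congruent_patch (chart_image c) (local_rep c f) (local_rep c \<xi>) T
        (local_rep c \<kappa>0) (local_rep c \<kappa>1)"
    and p: "p \<in> topspace X"
  shows "\<kappa>0 p + \<kappa>1 p < 0" "\<kappa>0 p \<noteq> \<kappa>1 p"
    "\<exists>a v \<phi>. (\<forall>w. T *v w = a *\<^sub>R w + (\<phi> \<bullet> w) *\<^sub>R v) \<and> K1 (\<kappa>0 p) (\<kappa>1 p) = - 1 / (a + \<phi> \<bullet> v)"
    "\<exists>c I (\<Omega> :: (real^'k) set) F g. normal_form_chart n X \<A> f \<xi> p (\<kappa>0 p) (\<kappa>1 p) c I \<Omega> F g"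
proof -
  obtain c0 where c0: "c0 \<in> \<A>" "p \<in> fst c0" using M p unfolding oriented_manifold_def by blast
  have tc: "topological_chart X c0" using M c0 by (simp add: oriented_manifold_def)
  note h0 = topological_chart_homeomorphic_maps[OF tc]
  let ?z = "snd c0 p"
  have z: "?z \<in> chart_image c0" using c0(2) by (simp add: chart_image_def)
  have rep: "local_rep c0 \<kappa> ?z = \<kappa> p" for \<kappa> :: "'m \<Rightarrow> real" using inv_into_f_f[OF h0(2) c0(2)] by (simp add: local_rep_def)
  have S: "congruent_surface (chart_image c0) (local_rep c0 f) (local_rep c0 \<xi>) T (local_rep c0 \<kappa>0) (local_rep c0 \<kappa>1)"
  proof
    show "congruent_patch (chart_image c0) (local_rep c0 f) (local_rep c0 \<xi>) T (local_rep c0 \<kappa>0) (local_rep c0 \<kappa>1)"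
      by (rule bspec[OF patch c0(1)])
    show "open (chart_image c0)" using tc by (simp add: topological_chart_def)
    show "det T \<noteq> 0" using T by (simp add: invertible_det_nz)
    show "local_rep c0 \<kappa>1 z \<noteq> 0" if "z \<in> chart_image c0" for z
    proof -
      have "inv_into (fst c0) (snd c0) z \<in> fst c0" using that by (auto simp: chart_image_def intro: inv_into_into)
      then show ?thesis using \<kappa>1 h0(3) by (auto simp: local_rep_def)
    qed
    show "CARD('k option) \<ge> 3" using dim by (simp add: card_UNIV_option)
  qed
  obtain U I and \<Omega> :: "(real^'k) set" and \<Psi> \<Phi> where UI: "open U" "U \<subseteq> chart_image c0" "?z \<in> U" "open_interval I" "I \<subseteq> {0<..}" "open \<Omega>"
    "homeomorphism U (product_domain I \<Omega>) \<Psi> \<Phi>" "smooth_on (product_domain I \<Omega>) \<Phi>" "smooth_on U \<Psi>"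
    and met: "\<exists>g. riemannian_metric_on \<Omega> g \<and>
       (\<forall>w\<in>product_domain I \<Omega>. affine_metric (\<lambda>w. local_rep c0 f (\<Phi> w)) (\<lambda>w. local_rep c0 \<xi> (\<Phi> w)) w = warped_metric ln g w)"
    and K: "\<exists>a v \<phi>. (\<forall>w. T *v w = a *\<^sub>R w + (\<phi> \<bullet> w) *\<^sub>R v) \<and> K1 (\<kappa>0 p) (\<kappa>1 p) = - 1 / (a + \<phi> \<bullet> v)"
    and neg: "\<kappa>0 p + \<kappa>1 p < 0"
    and hs: "(n + 2) * \<kappa>0 p + n * \<kappa>1 p \<noteq> 0 \<longrightarrow> NN n (\<kappa>0 p) (\<kappa>1 p) \<noteq> 0 \<and>
      (\<exists>g2 (L :: real^('k option option)^('k option option)).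
        adapted_hypersphere (\<kappa>0 p) (\<kappa>1 p) (top_of_set \<Omega>) (domain_atlas \<Omega>) g2 \<and> invertible L \<and>
        (\<forall>w\<in>product_domain I \<Omega>. L *v local_rep c0 f (\<Phi> w) =
           hypersphere_model (K1 (\<kappa>0 p) (\<kappa>1 p)) (NN n (\<kappa>0 p) (\<kappa>1 p)) g2 (w $ None, rest_coords w)))"
    and ma: "(n + 2) * \<kappa>0 p + n * \<kappa>1 p = 0 \<longrightarrow>
      (\<exists>\<phi>0 \<F> (L :: real^('k option option)^('k option option)).
        \<phi>0 \<noteq> 0 \<and> convex_monge_ampere_solution \<Omega> \<F> \<and> invertible L \<and>
        (\<forall>w\<in>product_domain I \<Omega>. L *v local_rep c0 f (\<Phi> w) =
           monge_ampere_model (K1 (\<kappa>0 p) (\<kappa>1 p)) \<phi>0 \<F> (w $ None, rest_coords w)))"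
    by (rule local_normal_form[OF S z n, unfolded rep]) (rule that)
  show "\<kappa>0 p + \<kappa>1 p < 0" by (rule neg)
  show "\<exists>a v \<phi>. (\<forall>w. T *v w = a *\<^sub>R w + (\<phi> \<bullet> w) *\<^sub>R v) \<and> K1 (\<kappa>0 p) (\<kappa>1 p) = - 1 / (a + \<phi> \<bullet> v)" by (rule K)
  show "\<kappa>0 p \<noteq> \<kappa>1 p" using bspec[OF patch c0(1)] z unfolding congruent_patch_def rep[symmetric] by blast
  have oI: "open I" using UI(4) by (simp add: open_interval_def)
  have oP: "open (product_domain I \<Omega>)" by (rule open_product_domain[OF oI UI(6)])
  define c where "c = ({q \<in> fst c0. snd c0 q \<in> U}, \<lambda>q. \<Psi> (snd c0 q))"
  note sc = smooth_chart_compose[OF M c0(1) UI(1,2) oP UI(7,9,8), folded c_def]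
  obtain g where g: "riemannian_metric_on \<Omega> g"
    "\<And>w. w \<in> product_domain I \<Omega> \<Longrightarrow> affine_metric (\<lambda>w. local_rep c0 f (\<Phi> w)) (\<lambda>w. local_rep c0 \<xi> (\<Phi> w)) w = warped_metric ln g w"
    using met by blast
  have "affine_metric (local_rep c f) (local_rep c \<xi>) w = warped_metric ln g w" if w: "w \<in> product_domain I \<Omega>" for w
    by (rule trans[OF affine_metric_cong[OF oP w] g(2)[OF w]]) (rule sc(3), assumption)+
  moreover have "smooth_on I ln"
    by (rule smooth_on_ln[OF oI smooth_on_ident[OF oI]]) (use UI(5) in auto)
  moreover have "p \<in> fst c" using c0(2) UI(3) by (simp add: c_def)
  moreover have "(n + 2) * \<kappa>0 p + n * \<kappa>1 p \<noteq> 0 \<longrightarrow> NN n (\<kappa>0 p) (\<kappa>1 p) \<noteq> 0 \<and>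
      (\<exists>g2 (L :: real^('k option option)^('k option option)) b.
        adapted_hypersphere (\<kappa>0 p) (\<kappa>1 p) (top_of_set \<Omega>) (domain_atlas \<Omega>) g2 \<and> invertible L \<and>
        (\<forall>w\<in>product_domain I \<Omega>. L *v local_rep c f w + b =
           hypersphere_model (K1 (\<kappa>0 p) (\<kappa>1 p)) (NN n (\<kappa>0 p) (\<kappa>1 p)) g2 (w $ None, rest_coords w)))"
  proof
    assume "(n + 2) * \<kappa>0 p + n * \<kappa>1 p \<noteq> 0"
    with hs obtain g2 and L :: "real^('k option option)^('k option option)" where
      "adapted_hypersphere (\<kappa>0 p) (\<kappa>1 p) (top_of_set \<Omega>) (domain_atlas \<Omega>) g2" "invertible L" "NN n (\<kappa>0 p) (\<kappa>1 p) \<noteq> 0"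
      and *: "\<forall>w\<in>product_domain I \<Omega>. L *v local_rep c0 f (\<Phi> w) =
           hypersphere_model (K1 (\<kappa>0 p) (\<kappa>1 p)) (NN n (\<kappa>0 p) (\<kappa>1 p)) g2 (w $ None, rest_coords w)"
      by blast
    \<comment> \<open>The normal form is reached by a linear map, so the translation part is
      zero.\<close>
    moreover have "L *v local_rep c f w + 0 =
        hypersphere_model (K1 (\<kappa>0 p) (\<kappa>1 p)) (NN n (\<kappa>0 p) (\<kappa>1 p)) g2 (w $ None, rest_coords w)"
      if "w \<in> product_domain I \<Omega>" for w
      using bspec[OF * that] by (simp add: sc(3)[OF that])
    ultimately show "NN n (\<kappa>0 p) (\<kappa>1 p) \<noteq> 0 \<and>
      (\<exists>g2 (L :: real^('k option option)^('k option option)) b.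
        adapted_hypersphere (\<kappa>0 p) (\<kappa>1 p) (top_of_set \<Omega>) (domain_atlas \<Omega>) g2 \<and> invertible L \<and>
        (\<forall>w\<in>product_domain I \<Omega>. L *v local_rep c f w + b =
           hypersphere_model (K1 (\<kappa>0 p) (\<kappa>1 p)) (NN n (\<kappa>0 p) (\<kappa>1 p)) g2 (w $ None, rest_coords w)))"
      by blast
  qed
  moreover have "(n + 2) * \<kappa>0 p + n * \<kappa>1 p = 0 \<longrightarrow>
      (\<exists>\<phi>0 \<F> (L :: real^('k option option)^('k option option)) b.
        \<phi>0 \<noteq> 0 \<and> convex_monge_ampere_solution \<Omega> \<F> \<and> invertible L \<and>
        (\<forall>w\<in>product_domain I \<Omega>. L *v local_rep c f w + b =
           monge_ampere_model (K1 (\<kappa>0 p) (\<kappa>1 p)) \<phi>0 \<F> (w $ None, rest_coords w)))"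
  proof
    assume "(n + 2) * \<kappa>0 p + n * \<kappa>1 p = 0"
    with ma obtain \<phi>0 \<F> and L :: "real^('k option option)^('k option option)" where
      "\<phi>0 \<noteq> 0" "convex_monge_ampere_solution \<Omega> \<F>" "invertible L"
      and *: "\<forall>w\<in>product_domain I \<Omega>. L *v local_rep c0 f (\<Phi> w) =
           monge_ampere_model (K1 (\<kappa>0 p) (\<kappa>1 p)) \<phi>0 \<F> (w $ None, rest_coords w)"
      by blast
    moreover have "L *v local_rep c f w + 0 =
        monge_ampere_model (K1 (\<kappa>0 p) (\<kappa>1 p)) \<phi>0 \<F> (w $ None, rest_coords w)"
      if "w \<in> product_domain I \<Omega>" for w
      using bspec[OF * that] by (simp add: sc(3)[OF that])
    ultimately show "\<exists>\<phi>0 \<F> (L :: real^('k option option)^('k option option)) b.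
        \<phi>0 \<noteq> 0 \<and> convex_monge_ampere_solution \<Omega> \<F> \<and> invertible L \<and>
        (\<forall>w\<in>product_domain I \<Omega>. L *v local_rep c f w + b =
           monge_ampere_model (K1 (\<kappa>0 p) (\<kappa>1 p)) \<phi>0 \<F> (w $ None, rest_coords w))"
      by blast
  qed
  ultimately have "normal_form_chart n X \<A> f \<xi> p (\<kappa>0 p) (\<kappa>1 p) c I \<Omega> ln g"
    unfolding normal_form_chart_def sc(2) using sc(1) UI(4,5,6) g(1)
    by (intro conjI ballI refl; assumption?; simp only:)
  then show "\<exists>c I (\<Omega> :: (real^'k) set) F g. normal_form_chart n X \<A> f \<xi> p (\<kappa>0 p) (\<kappa>1 p) c I \<Omega> F g"
    by blast
qed

lemma classification:
  fixes \<A> :: "('m, 'k::finite option) chart set"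
  assumes dim: "CARD('k) \<ge> 2" and n: "n = real CARD('k option)"
    and H: "centre_congruent_hypersurface X \<A> f \<xi> \<kappa>0 \<kappa>1"
  shows "\<forall>p\<in>topspace X. \<kappa>0 p + \<kappa>1 p < 0"
    "\<exists>k0 k1. \<forall>p\<in>topspace X. K0 (\<kappa>0 p) (\<kappa>1 p) = k0 \<and> K1 (\<kappa>0 p) (\<kappa>1 p) = k1"
    "\<forall>p\<in>topspace X. \<exists>c I (\<Omega> :: (real^'k) set) F g. normal_form_chart n X \<A> f \<xi> p (\<kappa>0 p) (\<kappa>1 p) c I \<Omega> F g"
proof -
  obtain T where T: "oriented_manifold X \<A>" "\<forall>p\<in>topspace X. \<kappa>1 p \<noteq> 0" "invertible T"
    "\<forall>c\<in>\<A>. congruent_patch (chart_image c) (local_rep c f) (local_rep c \<xi>) T (local_rep c \<kappa>0) (local_rep c \<kappa>1)"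
    using H unfolding centre_congruent_hypersurface_iff by blast
  note cl = classification_at[OF dim n T]
  show "\<forall>p\<in>topspace X. \<kappa>0 p + \<kappa>1 p < 0"
    "\<forall>p\<in>topspace X. \<exists>c I (\<Omega> :: (real^'k) set) F g. normal_form_chart n X \<A> f \<xi> p (\<kappa>0 p) (\<kappa>1 p) c I \<Omega> F g"
    using cl(1,4) by blast+
  have K01: "K0 l0 l1 = 1 + K1 l0 l1" if "l0 \<noteq> l1" for l0 l1 using that by (simp add: K0_def K1_def field_simps)
  have dim4: "CARD('k option option) \<ge> 3" using dim by (simp add: card_UNIV_option)
  show "\<exists>k0 k1. \<forall>p\<in>topspace X. K0 (\<kappa>0 p) (\<kappa>1 p) = k0 \<and> K1 (\<kappa>0 p) (\<kappa>1 p) = k1"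
  proof (cases "topspace X = {}")
    case False
    then obtain p0 where p0: "p0 \<in> topspace X" by blast
    \<comment> \<open>Both values are \<open>- 1 / \<beta>\<close> with \<open>\<beta>\<close>
      determined by \<open>T\<close>, so they agree even on different components of the
      manifold.\<close>
    have "K1 (\<kappa>0 p) (\<kappa>1 p) = K1 (\<kappa>0 p0) (\<kappa>1 p0)" if p: "p \<in> topspace X" for p
    proof -
      obtain a v \<phi> where 1: "\<And>w. T *v w = a *\<^sub>R w + (\<phi> \<bullet> w) *\<^sub>R v" "K1 (\<kappa>0 p) (\<kappa>1 p) = - 1 / (a + \<phi> \<bullet> v)"
        using cl(3)[OF p] by blast
      obtain b u \<psi> where 2: "\<And>w. T *v w = b *\<^sub>R w + (\<psi> \<bullet> w) *\<^sub>R u" "K1 (\<kappa>0 p0) (\<kappa>1 p0) = - 1 / (b + \<psi> \<bullet> u)"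
        using cl(3)[OF p0] by blast
      have "a + \<phi> \<bullet> v = b + \<psi> \<bullet> u" by (rule rank_one_perturbation_unique[OF 1(1) 2(1) dim4])
      then show ?thesis using 1(2) 2(2) by simp
    qed
    then show ?thesis using K01 cl(2) by metis
  qed blast
qed

lemma K_scaled:
  assumes "0 < C" "0 < t"
  shows "K0 (C * l0 / t\<^sup>2) (C * l1 / t\<^sup>2) = K0 l0 l1" "K1 (C * l0 / t\<^sup>2) (C * l1 / t\<^sup>2) = K1 l0 l1"
  using K0_cmult[of "C / t\<^sup>2" l0 l1] K1_cmult[of "C / t\<^sup>2" l0 l1] assms by simp_all

theorem theorem1p1:
  fixes n :: real
  assumes dim: "CARD('k::finite) \<ge> 2" and n: "n = real CARD('k option)"
  shows
    \<comment> \<open>existence\<close>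
    "(\<forall>l0 l1. l0 \<noteq> l1 \<and> l1 \<noteq> 0 \<and> NN n l0 l1 \<noteq> 0 \<longrightarrow>
        ((\<exists>(X :: (real \<times> (real^'k)) topology) (A :: (real \<times> (real^'k), 'k option) chart set) f \<xi> \<kappa>0 \<kappa>1.
            centre_congruent_hypersurface X A f \<xi> \<kappa>0 \<kappa>1 \<and>
            (\<exists>p\<in>topspace X. \<kappa>0 p = l0 \<and> \<kappa>1 p = l1))
         \<longleftrightarrow> l0 + l1 < 0))
   \<and> \<comment> \<open>classification\<close>
     (\<forall>(X :: 'm topology) (A :: ('m, 'k option) chart set) f \<xi> \<kappa>0 \<kappa>1.
        centre_congruent_hypersurface X A f \<xi> \<kappa>0 \<kappa>1 \<longrightarrow>
          (\<forall>p\<in>topspace X. \<kappa>0 p + \<kappa>1 p < 0) \<and>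
          (\<exists>k0 k1. \<forall>p\<in>topspace X. K0 (\<kappa>0 p) (\<kappa>1 p) = k0 \<and> K1 (\<kappa>0 p) (\<kappa>1 p) = k1) \<and>
          (\<forall>p\<in>topspace X. \<exists>c I (\<Omega> :: (real^'k) set) F g.
             smooth_chart X A c \<and> p \<in> fst c \<and>
             open_interval I \<and> I \<subseteq> {0<..} \<and> open \<Omega> \<and> chart_image c = product_domain I \<Omega> \<and>
             smooth_on I F \<and> riemannian_metric_on \<Omega> g \<and>
             (\<forall>z\<in>chart_image c.
                affine_metric (local_rep c f) (local_rep c \<xi>) z = warped_metric F g z) \<and>
             ((n + 2) * \<kappa>0 p + n * \<kappa>1 p \<noteq> 0 \<longrightarrow>
                NN n (\<kappa>0 p) (\<kappa>1 p) \<noteq> 0 \<and>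
                (\<exists>g2 (L :: real^('k option option)^('k option option)) b.
                   adapted_hypersphere (\<kappa>0 p) (\<kappa>1 p) (top_of_set \<Omega>) (domain_atlas \<Omega>) g2 \<and>
                   invertible L \<and>
                   (\<forall>z\<in>chart_image c. L *v local_rep c f z + b =
                      hypersphere_model (K1 (\<kappa>0 p) (\<kappa>1 p)) (NN n (\<kappa>0 p) (\<kappa>1 p)) g2
                        (z $ None, rest_coords z)))) \<and>
             ((n + 2) * \<kappa>0 p + n * \<kappa>1 p = 0 \<longrightarrow>
                (\<exists>\<phi>0 \<F> (L :: real^('k option option)^('k option option)) b.
                   \<phi>0 \<noteq> 0 \<and> convex_monge_ampere_solution \<Omega> \<F> \<and>
                   invertible L \<and>
                   (\<forall>z\<in>chart_image c. L *v local_rep c f z + b =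
                      monge_ampere_model (K1 (\<kappa>0 p) (\<kappa>1 p)) \<phi>0 \<F> (z $ None, rest_coords z))))))
   \<and> \<comment> \<open>converse of (i)\<close>
     (\<forall>l0 l1 (Y :: 'q topology) (B :: ('q, 'k) chart set) g2 I
        (L :: real^('k option option)^('k option option)).
        l0 \<noteq> l1 \<and> l1 \<noteq> 0 \<and> l0 + l1 < 0 \<and> (n + 2) * l0 + n * l1 \<noteq> 0 \<and> NN n l0 l1 \<noteq> 0 \<and>
        adapted_hypersphere l0 l1 Y B g2 \<and> open_interval I \<and> I \<subseteq> {0<..} \<and> invertible L \<longrightarrow>
          (\<exists>\<xi> \<kappa>0 \<kappa>1.
             centre_congruent_hypersurface (prod_topology (top_of_set I) Y) (line_product_atlas I B)
               (\<lambda>x. L *v hypersphere_model (K1 l0 l1) (NN n l0 l1) g2 x) \<xi> \<kappa>0 \<kappa>1 \<and>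
             (\<forall>p \<in> I \<times> topspace Y.
                K0 (\<kappa>0 p) (\<kappa>1 p) = K0 l0 l1 \<and> K1 (\<kappa>0 p) (\<kappa>1 p) = K1 l0 l1)))
   \<and> \<comment> \<open>converse of (ii)\<close>
     (\<forall>l0 l1 (\<Omega> :: (real^'k) set) \<phi>0 \<F> I (L :: real^('k option option)^('k option option)).
        l0 \<noteq> l1 \<and> l1 \<noteq> 0 \<and> l0 + l1 < 0 \<and> (n + 2) * l0 + n * l1 = 0 \<and>
        open \<Omega> \<and> \<phi>0 \<noteq> 0 \<and> convex_monge_ampere_solution \<Omega> \<F> \<and>
        open_interval I \<and> I \<subseteq> {0<..} \<and> invertible L \<longrightarrow>
          (\<exists>\<xi> \<kappa>0 \<kappa>1.
             centre_congruent_hypersurface (prod_topology (top_of_set I) (top_of_set \<Omega>))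
               (line_product_atlas I (domain_atlas \<Omega>))
               (\<lambda>x. L *v monge_ampere_model (K1 l0 l1) \<phi>0 \<F> x) \<xi> \<kappa>0 \<kappa>1 \<and>
             (\<forall>p \<in> I \<times> \<Omega>.
                K0 (\<kappa>0 p) (\<kappa>1 p) = K0 l0 l1 \<and> K1 (\<kappa>0 p) (\<kappa>1 p) = K1 l0 l1)))"
proof (rule conjI[OF _ conjI[OF _ conjI]], goal_cases)
  case 1
  show ?case
  proof (intro allI impI iffI)
    fix l0 l1
    assume l: "l0 \<noteq> l1 \<and> l1 \<noteq> 0 \<and> NN n l0 l1 \<noteq> 0"
    assume "\<exists>(X :: (real \<times> (real^'k)) topology) (A :: (real \<times> (real^'k), 'k option) chart set) f \<xi> \<kappa>0 \<kappa>1.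
      centre_congruent_hypersurface X A f \<xi> \<kappa>0 \<kappa>1 \<and> (\<exists>p\<in>topspace X. \<kappa>0 p = l0 \<and> \<kappa>1 p = l1)"
    then show "l0 + l1 < 0" using classification(1)[OF dim n] by blast
  qed (use existence[OF n] in blast)
next
  case 2
  show ?case
    by (intro allI impI conjI; erule classification[OF dim n, unfolded normal_form_chart_def])
next
  case 3
  show ?case
  proof (intro allI impI, elim conjE, goal_cases)
    case (1 l0 l1 Y B g2 I L)
    have I: "open I" using 1(7) by (simp add: open_interval_def)
    from converse_hypersphere[OF n 1(1-6) I 1(8,9)] obtain C \<xi> where C: "0 < C"
      "centre_congruent_hypersurface (prod_topology (top_of_set I) Y) (line_product_atlas I B)
         (\<lambda>x. L *v hypersphere_model (K1 l0 l1) (NN n l0 l1) g2 x) \<xi> (\<lambda>(t, q). C * l0 / t\<^sup>2) (\<lambda>(t, q). C * l1 / t\<^sup>2)"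
      by blast
    \<comment> \<open>The eigenvalue functions are \<open>l0\<close> and \<open>l1\<close> times the
      common positive factor \<open>C / t^2\<close>, under which \<open>K0\<close> and
      \<open>K1\<close> are invariant.\<close>
    show ?case
      by (rule exI[of _ \<xi>], rule exI[of _ "\<lambda>(t, q). C * l0 / t\<^sup>2"], rule exI[of _ "\<lambda>(t, q). C * l1 / t\<^sup>2"])
        (use C 1(8) K_scaled[of C _ l0 l1] in auto)
  qed
next
  case 4
  show ?case
  proof (intro allI impI, elim conjE, goal_cases)
    case (1 l0 l1 \<Omega> \<phi>0 \<F> I L)
    have I: "open I" using 1(8) by (simp add: open_interval_def)
    from converse_monge_ampere[OF n 1(1-7) I 1(9,10)] obtain C \<xi> where C: "0 < C"
      "centre_congruent_hypersurface (prod_topology (top_of_set I) (top_of_set \<Omega>)) (line_product_atlas I (domain_atlas \<Omega>))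
         (\<lambda>x. L *v monge_ampere_model (K1 l0 l1) \<phi>0 \<F> x) \<xi> (\<lambda>(t, q). C * l0 / t\<^sup>2) (\<lambda>(t, q). C * l1 / t\<^sup>2)"
      by blast
    show ?case
      by (rule exI[of _ \<xi>], rule exI[of _ "\<lambda>(t, q). C * l0 / t\<^sup>2"], rule exI[of _ "\<lambda>(t, q). C * l1 / t\<^sup>2"])
        (use C 1(9) K_scaled[of C _ l0 l1] in auto)
  qed
qed

end
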